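(* Let $k$ be a field and let $\mathcal{C}$ be an essentially small, finitely split semisimple, $k$-linear, additive, left-autonomous monoidal category such that $\mathrm{Hom}(X,Y)$ is finite-dimensional over $k$ for all objects $X,Y$. Let $M$ be an object that generates $\mathcal{C}$ as a fusion category, $\mathcal{G}$ the dimension graph of $\mathcal{C}$ with respect to $M$, $\mathcal{E}=(E^{(n)})_{n\in\mathbb{N}_0}$ an endomorphism system for $\mathcal{C}$ with respect to $M$, and $H=\mathbf{coend}(\mathcal{C},\omega)$. Then the surjection $\pi\colon H[\mathcal{G}]\to H$ factors through the canonical projection $H[\mathcal{G}]\to H[\mathcal{G},\mathcal{E}]$, giving rise to a surjection of WBAs $\bar\pi\colon H[\mathcal{G},\mathcal{E}]\to H$. Writing $[p|q]_m$ also for the class of $[p|q]_m$ in $H[\mathcal{G},\mathcal{E}]$, the map $\bar\pi$ satisfies: 1. $\bar\pi([j|\ell]_0)=[e^j|e_\ell]_{\mathbf 1}$ for all $j,\ell\in\mathcal{G}^0$. 2. $\bar\pi([p|q]_1)=[e^p|e_q]_M$ for all $p,q\in\mathcal{G}^1$. 3. $\bar\pi$ pushes forward the right $H[\mathcal{G},\mathcal{E}]$-comodule $k\mathcal{G}^1$ to the right $H$-comodule $\omega M$. 4. $\bar\pi$ pushes forward the right $H[\mathcal{G},\mathcal{E}]$-comodule $k\mathcal{G}^0$ to the right $H$-comodule $\omega\mathbf{1}$. 5. The restriction of $\bar\pi$ to $H[\mathcal{G},\mathcal{E}]_0\oplus H[\mathcal{G},\mathcal{E}]_1$ is injective.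
   Context: **Weak Bialgebras.** A Weak Bialgebra (WBA) over a field $k$ is a $k$-vector space $H$ with an associative unital algebra structure (unit element $1$) and a coassociative counital coalgebra structure $(\Delta,\varepsilon)$ such that, writing $\Delta(x)=x'\otimes x''$ (Sweedler notation), for all $x,y,z\in H$: $\Delta(xy)=\Delta(x)\Delta(y)$; $\varepsilon(xyz)=\varepsilon(xy')\varepsilon(y''z)=\varepsilon(xy'')\varepsilon(y'z)$; $(\Delta\otimes\mathrm{id})\Delta(1)=(\Delta(1)\otimes1)(1\otimes\Delta(1))=(1\otimes\Delta(1))(\Delta(1)\otimes1)$. A homomorphism of WBAs is a linear map that is a homomorphism of unital algebras and of counital coalgebras. A homomorphism $f\colon H\to H'$ pushes forward a right $H$-comodule $(V,\beta)$ to the right $H'$-comodule $(V,(\mathrm{id}_V\otimes f)\circ\beta)$. **The category.** In a $k$-linear category, $X$ is simple if $\mathrm{End}(X)\cong k$. $\mathcal{C}$ is *finitely split semisimple* if there is a finite family $(V_j)_{j\in I}$ of simple objects with $\mathrm{Hom}(V_j,V_\ell)=0$ for $j\neq\ell$ such that every object is a finite direct sum of objects $V_j$. The tensor product of a $k$-linear monoidal category $(\mathcal{C},\otimes,\mathbf{1},\alpha,\lambda,\rho)$ is $k$-bilinear on morphisms. $\mathcal{C}$ is *left-autonomous* if every object is equipped with a specified left dual. The unit $\mathbf{1}$ need not be simple. A (non-zero) object $M$ *generates $\mathcal{C}$ as a fusion category* if (i) every $V_j$ is a direct summand of $M^{\otimes n}$ for some $n\in\mathbb{N}_0$ (with $M^{\otimes0}=\mathbf{1}$);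 (ii) $M$ is multiplicity free: if $M\cong X\oplus Y\oplus Z$ with $X,Y\neq0$, then $X\not\cong Y$; (iii) no non-zero object is a direct summand of both $\mathbf{1}$ and $M$. **Long canonical functor and coend.** Let $\hat V=\bigoplus_{j\in I}V_j$, $R=\mathrm{End}(\hat V)\cong k^{|I|}$ with orthogonal idempotents $\lambda_j=\mathrm{id}_{V_j}$, and $\varepsilon_R\colon R\to k$ linear with $\varepsilon_R(\lambda_j)=1$ for all $j$. The long canonical functor is $\omega X=\mathrm{Hom}(\hat V,\hat V\otimes X)$, $(\omega f)(v)=(\mathrm{id}_{\hat V}\otimes f)\circ v$. Identify $(\omega X)^*$ with $\mathrm{Hom}(\hat V\otimes X,\hat V)$ by the non-degenerate pairing $g_X(\theta\otimes v)=\varepsilon_R(\theta\circ v)$. $H=\mathbf{coend}(\mathcal{C},\omega)$ is spanned by symbols $[\theta|v]_X$ ($X$ an object, $\theta\in(\omega X)^*$, $v\in\omega X$), bilinear in $\theta,v$, subject to $[\zeta|(\mathrm{id}_{\hat V}\otimes f)\circ v]_Y=[\zeta\circ(\mathrm{id}_{\hat V}\otimes f)|v]_X$ for all $f\colon X\to Y$; as a coalgebra $H=\bigoplus_{j\in I}(\omega V_j)^*\otimes\omega V_j$. Its WBA operations are $[\theta|v]_X[\zeta|w]_Y=[\zeta\circ(\theta\otimes\mathrm{id}_Y)\circ\alpha^{-1}_{\hat V,X,Y}\,|\,\alpha_{\hat V,X,Y}\circ(v\otimes\mathrm{id}_Y)\circ w]_{X\otimes Y}$, $1=[\rho_{\hat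 V}|\rho_{\hat V}^{-1}]_{\mathbf 1}$, $\Delta([\theta|v]_X)=\sum_j[\theta|e_j]_X\otimes[e^j|v]_X$ (dual bases with respect to $g_X$), $\varepsilon([\theta|v]_X)=\varepsilon_R(\theta\circ v)$. Each $\omega X$ is a right $H$-comodule with $\beta_{\omega X}(v)=\sum_j e_j\otimes[e^j|v]_X$. **Graphs and $H[\mathcal{G}]$.** A finite directed graph has finite sets $\mathcal{G}^0$ (vertices), $\mathcal{G}^1$ (edges) and source and target maps $\sigma,\tau\colon\mathcal{G}^1\to\mathcal{G}^0$; $\sigma(v)=\tau(v)=v$ for vertices. For $m\ge1$, $\mathcal{G}^m$ is the set of paths $(p_1,\dots,p_m)$ of edges with $\sigma(p_j)=\tau(p_{j+1})$, with $\tau(p)=\tau(p_1)$, $\sigma(p)=\sigma(p_m)$; $pq$ is concatenation, defined if $\sigma(p)=\tau(q)$ (vertices act as identities). The WBA $H[\mathcal{G}]=\bigoplus_{m\in\mathbb{N}_0}(k\mathcal{G}^m)^*\otimes k\mathcal{G}^m$ has basis $[p|q]_m$ ($p,q\in\mathcal{G}^m$) and $1=\sum_{j,\ell\in\mathcal{G}^0}[j|\ell]_0$, $[p|q]_m[r|s]_\ell=\delta_{\sigma(p),\tau(r)}\delta_{\sigma(q),\tau(s)}[pr|qs]_{m+\ell}$, $\Delta([p|q]_m)=\sum_{r\in\mathcal{G}^m}[p|r]_m\otimes[r|q]_m$, $\varepsilon([p|q]_m)=\delta_{pq}$. **Dimension graph.** $\mathcal{G}^0=I$, and the set of edges from $j$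 to $\ell$ (source $j$, target $\ell$) is a basis of $\mathrm{Hom}(V_j,V_\ell\otimes M)$. So $\mathcal{G}^1$ is a basis $(e_p)_{p\in\mathcal{G}^1}$ of $\omega M$; let $(e^p)$ be its dual basis with respect to $g_M$. Let $e_j=\rho_{\hat V}^{-1}\circ\lambda_j\in\omega\mathbf{1}$ and $e^j=\lambda_j\circ\rho_{\hat V}$ for $j\in I$. Via these bases identify $k\mathcal{G}^1=\omega M$, $k\mathcal{G}^0=\omega\mathbf{1}$. There is a unique WBA homomorphism $\pi\colon H[\mathcal{G}]\to H$ with $\pi([j|\ell]_0)=[e^j|e_\ell]_{\mathbf{1}}$ and $\pi([p|q]_1)=[e^p|e_q]_M$; it is surjective. **Endomorphism system.** Put $M^{\otimes(n+1)}=M^{\otimes n}\otimes M$, $M^{\otimes 1}=M$ (identified with $\mathbf 1\otimes M$). An endomorphism system is a sequence of sets $E^{(n)}\subseteq\mathrm{End}(M^{\otimes n})$, $n\in\mathbb{N}_0$, such that $\mathrm{End}(\mathbf{1})$ is generated as an associative algebra by $E^{(0)}\cup\{\mathrm{id}_{\mathbf 1}\}$ and, for $n\geq1$, $\mathrm{End}(M^{\otimes n})$ is generated as a unital associative algebra by $\{f\otimes\mathrm{id}_M\mid f\in E^{(n-1)}\}\cup E^{(n)}$. **$H[\mathcal{G},\mathcal{E}]$.** For a path $p=(p_1,\dots,p_n)$ with $n\ge2$ put $e_p=\alpha_{\hat V,M^{\otimes(n-1)},M}\circ(e_{(p_1,\dots,p_{n-1})}\otimes\mathrm{id}_M)\circ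 e_{p_n}\in\omega(M^{\otimes n})$; for every $n\ge0$ the $e_p$, $p\in\mathcal{G}^n$, form a basis of $\omega(M^{\otimes n})$. For $f\in\mathrm{End}(M^{\otimes n})$ let $(\omega f)(e_p)=\sum_{r\in\mathcal{G}^n}e_r f_{r;p}$. Then $H[\mathcal{G},\mathcal{E}]=H[\mathcal{G}]/I_{\mathcal{E}}$ (a WBA) where $I_{\mathcal{E}}$ is the two-sided ideal generated by $\sum_{p\in\mathcal{G}^n}[r|p]_n f_{p;q}-\sum_{p\in\mathcal{G}^n}f_{r;p}[p|q]_n$ for all $n\in\mathbb{N}_0$, $f\in E^{(n)}$, $r,q\in\mathcal{G}^n$. $H[\mathcal{G},\mathcal{E}]$ is graded, and $H[\mathcal{G},\mathcal{E}]_m$ is the image of $(k\mathcal{G}^m)^*\otimes k\mathcal{G}^m$. Each $k\mathcal{G}^m$ is a right $H[\mathcal{G},\mathcal{E}]$-comodule by $p\mapsto\sum_{q\in\mathcal{G}^m}q\otimes[q|p]_m$. *)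

theory Defs
  imports "HOL-Algebra.QuotRing" "HOL-Algebra.Module" "HOL-Library.Poly_Mapping" "HOL-Library.FuncSet"
    "Graph_Theory.Digraph"
begin

section \<open>Formal linear combinations\<close>

definition pm_scale :: "'k::field \<Rightarrow> ('a \<Rightarrow>\<^sub>0 'k) \<Rightarrow> ('a \<Rightarrow>\<^sub>0 'k)" where
  "pm_scale c t = Poly_Mapping.map (\<lambda>x. c * x) t"

definition basis_vec :: "'a \<Rightarrow> ('a \<Rightarrow>\<^sub>0 'k::field)" where
  "basis_vec x = Poly_Mapping.single x 1"

definition lin_extend :: "('a \<Rightarrow> ('b \<Rightarrow>\<^sub>0 'k)) \<Rightarrow> ('a \<Rightarrow>\<^sub>0 'k::field) \<Rightarrow> ('b \<Rightarrow>\<^sub>0 'k)" where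
  "lin_extend f t = (\<Sum>x\<in>Poly_Mapping.keys t. pm_scale (Poly_Mapping.lookup t x) (f x))"

definition bilin_extend ::
  "('a \<Rightarrow> 'b \<Rightarrow> ('c \<Rightarrow>\<^sub>0 'k)) \<Rightarrow> ('a \<Rightarrow>\<^sub>0 'k::field) \<Rightarrow> ('b \<Rightarrow>\<^sub>0 'k) \<Rightarrow> ('c \<Rightarrow>\<^sub>0 'k)" where
  "bilin_extend f s t = lin_extend (\<lambda>x. lin_extend (\<lambda>y. f x y) t) s"

definition lin_eval :: "('a \<Rightarrow> 'k) \<Rightarrow> ('a \<Rightarrow>\<^sub>0 'k::field) \<Rightarrow> 'k" where
  "lin_eval f t = (\<Sum>x\<in>Poly_Mapping.keys t. Poly_Mapping.lookup t x * f x)"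

section \<open>Vector spaces with carrier and their tensor products\<close>

text \<open>The field $k$ is a type of class \<^class>\<open>field\<close>; \<open>scalars\<close> is the corresponding HOL-Algebra
  structure. Vector spaces with carrier are HOL-Algebra modules over \<open>scalars\<close>. The record type of
  modules extends that of rings; the ring multiplication of a mere vector space is irrelevant.\<close>

definition scalars :: "'k::field ring" where
  "scalars = \<lparr>carrier = UNIV, mult = (*), one = 1, zero = 0, add = (+)\<rparr>"

definition linear_on ::
  "('k::field, 'a, 'y) module_scheme \<Rightarrow> ('k, 'b, 'z) module_scheme \<Rightarrow> ('a \<Rightarrow> 'b) \<Rightarrow> bool" where
  "linear_on V W f \<longleftrightarrow>
     f \<in> carrier V \<rightarrow> carrier W \<and>
     (\<forall>x\<in>carrier V. \<forall>y\<in>carrier V. f (x \<oplus>\<^bsub>V\<^esub> y) = f x \<oplus>\<^bsub>W\<^esub> f y) \<and>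
     (\<forall>c. \<forall>x\<in>carrier V. f (c \<odot>\<^bsub>V\<^esub> x) = c \<odot>\<^bsub>W\<^esub> f x)"

text \<open>An element of $V\otimes W$ is given by a formal linear combination of pairs $(v,w)$, read as
  $\sum_i c_i\, v_i\otimes w_i$. Two formal linear combinations denote the same element of
  $V\otimes W$ iff their difference is in the span of the usual bilinearity relations. A map with
  values in $V\otimes W$ picks one formal linear combination for each value, and all identities in
  $V\otimes W$ are stated by means of \<open>tensor_eq\<close>. Similarly for $U\otimes V\otimes W$.\<close>

definition tensor_relations ::
  "('k::field, 'a, 'y) module_scheme \<Rightarrow> ('k, 'b, 'z) module_scheme \<Rightarrow> ('a \<times> 'b \<Rightarrow>\<^sub>0 'k) set" where
  "tensor_relations V W = module.span pm_scale (
     {basis_vec (a \<oplus>\<^bsub>V\<^esub> a', b) - basis_vec (a, b) - basis_vec (a', b) | a a' b.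
        a \<in> carrier V \<and> a' \<in> carrier V \<and> b \<in> carrier W} \<union>
     {basis_vec (a, b \<oplus>\<^bsub>W\<^esub> b') - basis_vec (a, b) - basis_vec (a, b') | a b b'.
        a \<in> carrier V \<and> b \<in> carrier W \<and> b' \<in> carrier W} \<union>
     {basis_vec (c \<odot>\<^bsub>V\<^esub> a, b) - pm_scale c (basis_vec (a, b)) | c a b.
        a \<in> carrier V \<and> b \<in> carrier W} \<union>
     {basis_vec (a, c \<odot>\<^bsub>W\<^esub> b) - pm_scale c (basis_vec (a, b)) | c a b.
        a \<in> carrier V \<and> b \<in> carrier W})"

definition tensor_eq ::
  "('k::field, 'a, 'y) module_scheme \<Rightarrow> ('k, 'b, 'z) module_scheme \<Rightarrow>
   ('a \<times> 'b \<Rightarrow>\<^sub>0 'k) \<Rightarrow> ('a \<times> 'b \<Rightarrow>\<^sub>0 'k) \<Rightarrow> bool" where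
  "tensor_eq V W s t \<longleftrightarrow> s - t \<in> tensor_relations V W"

definition tensor3_relations ::
  "('k::field, 'a, 'x) module_scheme \<Rightarrow> ('k, 'b, 'y) module_scheme \<Rightarrow> ('k, 'c, 'z) module_scheme \<Rightarrow>
   ('a \<times> 'b \<times> 'c \<Rightarrow>\<^sub>0 'k) set" where
  "tensor3_relations U V W = module.span pm_scale (
     {basis_vec (a \<oplus>\<^bsub>U\<^esub> a', b, d) - basis_vec (a, b, d) - basis_vec (a', b, d) | a a' b d.
        a \<in> carrier U \<and> a' \<in> carrier U \<and> b \<in> carrier V \<and> d \<in> carrier W} \<union>
     {basis_vec (a, b \<oplus>\<^bsub>V\<^esub> b', d) - basis_vec (a, b, d) - basis_vec (a, b', d) | a b b' d.
        a \<in> carrier U \<and> b \<in> carrier V \<and> b' \<in> carrier V \<and> d \<in> carrier W} \<union>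
     {basis_vec (a, b, d \<oplus>\<^bsub>W\<^esub> d') - basis_vec (a, b, d) - basis_vec (a, b, d') | a b d d'.
        a \<in> carrier U \<and> b \<in> carrier V \<and> d \<in> carrier W \<and> d' \<in> carrier W} \<union>
     {basis_vec (c \<odot>\<^bsub>U\<^esub> a, b, d) - pm_scale c (basis_vec (a, b, d)) | c a b d.
        a \<in> carrier U \<and> b \<in> carrier V \<and> d \<in> carrier W} \<union>
     {basis_vec (a, c \<odot>\<^bsub>V\<^esub> b, d) - pm_scale c (basis_vec (a, b, d)) | c a b d.
        a \<in> carrier U \<and> b \<in> carrier V \<and> d \<in> carrier W} \<union>
     {basis_vec (a, b, c \<odot>\<^bsub>W\<^esub> d) - pm_scale c (basis_vec (a, b, d)) | c a b d.
        a \<in> carrier U \<and> b \<in> carrier V \<and> d \<in> carrier W})"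

definition tensor3_eq ::
  "('k::field, 'a, 'x) module_scheme \<Rightarrow> ('k, 'b, 'y) module_scheme \<Rightarrow> ('k, 'c, 'z) module_scheme \<Rightarrow>
   ('a \<times> 'b \<times> 'c \<Rightarrow>\<^sub>0 'k) \<Rightarrow> ('a \<times> 'b \<times> 'c \<Rightarrow>\<^sub>0 'k) \<Rightarrow> bool" where
  "tensor3_eq U V W s t \<longleftrightarrow> s - t \<in> tensor3_relations U V W"

definition tensor_map ::
  "('a \<Rightarrow> 'c) \<Rightarrow> ('b \<Rightarrow> 'd) \<Rightarrow> ('a \<times> 'b \<Rightarrow>\<^sub>0 'k::field) \<Rightarrow> ('c \<times> 'd \<Rightarrow>\<^sub>0 'k)" where
  "tensor_map f g = lin_extend (\<lambda>(a, b). basis_vec (f a, g b))"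

text \<open>The map $f\otimes\mathrm{id}$ for $f$ with values in a tensor product, and likewise
  $\mathrm{id}\otimes f$.\<close>

definition split_left ::
  "('a \<Rightarrow> ('c \<times> 'd \<Rightarrow>\<^sub>0 'k)) \<Rightarrow> ('a \<times> 'b \<Rightarrow>\<^sub>0 'k::field) \<Rightarrow> ('c \<times> 'd \<times> 'b \<Rightarrow>\<^sub>0 'k)" where
  "split_left f = lin_extend (\<lambda>(a, b). lin_extend (\<lambda>(c, d). basis_vec (c, d, b)) (f a))"

definition split_right ::
  "('b \<Rightarrow> ('c \<times> 'd \<Rightarrow>\<^sub>0 'k)) \<Rightarrow> ('a \<times> 'b \<Rightarrow>\<^sub>0 'k::field) \<Rightarrow> ('a \<times> 'c \<times> 'd \<Rightarrow>\<^sub>0 'k)" where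
  "split_right f = lin_extend (\<lambda>(a, b). lin_extend (\<lambda>(c, d). basis_vec (a, c, d)) (f b))"

text \<open>The linear maps $\mathrm{id}\otimes\varphi$ and $\varphi\otimes\mathrm{id}$ for a linear
  form $\varphi$.\<close>

definition contract_right ::
  "('k, 'a, 'z) module_scheme \<Rightarrow> ('b \<Rightarrow> 'k) \<Rightarrow> ('a \<times> 'b \<Rightarrow>\<^sub>0 'k::field) \<Rightarrow> 'a" where
  "contract_right V \<phi> t = (\<Oplus>\<^bsub>V\<^esub>x\<in>Poly_Mapping.keys t.
     (Poly_Mapping.lookup t x * \<phi> (snd x)) \<odot>\<^bsub>V\<^esub> fst x)"

definition contract_left ::
  "('k, 'b, 'z) module_scheme \<Rightarrow> ('a \<Rightarrow> 'k) \<Rightarrow> ('a \<times> 'b \<Rightarrow>\<^sub>0 'k::field) \<Rightarrow> 'b" where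
  "contract_left V \<phi> t = (\<Oplus>\<^bsub>V\<^esub>x\<in>Poly_Mapping.keys t.
     (Poly_Mapping.lookup t x * \<phi> (fst x)) \<odot>\<^bsub>V\<^esub> snd x)"

section \<open>Weak Bialgebras\<close>

record (overloaded) ('k::zero, 'a) wba = "('k, 'a) module" +
  comult :: "'a \<Rightarrow> ('a \<times> 'a \<Rightarrow>\<^sub>0 'k)"  ("\<Delta>\<index>")
  counit :: "'a \<Rightarrow> 'k"  ("\<epsilon>\<index>")

definition tensor_mult ::
  "('k::field, 'a, 'z) wba_scheme \<Rightarrow> ('a \<times> 'a \<Rightarrow>\<^sub>0 'k) \<Rightarrow> ('a \<times> 'a \<Rightarrow>\<^sub>0 'k) \<Rightarrow> ('a \<times> 'a \<Rightarrow>\<^sub>0 'k)" where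
  "tensor_mult H = bilin_extend (\<lambda>(a, b) (a', b'). basis_vec (a \<otimes>\<^bsub>H\<^esub> a', b \<otimes>\<^bsub>H\<^esub> b'))"

definition tensor3_mult ::
  "('k::field, 'a, 'z) wba_scheme \<Rightarrow> ('a \<times> 'a \<times> 'a \<Rightarrow>\<^sub>0 'k) \<Rightarrow> ('a \<times> 'a \<times> 'a \<Rightarrow>\<^sub>0 'k) \<Rightarrow>
   ('a \<times> 'a \<times> 'a \<Rightarrow>\<^sub>0 'k)" where
  "tensor3_mult H = bilin_extend (\<lambda>(a, b, c) (a', b', c').
     basis_vec (a \<otimes>\<^bsub>H\<^esub> a', b \<otimes>\<^bsub>H\<^esub> b', c \<otimes>\<^bsub>H\<^esub> c'))"

definition tensor_one_right ::
  "('k::field, 'a, 'z) wba_scheme \<Rightarrow> ('a \<times> 'a \<Rightarrow>\<^sub>0 'k) \<Rightarrow> ('a \<times> 'a \<times> 'a \<Rightarrow>\<^sub>0 'k)" where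
  "tensor_one_right H = lin_extend (\<lambda>(a, b). basis_vec (a, b, \<one>\<^bsub>H\<^esub>))"

definition tensor_one_left ::
  "('k::field, 'a, 'z) wba_scheme \<Rightarrow> ('a \<times> 'a \<Rightarrow>\<^sub>0 'k) \<Rightarrow> ('a \<times> 'a \<times> 'a \<Rightarrow>\<^sub>0 'k)" where
  "tensor_one_left H = lin_extend (\<lambda>(a, b). basis_vec (\<one>\<^bsub>H\<^esub>, a, b))"

locale weak_bialgebra =
  V: Module.module scalars H + A: ring H
  for H :: "('k::field, 'a) wba" (structure) +
  assumes smult_mult_left:
      "\<lbrakk>x \<in> carrier H; y \<in> carrier H\<rbrakk> \<Longrightarrow> (c \<odot> x) \<otimes> y = c \<odot> (x \<otimes> y)"
    and smult_mult_right:
      "\<lbrakk>x \<in> carrier H; y \<in> carrier H\<rbrakk> \<Longrightarrow> x \<otimes> (c \<odot> y) = c \<odot> (x \<otimes> y)"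
    and comult_closed:
      "x \<in> carrier H \<Longrightarrow> Poly_Mapping.keys (\<Delta> x) \<subseteq> carrier H \<times> carrier H"
    and comult_add:
      "\<lbrakk>x \<in> carrier H; y \<in> carrier H\<rbrakk> \<Longrightarrow> tensor_eq H H (\<Delta> (x \<oplus> y)) (\<Delta> x + \<Delta> y)"
    and comult_smult:
      "x \<in> carrier H \<Longrightarrow> tensor_eq H H (\<Delta> (c \<odot> x)) (pm_scale c (\<Delta> x))"
    and counit_add:
      "\<lbrakk>x \<in> carrier H; y \<in> carrier H\<rbrakk> \<Longrightarrow> \<epsilon> (x \<oplus> y) = \<epsilon> x + \<epsilon> y"
    and counit_smult: "x \<in> carrier H \<Longrightarrow> \<epsilon> (c \<odot> x) = c * \<epsilon> x"
    and coassoc: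
      "x \<in> carrier H \<Longrightarrow> tensor3_eq H H H (split_left (comult H) (\<Delta> x)) (split_right (comult H) (\<Delta> x))"
    and counit_left: "x \<in> carrier H \<Longrightarrow> contract_left H (counit H) (\<Delta> x) = x"
    and counit_right: "x \<in> carrier H \<Longrightarrow> contract_right H (counit H) (\<Delta> x) = x"
    and comult_mult:
      "\<lbrakk>x \<in> carrier H; y \<in> carrier H\<rbrakk> \<Longrightarrow> tensor_eq H H (\<Delta> (x \<otimes> y)) (tensor_mult H (\<Delta> x) (\<Delta> y))"
    and counit_mult:
      "\<lbrakk>x \<in> carrier H; y \<in> carrier H; z \<in> carrier H\<rbrakk> \<Longrightarrow>
        \<epsilon> (x \<otimes> y \<otimes> z) = lin_eval (\<lambda>(y', y''). \<epsilon> (x \<otimes> y') * \<epsilon> (y'' \<otimes> z)) (\<Delta> y)"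
    and counit_mult_op:
      "\<lbrakk>x \<in> carrier H; y \<in> carrier H; z \<in> carrier H\<rbrakk> \<Longrightarrow>
        \<epsilon> (x \<otimes> y \<otimes> z) = lin_eval (\<lambda>(y', y''). \<epsilon> (x \<otimes> y'') * \<epsilon> (y' \<otimes> z)) (\<Delta> y)"
    and comult_one:
      "tensor3_eq H H H (split_left (comult H) (\<Delta> \<one>))
        (tensor3_mult H (tensor_one_right H (\<Delta> \<one>)) (tensor_one_left H (\<Delta> \<one>)))"
    and comult_one_op:
      "tensor3_eq H H H (split_left (comult H) (\<Delta> \<one>))
        (tensor3_mult H (tensor_one_left H (\<Delta> \<one>)) (tensor_one_right H (\<Delta> \<one>)))"

definition wba_hom :: "('k::field, 'a) wba \<Rightarrow> ('k, 'b) wba \<Rightarrow> ('a \<Rightarrow> 'b) \<Rightarrow> bool" where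
  "wba_hom H H' f \<longleftrightarrow>
     weak_bialgebra H \<and> weak_bialgebra H' \<and>
     linear_on H H' f \<and> f \<in> ring_hom H H' \<and>
     (\<forall>x\<in>carrier H. tensor_eq H' H' (comult H' (f x)) (tensor_map f f (comult H x))) \<and>
     (\<forall>x\<in>carrier H. counit H' (f x) = counit H x)"

text \<open>The quotient of $H$ by a subspace $N$; the underlying ring structure is the library's
  \<open>H Quot N\<close>. The definition is meaningful if $N$ is compatible with the operations of $H$;
  comultiplication and counit are computed on an arbitrary representative.\<close>

definition wba_quot :: "('k::field, 'a) wba \<Rightarrow> 'a set \<Rightarrow> ('k, 'a set) wba" where
  "wba_quot H N =
     \<lparr>carrier = carrier (H Quot N), mult = mult (H Quot N), one = one (H Quot N),
      zero = zero (H Quot N), add = add (H Quot N),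
      smult = (\<lambda>c A. \<Union>a\<in>A. N +>\<^bsub>H\<^esub> (c \<odot>\<^bsub>H\<^esub> a)),
      comult = (\<lambda>A. tensor_map (a_r_coset H N) (a_r_coset H N) (comult H (SOME a. a \<in> A))),
      counit = (\<lambda>A. counit H (SOME a. a \<in> A))\<rparr>"

subsection \<open>Comodules\<close>

record (overloaded) ('k::zero, 'v, 'h) comodule = "('k, 'v) module" +
  coact :: "'v \<Rightarrow> ('v \<times> 'h \<Rightarrow>\<^sub>0 'k)"

definition right_comodule :: "('k::field, 'h) wba \<Rightarrow> ('k, 'v, 'h) comodule \<Rightarrow> bool" where
  "right_comodule H N \<longleftrightarrow>
     Module.module scalars N \<and>
     (\<forall>v\<in>carrier N. Poly_Mapping.keys (coact N v) \<subseteq> carrier N \<times> carrier H) \<and>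
     (\<forall>v\<in>carrier N. \<forall>w\<in>carrier N.
        tensor_eq N H (coact N (v \<oplus>\<^bsub>N\<^esub> w)) (coact N v + coact N w)) \<and>
     (\<forall>c. \<forall>v\<in>carrier N. tensor_eq N H (coact N (c \<odot>\<^bsub>N\<^esub> v)) (pm_scale c (coact N v))) \<and>
     (\<forall>v\<in>carrier N. tensor3_eq N H H
        (split_left (coact N) (coact N v)) (split_right (comult H) (coact N v))) \<and>
     (\<forall>v\<in>carrier N. contract_right N (counit H) (coact N v) = v)"

definition pushforward :: "('h \<Rightarrow> 'h') \<Rightarrow> ('k::field, 'v, 'h) comodule \<Rightarrow> ('k, 'v, 'h') comodule" where
  "pushforward f N =
     \<lparr>carrier = carrier N, mult = mult N, one = one N, zero = zero N, add = add N, smult = smult N,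
      coact = (\<lambda>v. tensor_map (\<lambda>x. x) f (coact N v))\<rparr>"

definition comodule_iso ::
  "('k::field, 'h) wba \<Rightarrow> ('k, 'v, 'h) comodule \<Rightarrow> ('k, 'w, 'h) comodule \<Rightarrow> ('v \<Rightarrow> 'w) \<Rightarrow> bool" where
  "comodule_iso H N N' \<phi> \<longleftrightarrow>
     right_comodule H N \<and> right_comodule H N' \<and>
     linear_on N N' \<phi> \<and> bij_betw \<phi> (carrier N) (carrier N') \<and>
     (\<forall>v\<in>carrier N. tensor_eq N' H (coact N' (\<phi> v)) (tensor_map \<phi> (\<lambda>x. x) (coact N v)))"

text \<open>The homomorphism $f\colon H\to H'$ pushes forward the right $H$-comodule \<open>N\<close> to the right
  $H'$-comodule \<open>N'\<close>, where the underlying vector spaces are identified by \<open>\<phi>\<close>.\<close>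

definition pushes_forward ::
  "('k::field, 'h) wba \<Rightarrow> ('k, 'h') wba \<Rightarrow> ('h \<Rightarrow> 'h') \<Rightarrow> ('v \<Rightarrow> 'w) \<Rightarrow>
   ('k, 'v, 'h) comodule \<Rightarrow> ('k, 'w, 'h') comodule \<Rightarrow> bool" where
  "pushes_forward H H' f \<phi> N N' \<longleftrightarrow>
     right_comodule H N \<and> comodule_iso H' (pushforward f N) N' \<phi>"

section \<open>The Weak Bialgebra of a finite directed graph\<close>

text \<open>A path is a pair of its target and its list of edges, so that the vertex \<open>j\<close> is the path
  \<open>(j, [])\<close> of length zero and $(p_1,\dots,p_m)$ is \<open>(head G p\<^sub>1, [p\<^sub>1, \<dots>, p\<^sub>m])\<close>. Source and target
  of an edge are the \<^const>\<open>tail\<close> and \<^const>\<open>head\<close> of the library.\<close>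

type_synonym ('v, 'e) gpath = "'v \<times> 'e list"

fun chain :: "('v, 'e) pre_digraph \<Rightarrow> 'v \<Rightarrow> 'e list \<Rightarrow> bool" where
  "chain G t [] \<longleftrightarrow> True"
| "chain G t (p # ps) \<longleftrightarrow> head G p = t \<and> chain G (tail G p) ps"

definition paths :: "('v, 'e) pre_digraph \<Rightarrow> nat \<Rightarrow> ('v, 'e) gpath set" where
  "paths G m = {(t, ps). t \<in> verts G \<and> set ps \<subseteq> arcs G \<and> length ps = m \<and> chain G t ps}"

definition path_target :: "('v, 'e) gpath \<Rightarrow> 'v" where
  "path_target p = fst p"

definition path_source :: "('v, 'e) pre_digraph \<Rightarrow> ('v, 'e) gpath \<Rightarrow> 'v" where
  "path_source G p = (if snd p = [] then fst p else tail G (last (snd p)))"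

definition path_length :: "('v, 'e) gpath \<Rightarrow> nat" where
  "path_length p = length (snd p)"

definition path_append :: "('v, 'e) gpath \<Rightarrow> ('v, 'e) gpath \<Rightarrow> ('v, 'e) gpath" where
  "path_append p q = (fst p, snd p @ snd q)"

definition vertex_path :: "'v \<Rightarrow> ('v, 'e) gpath" where
  "vertex_path j = (j, [])"

definition edge_path :: "('v, 'e) pre_digraph \<Rightarrow> 'e \<Rightarrow> ('v, 'e) gpath" where
  "edge_path G p = (head G p, [p])"

text \<open>\<open>basis_vec (p, q)\<close> is the basis vector $[p|q]_m$ of $(k\mathcal{G}^m)^*\otimes k\mathcal{G}^m$;
  the degree $m$ is the common length of $p$ and $q$.\<close>

definition graph_wba ::
  "('v, 'e) pre_digraph \<Rightarrow> ('k::field, ('v, 'e) gpath \<times> ('v, 'e) gpath \<Rightarrow>\<^sub>0 'k) wba" where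
  "graph_wba G =
     \<lparr>carrier = {t. Poly_Mapping.keys t \<subseteq> (\<Union>m. paths G m \<times> paths G m)},
      mult = bilin_extend (\<lambda>(p, q) (r, s).
        if path_source G p = path_target r \<and> path_source G q = path_target s
        then basis_vec (path_append p r, path_append q s) else 0),
      one = (\<Sum>j\<in>verts G. \<Sum>l\<in>verts G. basis_vec (vertex_path j, vertex_path l)),
      zero = 0, add = (+), smult = pm_scale,
      comult = lin_extend (\<lambda>(p, q). \<Sum>r\<in>paths G (path_length p).
        basis_vec (basis_vec (p, r), basis_vec (r, q))),
      counit = lin_eval (\<lambda>(p, q). if p = q then 1 else 0)\<rparr>"

section \<open>Linear monoidal categories\<close>

text \<open>The objects of the (essentially) small category form a set \<open>obj C\<close>. The morphisms of all
  hom-spaces live in one ambient vector space, of which each \<open>Hom C X Y\<close> is a subspace; composition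
  \<open>g \<cdot> f\<close> ($f$ first) and the tensor product \<open>f \<star> g\<close> of morphisms are only used on composable
  morphisms and on morphisms between given objects, respectively. Every small $k$-linear category is
  of this form, the ambient space being the direct sum of all hom-spaces and the two operations
  being extended bilinearly.\<close>

record ('k, 'o, 'm) lmcat =
  obj :: "'o set"
  Hom :: "'o \<Rightarrow> 'o \<Rightarrow> 'm set"
  ident :: "'o \<Rightarrow> 'm"  ("\<I>\<index>")
  cmp :: "'m \<Rightarrow> 'm \<Rightarrow> 'm"  (infixl "\<cdot>\<index>" 70)
  scal :: "'k \<Rightarrow> 'm \<Rightarrow> 'm"
  tobj :: "'o \<Rightarrow> 'o \<Rightarrow> 'o"  (infixl "\<boxtimes>\<index>" 75)
  tmor :: "'m \<Rightarrow> 'm \<Rightarrow> 'm"  (infixl "\<star>\<index>" 75)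
  unit_obj :: "'o"  ("\<bbbone>\<index>")
  assoc :: "'o \<Rightarrow> 'o \<Rightarrow> 'o \<Rightarrow> 'm"  ("\<alpha>\<^sub>u\<index>")
  lunit :: "'o \<Rightarrow> 'm"  ("\<lambda>\<^sub>u\<index>")
  runit :: "'o \<Rightarrow> 'm"  ("\<rho>\<^sub>u\<index>")

definition inverse_mor ::
  "('k, 'o, 'm, 'z) lmcat_scheme \<Rightarrow> 'o \<Rightarrow> 'o \<Rightarrow> 'm \<Rightarrow> 'm \<Rightarrow> bool" where
  "inverse_mor C X Y f g \<longleftrightarrow> g \<in> Hom C Y X \<and> g \<cdot> f = \<I> X \<and> f \<cdot> g = \<I> Y"
  for C (structure)

definition inv_mor :: "('k, 'o, 'm, 'z) lmcat_scheme \<Rightarrow> 'o \<Rightarrow> 'o \<Rightarrow> 'm \<Rightarrow> 'm" where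
  "inv_mor C X Y f = (THE g. inverse_mor C X Y f g)"

definition iso_mor :: "('k, 'o, 'm, 'z) lmcat_scheme \<Rightarrow> 'o \<Rightarrow> 'o \<Rightarrow> 'm \<Rightarrow> bool" where
  "iso_mor C X Y f \<longleftrightarrow> f \<in> Hom C X Y \<and> (\<exists>g. inverse_mor C X Y f g)"

definition iso_obj :: "('k, 'o, 'm, 'z) lmcat_scheme \<Rightarrow> 'o \<Rightarrow> 'o \<Rightarrow> bool" where
  "iso_obj C X Y \<longleftrightarrow> (\<exists>f. iso_mor C X Y f)"

abbreviation assoc_inv where
  "assoc_inv C X Y Z \<equiv>
     inv_mor C (tobj C (tobj C X Y) Z) (tobj C X (tobj C Y Z)) (assoc C X Y Z)"

abbreviation lunit_inv where
  "lunit_inv C X \<equiv> inv_mor C (tobj C (unit_obj C) X) X (lunit C X)"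

abbreviation runit_inv where
  "runit_inv C X \<equiv> inv_mor C (tobj C X (unit_obj C)) X (runit C X)"

locale linear_category = vector_space "scal C"
  for C :: "('k::field, 'o, 'm::ab_group_add, 'z) lmcat_scheme" (structure) +
  assumes hom_subspace: "\<lbrakk>X \<in> obj C; Y \<in> obj C\<rbrakk> \<Longrightarrow> subspace (Hom C X Y)"
    and id_in_hom: "X \<in> obj C \<Longrightarrow> \<I> X \<in> Hom C X X"
    and comp_in_hom:
      "\<lbrakk>X \<in> obj C; Y \<in> obj C; Z \<in> obj C; f \<in> Hom C X Y; g \<in> Hom C Y Z\<rbrakk> \<Longrightarrow> g \<cdot> f \<in> Hom C X Z"
    and id_left: "\<lbrakk>X \<in> obj C; Y \<in> obj C; f \<in> Hom C X Y\<rbrakk> \<Longrightarrow> \<I> Y \<cdot> f = f"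
    and id_right: "\<lbrakk>X \<in> obj C; Y \<in> obj C; f \<in> Hom C X Y\<rbrakk> \<Longrightarrow> f \<cdot> \<I> X = f"
    and comp_assoc:
      "\<lbrakk>W \<in> obj C; X \<in> obj C; Y \<in> obj C; Z \<in> obj C;
        f \<in> Hom C W X; g \<in> Hom C X Y; h \<in> Hom C Y Z\<rbrakk> \<Longrightarrow> (h \<cdot> g) \<cdot> f = h \<cdot> (g \<cdot> f)"
    and comp_add_left:
      "\<lbrakk>X \<in> obj C; Y \<in> obj C; Z \<in> obj C; f \<in> Hom C X Y; g \<in> Hom C Y Z; g' \<in> Hom C Y Z\<rbrakk> \<Longrightarrow>
        (g + g') \<cdot> f = g \<cdot> f + g' \<cdot> f"
    and comp_add_right:
      "\<lbrakk>X \<in> obj C; Y \<in> obj C; Z \<in> obj C; f \<in> Hom C X Y; f' \<in> Hom C X Y; g \<in> Hom C Y Z\<rbrakk> \<Longrightarrow>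
        g \<cdot> (f + f') = g \<cdot> f + g \<cdot> f'"
    and comp_scal_left:
      "\<lbrakk>X \<in> obj C; Y \<in> obj C; Z \<in> obj C; f \<in> Hom C X Y; g \<in> Hom C Y Z\<rbrakk> \<Longrightarrow>
        scal C c g \<cdot> f = scal C c (g \<cdot> f)"
    and comp_scal_right:
      "\<lbrakk>X \<in> obj C; Y \<in> obj C; Z \<in> obj C; f \<in> Hom C X Y; g \<in> Hom C Y Z\<rbrakk> \<Longrightarrow>
        g \<cdot> scal C c f = scal C c (g \<cdot> f)"

locale linear_monoidal_category = linear_category C
  for C :: "('k::field, 'o, 'm::ab_group_add, 'z) lmcat_scheme" (structure) +
  assumes tobj_closed: "\<lbrakk>X \<in> obj C; Y \<in> obj C\<rbrakk> \<Longrightarrow> X \<boxtimes> Y \<in> obj C"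
    and unit_closed: "\<bbbone> \<in> obj C"
    and tmor_in_hom:
      "\<lbrakk>X \<in> obj C; X' \<in> obj C; Y \<in> obj C; Y' \<in> obj C; f \<in> Hom C X X'; g \<in> Hom C Y Y'\<rbrakk> \<Longrightarrow>
        f \<star> g \<in> Hom C (X \<boxtimes> Y) (X' \<boxtimes> Y')"
    and tmor_id: "\<lbrakk>X \<in> obj C; Y \<in> obj C\<rbrakk> \<Longrightarrow> \<I> X \<star> \<I> Y = \<I> (X \<boxtimes> Y)"
    and tmor_comp:
      "\<lbrakk>X \<in> obj C; X' \<in> obj C; X'' \<in> obj C; Y \<in> obj C; Y' \<in> obj C; Y'' \<in> obj C;
        f \<in> Hom C X X'; f' \<in> Hom C X' X''; g \<in> Hom C Y Y'; g' \<in> Hom C Y' Y''\<rbrakk> \<Longrightarrow>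
        (f' \<cdot> f) \<star> (g' \<cdot> g) = (f' \<star> g') \<cdot> (f \<star> g)"
    and tmor_add_left:
      "\<lbrakk>X \<in> obj C; X' \<in> obj C; Y \<in> obj C; Y' \<in> obj C;
        f \<in> Hom C X X'; f' \<in> Hom C X X'; g \<in> Hom C Y Y'\<rbrakk> \<Longrightarrow> (f + f') \<star> g = f \<star> g + f' \<star> g"
    and tmor_add_right:
      "\<lbrakk>X \<in> obj C; X' \<in> obj C; Y \<in> obj C; Y' \<in> obj C;
        f \<in> Hom C X X'; g \<in> Hom C Y Y'; g' \<in> Hom C Y Y'\<rbrakk> \<Longrightarrow> f \<star> (g + g') = f \<star> g + f \<star> g'"
    and tmor_scal_left:
      "\<lbrakk>X \<in> obj C; X' \<in> obj C; Y \<in> obj C; Y' \<in> obj C; f \<in> Hom C X X'; g \<in> Hom C Y Y'\<rbrakk> \<Longrightarrow>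
        scal C c f \<star> g = scal C c (f \<star> g)"
    and tmor_scal_right:
      "\<lbrakk>X \<in> obj C; X' \<in> obj C; Y \<in> obj C; Y' \<in> obj C; f \<in> Hom C X X'; g \<in> Hom C Y Y'\<rbrakk> \<Longrightarrow>
        f \<star> scal C c g = scal C c (f \<star> g)"
    and assoc_iso:
      "\<lbrakk>X \<in> obj C; Y \<in> obj C; Z \<in> obj C\<rbrakk> \<Longrightarrow>
        iso_mor C ((X \<boxtimes> Y) \<boxtimes> Z) (X \<boxtimes> (Y \<boxtimes> Z)) (\<alpha>\<^sub>u X Y Z)"
    and lunit_iso: "X \<in> obj C \<Longrightarrow> iso_mor C (\<bbbone> \<boxtimes> X) X (\<lambda>\<^sub>u X)"
    and runit_iso: "X \<in> obj C \<Longrightarrow> iso_mor C (X \<boxtimes> \<bbbone>) X (\<rho>\<^sub>u X)"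
    and assoc_natural:
      "\<lbrakk>X \<in> obj C; X' \<in> obj C; Y \<in> obj C; Y' \<in> obj C; Z \<in> obj C; Z' \<in> obj C;
        f \<in> Hom C X X'; g \<in> Hom C Y Y'; h \<in> Hom C Z Z'\<rbrakk> \<Longrightarrow>
        \<alpha>\<^sub>u X' Y' Z' \<cdot> ((f \<star> g) \<star> h) = (f \<star> (g \<star> h)) \<cdot> \<alpha>\<^sub>u X Y Z"
    and lunit_natural:
      "\<lbrakk>X \<in> obj C; Y \<in> obj C; f \<in> Hom C X Y\<rbrakk> \<Longrightarrow> \<lambda>\<^sub>u Y \<cdot> (\<I> \<bbbone> \<star> f) = f \<cdot> \<lambda>\<^sub>u X"
    and runit_natural:
      "\<lbrakk>X \<in> obj C; Y \<in> obj C; f \<in> Hom C X Y\<rbrakk> \<Longrightarrow> \<rho>\<^sub>u Y \<cdot> (f \<star> \<I> \<bbbone>) = f \<cdot> \<rho>\<^sub>u X"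
    and pentagon:
      "\<lbrakk>W \<in> obj C; X \<in> obj C; Y \<in> obj C; Z \<in> obj C\<rbrakk> \<Longrightarrow>
        \<alpha>\<^sub>u W X (Y \<boxtimes> Z) \<cdot> \<alpha>\<^sub>u (W \<boxtimes> X) Y Z =
        (\<I> W \<star> \<alpha>\<^sub>u X Y Z) \<cdot> \<alpha>\<^sub>u W (X \<boxtimes> Y) Z \<cdot> (\<alpha>\<^sub>u W X Y \<star> \<I> Z)"
    and triangle:
      "\<lbrakk>X \<in> obj C; Y \<in> obj C\<rbrakk> \<Longrightarrow> (\<I> X \<star> \<lambda>\<^sub>u Y) \<cdot> \<alpha>\<^sub>u X \<bbbone> Y = \<rho>\<^sub>u X \<star> \<I> Y"

subsection \<open>Direct sums, simple objects\<close>

definition direct_sum ::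
  "('k, 'o, 'm::ab_group_add, 'z) lmcat_scheme \<Rightarrow> 'b set \<Rightarrow> ('b \<Rightarrow> 'o) \<Rightarrow> 'o \<Rightarrow>
   ('b \<Rightarrow> 'm) \<Rightarrow> ('b \<Rightarrow> 'm) \<Rightarrow> bool" where
  "direct_sum C K W X i p \<longleftrightarrow>
     finite K \<and> X \<in> obj C \<and> (\<forall>a\<in>K. W a \<in> obj C) \<and>
     (\<forall>a\<in>K. i a \<in> Hom C (W a) X \<and> p a \<in> Hom C X (W a)) \<and>
     (\<forall>a\<in>K. \<forall>b\<in>K. p a \<cdot> i b = (if a = b then \<I> (W a) else 0)) \<and>
     \<I> X = (\<Sum>a\<in>K. i a \<cdot> p a)"
  for C (structure)

definition is_direct_sum ::
  "('k, 'o, 'm::ab_group_add, 'z) lmcat_scheme \<Rightarrow> 'o list \<Rightarrow> 'o \<Rightarrow> bool" where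
  "is_direct_sum C Xs X \<longleftrightarrow> (\<exists>i p. direct_sum C {..<length Xs} (\<lambda>n. Xs ! n) X i p)"

definition zero_obj :: "('k, 'o, 'm::ab_group_add, 'z) lmcat_scheme \<Rightarrow> 'o \<Rightarrow> bool" where
  "zero_obj C X \<longleftrightarrow> is_direct_sum C [] X"

definition direct_summand :: "('k, 'o, 'm::ab_group_add, 'z) lmcat_scheme \<Rightarrow> 'o \<Rightarrow> 'o \<Rightarrow> bool" where
  "direct_summand C Y X \<longleftrightarrow> (\<exists>Z\<in>obj C. is_direct_sum C [Y, Z] X)"

definition additive_category :: "('k, 'o, 'm::ab_group_add, 'z) lmcat_scheme \<Rightarrow> bool" where
  "additive_category C \<longleftrightarrow> (\<exists>Z\<in>obj C. zero_obj C Z) \<and>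
     (\<forall>X\<in>obj C. \<forall>Y\<in>obj C. \<exists>Z\<in>obj C. is_direct_sum C [X, Y] Z)"

definition hom_finite :: "('k::field, 'o, 'm::ab_group_add, 'z) lmcat_scheme \<Rightarrow> bool" where
  "hom_finite C \<longleftrightarrow>
     (\<forall>X\<in>obj C. \<forall>Y\<in>obj C. \<exists>B. finite B \<and> module.span (scal C) B = Hom C X Y)"

definition simple_obj :: "('k::field, 'o, 'm::ab_group_add, 'z) lmcat_scheme \<Rightarrow> 'o \<Rightarrow> bool" where
  "simple_obj C X \<longleftrightarrow> X \<in> obj C \<and>
     (\<exists>\<phi>. bij_betw \<phi> (Hom C X X) (UNIV :: 'k set) \<and> \<phi> (\<I> X) = 1 \<and>
        (\<forall>f\<in>Hom C X X. \<forall>g\<in>Hom C X X. \<phi> (f + g) = \<phi> f + \<phi> g \<and> \<phi> (f \<cdot> g) = \<phi> f * \<phi> g) \<and>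
        (\<forall>c. \<forall>f\<in>Hom C X X. \<phi> (scal C c f) = c * \<phi> f))"
  for C (structure)

text \<open>A linear monoidal category with the chosen data of the reconstruction: left duals with
  evaluation and coevaluation, the finite family $(V_j)_{j\in I}$ of simple objects, and their direct
  sum $\hat V$ with its injections and projections.\<close>

record ('k, 'o, 'm, 'i) fcat = "('k, 'o, 'm) lmcat" +
  ldual :: "'o \<Rightarrow> 'o"
  ev :: "'o \<Rightarrow> 'm"
  coev :: "'o \<Rightarrow> 'm"
  idx :: "'i set"
  smp :: "'i \<Rightarrow> 'o"
  Vhat :: "'o"
  vinj :: "'i \<Rightarrow> 'm"
  vprj :: "'i \<Rightarrow> 'm"

definition left_autonomous :: "('k, 'o, 'm::ab_group_add, 'i) fcat \<Rightarrow> bool" where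
  "left_autonomous C \<longleftrightarrow> (\<forall>X\<in>obj C.
     ldual C X \<in> obj C \<and>
     ev C X \<in> Hom C (ldual C X \<boxtimes> X) \<bbbone> \<and>
     coev C X \<in> Hom C \<bbbone> (X \<boxtimes> ldual C X) \<and>
     \<rho>\<^sub>u X \<cdot> (\<I> X \<star> ev C X) \<cdot> \<alpha>\<^sub>u X (ldual C X) X \<cdot> (coev C X \<star> \<I> X) \<cdot> lunit_inv C X = \<I> X \<and>
     \<lambda>\<^sub>u (ldual C X) \<cdot> (ev C X \<star> \<I> (ldual C X)) \<cdot> assoc_inv C (ldual C X) X (ldual C X)
       \<cdot> (\<I> (ldual C X) \<star> coev C X) \<cdot> runit_inv C (ldual C X) = \<I> (ldual C X))"
  for C (structure)

definition finitely_split_semisimple :: "('k::field, 'o, 'm::ab_group_add, 'i) fcat \<Rightarrow> bool" where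
  "finitely_split_semisimple C \<longleftrightarrow>
     finite (idx C) \<and> (\<forall>j\<in>idx C. simple_obj C (smp C j)) \<and>
     (\<forall>j\<in>idx C. \<forall>l\<in>idx C. j \<noteq> l \<longrightarrow> Hom C (smp C j) (smp C l) = {0}) \<and>
     (\<forall>X\<in>obj C. \<exists>js. set js \<subseteq> idx C \<and> is_direct_sum C (map (smp C) js) X)"

definition Vhat_direct_sum :: "('k, 'o, 'm::ab_group_add, 'i) fcat \<Rightarrow> bool" where
  "Vhat_direct_sum C \<longleftrightarrow> direct_sum C (idx C) (smp C) (Vhat C) (vinj C) (vprj C)"

text \<open>$M^{\otimes 0}=\mathbf 1$, $M^{\otimes 1}=M$ and $M^{\otimes (n+1)}=M^{\otimes n}\otimes M$.\<close>

fun tensor_power :: "('k, 'o, 'm, 'z) lmcat_scheme \<Rightarrow> 'o \<Rightarrow> nat \<Rightarrow> 'o" where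
  "tensor_power C M 0 = unit_obj C"
| "tensor_power C M (Suc 0) = M"
| "tensor_power C M (Suc (Suc n)) = tobj C (tensor_power C M (Suc n)) M"

definition generates_as_fusion_category :: "('k, 'o, 'm::ab_group_add, 'i) fcat \<Rightarrow> 'o \<Rightarrow> bool" where
  "generates_as_fusion_category C M \<longleftrightarrow>
     M \<in> obj C \<and> \<not> zero_obj C M \<and>
     (\<forall>j\<in>idx C. \<exists>n. direct_summand C (smp C j) (tensor_power C M n)) \<and>
     (\<forall>X\<in>obj C. \<forall>Y\<in>obj C. \<forall>Z\<in>obj C. is_direct_sum C [X, Y, Z] M \<longrightarrow>
        \<not> zero_obj C X \<longrightarrow> \<not> zero_obj C Y \<longrightarrow> \<not> iso_obj C X Y) \<and>
     \<not> (\<exists>X\<in>obj C. \<not> zero_obj C X \<and> direct_summand C X (unit_obj C) \<and> direct_summand C X M)"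

section \<open>The long canonical functor and the coend\<close>

definition omega :: "('k, 'o, 'm, 'i) fcat \<Rightarrow> 'o \<Rightarrow> 'm set" where
  "omega C X = Hom C (Vhat C) (Vhat C \<boxtimes> X)"
  for C (structure)

definition omega_map :: "('k, 'o, 'm, 'i) fcat \<Rightarrow> 'm \<Rightarrow> 'm \<Rightarrow> 'm" where
  "omega_map C f v = (\<I> (Vhat C) \<star> f) \<cdot> v"
  for C (structure)

definition omega_dual :: "('k, 'o, 'm, 'i) fcat \<Rightarrow> 'o \<Rightarrow> 'm set" where
  "omega_dual C X = Hom C (Vhat C \<boxtimes> X) (Vhat C)"
  for C (structure)

text \<open>$\lambda_j\in R=\mathrm{End}(\hat V)$ is $\mathrm{id}_{V_j}$ on the summand $V_j$; these elements
  form a basis of $R$, and $\varepsilon_R$ is the linear form with $\varepsilon_R(\lambda_j)=1$.\<close>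

definition lam :: "('k, 'o, 'm, 'i) fcat \<Rightarrow> 'i \<Rightarrow> 'm" where
  "lam C j = vinj C j \<cdot> vprj C j"
  for C (structure)

definition eps_R :: "('k::field, 'o, 'm::ab_group_add, 'i) fcat \<Rightarrow> 'm \<Rightarrow> 'k" where
  "eps_R C f = (\<Sum>j\<in>idx C. module.representation (scal C) (lam C ` idx C) f (lam C j))"

definition pairing :: "('k::field, 'o, 'm::ab_group_add, 'i) fcat \<Rightarrow> 'm \<Rightarrow> 'm \<Rightarrow> 'k" where
  "pairing C \<theta> v = eps_R C (\<theta> \<cdot> v)"
  for C (structure)

text \<open>The vector $e^j\in(\omega X)^*$ of the basis dual to the basis $(e_j)_{j\in K}$ of $\omega X$.\<close>

definition dual_vec ::
  "('k::field, 'o, 'm::ab_group_add, 'i) fcat \<Rightarrow> 'o \<Rightarrow> ('b \<Rightarrow> 'm) \<Rightarrow> 'b set \<Rightarrow> 'b \<Rightarrow> 'm" where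
  "dual_vec C X e K j =
     (THE \<theta>. \<theta> \<in> omega_dual C X \<and> (\<forall>l\<in>K. pairing C \<theta> (e l) = (if l = j then 1 else 0)))"

definition is_basis_of ::
  "('k::field, 'o, 'm::ab_group_add, 'z) lmcat_scheme \<Rightarrow> 'm set \<Rightarrow> 'm set \<Rightarrow> bool" where
  "is_basis_of C B W \<longleftrightarrow> \<not> module.dependent (scal C) B \<and> module.span (scal C) B = W"

text \<open>An arbitrary basis of $\omega X$. The elements $\sum_j e_j\otimes e^j$ of
  $\omega X\otimes(\omega X)^*$, and hence $\Delta$ and $\beta_{\omega X}$ below, do not depend on it.\<close>

definition omega_basis :: "('k::field, 'o, 'm::ab_group_add, 'i) fcat \<Rightarrow> 'o \<Rightarrow> 'm set" where
  "omega_basis C X = (SOME B. is_basis_of C B (omega C X))"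

text \<open>The coend is the quotient of the free vector space on the symbols $(X,\theta,v)$ by the
  bilinearity relations and by the relations
  $[\zeta|(\omega f)(v)]_Y=[\zeta\circ(\mathrm{id}_{\hat V}\otimes f)|v]_X$.\<close>

definition coend_symbols :: "('k, 'o, 'm, 'i) fcat \<Rightarrow> ('o \<times> 'm \<times> 'm) set" where
  "coend_symbols C = {(X, \<theta>, v). X \<in> obj C \<and> \<theta> \<in> omega_dual C X \<and> v \<in> omega C X}"

definition coend_relations ::
  "('k::field, 'o, 'm::ab_group_add, 'i) fcat \<Rightarrow> ('o \<times> 'm \<times> 'm \<Rightarrow>\<^sub>0 'k) set" where
  "coend_relations C = module.span pm_scale (
     {basis_vec (X, \<theta> + \<theta>', v) - basis_vec (X, \<theta>, v) - basis_vec (X, \<theta>', v) | X \<theta> \<theta>' v.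
        X \<in> obj C \<and> \<theta> \<in> omega_dual C X \<and> \<theta>' \<in> omega_dual C X \<and> v \<in> omega C X} \<union>
     {basis_vec (X, \<theta>, v + v') - basis_vec (X, \<theta>, v) - basis_vec (X, \<theta>, v') | X \<theta> v v'.
        X \<in> obj C \<and> \<theta> \<in> omega_dual C X \<and> v \<in> omega C X \<and> v' \<in> omega C X} \<union>
     {basis_vec (X, scal C c \<theta>, v) - pm_scale c (basis_vec (X, \<theta>, v)) | X c \<theta> v.
        X \<in> obj C \<and> \<theta> \<in> omega_dual C X \<and> v \<in> omega C X} \<union>
     {basis_vec (X, \<theta>, scal C c v) - pm_scale c (basis_vec (X, \<theta>, v)) | X c \<theta> v.
        X \<in> obj C \<and> \<theta> \<in> omega_dual C X \<and> v \<in> omega C X} \<union>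
     {basis_vec (Y, \<zeta>, omega_map C f v) - basis_vec (X, \<zeta> \<cdot> (\<I> (Vhat C) \<star> f), v) | X Y f \<zeta> v.
        X \<in> obj C \<and> Y \<in> obj C \<and> f \<in> Hom C X Y \<and> \<zeta> \<in> omega_dual C Y \<and> v \<in> omega C X})"
  for C (structure)

text \<open>The operations of the coend on the level of symbols. This is not a Weak Bialgebra, but its
  quotient by the relations is.\<close>

definition coend_free ::
  "('k::field, 'o, 'm::ab_group_add, 'i) fcat \<Rightarrow> ('k, 'o \<times> 'm \<times> 'm \<Rightarrow>\<^sub>0 'k) wba" where
  "coend_free C =
     \<lparr>carrier = {t. Poly_Mapping.keys t \<subseteq> coend_symbols C},
      mult = bilin_extend (\<lambda>(X, \<theta>, v) (Y, \<zeta>, w). basis_vec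
        (X \<boxtimes> Y,
         \<zeta> \<cdot> (\<theta> \<star> \<I> Y) \<cdot> assoc_inv C (Vhat C) X Y,
         \<alpha>\<^sub>u (Vhat C) X Y \<cdot> (v \<star> \<I> Y) \<cdot> w)),
      one = basis_vec (\<bbbone>, \<rho>\<^sub>u (Vhat C), runit_inv C (Vhat C)),
      zero = 0, add = (+), smult = pm_scale,
      comult = lin_extend (\<lambda>(X, \<theta>, v). \<Sum>b\<in>omega_basis C X. basis_vec
        (basis_vec (X, \<theta>, b), basis_vec (X, dual_vec C X (\<lambda>x. x) (omega_basis C X) b, v))),
      counit = lin_eval (\<lambda>(X, \<theta>, v). eps_R C (\<theta> \<cdot> v))\<rparr>"
  for C (structure)

definition coend ::
  "('k::field, 'o, 'm::ab_group_add, 'i) fcat \<Rightarrow> ('k, ('o \<times> 'm \<times> 'm \<Rightarrow>\<^sub>0 'k) set) wba" where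
  "coend C = wba_quot (coend_free C) (coend_relations C)"

text \<open>The element $[\theta|v]_X$.\<close>

definition coend_elem ::
  "('k::field, 'o, 'm::ab_group_add, 'i) fcat \<Rightarrow> 'o \<Rightarrow> 'm \<Rightarrow> 'm \<Rightarrow> ('o \<times> 'm \<times> 'm \<Rightarrow>\<^sub>0 'k) set" where
  "coend_elem C X \<theta> v = coend_relations C +>\<^bsub>coend_free C\<^esub> basis_vec (X, \<theta>, v)"

definition omega_comodule ::
  "('k::field, 'o, 'm::ab_group_add, 'i) fcat \<Rightarrow> 'o \<Rightarrow>
   ('k, 'm, ('o \<times> 'm \<times> 'm \<Rightarrow>\<^sub>0 'k) set) comodule" where
  "omega_comodule C X =
     \<lparr>carrier = omega C X, mult = undefined, one = undefined, zero = 0, add = (+), smult = scal C,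
      coact = (\<lambda>v. \<Sum>b\<in>omega_basis C X. basis_vec
        (b, coend_elem C X (dual_vec C X (\<lambda>x. x) (omega_basis C X) b) v))\<rparr>"

section \<open>The dimension graph\<close>

text \<open>\<open>B j l\<close> is the chosen basis of $\mathrm{Hom}(V_j,V_\ell\otimes M)$; the edge \<open>(j, b, l)\<close> is the
  basis vector \<open>b\<close> tagged with source and target.\<close>

definition edge_bases ::
  "('k::field, 'o, 'm::ab_group_add, 'i) fcat \<Rightarrow> 'o \<Rightarrow> ('i \<Rightarrow> 'i \<Rightarrow> 'm set) \<Rightarrow> bool" where
  "edge_bases C M B \<longleftrightarrow>
     (\<forall>j\<in>idx C. \<forall>l\<in>idx C. is_basis_of C (B j l) (Hom C (smp C j) (smp C l \<boxtimes> M)))"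
  for C (structure)

definition dimension_graph ::
  "('k, 'o, 'm, 'i) fcat \<Rightarrow> ('i \<Rightarrow> 'i \<Rightarrow> 'm set) \<Rightarrow> ('i, 'i \<times> 'm \<times> 'i) pre_digraph" where
  "dimension_graph C B =
     \<lparr>verts = idx C, arcs = {(j, b, l). j \<in> idx C \<and> l \<in> idx C \<and> b \<in> B j l},
      tail = (\<lambda>(j, b, l). j), head = (\<lambda>(j, b, l). l)\<rparr>"

definition vertex_vec :: "('k, 'o, 'm, 'i) fcat \<Rightarrow> 'i \<Rightarrow> 'm" where
  "vertex_vec C j = runit_inv C (Vhat C) \<cdot> lam C j"
  for C (structure)

definition vertex_covec :: "('k, 'o, 'm, 'i) fcat \<Rightarrow> 'i \<Rightarrow> 'm" where
  "vertex_covec C j = lam C j \<cdot> \<rho>\<^sub>u (Vhat C)"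
  for C (structure)

text \<open>The edge \<open>(j, b, l)\<close> as an element of
  $\omega M=\bigoplus_{j,\ell}\mathrm{Hom}(V_j,V_\ell\otimes M)$.\<close>

definition edge_vec :: "('k, 'o, 'm, 'i) fcat \<Rightarrow> 'o \<Rightarrow> 'i \<times> 'm \<times> 'i \<Rightarrow> 'm" where
  "edge_vec C M = (\<lambda>(j, b, l). (vinj C l \<star> \<I> M) \<cdot> b \<cdot> vprj C j)"
  for C (structure)

definition edge_covec ::
  "('k::field, 'o, 'm::ab_group_add, 'i) fcat \<Rightarrow> 'o \<Rightarrow> ('i \<Rightarrow> 'i \<Rightarrow> 'm set) \<Rightarrow> 'i \<times> 'm \<times> 'i \<Rightarrow> 'm" where
  "edge_covec C M B p = dual_vec C M (edge_vec C M) (arcs (dimension_graph C B)) p"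

text \<open>$e_p\in\omega(M^{\otimes n})$ for a path $p$ of length $n$. The recursion is on the last edge,
  whence the reversed list of edges.\<close>

fun rev_path_vec :: "('k, 'o, 'm::zero, 'i) fcat \<Rightarrow> 'o \<Rightarrow> ('i \<times> 'm \<times> 'i) list \<Rightarrow> 'm" where
  "rev_path_vec C M [] = 0"
| "rev_path_vec C M [p] = edge_vec C M p"
| "rev_path_vec C M (p # q # ps) =
     cmp C (cmp C (assoc C (Vhat C) (tensor_power C M (length (q # ps))) M)
       (tmor C (rev_path_vec C M (q # ps)) (ident C M))) (edge_vec C M p)"

definition path_vec :: "('k, 'o, 'm::zero, 'i) fcat \<Rightarrow> 'o \<Rightarrow> ('i, 'i \<times> 'm \<times> 'i) gpath \<Rightarrow> 'm" where
  "path_vec C M p =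
     (if snd p = [] then vertex_vec C (fst p) else rev_path_vec C M (rev (snd p)))"

text \<open>The matrix element $f_{r;p}$ of $\omega f$ for $f\in\mathrm{End}(M^{\otimes n})$.\<close>

definition matrix_elem ::
  "('k::field, 'o, 'm::ab_group_add, 'i) fcat \<Rightarrow> 'o \<Rightarrow> ('i \<Rightarrow> 'i \<Rightarrow> 'm set) \<Rightarrow> nat \<Rightarrow> 'm \<Rightarrow>
   ('i, 'i \<times> 'm \<times> 'i) gpath \<Rightarrow> ('i, 'i \<times> 'm \<times> 'i) gpath \<Rightarrow> 'k" where
  "matrix_elem C M B n f r p =
     module.representation (scal C) (path_vec C M ` paths (dimension_graph C B) n)
       (omega_map C f (path_vec C M p)) (path_vec C M r)"

section \<open>Endomorphism systems\<close>

inductive_set generated_algebra ::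
  "('k, 'o, 'm::ab_group_add, 'z) lmcat_scheme \<Rightarrow> 'm set \<Rightarrow> 'm set"
  for C :: "('k, 'o, 'm::ab_group_add, 'z) lmcat_scheme" and S :: "'m set" where
  "0 \<in> generated_algebra C S"
| "f \<in> S \<Longrightarrow> f \<in> generated_algebra C S"
| "\<lbrakk>f \<in> generated_algebra C S; g \<in> generated_algebra C S\<rbrakk> \<Longrightarrow> f + g \<in> generated_algebra C S"
| "f \<in> generated_algebra C S \<Longrightarrow> scal C c f \<in> generated_algebra C S"
| "\<lbrakk>f \<in> generated_algebra C S; g \<in> generated_algebra C S\<rbrakk> \<Longrightarrow> cmp C f g \<in> generated_algebra C S"

text \<open>$f\mapsto f\otimes\mathrm{id}_M$ from $\mathrm{End}(M^{\otimes n})$ to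
  $\mathrm{End}(M^{\otimes(n+1)})$; for $n=0$ this involves the identification of
  $\mathbf 1\otimes M$ with $M$ by the left unit isomorphism.\<close>

definition tensor_M :: "('k, 'o, 'm, 'z) lmcat_scheme \<Rightarrow> 'o \<Rightarrow> nat \<Rightarrow> 'm \<Rightarrow> 'm" where
  "tensor_M C M n f =
     (if n = 0 then \<lambda>\<^sub>u M \<cdot> (f \<star> \<I> M) \<cdot> lunit_inv C M else f \<star> \<I> M)"
  for C (structure)

definition endomorphism_system ::
  "('k, 'o, 'm::ab_group_add, 'z) lmcat_scheme \<Rightarrow> 'o \<Rightarrow> (nat \<Rightarrow> 'm set) \<Rightarrow> bool" where
  "endomorphism_system C M E \<longleftrightarrow>
     (\<forall>n. E n \<subseteq> Hom C (tensor_power C M n) (tensor_power C M n)) \<and>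
     Hom C \<bbbone> \<bbbone> = generated_algebra C (E 0 \<union> {\<I> \<bbbone>}) \<and>
     (\<forall>n. Hom C (tensor_power C M (Suc n)) (tensor_power C M (Suc n)) =
        generated_algebra C ({tensor_M C M n f | f. f \<in> E n} \<union> E (Suc n)
          \<union> {\<I> (tensor_power C M (Suc n))}))"
  for C (structure)

section \<open>The quotient of the graph Weak Bialgebra by an endomorphism system\<close>

definition endo_relations ::
  "('k::field, 'o, 'm::ab_group_add, 'i) fcat \<Rightarrow> 'o \<Rightarrow> ('i \<Rightarrow> 'i \<Rightarrow> 'm set) \<Rightarrow> (nat \<Rightarrow> 'm set) \<Rightarrow>
   (('i, 'i \<times> 'm \<times> 'i) gpath \<times> ('i, 'i \<times> 'm \<times> 'i) gpath \<Rightarrow>\<^sub>0 'k) set" where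
  "endo_relations C M B E =
     {(\<Sum>p\<in>paths (dimension_graph C B) n.
          pm_scale (matrix_elem C M B n f p q) (basis_vec (r, p))) -
      (\<Sum>p\<in>paths (dimension_graph C B) n.
          pm_scale (matrix_elem C M B n f r p) (basis_vec (p, q))) | n f r q.
      f \<in> E n \<and> r \<in> paths (dimension_graph C B) n \<and> q \<in> paths (dimension_graph C B) n}"

definition endo_ideal ::
  "('k::field, 'o, 'm::ab_group_add, 'i) fcat \<Rightarrow> 'o \<Rightarrow> ('i \<Rightarrow> 'i \<Rightarrow> 'm set) \<Rightarrow> (nat \<Rightarrow> 'm set) \<Rightarrow>
   (('i, 'i \<times> 'm \<times> 'i) gpath \<times> ('i, 'i \<times> 'm \<times> 'i) gpath \<Rightarrow>\<^sub>0 'k) set" where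
  "endo_ideal C M B E =
     genideal (graph_wba (dimension_graph C B)) (endo_relations C M B E)"

definition graph_endo_wba ::
  "('k::field, 'o, 'm::ab_group_add, 'i) fcat \<Rightarrow> 'o \<Rightarrow> ('i \<Rightarrow> 'i \<Rightarrow> 'm set) \<Rightarrow> (nat \<Rightarrow> 'm set) \<Rightarrow>
   ('k, (('i, 'i \<times> 'm \<times> 'i) gpath \<times> ('i, 'i \<times> 'm \<times> 'i) gpath \<Rightarrow>\<^sub>0 'k) set) wba" where
  "graph_endo_wba C M B E = wba_quot (graph_wba (dimension_graph C B)) (endo_ideal C M B E)"

definition endo_proj ::
  "('k::field, 'o, 'm::ab_group_add, 'i) fcat \<Rightarrow> 'o \<Rightarrow> ('i \<Rightarrow> 'i \<Rightarrow> 'm set) \<Rightarrow> (nat \<Rightarrow> 'm set) \<Rightarrow>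
   (('i, 'i \<times> 'm \<times> 'i) gpath \<times> ('i, 'i \<times> 'm \<times> 'i) gpath \<Rightarrow>\<^sub>0 'k) \<Rightarrow>
   (('i, 'i \<times> 'm \<times> 'i) gpath \<times> ('i, 'i \<times> 'm \<times> 'i) gpath \<Rightarrow>\<^sub>0 'k) set" where
  "endo_proj C M B E x = endo_ideal C M B E +>\<^bsub>graph_wba (dimension_graph C B)\<^esub> x"

definition graph_endo_component ::
  "('k::field, 'o, 'm::ab_group_add, 'i) fcat \<Rightarrow> 'o \<Rightarrow> ('i \<Rightarrow> 'i \<Rightarrow> 'm set) \<Rightarrow> (nat \<Rightarrow> 'm set) \<Rightarrow>
   nat \<Rightarrow> (('i, 'i \<times> 'm \<times> 'i) gpath \<times> ('i, 'i \<times> 'm \<times> 'i) gpath \<Rightarrow>\<^sub>0 'k) set set" where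
  "graph_endo_component C M B E m = endo_proj C M B E `
     {t. Poly_Mapping.keys t \<subseteq> paths (dimension_graph C B) m \<times> paths (dimension_graph C B) m}"

definition path_comodule ::
  "('k::field, 'o, 'm::ab_group_add, 'i) fcat \<Rightarrow> 'o \<Rightarrow> ('i \<Rightarrow> 'i \<Rightarrow> 'm set) \<Rightarrow> (nat \<Rightarrow> 'm set) \<Rightarrow>
   nat \<Rightarrow> ('k, ('i, 'i \<times> 'm \<times> 'i) gpath \<Rightarrow>\<^sub>0 'k,
     (('i, 'i \<times> 'm \<times> 'i) gpath \<times> ('i, 'i \<times> 'm \<times> 'i) gpath \<Rightarrow>\<^sub>0 'k) set) comodule" where
  "path_comodule C M B E m =
     \<lparr>carrier = {t. Poly_Mapping.keys t \<subseteq> paths (dimension_graph C B) m},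
      mult = undefined, one = undefined, zero = 0, add = (+), smult = pm_scale,
      coact = lin_extend (\<lambda>p. \<Sum>q\<in>paths (dimension_graph C B) m.
        basis_vec (basis_vec q, endo_proj C M B E (basis_vec (q, p))))\<rparr>"

text \<open>The identification $k\mathcal{G}^m\to\omega(M^{\otimes m})$, $p\mapsto e_p$; it is used for
  $m=0$ and $m=1$.\<close>

definition path_ident ::
  "('k::field, 'o, 'm::ab_group_add, 'i) fcat \<Rightarrow> 'o \<Rightarrow> (('i, 'i \<times> 'm \<times> 'i) gpath \<Rightarrow>\<^sub>0 'k) \<Rightarrow> 'm" where
  "path_ident C M t =
     (\<Sum>p\<in>Poly_Mapping.keys t. scal C (Poly_Mapping.lookup t p) (path_vec C M p))"

text \<open>The unique homomorphism $\pi$ from the graph Weak Bialgebra to the coend (made unique as a HOL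
  function by requiring it to be \<open>undefined\<close> outside the carrier).\<close>

definition canonical_pi ::
  "('k::field, 'o, 'm::ab_group_add, 'i) fcat \<Rightarrow> 'o \<Rightarrow> ('i \<Rightarrow> 'i \<Rightarrow> 'm set) \<Rightarrow>
   (('i, 'i \<times> 'm \<times> 'i) gpath \<times> ('i, 'i \<times> 'm \<times> 'i) gpath \<Rightarrow>\<^sub>0 'k) \<Rightarrow>
   ('o \<times> 'm \<times> 'm \<Rightarrow>\<^sub>0 'k) set" where
  "canonical_pi C M B = (THE \<pi>.
     \<pi> \<in> extensional (carrier (graph_wba (dimension_graph C B))) \<and>
     wba_hom (graph_wba (dimension_graph C B)) (coend C) \<pi> \<and>
     (\<forall>j\<in>idx C. \<forall>l\<in>idx C. \<pi> (basis_vec (vertex_path j, vertex_path l)) =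
        coend_elem C (unit_obj C) (vertex_covec C j) (vertex_vec C l)) \<and>
     (\<forall>p\<in>arcs (dimension_graph C B). \<forall>q\<in>arcs (dimension_graph C B).
        \<pi> (basis_vec (edge_path (dimension_graph C B) p, edge_path (dimension_graph C B) q)) =
        coend_elem C M (edge_covec C M B p) (edge_vec C M q)))"

end

(*
  Elements of a tensor product, of a quotient or of the coend are compared by testing them against all
  (bi-, trilinear or dinatural) forms, which turns the axioms of Weak Bialgebras and comodules into
  identities between scalars; they pass to any surjective image that respects all operations.

  Write <theta, v> for the pairing of omega X. The vectors e_p of the paths p of length n have dual
  bases with respect to the pairing, and M^n (x) M^m -> M^(n+m) sends e_p (x) e_r to e_(pr), or to 0 if
  p and r do not compose. Hence [p|q]_n |-> [e^p|e_q] respects all operations, and by (i) it is surjective.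
  The relations of the ideal hold in the coend since it is dinatural in X, and since the matrix
  coefficients of the coalgebra components square with the relations the ideal is also a coideal.

  For injectivity let V_j be a retract of M^(n_j), where by (iii) the exponent n_j can be taken to be 0
  or 1 whenever V_j is a summand of 1 or of M, respectively. Factoring id_X through the corresponding
  tensor powers gives a map from the symbols [theta|v]_X back to the graph Weak Bialgebra. It sends the
  relations of the coend to 0 for any choice of such factorizations, and in degrees 0 and 1 it inverts
  the surjection up to the relations of End(1) and End(M), which are generated by those of E.
*)

theory Submission
 imports Defs
begin

text \<open>Hardly any identity of the coend holds on the nose: elements of tensor products have no
  normal form, products of three symbols are bracketed differently on the two sides of
  associativity, and the product of the n-th and m-th tensor powers differs as an object from the
  power n + m. Hence no axiom is checked for the coend itself. Its operations are only shown to
  descend to classes, and the axioms are carried over from the graph Weak Bialgebra, where paths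
  concatenate strictly.

  The degree confines injectivity to degrees zero and one. The generators of the ideal are
  homogeneous, whereas factoring identities through tensor powers may turn a symbol of degree n into
  one of degree n_j. Only if n_j = n for every V_j in the n-th power can the way back be compared
  with the identity by means of the relations of its endomorphisms. In degree one these
  endomorphisms include the f (x) id_M with f in E^(0), whose relations need not be among the
  generators; they arise from degree zero by multiplication with the symbols [r|q]_1, since f acts
  diagonally.\<close>

abbreviation keys where "keys \<equiv> Poly_Mapping.keys"

abbreviation lookup where "lookup \<equiv> Poly_Mapping.lookup"

section \<open>Linear forms on formal linear combinations\<close>

lemma lookup_pm_scale [simp]: "lookup (pm_scale c t) x = c * lookup t x"
 by (simp add: pm_scale_def Poly_Mapping.map.rep_eq when_def)

interpretation pm: vector_space "pm_scale :: 'k::field \<Rightarrow> ('a \<Rightarrow>\<^sub>0 'k) \<Rightarrow> _"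
 by unfold_locales (auto intro!: poly_mapping_eqI simp: lookup_add algebra_simps)

lemma lookup_basis_vec: "lookup (basis_vec x) y = (if x = y then 1 else 0)"
 by (simp add: basis_vec_def lookup_single when_def)

lemma keys_basis_vec [simp]: "keys (basis_vec x :: 'a \<Rightarrow>\<^sub>0 'k::field) = {x}"
 by (simp add: basis_vec_def)

lemma keys_pm_scale: "keys (pm_scale c t) \<subseteq> keys t"
 by (auto simp: in_keys_iff)

lemma keys_sum_subset: "keys (\<Sum>x\<in>A. f x) \<subseteq> (\<Union>x\<in>A. keys (f x))"
proof (induction A rule: infinite_finite_induct)
 case (insert x A)
 then show ?case using Poly_Mapping.keys_add[of "f x" "sum f A"] by auto
qed auto

lemma keys_diff_subset:
 "keys (s - t) \<subseteq> keys s \<union> keys (t :: 'a \<Rightarrow>\<^sub>0 'k::ab_group_add)"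
 by (auto simp: in_keys_iff lookup_minus)

lemma lin_eval_superset:
 assumes "finite A" "keys t \<subseteq> A"
 shows "lin_eval f t = (\<Sum>x\<in>A. lookup t x * f x)"
 unfolding lin_eval_def using assms by (intro sum.mono_neutral_left) (auto simp: in_keys_iff)

lemma lin_eval_zero [simp]: "lin_eval f 0 = 0"
 by (simp add: lin_eval_def)

lemma lin_eval_basis_vec [simp]: "lin_eval f (basis_vec x) = f x"
 by (simp add: lin_eval_def lookup_basis_vec)

lemma lin_eval_add: "lin_eval f (s + t) = lin_eval f s + lin_eval f t"
proof -
 let ?A = "keys s \<union> keys t"
 have "keys (s + t) \<subseteq> ?A" by (rule Poly_Mapping.keys_add)
 then show ?thesis
  by (simp add: lin_eval_superset[of ?A] lookup_add distrib_right sum.distrib)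
qed

lemma lin_eval_scale: "lin_eval f (pm_scale c t) = c * lin_eval f t"
 using keys_pm_scale[of c t]
 by (simp add: lin_eval_superset[of "keys t"] sum_distrib_left mult.assoc)

lemma lin_eval_diff: "lin_eval f (s - t) = lin_eval f s - lin_eval f t"
proof -
 have "lin_eval f s = lin_eval f ((s - t) + t)" by simp
 then show ?thesis unfolding lin_eval_add by simp
qed

lemma lin_eval_sum: "lin_eval f (\<Sum>x\<in>A. g x) = (\<Sum>x\<in>A. lin_eval f (g x))"
 by (induction A rule: infinite_finite_induct) (simp_all add: lin_eval_add)

lemma lin_eval_cong: "(\<And>x. x \<in> keys t \<Longrightarrow> f x = g x) \<Longrightarrow> lin_eval f t = lin_eval g t"
 by (simp add: lin_eval_def)

lemma lin_eval_fun_add: "lin_eval (\<lambda>x. f x + g x) t = lin_eval f t + lin_eval g t"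
 by (simp add: lin_eval_def distrib_left sum.distrib)

lemma lin_eval_fun_scale: "lin_eval (\<lambda>x. c * f x) t = c * lin_eval f t"
 by (simp add: lin_eval_def sum_distrib_left mult.left_commute)

lemma lin_eval_fun_zero [simp]: "lin_eval (\<lambda>x. 0) t = 0"
 by (simp add: lin_eval_def)

lemma lin_eval_fun_sum: "lin_eval (\<lambda>x. \<Sum>i\<in>A. f i x) t = (\<Sum>i\<in>A. lin_eval (f i) t)"
 by (induction A rule: infinite_finite_induct) (simp_all add: lin_eval_fun_add)

lemma lin_eval_swap:
 "lin_eval (\<lambda>x. lin_eval (\<lambda>y. f x y) t) s = lin_eval (\<lambda>y. lin_eval (\<lambda>x. f x y) s) t"
 unfolding lin_eval_def sum_distrib_left by (subst sum.swap) (simp add: mult.left_commute)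

lemma lin_eval_extend: "lin_eval f (lin_extend g t) = lin_eval (\<lambda>x. lin_eval f (g x)) t"
 by (simp add: lin_extend_def lin_eval_sum lin_eval_scale) (simp add: lin_eval_def)

text \<open>The coordinate functions are among the forms \<open>lin_eval f\<close>. Identities
  between formal combinations thus become identities between scalars, where sums can be exchanged
  freely.\<close>

lemma pm_eqI: "(\<And>f. lin_eval f s = lin_eval f t) \<Longrightarrow> s = (t :: 'a \<Rightarrow>\<^sub>0 'k::field)"
proof (rule poly_mapping_eqI)
 fix x assume *: "\<And>f. lin_eval f s = lin_eval f t"
 have "lin_eval (\<lambda>y. if y = x then 1 else 0) u = lookup u x" for u :: "'a \<Rightarrow>\<^sub>0 'k"
  by (simp add: lin_eval_def if_distrib[of "(*) _"] sum.delta in_keys_iff cong: if_cong)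
 with *[of "\<lambda>y. if y = x then 1 else 0"]
 show "lookup s x = lookup t x" by simp
qed

lemma lin_extend_basis_vec [simp]: "lin_extend g (basis_vec x) = g x"
 by (rule pm_eqI) (simp add: lin_eval_extend)

lemma lin_extend_zero [simp]: "lin_extend g 0 = 0"
 by (simp add: lin_extend_def)

lemma lin_extend_add: "lin_extend g (s + t) = lin_extend g s + lin_extend g t"
 by (rule pm_eqI) (simp add: lin_eval_extend lin_eval_add)

lemma lin_extend_scale: "lin_extend g (pm_scale c t) = pm_scale c (lin_extend g t)"
 by (rule pm_eqI) (simp add: lin_eval_extend lin_eval_scale)

lemma lin_extend_diff: "lin_extend g (s - t) = lin_extend g s - lin_extend g t"
 by (rule pm_eqI) (simp add: lin_eval_extend lin_eval_diff)

lemma lin_extend_sum: "lin_extend g (\<Sum>x\<in>A. h x) = (\<Sum>x\<in>A. lin_extend g (h x))"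
 by (rule pm_eqI) (simp add: lin_eval_extend lin_eval_sum)

lemma lin_extend_cong: "(\<And>x. x \<in> keys t \<Longrightarrow> f x = g x) \<Longrightarrow> lin_extend f t = lin_extend g t"
 by (simp add: lin_extend_def)

lemma lin_extend_lin_extend: "lin_extend f (lin_extend g t) = lin_extend (\<lambda>x. lin_extend f (g x)) t"
 by (rule pm_eqI) (simp add: lin_eval_extend)

lemma lin_extend_basis: "lin_extend basis_vec t = t"
 by (rule pm_eqI) (simp add: lin_eval_extend)

lemma keys_lin_extend: "keys (lin_extend g t) \<subseteq> (\<Union>x\<in>keys t. keys (g x))"
 unfolding lin_extend_def using keys_sum_subset keys_pm_scale by fastforce

lemma lin_eval_bilin_extend:
 "lin_eval f (bilin_extend g s t) = lin_eval (\<lambda>x. lin_eval (\<lambda>y. lin_eval f (g x y)) t) s"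
 by (simp add: bilin_extend_def lin_eval_extend)

lemma bilin_extend_basis_vec [simp]: "bilin_extend g (basis_vec x) (basis_vec y) = g x y"
 by (simp add: bilin_extend_def)

lemma bilin_extend_add_left: "bilin_extend g (s + s') t = bilin_extend g s t + bilin_extend g s' t"
 by (simp add: bilin_extend_def lin_extend_add)

lemma bilin_extend_add_right: "bilin_extend g s (t + t') = bilin_extend g s t + bilin_extend g s t'"
 by (rule pm_eqI) (simp add: lin_eval_bilin_extend lin_eval_add lin_eval_fun_add)

lemma bilin_extend_scale_left: "bilin_extend g (pm_scale c s) t = pm_scale c (bilin_extend g s t)"
 by (simp add: bilin_extend_def lin_extend_scale)

lemma bilin_extend_scale_right: "bilin_extend g s (pm_scale c t) = pm_scale c (bilin_extend g s t)"
 by (rule pm_eqI) (simp add: lin_eval_bilin_extend lin_eval_scale lin_eval_fun_scale)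

lemma bilin_extend_sum_left: "bilin_extend g (\<Sum>i\<in>A. s i) t = (\<Sum>i\<in>A. bilin_extend g (s i) t)"
 by (simp add: bilin_extend_def lin_extend_sum)

lemma bilin_extend_sum_right: "bilin_extend g s (\<Sum>i\<in>A. t i) = (\<Sum>i\<in>A. bilin_extend g s (t i))"
 by (rule pm_eqI) (simp add: lin_eval_bilin_extend lin_eval_sum lin_eval_fun_sum)

lemma bilin_extend_zero [simp]: "bilin_extend g 0 t = 0" "bilin_extend g s 0 = 0"
 using bilin_extend_scale_left[of g 0 s t] bilin_extend_scale_right[of g s 0 t] by simp_all

lemma keys_bilin_extend:
 "keys (bilin_extend g s t) \<subseteq>
   (\<Union>x\<in>keys s. \<Union>y\<in>keys t. keys (g x y))"
 unfolding bilin_extend_def by (rule order_trans[OF keys_lin_extend UN_mono[OF subset_refl keys_lin_extend]])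

text \<open>The supports are kept inside \<open>A\<close> throughout, because the maps to which this
  is applied are often linear only on a carrier, namely on the combinations supported in
  \<open>A\<close>.\<close>

lemma pm_basis_induct [consumes 1, case_names zero basis add scale]:
 assumes "keys t \<subseteq> A"
  and "P 0" "\<And>x. x \<in> A \<Longrightarrow> P (basis_vec x)"
  and "\<And>s t. \<lbrakk>keys s \<subseteq> A; keys t \<subseteq> A; P s; P t\<rbrakk> \<Longrightarrow> P (s + t)"
  and "\<And>c s. keys s \<subseteq> A \<Longrightarrow> P s \<Longrightarrow> P (pm_scale c s)"
 shows "P (t :: 'a \<Rightarrow>\<^sub>0 'k::field)"
proof -
 have "keys (\<Sum>x\<in>B. pm_scale (c x) (basis_vec x)) \<subseteq> A \<and>
   P (\<Sum>x\<in>B. pm_scale (c x) (basis_vec x))" if "finite B" "B \<subseteq> A" for B and c :: "'a \<Rightarrow> 'k"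
  using that
 proof (induction B)
  case (insert x B)
  then have "P (pm_scale (c x) (basis_vec x))" "keys (pm_scale (c x) (basis_vec x)) \<subseteq> A"
   using keys_pm_scale[of "c x" "basis_vec x"] by (auto intro!: assms(3,5))
  with insert show ?case
   using Poly_Mapping.keys_add[of "pm_scale (c x) (basis_vec x)" "\<Sum>x\<in>B. pm_scale (c x) (basis_vec x)"]
   by (auto intro!: assms(4))
 qed (use assms(2) in auto)
 from this[of "keys t"] assms(1)
 have "P (lin_extend basis_vec t)" by (simp add: lin_extend_def)
 then show ?thesis by (simp add: lin_extend_basis)
qed

lemma linear_is_lin_eval:
 assumes "Vector_Spaces.linear (pm_scale :: 'k::field \<Rightarrow> _) (*) g"
 shows "g t = lin_eval (\<lambda>x. g (basis_vec x)) t"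
proof -
 interpret g: Vector_Spaces.linear "pm_scale :: 'k \<Rightarrow> _" "(*)" g by fact
 have "g (lin_extend basis_vec t) = lin_eval (\<lambda>x. g (basis_vec x)) t"
  by (simp add: lin_extend_def lin_eval_def g.sum g.scale)
 then show ?thesis by (simp add: lin_extend_basis)
qed

text \<open>If \<open>t\<close> lies outside the span, a basis of the span chosen from
  \<open>S\<close> stays independent after adding \<open>t\<close>, and a form exists that is 1 at
  \<open>t\<close> and 0 on this basis. Membership in the relations of a tensor product, in those of
  the coend and in the ideal is decided by this criterion.\<close>

lemma in_pm_span_iff:
 "t \<in> pm.span S \<longleftrightarrow> (\<forall>f. (\<forall>s\<in>S. lin_eval f s = 0) \<longrightarrow> lin_eval f t = (0 :: 'k::field))"
proof
 assume t: "t \<in> pm.span S"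
 show "\<forall>f. (\<forall>s\<in>S. lin_eval f s = 0) \<longrightarrow> lin_eval f t = 0"
 proof (intro allI impI)
  fix f :: "'a \<Rightarrow> 'k" assume f: "\<forall>s\<in>S. lin_eval f s = 0"
  show "lin_eval f t = 0"
   by (rule pm.span_induct[OF t])
    (use f in \<open>auto simp: pm.subspace_def lin_eval_add lin_eval_scale\<close>)
 qed
next
 assume *: "\<forall>f. (\<forall>s\<in>S. lin_eval f s = 0) \<longrightarrow> lin_eval f t = 0"
 interpret vector_space_pair "pm_scale :: 'k \<Rightarrow> ('a \<Rightarrow>\<^sub>0 'k) \<Rightarrow> _" "(*) :: 'k \<Rightarrow> _"
  by unfold_locales (auto simp: algebra_simps)
 obtain B where B: "B \<subseteq> S" "pm.independent B" "S \<subseteq> pm.span B"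
  using pm.maximal_independent_subset by blast
 show "t \<in> pm.span S"
 proof (rule ccontr)
  assume "t \<notin> pm.span S"
  then have t: "t \<notin> pm.span B" using pm.span_mono[OF B(1)] by blast
  then have "pm.independent (insert t B)" using B(2) by (rule pm.independent_insertI)
  from linear_independent_extend[OF this, of "\<lambda>x. if x = t then 1 else 0"]
  obtain g where g: "Vector_Spaces.linear pm_scale (*) g"
   "\<And>x. x \<in> insert t B \<Longrightarrow> g x = (if x = t then 1 else 0)" by blast
  have geq: "lin_eval (\<lambda>x. g (basis_vec x)) s = g s" for s
   by (rule linear_is_lin_eval[OF g(1), symmetric])
  have "t \<notin> B" using t pm.span_base by blast
  interpret g: Vector_Spaces.linear pm_scale "(*)" g by (fact g(1))
  have "g s = 0" if "s \<in> pm.span B" for s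
   by (rule pm.span_induct[OF that])
    (use g(2) \<open>t \<notin> B\<close> in \<open>auto simp: pm.subspace_def g.add g.scale\<close>)
  then have "\<forall>s\<in>S. lin_eval (\<lambda>x. g (basis_vec x)) s = 0" using B(3) by (auto simp: geq)
  with * have "lin_eval (\<lambda>x. g (basis_vec x)) t = 0" by blast
  then have "g t = 0" unfolding geq .
  then show False using g(2)[of t] by simp
 qed
qed

section \<open>Bilinear and trilinear forms\<close>

definition linear_form :: "('k::field, 'a, 'z) module_scheme \<Rightarrow> ('a \<Rightarrow> 'k) \<Rightarrow> bool" where
 "linear_form V f \<longleftrightarrow>
   (\<forall>x\<in>carrier V. \<forall>y\<in>carrier V. f (x \<oplus>\<^bsub>V\<^esub> y) = f x + f y) \<and>
   (\<forall>c. \<forall>x\<in>carrier V. f (c \<odot>\<^bsub>V\<^esub> x) = c * f x)"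

definition bilinear_form ::
 "('k::field, 'a, 'y) module_scheme \<Rightarrow> ('k, 'b, 'z) module_scheme \<Rightarrow> ('a \<times> 'b \<Rightarrow> 'k) \<Rightarrow> bool" where
 "bilinear_form V W f \<longleftrightarrow>
   (\<forall>b\<in>carrier W. linear_form V (\<lambda>a. f (a, b))) \<and> (\<forall>a\<in>carrier V. linear_form W (\<lambda>b. f (a, b)))"

definition trilinear_form ::
 "('k::field, 'a, 'x) module_scheme \<Rightarrow> ('k, 'b, 'y) module_scheme \<Rightarrow> ('k, 'c, 'z) module_scheme \<Rightarrow>
  ('a \<times> 'b \<times> 'c \<Rightarrow> 'k) \<Rightarrow> bool" where
 "trilinear_form U V W f \<longleftrightarrow>
   (\<forall>b\<in>carrier V. \<forall>d\<in>carrier W. linear_form U (\<lambda>a. f (a, b, d))) \<and>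
   (\<forall>a\<in>carrier U. \<forall>d\<in>carrier W. linear_form V (\<lambda>b. f (a, b, d))) \<and>
   (\<forall>a\<in>carrier U. \<forall>b\<in>carrier V. linear_form W (\<lambda>d. f (a, b, d)))"

lemma linear_form_add:
 "\<lbrakk>linear_form V f; x \<in> carrier V; y \<in> carrier V\<rbrakk> \<Longrightarrow> f (x \<oplus>\<^bsub>V\<^esub> y) = f x + f y"
 by (simp add: linear_form_def)

lemma linear_form_smult: "linear_form V f \<Longrightarrow> x \<in> carrier V \<Longrightarrow> f (c \<odot>\<^bsub>V\<^esub> x) = c * f x"
 by (simp add: linear_form_def)

lemma linear_form_lin_eval:
 assumes "\<And>y. y \<in> keys t \<Longrightarrow> linear_form V (\<lambda>x. f x y)"
 shows "linear_form V (\<lambda>x. lin_eval (f x) t)"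
 using assms unfolding linear_form_def lin_eval_def
 by (simp add: distrib_left sum.distrib sum_distrib_left mult.left_commute)

text \<open>A form that is linear only on the carrier agrees there with an evaluation
  \<open>lin_eval\<close>, to which the criterion for spans applies. The premises fit the carriers
  of \<open>graph_wba\<close> and of \<open>coend_free\<close> alike.\<close>

lemma linear_form_free:
 assumes V: "carrier V = {t. keys t \<subseteq> A}" "\<And>x y. x \<oplus>\<^bsub>V\<^esub> y = x + y" "\<And>c x. c \<odot>\<^bsub>V\<^esub> x = pm_scale c x"
  and g: "linear_form V g" and t: "t \<in> carrier V"
 shows "g t = lin_eval (\<lambda>s. g (basis_vec s)) (t :: 'a \<Rightarrow>\<^sub>0 'k::field)"
proof -
 have add: "g (s + t) = g s + g t" if "s \<in> carrier V" "t \<in> carrier V" for s t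
  using linear_form_add[OF g that] V(2) by simp
 have scale: "g (pm_scale c s) = c * g s" if "s \<in> carrier V" for c s
  using linear_form_smult[OF g that] V(3) by simp
 have "keys t \<subseteq> A" using t V(1) by simp
 then show ?thesis
 proof (induction t rule: pm_basis_induct)
  case zero
  show ?case using scale[of 0 0] by (simp add: V(1))
 qed (simp_all add: V(1) add scale lin_eval_add lin_eval_scale)
qed

lemma bilinear_formI:
 "(\<And>b. b \<in> carrier W \<Longrightarrow> linear_form V (\<lambda>a. f (a, b))) \<Longrightarrow>
  (\<And>a. a \<in> carrier V \<Longrightarrow> linear_form W (\<lambda>b. f (a, b))) \<Longrightarrow> bilinear_form V W f"
 by (simp add: bilinear_form_def)

lemma bilinear_form_left: "bilinear_form V W f \<Longrightarrow> b \<in> carrier W \<Longrightarrow> linear_form V (\<lambda>a. f (a, b))"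
 by (simp add: bilinear_form_def)

lemma bilinear_form_right: "bilinear_form V W f \<Longrightarrow> a \<in> carrier V \<Longrightarrow> linear_form W (\<lambda>b. f (a, b))"
 by (simp add: bilinear_form_def)

lemma trilinear_form_1:
 "\<lbrakk>trilinear_form U V W f; b \<in> carrier V; d \<in> carrier W\<rbrakk> \<Longrightarrow> linear_form U (\<lambda>a. f (a, b, d))"
 by (simp add: trilinear_form_def)

lemma trilinear_form_2:
 "\<lbrakk>trilinear_form U V W f; a \<in> carrier U; d \<in> carrier W\<rbrakk> \<Longrightarrow> linear_form V (\<lambda>b. f (a, b, d))"
 by (simp add: trilinear_form_def)

lemma trilinear_form_3:
 "\<lbrakk>trilinear_form U V W f; a \<in> carrier U; b \<in> carrier V\<rbrakk> \<Longrightarrow> linear_form W (\<lambda>d. f (a, b, d))"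
 by (simp add: trilinear_form_def)

text \<open>A function on pairs kills the generating relations exactly when it is bilinear, so the
  criterion for spans turns equality in the tensor product into agreement under all bilinear
  forms.\<close>

lemma tensor_eq_iff:
 "tensor_eq V W s t \<longleftrightarrow> (\<forall>f. bilinear_form V W f \<longrightarrow> lin_eval f s = lin_eval f t)"
proof -
 have *: "(\<forall>x\<in>{F a a' b | a a' b. P a a' b}. Q x) \<longleftrightarrow> (\<forall>a a' b. P a a' b \<longrightarrow> Q (F a a' b))" for F P Q
  by blast
 define S where "S = (
   {basis_vec (a \<oplus>\<^bsub>V\<^esub> a', b) - basis_vec (a, b) - basis_vec (a', b) | a a' b.
    a \<in> carrier V \<and> a' \<in> carrier V \<and> b \<in> carrier W} \<union>
   {basis_vec (a, b \<oplus>\<^bsub>W\<^esub> b') - basis_vec (a, b) - basis_vec (a, b') | a b b'.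
    a \<in> carrier V \<and> b \<in> carrier W \<and> b' \<in> carrier W} \<union>
   {basis_vec (c \<odot>\<^bsub>V\<^esub> a, b) - pm_scale c (basis_vec (a, b)) | c a b.
    a \<in> carrier V \<and> b \<in> carrier W} \<union>
   {basis_vec (a, c \<odot>\<^bsub>W\<^esub> b) - pm_scale c (basis_vec (a, b)) | c a b.
    a \<in> carrier V \<and> b \<in> carrier W})"
 have forms: "(\<forall>s\<in>S. lin_eval f s = 0) \<longleftrightarrow> bilinear_form V W f" for f
  unfolding S_def
  unfolding bilinear_form_def linear_form_def ball_Un * lin_eval_diff lin_eval_scale
   lin_eval_basis_vec diff_diff_eq right_minus_eq
  by (auto simp: lin_eval_add)
 have rel: "tensor_relations V W = pm.span S"
  by (simp only: tensor_relations_def S_def)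
 show ?thesis
  unfolding tensor_eq_def rel in_pm_span_iff forms lin_eval_diff right_minus_eq
  by (rule refl)
qed

lemma tensor3_eq_iff:
 "tensor3_eq U V W s t \<longleftrightarrow> (\<forall>f. trilinear_form U V W f \<longrightarrow> lin_eval f s = lin_eval f t)"
proof -
 have *: "(\<forall>x\<in>{F a a' b d | a a' b d. P a a' b d}. Q x) \<longleftrightarrow>
   (\<forall>a a' b d. P a a' b d \<longrightarrow> Q (F a a' b d))" for F P Q
  by blast
 define S where "S = (
   {basis_vec (a \<oplus>\<^bsub>U\<^esub> a', b, d) - basis_vec (a, b, d) - basis_vec (a', b, d) | a a' b d.
    a \<in> carrier U \<and> a' \<in> carrier U \<and> b \<in> carrier V \<and> d \<in> carrier W} \<union>
   {basis_vec (a, b \<oplus>\<^bsub>V\<^esub> b', d) - basis_vec (a, b, d) - basis_vec (a, b', d) | a b b' d.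
    a \<in> carrier U \<and> b \<in> carrier V \<and> b' \<in> carrier V \<and> d \<in> carrier W} \<union>
   {basis_vec (a, b, d \<oplus>\<^bsub>W\<^esub> d') - basis_vec (a, b, d) - basis_vec (a, b, d') | a b d d'.
    a \<in> carrier U \<and> b \<in> carrier V \<and> d \<in> carrier W \<and> d' \<in> carrier W} \<union>
   {basis_vec (c \<odot>\<^bsub>U\<^esub> a, b, d) - pm_scale c (basis_vec (a, b, d)) | c a b d.
    a \<in> carrier U \<and> b \<in> carrier V \<and> d \<in> carrier W} \<union>
   {basis_vec (a, c \<odot>\<^bsub>V\<^esub> b, d) - pm_scale c (basis_vec (a, b, d)) | c a b d.
    a \<in> carrier U \<and> b \<in> carrier V \<and> d \<in> carrier W} \<union>
   {basis_vec (a, b, c \<odot>\<^bsub>W\<^esub> d) - pm_scale c (basis_vec (a, b, d)) | c a b d.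
    a \<in> carrier U \<and> b \<in> carrier V \<and> d \<in> carrier W})"
 have forms: "(\<forall>s\<in>S. lin_eval f s = 0) \<longleftrightarrow> trilinear_form U V W f" for f
  unfolding S_def
  unfolding trilinear_form_def linear_form_def ball_Un * lin_eval_diff lin_eval_scale
   lin_eval_basis_vec diff_diff_eq right_minus_eq
  by (auto simp: lin_eval_add)
 have rel: "tensor3_relations U V W = pm.span S"
  by (simp only: tensor3_relations_def S_def)
 show ?thesis
  unfolding tensor3_eq_def rel in_pm_span_iff forms lin_eval_diff right_minus_eq
  by (rule refl)
qed

lemma tensor_eqD: "tensor_eq V W s t \<Longrightarrow> bilinear_form V W f \<Longrightarrow> lin_eval f s = lin_eval f t"
 by (simp add: tensor_eq_iff)

lemma tensor3_eqD: "tensor3_eq U V W s t \<Longrightarrow> trilinear_form U V W f \<Longrightarrow> lin_eval f s = lin_eval f t"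
 by (simp add: tensor3_eq_iff)

lemma tensor_eq_refl: "s = t \<Longrightarrow> tensor_eq V W s t"
 by (simp add: tensor_eq_iff)

lemma lin_eval_tensor_map: "lin_eval \<beta> (tensor_map f g t) = lin_eval (\<lambda>(a, b). \<beta> (f a, g b)) t"
 by (simp add: tensor_map_def lin_eval_extend case_prod_unfold)

lemma lin_eval_split_left:
 "lin_eval \<gamma> (split_left f t) = lin_eval (\<lambda>(a, b). lin_eval (\<lambda>(c, d). \<gamma> (c, d, b)) (f a)) t"
 by (simp add: split_left_def lin_eval_extend case_prod_unfold)

lemma lin_eval_split_right:
 "lin_eval \<gamma> (split_right f t) = lin_eval (\<lambda>(a, b). lin_eval (\<lambda>(c, d). \<gamma> (a, c, d)) (f b)) t"
 by (simp add: split_right_def lin_eval_extend case_prod_unfold)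

lemma lin_eval_tensor_mult:
 "lin_eval \<beta> (tensor_mult H s t) =
   lin_eval (\<lambda>(a, b). lin_eval (\<lambda>(a', b'). \<beta> (a \<otimes>\<^bsub>H\<^esub> a', b \<otimes>\<^bsub>H\<^esub> b')) t) s"
 by (simp add: tensor_mult_def lin_eval_bilin_extend case_prod_unfold)

lemma lin_eval_tensor3_mult_one:
 "lin_eval \<gamma> (tensor3_mult H (tensor_one_right H s) (tensor_one_left H t)) =
   lin_eval (\<lambda>(a, b). lin_eval (\<lambda>(a', b').
    \<gamma> (a \<otimes>\<^bsub>H\<^esub> \<one>\<^bsub>H\<^esub>, b \<otimes>\<^bsub>H\<^esub> a', \<one>\<^bsub>H\<^esub> \<otimes>\<^bsub>H\<^esub> b')) t) s"
 "lin_eval \<gamma> (tensor3_mult H (tensor_one_left H s) (tensor_one_right H t)) =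
   lin_eval (\<lambda>(a, b). lin_eval (\<lambda>(a', b').
    \<gamma> (\<one>\<^bsub>H\<^esub> \<otimes>\<^bsub>H\<^esub> a', a \<otimes>\<^bsub>H\<^esub> b', b \<otimes>\<^bsub>H\<^esub> \<one>\<^bsub>H\<^esub>)) t) s"
 by (simp_all add: tensor3_mult_def tensor_one_left_def tensor_one_right_def lin_eval_bilin_extend
   lin_eval_extend case_prod_unfold)

lemma keys_tensor_map:
 assumes "keys t \<subseteq> A \<times> B" "\<And>a. a \<in> A \<Longrightarrow> f a \<in> A'" "\<And>b. b \<in> B \<Longrightarrow> g b \<in> B'"
 shows "keys (tensor_map f g t) \<subseteq> A' \<times> B'"
proof
 fix z assume "z \<in> keys (tensor_map f g t)"
 then obtain x where "x \<in> keys t" "z = (f (fst x), g (snd x))"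
  using keys_lin_extend[of "\<lambda>(a, b). basis_vec (f a, g b)" t]
  unfolding tensor_map_def by (auto simp: case_prod_unfold)
 then show "z \<in> A' \<times> B'" using assms by auto
qed

section \<open>Modules over the scalars\<close>

lemma cring_scalars: "cring (scalars :: 'k::field ring)"
proof (rule cringI)
 show "abelian_group (scalars :: 'k ring)"
 proof (rule abelian_groupI)
  fix x :: 'k
  show "\<exists>y\<in>carrier scalars. y \<oplus>\<^bsub>scalars\<^esub> x = \<zero>\<^bsub>scalars\<^esub>"
   by (rule bexI[of _ "- x"]) (simp_all add: scalars_def)
 qed (auto simp: scalars_def)
 show "Group.comm_monoid (scalars :: 'k ring)"
  by (rule comm_monoidI) (auto simp: scalars_def)
qed (auto simp: scalars_def algebra_simps)

lemma scalars_simps [simp]: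
 "carrier scalars = UNIV" "a \<oplus>\<^bsub>scalars\<^esub> b = a + b" "a \<otimes>\<^bsub>scalars\<^esub> b = a * b"
 "\<one>\<^bsub>scalars\<^esub> = 1" "\<zero>\<^bsub>scalars\<^esub> = 0"
 by (simp_all add: scalars_def)

text \<open>Additive inverses are obtained as \<open>(- 1) \<odot> x\<close>, which is why the
  equation for \<open>0 \<odot> x\<close> stands among the premises in place of an axiom on
  inverses.\<close>

lemma scalars_moduleI:
 fixes M :: "('k::field, 'a, 'z) module_scheme" (structure)
 assumes "\<And>x y. \<lbrakk>x \<in> carrier M; y \<in> carrier M\<rbrakk> \<Longrightarrow> x \<oplus> y \<in> carrier M"
  and "\<zero> \<in> carrier M"
  and "\<And>x y z. \<lbrakk>x \<in> carrier M; y \<in> carrier M; z \<in> carrier M\<rbrakk> \<Longrightarrow> (x \<oplus> y) \<oplus> z = x \<oplus> (y \<oplus> z)"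
  and "\<And>x y. \<lbrakk>x \<in> carrier M; y \<in> carrier M\<rbrakk> \<Longrightarrow> x \<oplus> y = y \<oplus> x"
  and "\<And>x. x \<in> carrier M \<Longrightarrow> \<zero> \<oplus> x = x"
  and "\<And>c x. x \<in> carrier M \<Longrightarrow> c \<odot> x \<in> carrier M"
  and "\<And>a b x. x \<in> carrier M \<Longrightarrow> (a + b) \<odot> x = a \<odot> x \<oplus> b \<odot> x"
  and "\<And>a x y. \<lbrakk>x \<in> carrier M; y \<in> carrier M\<rbrakk> \<Longrightarrow> a \<odot> (x \<oplus> y) = a \<odot> x \<oplus> a \<odot> y"
  and "\<And>a b x. x \<in> carrier M \<Longrightarrow> (a * b) \<odot> x = a \<odot> (b \<odot> x)"
  and "\<And>x. x \<in> carrier M \<Longrightarrow> 1 \<odot> x = x"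
  and "\<And>x. x \<in> carrier M \<Longrightarrow> 0 \<odot> x = \<zero>"
 shows "Module.module scalars M"
proof (rule moduleI)
 show "abelian_group M"
 proof (rule abelian_groupI)
  fix x assume x: "x \<in> carrier M"
  then have "(- 1) \<odot> x \<oplus> x = ((- 1) + 1) \<odot> x" by (simp only: assms(7,10))
  with x show "\<exists>y\<in>carrier M. y \<oplus> x = \<zero>" by (intro bexI[of _ "(- 1) \<odot> x"]) (auto simp: assms)
 qed (auto intro: assms)
qed (auto intro: assms cring_scalars)

locale scalars_module = Module.module scalars V
 for V :: "('k::field, 'a, 'z) module_scheme" (structure)
begin

lemma smult_zero_left: "x \<in> carrier V \<Longrightarrow> 0 \<odot> x = \<zero>"
 using smult_l_null[of x] by simp

lemma smult_add: "x \<in> carrier V \<Longrightarrow> (a + b) \<odot> x = a \<odot> x \<oplus> b \<odot> x"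
 using smult_l_distr[of a b x] by simp

lemma smult_mult: "x \<in> carrier V \<Longrightarrow> (a * b) \<odot> x = a \<odot> (b \<odot> x)"
 using smult_assoc1[of a b x] by simp

lemma smult_1: "x \<in> carrier V \<Longrightarrow> 1 \<odot> x = x"
 using smult_one[of x] by simp

lemma smult_in: "x \<in> carrier V \<Longrightarrow> c \<odot> x \<in> carrier V"
 using smult_closed[of c x] by simp

lemma smult_distrib: "x \<in> carrier V \<Longrightarrow> y \<in> carrier V \<Longrightarrow> c \<odot> (x \<oplus> y) = c \<odot> x \<oplus> c \<odot> y"
 using smult_r_distr[of c x y] by simp

lemma linear_form_zero: "linear_form V f \<Longrightarrow> f \<zero> = 0"
 using linear_form_smult[of V f \<zero> 0] smult_zero_left[of \<zero>] by simp

text \<open>The linear extension of \<open>g\<close> to formal combinations, with values in a module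
  that is given by a carrier.\<close>

definition comb :: "('b \<Rightarrow> 'a) \<Rightarrow> ('b \<Rightarrow>\<^sub>0 'k) \<Rightarrow> 'a" where
 "comb g t = (\<Oplus>x\<in>keys t. lookup t x \<odot> g x)"

lemma comb_superset:
 assumes "finite A" "keys t \<subseteq> A" "g ` A \<subseteq> carrier V"
 shows "comb g t = (\<Oplus>x\<in>A. lookup t x \<odot> g x)"
 unfolding comb_def using assms
 by (intro add.finprod_mono_neutral_cong_left)
   (auto simp: in_keys_iff smult_zero_left intro!: smult_in)

lemma comb_closed: "g ` keys t \<subseteq> carrier V \<Longrightarrow> comb g t \<in> carrier V"
 unfolding comb_def by (intro finsum_closed) (auto intro!: smult_in)

lemma comb_add:
 assumes "g ` keys s \<subseteq> carrier V" "g ` keys t \<subseteq> carrier V"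
 shows "comb g (s + t) = comb g s \<oplus> comb g t"
proof -
 let ?A = "keys s \<union> keys t"
 have *: "comb g u = (\<Oplus>x\<in>?A. lookup u x \<odot> g x)" if "keys u \<subseteq> ?A" for u
  by (rule comb_superset) (use assms that in auto)
 have "(\<Oplus>x\<in>?A. lookup s x \<odot> g x) \<oplus> (\<Oplus>x\<in>?A. lookup t x \<odot> g x) =
   (\<Oplus>x\<in>?A. lookup s x \<odot> g x \<oplus> lookup t x \<odot> g x)"
  using assms by (intro finsum_addf[symmetric]) (auto intro!: smult_in)
 also have "\<dots> = (\<Oplus>x\<in>?A. lookup (s + t) x \<odot> g x)"
  using assms by (intro finsum_cong') (auto simp: lookup_add smult_add intro!: smult_in)
 finally show ?thesis
  using *[of s] *[of t] *[of "s + t"] Poly_Mapping.keys_add[of s t] by auto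
qed

lemma comb_basis_vec: "g x \<in> carrier V \<Longrightarrow> comb g (basis_vec x) = g x"
 by (simp add: comb_def lookup_basis_vec smult_1)

lemma comb_scale:
 assumes "g ` keys t \<subseteq> carrier V"
 shows "comb g (pm_scale c t) = c \<odot> comb g t"
proof -
 have "comb g (pm_scale c t) = (\<Oplus>x\<in>keys t. lookup (pm_scale c t) x \<odot> g x)"
  using assms keys_pm_scale[of c t] by (intro comb_superset) auto
 also have "\<dots> = (\<Oplus>x\<in>keys t. c \<odot> (lookup t x \<odot> g x))"
  using assms by (intro finsum_cong') (auto simp: smult_mult intro!: smult_in)
 also have "\<dots> = c \<odot> comb g t"
  unfolding comb_def using assms by (intro finsum_smult_ldistr[symmetric]) (auto intro!: smult_in)
 finally show ?thesis .
qed

lemma linear_form_comb: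
 assumes "g ` keys t \<subseteq> carrier V" "linear_form V f"
 shows "f (comb g t) = lin_eval (f \<circ> g) t"
proof -
 have "keys t \<subseteq> {x. g x \<in> carrier V}" using assms(1) by auto
 then show ?thesis
 proof (induction rule: pm_basis_induct)
  case zero
  then show ?case using linear_form_zero[OF assms(2)] by (simp add: comb_def)
 next
  case (basis x)
  then show ?case by (simp add: comb_basis_vec)
 next
  case (add s t)
  have "comb g (s + t) = comb g s \<oplus> comb g t" using add.hyps by (intro comb_add) auto
  moreover have "comb g s \<in> carrier V" "comb g t \<in> carrier V"
   using add.hyps by (auto intro!: comb_closed)
  ultimately show ?case using add.IH by (simp add: linear_form_add[OF assms(2)] lin_eval_add)
 next
  case (scale c s)
  have "comb g (pm_scale c s) = c \<odot> comb g s" using scale.hyps by (intro comb_scale) auto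
  moreover have "comb g s \<in> carrier V" using scale.hyps by (auto intro!: comb_closed)
  ultimately show ?case using scale.IH by (simp add: linear_form_smult[OF assms(2)] lin_eval_scale)
 qed
qed

text \<open>Presents \<open>V\<close> as the quotient of the free vector space on its carrier by the
  relations \<open>S\<close>. A function killing \<open>S\<close> is a linear form on
  \<open>V\<close>, so a difference that no linear form sees lies in the span of \<open>S\<close>,
  and this span is contained in the kernel \<open>?K\<close> of the evaluation
  \<open>comb\<close>.\<close>

lemma linear_forms_separate:
 assumes x: "x \<in> carrier V" and y: "y \<in> carrier V" and eq: "\<And>f. linear_form V f \<Longrightarrow> f x = f y"
 shows "x = y"
proof -
 define S :: "('a \<Rightarrow>\<^sub>0 'k) set" where "S =
  {basis_vec (a \<oplus> b) - basis_vec a - basis_vec b | a b. a \<in> carrier V \<and> b \<in> carrier V} \<union>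
  {basis_vec (c \<odot> a) - pm_scale c (basis_vec a) | c a. a \<in> carrier V}"
 let ?K = "{t. keys t \<subseteq> carrier V \<and> comb (\<lambda>x. x) t = \<zero>}"
 have "linear_form V f" if "\<forall>s\<in>S. lin_eval f s = 0" for f
 proof -
  have "lin_eval f (basis_vec (a \<oplus> b) - basis_vec a - basis_vec b) = 0"
   if "a \<in> carrier V" "b \<in> carrier V" for a b
   using \<open>\<forall>s\<in>S. _ s\<close> that unfolding S_def by blast
  moreover have "lin_eval f (basis_vec (c \<odot> a) - pm_scale c (basis_vec a)) = 0"
   if "a \<in> carrier V" for a c
   using \<open>\<forall>s\<in>S. _ s\<close> that unfolding S_def by blast
  ultimately show ?thesis
   unfolding linear_form_def by (simp add: lin_eval_diff lin_eval_add lin_eval_scale algebra_simps)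
 qed
 then have *: "basis_vec x - basis_vec y \<in> pm.span S"
  unfolding in_pm_span_iff using eq by (auto simp: lin_eval_diff)
 have sub: "pm.subspace ?K"
 proof (rule pm.subspaceI)
  fix s t assume "s \<in> ?K" "t \<in> ?K"
  then show "s + t \<in> ?K" using Poly_Mapping.keys_add[of s t] by (auto simp: comb_add)
 next
  fix c s assume "s \<in> ?K"
  then show "pm_scale c s \<in> ?K" using keys_pm_scale[of c s] by (auto simp: comb_scale smult_r_null)
 qed (simp add: comb_def)
 have diff: "s - t \<in> ?K" if "keys s \<subseteq> carrier V" "keys t \<subseteq> carrier V"
  "comb (\<lambda>x. x) s = comb (\<lambda>x. x) t" for s t
 proof -
  have k: "keys (s - t) \<subseteq> carrier V" using keys_diff_subset[of s t] that by auto
  have "comb (\<lambda>x. x) ((s - t) + t) = comb (\<lambda>x. x) (s - t) \<oplus> comb (\<lambda>x. x) t"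
   using that k by (intro comb_add) auto
  then have "comb (\<lambda>x. x) (s - t) \<oplus> comb (\<lambda>x. x) t = comb (\<lambda>x. x) t"
   using that(3) by simp
  then show ?thesis
   using that k comb_closed[of "\<lambda>x. x" "s - t"] comb_closed[of "\<lambda>x. x" t] by simp
 qed
 have "S \<subseteq> ?K"
 proof -
  have "basis_vec (a \<oplus> b) - basis_vec a - basis_vec b \<in> ?K" if "a \<in> carrier V" "b \<in> carrier V" for a b
   unfolding diff_diff_eq
   by (rule diff) (use that Poly_Mapping.keys_add[of "basis_vec a" "basis_vec b :: _ \<Rightarrow>\<^sub>0 'k"] in
     \<open>auto simp: comb_basis_vec comb_add\<close>)
  moreover have "basis_vec (c \<odot> a) - pm_scale c (basis_vec a) \<in> ?K" if "a \<in> carrier V" for c a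
   by (rule diff) (use that keys_pm_scale[of c "basis_vec a"] in
     \<open>auto simp: comb_basis_vec comb_scale smult_in\<close>)
  ultimately show ?thesis unfolding S_def by blast
 qed
 with * have "basis_vec x - basis_vec y \<in> ?K"
  using pm.span_minimal[OF _ sub] by blast
 then have "comb (\<lambda>x. x) ((basis_vec x - basis_vec y) + basis_vec y) = \<zero> \<oplus> comb (\<lambda>x. x) (basis_vec y)"
  using y by (subst comb_add) auto
 then show ?thesis using x y by (simp add: comb_basis_vec)
qed

lemma contract_right_comb:
 assumes "keys t \<subseteq> carrier V \<times> B"
 shows "contract_right V \<phi> t = comb (\<lambda>(a, b). \<phi> b \<odot> a) t"
 unfolding contract_right_def comb_def
 using assms by (intro finsum_cong') (auto simp: smult_mult intro!: smult_in)

lemma contract_left_comb: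
 assumes "keys t \<subseteq> B \<times> carrier V"
 shows "contract_left V \<phi> t = comb (\<lambda>(b, a). \<phi> b \<odot> a) t"
 unfolding contract_left_def comb_def
 using assms by (intro finsum_cong') (auto simp: smult_mult intro!: smult_in)

text \<open>Since linear forms separate vectors, the counit axioms, which are equations between
  vectors, become identities between scalars like all the other axioms.\<close>

lemma contract_right_eq_iff:
 assumes t: "keys t \<subseteq> carrier V \<times> B" and x: "x \<in> carrier V"
 shows "contract_right V \<phi> t = x \<longleftrightarrow>
  (\<forall>f. linear_form V f \<longrightarrow> lin_eval (\<lambda>(a, b). \<phi> b * f a) t = f x)"
proof -
 have c: "(\<lambda>(a, b). \<phi> b \<odot> a) ` keys t \<subseteq> carrier V" using t by (auto intro!: smult_in)
 have "f (contract_right V \<phi> t) = lin_eval (\<lambda>(a, b). \<phi> b * f a) t" if "linear_form V f" for f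
  unfolding contract_right_comb[OF t] linear_form_comb[OF c that]
  by (rule lin_eval_cong) (use t in \<open>auto simp: linear_form_smult[OF that]\<close>)
 moreover have "contract_right V \<phi> t \<in> carrier V"
  unfolding contract_right_comb[OF t] by (rule comb_closed[OF c])
 ultimately show ?thesis using linear_forms_separate[OF _ x] by fastforce
qed

lemma contract_left_eq_iff:
 assumes t: "keys t \<subseteq> B \<times> carrier V" and x: "x \<in> carrier V"
 shows "contract_left V \<phi> t = x \<longleftrightarrow>
  (\<forall>f. linear_form V f \<longrightarrow> lin_eval (\<lambda>(b, a). \<phi> b * f a) t = f x)"
proof -
 have c: "(\<lambda>(b, a). \<phi> b \<odot> a) ` keys t \<subseteq> carrier V" using t by (auto intro!: smult_in)
 have "f (contract_left V \<phi> t) = lin_eval (\<lambda>(b, a). \<phi> b * f a) t" if "linear_form V f" for f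
  unfolding contract_left_comb[OF t] linear_form_comb[OF c that]
  by (rule lin_eval_cong) (use t in \<open>auto simp: linear_form_smult[OF that]\<close>)
 moreover have "contract_left V \<phi> t \<in> carrier V"
  unfolding contract_left_comb[OF t] by (rule comb_closed[OF c])
 ultimately show ?thesis using linear_forms_separate[OF _ x] by fastforce
qed

end

section \<open>Surjective images, quotients and comodules\<close>

lemma linear_on_closed: "linear_on V W f \<Longrightarrow> x \<in> carrier V \<Longrightarrow> f x \<in> carrier W"
 by (auto simp: linear_on_def)

lemma linear_on_add:
 "\<lbrakk>linear_on V W f; x \<in> carrier V; y \<in> carrier V\<rbrakk> \<Longrightarrow> f (x \<oplus>\<^bsub>V\<^esub> y) = f x \<oplus>\<^bsub>W\<^esub> f y"
 by (auto simp: linear_on_def)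

lemma linear_on_smult: "linear_on V W f \<Longrightarrow> x \<in> carrier V \<Longrightarrow> f (c \<odot>\<^bsub>V\<^esub> x) = c \<odot>\<^bsub>W\<^esub> f x"
 by (auto simp: linear_on_def)

lemma linear_form_comp:
 "linear_form W g \<Longrightarrow> linear_on V W f \<Longrightarrow> linear_form V (\<lambda>x. g (f x))"
 by (auto simp: linear_form_def linear_on_def Pi_iff)

lemma bilinear_form_comp:
 assumes \<beta>: "bilinear_form V' W' \<beta>" and f: "linear_on V V' f" and g: "linear_on W W' g"
 shows "bilinear_form V W (\<lambda>(a, b). \<beta> (f a, g b))"
proof (rule bilinear_formI)
 fix b assume "b \<in> carrier W"
 then show "linear_form V (\<lambda>a. case (a, b) of (a, b) \<Rightarrow> \<beta> (f a, g b))"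
  using linear_form_comp[OF bilinear_form_left[OF \<beta> linear_on_closed[OF g]] f] by simp
next
 fix a assume "a \<in> carrier V"
 then show "linear_form W (\<lambda>b. case (a, b) of (a, b) \<Rightarrow> \<beta> (f a, g b))"
  using linear_form_comp[OF bilinear_form_right[OF \<beta> linear_on_closed[OF f]] g] by simp
qed

lemma trilinear_form_comp:
 assumes \<gamma>: "trilinear_form U' V' W' \<gamma>"
  and e: "linear_on U U' e" and f: "linear_on V V' f" and g: "linear_on W W' g"
 shows "trilinear_form U V W (\<lambda>(a, b, c). \<gamma> (e a, f b, g c))"
 unfolding trilinear_form_def prod.case
 using linear_form_comp[OF trilinear_form_1[OF \<gamma> linear_on_closed[OF f] linear_on_closed[OF g]] e]
  linear_form_comp[OF trilinear_form_2[OF \<gamma> linear_on_closed[OF e] linear_on_closed[OF g]] f]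
  linear_form_comp[OF trilinear_form_3[OF \<gamma> linear_on_closed[OF e] linear_on_closed[OF f]] g]
 by blast

lemma linear_on_id: "linear_on V V (\<lambda>x. x)"
 by (simp add: linear_on_def)

lemma trilinear_form_12:
 "trilinear_form U V W \<gamma> \<Longrightarrow> d \<in> carrier W \<Longrightarrow> bilinear_form U V (\<lambda>(a, b). \<gamma> (a, b, d))"
 by (auto simp: trilinear_form_def bilinear_form_def)

lemma trilinear_form_23:
 "trilinear_form U V W \<gamma> \<Longrightarrow> a \<in> carrier U \<Longrightarrow> bilinear_form V W (\<lambda>(b, d). \<gamma> (a, b, d))"
 by (auto simp: trilinear_form_def bilinear_form_def)

lemma linear_form_scale: "linear_form V f \<Longrightarrow> linear_form V (\<lambda>x. c * f x)"
 by (auto simp: linear_form_def algebra_simps)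

lemma linear_form_scale_right: "linear_form V f \<Longrightarrow> linear_form V (\<lambda>x. f x * c)"
 by (auto simp: linear_form_def algebra_simps)

lemma tensor_map_bilinear:
 assumes "tensor_eq V W s (tensor_map f g t)" "bilinear_form V W \<beta>"
 shows "lin_eval \<beta> s = lin_eval (\<lambda>(a, b). \<beta> (f a, g b)) t"
 using tensor_eqD[OF assms] by (simp add: lin_eval_tensor_map)

section \<open>Forms on a Weak Bialgebra and transfer of its axioms along a surjection\<close>

context weak_bialgebra
begin

sublocale S: scalars_module H
 by (rule scalars_module.intro[OF V.module_axioms])

lemma linear_form_comult: "bilinear_form H H \<beta> \<Longrightarrow> linear_form H (\<lambda>x. lin_eval \<beta> (\<Delta> x))"
 using tensor_eqD[OF comult_add] tensor_eqD[OF comult_smult]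
 by (auto simp: linear_form_def lin_eval_add lin_eval_scale)

lemma linear_form_counit: "linear_form H \<epsilon>"
 by (simp add: linear_form_def counit_add counit_smult)

lemma linear_form_mult_left: "linear_form H g \<Longrightarrow> y \<in> carrier H \<Longrightarrow> linear_form H (\<lambda>x. g (x \<otimes> y))"
 by (auto simp: linear_form_def A.l_distr smult_mult_left)

lemma linear_form_mult_right: "linear_form H g \<Longrightarrow> y \<in> carrier H \<Longrightarrow> linear_form H (\<lambda>x. g (y \<otimes> x))"
 by (auto simp: linear_form_def A.r_distr smult_mult_right)

lemma keys_comult: "x \<in> carrier H \<Longrightarrow> (a, b) \<in> keys (\<Delta> x) \<Longrightarrow> a \<in> carrier H \<and> b \<in> carrier H"
 using comult_closed by blast

end

text \<open>Of \<open>H'\<close> it is only assumed that a surjection from a Weak Bialgebra respects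
  its operations, the comultiplication up to \<open>tensor_eq\<close>, and that its comultiplication
  takes values over the carrier. All axioms of \<open>H'\<close>, including those of a vector space
  and the linearity of its comultiplication, are conclusions.\<close>

locale wba_surjection =
 fixes H :: "('k::field, 'a) wba" and H' :: "('k, 'b) wba" and f :: "'a \<Rightarrow> 'b"
 assumes wba: "weak_bialgebra H"
  and surj: "f ` carrier H = carrier H'"
  and hom_add: "\<And>x y. x \<in> carrier H \<Longrightarrow> y \<in> carrier H \<Longrightarrow> f (x \<oplus>\<^bsub>H\<^esub> y) = f x \<oplus>\<^bsub>H'\<^esub> f y"
  and hom_smult: "\<And>c x. x \<in> carrier H \<Longrightarrow> f (c \<odot>\<^bsub>H\<^esub> x) = c \<odot>\<^bsub>H'\<^esub> f x"
  and hom_mult: "\<And>x y. x \<in> carrier H \<Longrightarrow> y \<in> carrier H \<Longrightarrow> f (x \<otimes>\<^bsub>H\<^esub> y) = f x \<otimes>\<^bsub>H'\<^esub> f y"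
  and hom_zero: "f \<zero>\<^bsub>H\<^esub> = \<zero>\<^bsub>H'\<^esub>"
  and hom_one: "f \<one>\<^bsub>H\<^esub> = \<one>\<^bsub>H'\<^esub>"
  and comult_closed': "\<And>x. x \<in> carrier H \<Longrightarrow>
   keys (comult H' (f x)) \<subseteq> carrier H' \<times> carrier H'"
  and hom_comult: "\<And>x. x \<in> carrier H \<Longrightarrow>
   tensor_eq H' H' (comult H' (f x)) (tensor_map f f (comult H x))"
  and hom_counit: "\<And>x. x \<in> carrier H \<Longrightarrow> counit H' (f x) = counit H x"
begin

abbreviation mult' (infixl "\<otimes>''" 70) where "x \<otimes>' y \<equiv> x \<otimes>\<^bsub>H'\<^esub> y"

sublocale H: weak_bialgebra H by (rule wba)

lemma closed: "x \<in> carrier H \<Longrightarrow> f x \<in> carrier H'"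
 using surj by blast

lemma surjE:
 assumes "y \<in> carrier H'" obtains x where "x \<in> carrier H" "y = f x"
 using assms surj by blast

lemma linear: "linear_on H H' f"
 by (auto simp: linear_on_def hom_add hom_smult closed)

lemma bil: "bilinear_form H' H' \<beta> \<Longrightarrow> bilinear_form H H (\<lambda>(a, b). \<beta> (f a, f b))"
 using bilinear_form_comp linear by blast

lemma tri: "trilinear_form H' H' H' \<gamma> \<Longrightarrow> trilinear_form H H H (\<lambda>(a, b, c). \<gamma> (f a, f b, f c))"
 using trilinear_form_comp linear by blast

lemma push: "bilinear_form H' H' \<beta> \<Longrightarrow> x \<in> carrier H \<Longrightarrow>
  lin_eval \<beta> (comult H' (f x)) = lin_eval (\<lambda>(a, b). \<beta> (f a, f b)) (comult H x)"
 by (rule tensor_map_bilinear[OF hom_comult])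

lemma module': "Module.module scalars H'"
proof (rule scalars_moduleI)
 show "\<zero>\<^bsub>H'\<^esub> \<in> carrier H'" using closed[of "\<zero>\<^bsub>H\<^esub>"] hom_zero by simp
qed (auto elim!: surjE simp flip: hom_add hom_smult hom_zero
  simp: closed H.V.a_ac H.S.smult_in H.S.smult_add H.S.smult_distrib H.S.smult_mult H.S.smult_1
   H.S.smult_zero_left)

lemma ring': "ring H'"
proof (rule ringI)
 show "abelian_group H'" using module' by (rule Module.module.axioms(2))
 show "Group.monoid H'"
 proof (rule monoidI)
  show "\<one>\<^bsub>H'\<^esub> \<in> carrier H'" using closed[of "\<one>\<^bsub>H\<^esub>"] hom_one by simp
 qed (auto elim!: surjE simp flip: hom_mult hom_one simp: closed H.A.m_assoc)
qed (auto elim!: surjE simp flip: hom_mult hom_add simp: H.A.l_distr H.A.r_distr)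

text \<open>Pulled back along \<open>f\<close>, the function becomes the evaluation of a bilinear
  form on the comultiplication of \<open>H\<close>; surjectivity then yields linearity on
  \<open>H'\<close>.\<close>

lemma linear_form_comult':
 assumes "bilinear_form H' H' \<beta>"
 shows "linear_form H' (\<lambda>y. lin_eval \<beta> (comult H' y))"
proof -
 have "linear_form H (\<lambda>x. lin_eval (\<lambda>(a, b). \<beta> (f a, f b)) (comult H x))"
  by (rule H.linear_form_comult[OF bil[OF assms]])
 then have "linear_form H (\<lambda>x. lin_eval \<beta> (comult H' (f x)))"
  by (simp add: linear_form_def push[OF assms])
 then show ?thesis
  by (auto simp: linear_form_def simp flip: hom_add hom_smult elim!: surjE)
qed

lemma linear_form_mult':
 assumes "linear_form H' g" "y \<in> carrier H'"
 shows "linear_form H' (\<lambda>x. g (x \<otimes>' y))" "linear_form H' (\<lambda>x. g (y \<otimes>' x))"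
proof -
 obtain z where z: "z \<in> carrier H" "y = f z" using assms(2) by (rule surjE)
 have *: "linear_form H (\<lambda>x. g (f x))" by (rule linear_form_comp[OF assms(1) linear])
 have "linear_form H (\<lambda>x. g (f (x \<otimes>\<^bsub>H\<^esub> z)))" "linear_form H (\<lambda>x. g (f (z \<otimes>\<^bsub>H\<^esub> x)))"
  using H.linear_form_mult_left[OF *] H.linear_form_mult_right[OF *] z by auto
 then show "linear_form H' (\<lambda>x. g (x \<otimes>' y))" "linear_form H' (\<lambda>x. g (y \<otimes>' x))"
  using z by (auto simp: linear_form_def hom_mult simp flip: hom_add hom_smult elim!: surjE)
qed

lemma linear_form_counit': "linear_form H' (counit H')"
 by (auto simp: linear_form_def hom_counit H.counit_add H.counit_smult
   simp flip: hom_add hom_smult elim!: surjE)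

text \<open>The comultiplication occurs twice, so \<open>push\<close> is applied twice: to the outer
  one with a form that already contains the inner comultiplication of \<open>H'\<close>, then to the
  inner one on the pairs that occur. That the former is bilinear rests on
  \<open>linear_form_comult'\<close>.\<close>

lemma split_left':
 assumes \<gamma>: "trilinear_form H' H' H' \<gamma>" and x: "x \<in> carrier H"
 shows "lin_eval \<gamma> (split_left (comult H') (comult H' (f x))) =
  lin_eval (\<lambda>(a, b, c). \<gamma> (f a, f b, f c)) (split_left (comult H) (comult H x))"
proof -
 have "bilinear_form H' H' (\<lambda>(a, b). lin_eval (\<lambda>(c, d). \<gamma> (c, d, b)) (comult H' a))"
 proof (rule bilinear_formI)
  fix b assume "b \<in> carrier H'"
  then show "linear_form H' (\<lambda>a. case (a, b) of (a, b) \<Rightarrow> lin_eval (\<lambda>(c, d). \<gamma> (c, d, b)) (comult H' a))"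
   using linear_form_comult'[OF trilinear_form_12[OF \<gamma>]] by simp
 next
  fix a assume "a \<in> carrier H'"
  then have "keys (comult H' a) \<subseteq> carrier H' \<times> carrier H'"
   using comult_closed' by (auto elim!: surjE)
  then show "linear_form H' (\<lambda>b. case (a, b) of (a, b) \<Rightarrow> lin_eval (\<lambda>(c, d). \<gamma> (c, d, b)) (comult H' a))"
   by (auto intro!: linear_form_lin_eval trilinear_form_3[OF \<gamma>])
 qed
 from push[OF this x]
 have "lin_eval \<gamma> (split_left (comult H') (comult H' (f x))) =
   lin_eval (\<lambda>(a, b). lin_eval (\<lambda>(c, d). \<gamma> (c, d, f b)) (comult H' (f a))) (comult H x)"
  by (simp add: lin_eval_split_left)
 also have "\<dots> = lin_eval (\<lambda>(a, b). lin_eval (\<lambda>(c, d). \<gamma> (f c, f d, f b)) (comult H a)) (comult H x)"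
  using H.keys_comult[OF x]
  by (intro lin_eval_cong) (auto simp: push[OF trilinear_form_12[OF \<gamma>]] closed)
 finally show ?thesis by (simp add: lin_eval_split_left)
qed

lemma split_right':
 assumes \<gamma>: "trilinear_form H' H' H' \<gamma>" and x: "x \<in> carrier H"
 shows "lin_eval \<gamma> (split_right (comult H') (comult H' (f x))) =
  lin_eval (\<lambda>(a, b, c). \<gamma> (f a, f b, f c)) (split_right (comult H) (comult H x))"
proof -
 have "bilinear_form H' H' (\<lambda>(a, b). lin_eval (\<lambda>(c, d). \<gamma> (a, c, d)) (comult H' b))"
 proof (rule bilinear_formI)
  fix b assume "b \<in> carrier H'"
  then have "keys (comult H' b) \<subseteq> carrier H' \<times> carrier H'"
   using comult_closed' by (auto elim!: surjE)
  then show "linear_form H' (\<lambda>a. case (a, b) of (a, b) \<Rightarrow> lin_eval (\<lambda>(c, d). \<gamma> (a, c, d)) (comult H' b))"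
   by (auto intro!: linear_form_lin_eval trilinear_form_1[OF \<gamma>])
 next
  fix a assume "a \<in> carrier H'"
  then show "linear_form H' (\<lambda>b. case (a, b) of (a, b) \<Rightarrow> lin_eval (\<lambda>(c, d). \<gamma> (a, c, d)) (comult H' b))"
   using linear_form_comult'[OF trilinear_form_23[OF \<gamma>]] by simp
 qed
 from push[OF this x]
 have "lin_eval \<gamma> (split_right (comult H') (comult H' (f x))) =
   lin_eval (\<lambda>(a, b). lin_eval (\<lambda>(c, d). \<gamma> (f a, c, d)) (comult H' (f b))) (comult H x)"
  by (simp add: lin_eval_split_right)
 also have "\<dots> = lin_eval (\<lambda>(a, b). lin_eval (\<lambda>(c, d). \<gamma> (f a, f c, f d)) (comult H b)) (comult H x)"
  using H.keys_comult[OF x]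
  by (intro lin_eval_cong) (auto simp: push[OF trilinear_form_23[OF \<gamma>]] closed)
 finally show ?thesis by (simp add: lin_eval_split_right)
qed

text \<open>Expressions in two independent coproducts, as in the product of
  \<open>\<Delta> x\<close> and \<open>\<Delta> y\<close> or in the axioms for the coproduct of the
  unit, are bilinear in each of the two pairs separately. The coproducts are replaced one after the
  other.\<close>

lemma double_push:
 assumes left: "\<And>a' b'. a' \<in> carrier H' \<Longrightarrow> b' \<in> carrier H' \<Longrightarrow>
   bilinear_form H' H' (\<lambda>(a, b). F a b a' b')"
  and right: "\<And>a b. a \<in> carrier H' \<Longrightarrow> b \<in> carrier H' \<Longrightarrow>
   bilinear_form H' H' (\<lambda>(a', b'). F a b a' b')"
  and x: "x \<in> carrier H" and y: "y \<in> carrier H"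
 shows "lin_eval (\<lambda>(a, b). lin_eval (\<lambda>(a', b'). F a b a' b') (comult H' (f y))) (comult H' (f x)) =
  lin_eval (\<lambda>(a, b). lin_eval (\<lambda>(a', b'). F (f a) (f b) (f a') (f b')) (comult H y)) (comult H x)"
proof -
 have "lin_eval (\<lambda>(a, b). lin_eval (\<lambda>(a', b'). F (f a) (f b) (f a') (f b')) (comult H y)) (comult H x) =
   lin_eval (\<lambda>(a, b). lin_eval (\<lambda>(a', b'). F (f a) (f b) a' b') (comult H' (f y))) (comult H x)"
  using H.keys_comult[OF x]
  by (intro lin_eval_cong) (auto simp: push[OF right _, OF closed closed y])
 also have "\<dots> = lin_eval (\<lambda>(a, b). lin_eval (\<lambda>(a', b'). F a b a' b') (comult H' (f y))) (comult H' (f x))"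
 proof (subst push[OF _ x])
  show "bilinear_form H' H' (\<lambda>(a, b). lin_eval (\<lambda>(a', b'). F a b a' b') (comult H' (f y)))"
   using comult_closed'[OF y] bilinear_form_left[OF left] bilinear_form_right[OF left]
   by (intro bilinear_formI) (auto intro!: linear_form_lin_eval)
 qed simp
 finally show ?thesis by simp
qed

lemma bilinear_mult:
 assumes \<beta>: "bilinear_form H' H' \<beta>" and "c \<in> carrier H'" "d \<in> carrier H'"
 shows "bilinear_form H' H' (\<lambda>(a, b). \<beta> (a \<otimes>' c, b \<otimes>' d))"
  and "bilinear_form H' H' (\<lambda>(a, b). \<beta> (c \<otimes>' a, d \<otimes>' b))"
proof -
 interpret R: ring H' by (rule ring')
 show "bilinear_form H' H' (\<lambda>(a, b). \<beta> (a \<otimes>' c, b \<otimes>' d))"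
  and "bilinear_form H' H' (\<lambda>(a, b). \<beta> (c \<otimes>' a, d \<otimes>' b))"
  using assms
  by (auto intro!: bilinear_formI linear_form_mult' bilinear_form_left[OF \<beta>] bilinear_form_right[OF \<beta>])
qed

lemma tri_mult:
 assumes \<gamma>: "trilinear_form H' H' H' \<gamma>" and "a' \<in> carrier H'" "b' \<in> carrier H'" "c \<in> carrier H'"
 shows "bilinear_form H' H' (\<lambda>(a, b). \<gamma> (a \<otimes>' c, b \<otimes>' a', b'))"
  and "bilinear_form H' H' (\<lambda>(a, b). \<gamma> (a', b' \<otimes>' a, c \<otimes>' b))"
  and "bilinear_form H' H' (\<lambda>(a, b). \<gamma> (a', a \<otimes>' b', b \<otimes>' c))"
  and "bilinear_form H' H' (\<lambda>(a, b). \<gamma> (c \<otimes>' a, a' \<otimes>' b, b'))"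
proof -
 interpret R: ring H' by (rule ring')
 note * = bilinear_mult[OF trilinear_form_12[OF \<gamma>]] bilinear_mult[OF trilinear_form_23[OF \<gamma>]]
 show "bilinear_form H' H' (\<lambda>(a, b). \<gamma> (a \<otimes>' c, b \<otimes>' a', b'))"
  using *(1)[of b' c a'] assms by simp
 show "bilinear_form H' H' (\<lambda>(a, b). \<gamma> (a', b' \<otimes>' a, c \<otimes>' b))"
  using *(4)[of a' b' c] assms by simp
 show "bilinear_form H' H' (\<lambda>(a, b). \<gamma> (a', a \<otimes>' b', b \<otimes>' c))"
  using *(3)[of a' b' c] assms by simp
 show "bilinear_form H' H' (\<lambda>(a, b). \<gamma> (c \<otimes>' a, a' \<otimes>' b, b'))"
  using *(2)[of b' c a'] assms by simp
qed

lemma tensor3_one':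
 assumes \<gamma>: "trilinear_form H' H' H' \<gamma>"
 shows "lin_eval \<gamma> (tensor3_mult H' (tensor_one_right H' (comult H' \<one>\<^bsub>H'\<^esub>)) (tensor_one_left H' (comult H' \<one>\<^bsub>H'\<^esub>))) =
   lin_eval (\<lambda>(a, b, c). \<gamma> (f a, f b, f c))
    (tensor3_mult H (tensor_one_right H (comult H \<one>\<^bsub>H\<^esub>)) (tensor_one_left H (comult H \<one>\<^bsub>H\<^esub>)))"
  and "lin_eval \<gamma> (tensor3_mult H' (tensor_one_left H' (comult H' \<one>\<^bsub>H'\<^esub>)) (tensor_one_right H' (comult H' \<one>\<^bsub>H'\<^esub>))) =
   lin_eval (\<lambda>(a, b, c). \<gamma> (f a, f b, f c))
    (tensor3_mult H (tensor_one_left H (comult H \<one>\<^bsub>H\<^esub>)) (tensor_one_right H (comult H \<one>\<^bsub>H\<^esub>)))"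
proof -
 interpret R: ring H' by (rule ring')
 have fm: "f a \<otimes>' f b = f (a \<otimes>\<^bsub>H\<^esub> b)" if "a \<in> carrier H" "b \<in> carrier H" for a b
  using hom_mult that by simp
 have "lin_eval \<gamma> (tensor3_mult H' (tensor_one_right H' (comult H' (f \<one>\<^bsub>H\<^esub>))) (tensor_one_left H' (comult H' (f \<one>\<^bsub>H\<^esub>)))) =
   lin_eval (\<lambda>(a, b). lin_eval (\<lambda>(a', b'). \<gamma> (f a \<otimes>' \<one>\<^bsub>H'\<^esub>, f b \<otimes>' f a', \<one>\<^bsub>H'\<^esub> \<otimes>' f b'))
    (comult H \<one>\<^bsub>H\<^esub>)) (comult H \<one>\<^bsub>H\<^esub>)"
  unfolding lin_eval_tensor3_mult_one
  by (rule double_push) (auto intro!: tri_mult[OF \<gamma>])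
 also have "\<dots> = lin_eval (\<lambda>(a, b). lin_eval (\<lambda>(a', b').
    \<gamma> (f (a \<otimes>\<^bsub>H\<^esub> \<one>\<^bsub>H\<^esub>), f (b \<otimes>\<^bsub>H\<^esub> a'), f (\<one>\<^bsub>H\<^esub> \<otimes>\<^bsub>H\<^esub> b'))) (comult H \<one>\<^bsub>H\<^esub>)) (comult H \<one>\<^bsub>H\<^esub>)"
  using H.keys_comult[of "\<one>\<^bsub>H\<^esub>"]
  by (intro lin_eval_cong) (auto intro!: lin_eval_cong simp: fm hom_one[symmetric] simp del: H.A.r_one H.A.l_one)
 finally show "lin_eval \<gamma> (tensor3_mult H' (tensor_one_right H' (comult H' \<one>\<^bsub>H'\<^esub>)) (tensor_one_left H' (comult H' \<one>\<^bsub>H'\<^esub>))) =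
   lin_eval (\<lambda>(a, b, c). \<gamma> (f a, f b, f c))
    (tensor3_mult H (tensor_one_right H (comult H \<one>\<^bsub>H\<^esub>)) (tensor_one_left H (comult H \<one>\<^bsub>H\<^esub>)))"
  by (simp only: lin_eval_tensor3_mult_one hom_one prod.case)
 have "lin_eval \<gamma> (tensor3_mult H' (tensor_one_left H' (comult H' (f \<one>\<^bsub>H\<^esub>))) (tensor_one_right H' (comult H' (f \<one>\<^bsub>H\<^esub>)))) =
   lin_eval (\<lambda>(a, b). lin_eval (\<lambda>(a', b'). \<gamma> (\<one>\<^bsub>H'\<^esub> \<otimes>' f a', f a \<otimes>' f b', f b \<otimes>' \<one>\<^bsub>H'\<^esub>))
    (comult H \<one>\<^bsub>H\<^esub>)) (comult H \<one>\<^bsub>H\<^esub>)"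
  unfolding lin_eval_tensor3_mult_one
  by (rule double_push) (auto intro!: tri_mult[OF \<gamma>])
 also have "\<dots> = lin_eval (\<lambda>(a, b). lin_eval (\<lambda>(a', b').
    \<gamma> (f (\<one>\<^bsub>H\<^esub> \<otimes>\<^bsub>H\<^esub> a'), f (a \<otimes>\<^bsub>H\<^esub> b'), f (b \<otimes>\<^bsub>H\<^esub> \<one>\<^bsub>H\<^esub>))) (comult H \<one>\<^bsub>H\<^esub>)) (comult H \<one>\<^bsub>H\<^esub>)"
  using H.keys_comult[of "\<one>\<^bsub>H\<^esub>"]
  by (intro lin_eval_cong) (auto intro!: lin_eval_cong simp: fm hom_one[symmetric] simp del: H.A.r_one H.A.l_one)
 finally show "lin_eval \<gamma> (tensor3_mult H' (tensor_one_left H' (comult H' \<one>\<^bsub>H'\<^esub>)) (tensor_one_right H' (comult H' \<one>\<^bsub>H'\<^esub>))) =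
   lin_eval (\<lambda>(a, b, c). \<gamma> (f a, f b, f c))
    (tensor3_mult H (tensor_one_left H (comult H \<one>\<^bsub>H\<^esub>)) (tensor_one_right H (comult H \<one>\<^bsub>H\<^esub>)))"
  by (simp only: lin_eval_tensor3_mult_one hom_one prod.case)
qed

lemma mod_eq:
 "x \<in> carrier H \<Longrightarrow> tensor_eq H' H' (comult H' (c \<odot>\<^bsub>H'\<^esub> f x)) (pm_scale c (comult H' (f x)))"
 "x \<in> carrier H \<Longrightarrow> y \<in> carrier H \<Longrightarrow>
  tensor_eq H' H' (comult H' (f x \<oplus>\<^bsub>H'\<^esub> f y)) (comult H' (f x) + comult H' (f y))"
 using linear_form_comult' closed
 by (auto simp: tensor_eq_iff lin_eval_add lin_eval_scale linear_form_def)

lemma counit_mult':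
 assumes x: "x \<in> carrier H" and y: "y \<in> carrier H" and z: "z \<in> carrier H"
 shows "counit H' (f x \<otimes>' f y \<otimes>' f z) =
   lin_eval (\<lambda>(y', y''). counit H' (f x \<otimes>' y') * counit H' (y'' \<otimes>' f z)) (comult H' (f y))"
  and "counit H' (f x \<otimes>' f y \<otimes>' f z) =
   lin_eval (\<lambda>(y', y''). counit H' (f x \<otimes>' y'') * counit H' (y' \<otimes>' f z)) (comult H' (f y))"
proof -
 interpret R: ring H' by (rule ring')
 note l = linear_form_mult'[OF linear_form_counit' closed[OF x]] linear_form_mult'[OF linear_form_counit' closed[OF z]]
 have b: "bilinear_form H' H' (\<lambda>(y', y''). counit H' (f x \<otimes>' y') * counit H' (y'' \<otimes>' f z))"
  "bilinear_form H' H' (\<lambda>(y', y''). counit H' (f x \<otimes>' y'') * counit H' (y' \<otimes>' f z))"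
  by (auto intro!: bilinear_formI linear_form_scale linear_form_scale_right l)
 have e: "counit H' (f x \<otimes>' f y \<otimes>' f z) = counit H (x \<otimes>\<^bsub>H\<^esub> y \<otimes>\<^bsub>H\<^esub> z)"
  using x y z by (simp flip: hom_mult add: hom_counit)
 have c: "counit H' (f u \<otimes>' f v) = counit H (u \<otimes>\<^bsub>H\<^esub> v)" if "u \<in> carrier H" "v \<in> carrier H" for u v
  using that by (simp flip: hom_mult add: hom_counit)
 show "counit H' (f x \<otimes>' f y \<otimes>' f z) =
   lin_eval (\<lambda>(y', y''). counit H' (f x \<otimes>' y') * counit H' (y'' \<otimes>' f z)) (comult H' (f y))"
  unfolding push[OF b(1) y] e H.counit_mult[OF x y z]
  by (rule lin_eval_cong) (use H.keys_comult[OF y] x z in \<open>auto simp: c\<close>)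
 show "counit H' (f x \<otimes>' f y \<otimes>' f z) =
   lin_eval (\<lambda>(y', y''). counit H' (f x \<otimes>' y'') * counit H' (y' \<otimes>' f z)) (comult H' (f y))"
  unfolding push[OF b(2) y] e H.counit_mult_op[OF x y z]
  by (rule lin_eval_cong) (use H.keys_comult[OF y] x z in \<open>auto simp: c\<close>)
qed

lemma comult_mult':
 assumes x: "x \<in> carrier H" and y: "y \<in> carrier H"
 shows "tensor_eq H' H' (comult H' (f x \<otimes>' f y)) (tensor_mult H' (comult H' (f x)) (comult H' (f y)))"
 unfolding tensor_eq_iff
proof (intro allI impI)
 fix \<beta> assume \<beta>: "bilinear_form H' H' \<beta>"
 have "lin_eval \<beta> (comult H' (f x \<otimes>' f y)) = lin_eval \<beta> (comult H' (f (x \<otimes>\<^bsub>H\<^esub> y)))"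
  using x y by (simp add: hom_mult)
 also have "\<dots> = lin_eval (\<lambda>(a, b). \<beta> (f a, f b)) (tensor_mult H (comult H x) (comult H y))"
  using x y by (simp add: push[OF \<beta>] tensor_eqD[OF H.comult_mult bil[OF \<beta>]])
 also have "\<dots> = lin_eval (\<lambda>(a, b). lin_eval (\<lambda>(a', b'). \<beta> (f a \<otimes>' f a', f b \<otimes>' f b'))
   (comult H y)) (comult H x)"
  unfolding lin_eval_tensor_mult
  using H.keys_comult[OF x] H.keys_comult[OF y]
  by (intro lin_eval_cong) (auto intro!: lin_eval_cong simp: hom_mult)
 also have "\<dots> = lin_eval \<beta> (tensor_mult H' (comult H' (f x)) (comult H' (f y)))"
  unfolding lin_eval_tensor_mult
  by (rule double_push[symmetric]) (auto intro!: bilinear_mult[OF \<beta>] x y)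
 finally show "lin_eval \<beta> (comult H' (f x \<otimes>' f y)) =
   lin_eval \<beta> (tensor_mult H' (comult H' (f x)) (comult H' (f y)))" .
qed

lemma counit':
 assumes x: "x \<in> carrier H"
 shows "contract_left H' (counit H') (comult H' (f x)) = f x"
  and "contract_right H' (counit H') (comult H' (f x)) = f x"
proof -
 interpret S': scalars_module H' by (rule scalars_module.intro[OF module'])
 note c' = comult_closed'[OF x]
 note c = H.comult_closed[OF x]
 show "contract_left H' (counit H') (comult H' (f x)) = f x"
  unfolding S'.contract_left_eq_iff[OF c' closed[OF x]]
 proof (intro allI impI)
  fix g assume g: "linear_form H' g"
  have "bilinear_form H' H' (\<lambda>(b, a). counit H' b * g a)"
   by (auto intro!: bilinear_formI linear_form_scale linear_form_scale_right g linear_form_counit')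
  from push[OF this x]
  have "lin_eval (\<lambda>(b, a). counit H' b * g a) (comult H' (f x)) =
    lin_eval (\<lambda>(b, a). counit H' (f b) * g (f a)) (comult H x)" by simp
  also have "\<dots> = lin_eval (\<lambda>(b, a). counit H b * g (f a)) (comult H x)"
   by (rule lin_eval_cong) (use H.keys_comult[OF x] in \<open>auto simp: hom_counit\<close>)
  also have "\<dots> = g (f x)"
   using H.counit_left[OF x] linear_form_comp[OF g linear]
   unfolding H.S.contract_left_eq_iff[OF c x] by blast
  finally show "lin_eval (\<lambda>(b, a). counit H' b * g a) (comult H' (f x)) = g (f x)" .
 qed
 show "contract_right H' (counit H') (comult H' (f x)) = f x"
  unfolding S'.contract_right_eq_iff[OF c' closed[OF x]]
 proof (intro allI impI)
  fix g assume g: "linear_form H' g"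
  have "bilinear_form H' H' (\<lambda>(a, b). counit H' b * g a)"
   by (auto intro!: bilinear_formI linear_form_scale linear_form_scale_right g linear_form_counit')
  from push[OF this x]
  have "lin_eval (\<lambda>(a, b). counit H' b * g a) (comult H' (f x)) =
    lin_eval (\<lambda>(a, b). counit H' (f b) * g (f a)) (comult H x)" by simp
  also have "\<dots> = lin_eval (\<lambda>(a, b). counit H b * g (f a)) (comult H x)"
   by (rule lin_eval_cong) (use H.keys_comult[OF x] in \<open>auto simp: hom_counit\<close>)
  also have "\<dots> = g (f x)"
   using H.counit_right[OF x] linear_form_comp[OF g linear]
   unfolding H.S.contract_right_eq_iff[OF c x] by blast
  finally show "lin_eval (\<lambda>(a, b). counit H' b * g a) (comult H' (f x)) = g (f x)" .
 qed
qed

theorem weak_bialgebra': "weak_bialgebra H'"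
proof (intro weak_bialgebra.intro module' ring' weak_bialgebra_axioms.intro)
 fix x y c assume "x \<in> carrier H'" "y \<in> carrier H'"
 then show "(c \<odot>\<^bsub>H'\<^esub> x) \<otimes>' y = c \<odot>\<^bsub>H'\<^esub> (x \<otimes>' y)"
  and "x \<otimes>' (c \<odot>\<^bsub>H'\<^esub> y) = c \<odot>\<^bsub>H'\<^esub> (x \<otimes>' y)"
  by (auto elim!: surjE simp flip: hom_mult hom_smult
    simp: H.smult_mult_left H.smult_mult_right H.S.smult_in)
next
 fix x assume "x \<in> carrier H'"
 then show "tensor3_eq H' H' H' (split_left (comult H') (comult H' x)) (split_right (comult H') (comult H' x))"
  unfolding tensor3_eq_iff
  by (auto elim!: surjE simp: split_left' split_right' tensor3_eqD[OF H.coassoc tri])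
next
 show "tensor3_eq H' H' H' (split_left (comult H') (comult H' \<one>\<^bsub>H'\<^esub>))
    (tensor3_mult H' (tensor_one_right H' (comult H' \<one>\<^bsub>H'\<^esub>)) (tensor_one_left H' (comult H' \<one>\<^bsub>H'\<^esub>)))"
  unfolding tensor3_eq_iff tensor3_one' hom_one[symmetric]
  by (auto simp: split_left' tensor3_one'[unfolded hom_one[symmetric]] tensor3_eqD[OF H.comult_one tri])
 show "tensor3_eq H' H' H' (split_left (comult H') (comult H' \<one>\<^bsub>H'\<^esub>))
    (tensor3_mult H' (tensor_one_left H' (comult H' \<one>\<^bsub>H'\<^esub>)) (tensor_one_right H' (comult H' \<one>\<^bsub>H'\<^esub>)))"
  unfolding tensor3_eq_iff hom_one[symmetric]
  by (auto simp: split_left' tensor3_one'[unfolded hom_one[symmetric]] tensor3_eqD[OF H.comult_one_op tri])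
next
 fix x assume "x \<in> carrier H'"
 then show "keys (comult H' x) \<subseteq> carrier H' \<times> carrier H'"
  using comult_closed' by (auto elim!: surjE)
next
 fix x y z assume "x \<in> carrier H'" "y \<in> carrier H'" "z \<in> carrier H'"
 then show "counit H' (x \<otimes>' y \<otimes>' z) =
   lin_eval (\<lambda>(y', y''). counit H' (x \<otimes>' y') * counit H' (y'' \<otimes>' z)) (comult H' y)"
  and "counit H' (x \<otimes>' y \<otimes>' z) =
   lin_eval (\<lambda>(y', y''). counit H' (x \<otimes>' y'') * counit H' (y' \<otimes>' z)) (comult H' y)"
  using counit_mult' by (auto elim!: surjE)
qed (auto elim!: surjE simp: counit' mod_eq comult_mult' linear_form_add[OF linear_form_counit']
  linear_form_smult[OF linear_form_counit'] closed)

theorem hom: "wba_hom H H' f"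
 unfolding wba_hom_def
 using weak_bialgebra' linear
 by (auto simp: wba hom_comult hom_counit ring_hom_def hom_add hom_mult hom_one closed)

end

text \<open>The conditions under which the operations descend to cosets. Associativity is not among
  them, since products of symbols in \<open>coend_free\<close> are associative only up to the
  associator. \<open>N_comult\<close> is the coideal property in terms of forms: the
  comultiplication maps \<open>N\<close> into the sum of \<open>N \<otimes> H\<close> and
  \<open>H \<otimes> N\<close>.\<close>

locale wba_quotient =
 fixes H :: "('k::field, 'a) wba" (structure) and N :: "'a set"
 assumes module_H: "Module.module scalars H"
  and N_subset: "N \<subseteq> carrier H"
  and N_zero: "\<zero> \<in> N"
  and N_add: "\<And>x y. x \<in> N \<Longrightarrow> y \<in> N \<Longrightarrow> x \<oplus> y \<in> N"
  and N_smult: "\<And>c x. x \<in> N \<Longrightarrow> c \<odot> x \<in> N"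
  and mult_closed: "\<And>x y. x \<in> carrier H \<Longrightarrow> y \<in> carrier H \<Longrightarrow> x \<otimes> y \<in> carrier H"
  and one_closed: "\<one> \<in> carrier H"
  and mult_add_left: "\<And>x y z. \<lbrakk>x \<in> carrier H; y \<in> carrier H; z \<in> carrier H\<rbrakk> \<Longrightarrow>
   (x \<oplus> y) \<otimes> z = x \<otimes> z \<oplus> y \<otimes> z"
  and mult_add_right: "\<And>x y z. \<lbrakk>x \<in> carrier H; y \<in> carrier H; z \<in> carrier H\<rbrakk> \<Longrightarrow>
   z \<otimes> (x \<oplus> y) = z \<otimes> x \<oplus> z \<otimes> y"
  and N_mult_left: "\<And>x n. x \<in> carrier H \<Longrightarrow> n \<in> N \<Longrightarrow> x \<otimes> n \<in> N"
  and N_mult_right: "\<And>x n. x \<in> carrier H \<Longrightarrow> n \<in> N \<Longrightarrow> n \<otimes> x \<in> N"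
  and keys_comult: "\<And>x. x \<in> carrier H \<Longrightarrow> keys (\<Delta> x) \<subseteq> carrier H \<times> carrier H"
  and comult_form: "\<And>\<beta>. bilinear_form H H \<beta> \<Longrightarrow> linear_form H (\<lambda>x. lin_eval \<beta> (\<Delta> x))"
  and N_comult: "\<And>\<beta> n. \<lbrakk>bilinear_form H H \<beta>;
   (\<And>m x. m \<in> N \<Longrightarrow> x \<in> carrier H \<Longrightarrow> \<beta> (m, x) = 0 \<and> \<beta> (x, m) = 0); n \<in> N\<rbrakk> \<Longrightarrow>
   lin_eval \<beta> (\<Delta> n) = 0"
  and counit_form: "linear_form H \<epsilon>"
  and N_counit: "\<And>n. n \<in> N \<Longrightarrow> \<epsilon> n = 0"
begin

sublocale S: scalars_module H
 by (rule scalars_module.intro[OF module_H])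

abbreviation Q :: "('k, 'a set) wba" where "Q \<equiv> wba_quot H N"

abbreviation cl :: "'a \<Rightarrow> 'a set" where "cl \<equiv> a_r_coset H N"

sublocale N: abelian_subgroup N H
proof (rule abelian_subgroupI3)
 have "\<ominus> x \<in> N" if "x \<in> N" for x
 proof -
  have x: "x \<in> carrier H" using that N_subset by auto
  have "(- 1) \<odot> x \<oplus> x = \<zero>"
   using S.smult_add[OF x, of "- 1" 1] S.smult_1[OF x] S.smult_zero_left[OF x] by simp
  then have "(- 1) \<odot> x = \<ominus> x"
   using x by (intro S.minus_equality[symmetric]) (auto intro: S.smult_in)
  with N_smult[OF that, of "- 1"] show ?thesis by simp
 qed
 then show "additive_subgroup N H"
  unfolding additive_subgroup_def
  by (intro S.add.subgroupI) (use N_subset N_zero N_add in \<open>auto simp: a_inv_def\<close>)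
qed (rule Module.module.axioms(2)[OF module_H])

lemma cl_self: "x \<in> carrier H \<Longrightarrow> x \<in> cl x"
 by (rule N.a_rcos_self)

lemma mem_clD: "y \<in> cl x \<Longrightarrow> x \<in> carrier H \<Longrightarrow> y \<in> carrier H \<and> (\<exists>n\<in>N. y = n \<oplus> x)"
 using N_subset by (auto simp: a_r_coset_def')

lemma cl_cong: "n \<in> N \<Longrightarrow> x \<in> carrier H \<Longrightarrow> cl (n \<oplus> x) = cl x"
 using N.a_repr_independence'[of "n \<oplus> x" x] by (auto simp: a_r_coset_def')

lemma cl_eq_iff:
 assumes "x \<in> carrier H" "y \<in> carrier H"
 shows "cl x = cl y \<longleftrightarrow> x \<ominus> y \<in> N"
proof
 assume "cl x = cl y"
 then have "x \<in> cl y" using cl_self[OF assms(1)] by simp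
 then show "x \<ominus> y \<in> N" using N.a_rcos_module_minus[OF _ assms(2,1)] S.is_abelian_group
  by (auto dest!: mem_clD[OF _ assms(2)] simp: a_minus_def S.a_assoc S.r_neg assms N_subset[THEN subsetD])
next
 assume *: "x \<ominus> y \<in> N"
 have "x = (x \<ominus> y) \<oplus> y" using assms by (simp add: a_minus_def S.a_assoc S.l_neg)
 then show "cl x = cl y" using cl_cong[OF * assms(2)] by simp
qed

lemma carrier_Q: "carrier Q = cl ` carrier H"
 by (auto simp: wba_quot_def FactRing_def A_RCOSETS_def')

lemma add_Q: "x \<in> carrier H \<Longrightarrow> y \<in> carrier H \<Longrightarrow> cl x \<oplus>\<^bsub>Q\<^esub> cl y = cl (x \<oplus> y)"
 by (simp add: wba_quot_def FactRing_def N.a_rcos_sum)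

lemma zero_Q: "\<zero>\<^bsub>Q\<^esub> = cl \<zero>"
 using N.a_rcos_const[OF N_zero] by (simp add: wba_quot_def FactRing_def)

lemma one_Q: "\<one>\<^bsub>Q\<^esub> = cl \<one>"
 by (simp add: wba_quot_def FactRing_def)

lemma cl_mult_cong:
 assumes "x \<in> carrier H" "y \<in> carrier H" "a \<in> cl x" "b \<in> cl y"
 shows "cl (a \<otimes> b) = cl (x \<otimes> y)"
proof -
 from assms obtain m n where mn: "m \<in> N" "n \<in> N" "a = m \<oplus> x" "b = n \<oplus> y"
  using mem_clD by meson
 then have c: "m \<in> carrier H" "n \<in> carrier H" using N_subset by auto
 have "a \<otimes> b = (m \<otimes> n \<oplus> m \<otimes> y \<oplus> x \<otimes> n) \<oplus> x \<otimes> y"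
  unfolding mn(3,4) using assms(1,2) c
  by (simp add: mult_add_left mult_add_right mult_closed S.a_ac)
 moreover have "m \<otimes> n \<oplus> m \<otimes> y \<oplus> x \<otimes> n \<in> N"
  by (intro N_add N_mult_left[OF c(1) mn(2)] N_mult_right[OF assms(2) mn(1)] N_mult_left[OF assms(1) mn(2)])
 ultimately show ?thesis using assms by (simp add: cl_cong mult_closed)
qed

lemma mult_Q:
 assumes "x \<in> carrier H" "y \<in> carrier H"
 shows "cl x \<otimes>\<^bsub>Q\<^esub> cl y = cl (x \<otimes> y)"
proof -
 have "(\<Union>a\<in>cl x. \<Union>b\<in>cl y. cl (a \<otimes> b)) = (\<Union>a\<in>cl x. \<Union>b\<in>cl y. cl (x \<otimes> y))"
  by (intro SUP_cong refl cl_mult_cong assms)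
 also have "\<dots> = cl (x \<otimes> y)" using cl_self assms by blast
 finally show ?thesis by (simp add: wba_quot_def FactRing_def rcoset_mult_def)
qed

lemma smult_Q: "x \<in> carrier H \<Longrightarrow> c \<odot>\<^bsub>Q\<^esub> cl x = cl (c \<odot> x)"
proof -
 assume x: "x \<in> carrier H"
 have "cl (c \<odot> a) = cl (c \<odot> x)" if a: "a \<in> cl x" for a
 proof -
  from mem_clD[OF a x] obtain n where n: "n \<in> N" "a = n \<oplus> x" by auto
  then show ?thesis using x N_subset cl_cong[OF N_smult[OF n(1), of c]]
   by (auto simp: S.smult_distrib S.smult_in)
 qed
 then have "(\<Union>a\<in>cl x. cl (c \<odot> a)) = (\<Union>a\<in>cl x. cl (c \<odot> x))" by (intro SUP_cong refl)
 also have "\<dots> = cl (c \<odot> x)" using cl_self[OF x] by blast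
 finally show ?thesis by (simp add: wba_quot_def)
qed

text \<open>Comultiplication and counit of the quotient are evaluated at a chosen representative of
  the coset; this is all that is known about the choice.\<close>

lemma some_cl: "x \<in> carrier H \<Longrightarrow> \<exists>n\<in>N. (SOME a. a \<in> cl x) = n \<oplus> x"
 using someI[of "\<lambda>a. a \<in> cl x", OF cl_self] mem_clD by blast

lemma counit_Q: "x \<in> carrier H \<Longrightarrow> counit Q (cl x) = \<epsilon> x"
 using some_cl[of x] N_subset
 by (auto simp: wba_quot_def linear_form_add[OF counit_form] N_counit subset_iff)

lemma linear_cl: "linear_on H Q cl"
 by (auto simp: linear_on_def carrier_Q add_Q smult_Q)

lemma cl_N: "n \<in> N \<Longrightarrow> cl n = \<zero>\<^bsub>Q\<^esub>"
 using N.a_rcos_const by (simp add: wba_quot_def FactRing_def)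

text \<open>The chosen representative differs from \<open>x\<close> by some \<open>n\<close> in
  \<open>N\<close>. A bilinear form on the quotient, pulled back to \<open>H\<close>, vanishes as
  soon as one of its arguments lies in \<open>N\<close>, so the coideal property removes the
  contribution of \<open>n\<close>.\<close>

lemma comult_Q:
 assumes x: "x \<in> carrier H"
 shows "tensor_eq Q Q (comult Q (cl x)) (tensor_map cl cl (\<Delta> x))"
 unfolding tensor_eq_iff
proof (intro allI impI)
 fix \<beta> assume \<beta>: "bilinear_form Q Q \<beta>"
 let ?\<beta> = "\<lambda>(a, b). \<beta> (cl a, cl b)"
 have b: "bilinear_form H H ?\<beta>" by (rule bilinear_form_comp[OF \<beta> linear_cl linear_cl])
 have z: "\<beta> (\<zero>\<^bsub>Q\<^esub>, cl y) = 0 \<and> \<beta> (cl y, \<zero>\<^bsub>Q\<^esub>) = 0" if y: "y \<in> carrier H" for y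
 proof -
  have q: "cl y \<in> carrier Q" "\<zero>\<^bsub>Q\<^esub> \<in> carrier Q" "0 \<odot>\<^bsub>Q\<^esub> \<zero>\<^bsub>Q\<^esub> = \<zero>\<^bsub>Q\<^esub>"
   using y by (auto simp: carrier_Q zero_Q smult_Q S.smult_zero_left)
  then show ?thesis
   using linear_form_smult[OF bilinear_form_left[OF \<beta> q(1)] q(2), of 0]
    linear_form_smult[OF bilinear_form_right[OF \<beta> q(1)] q(2), of 0] by simp
 qed
 from some_cl[OF x] obtain n where n: "n \<in> N" "(SOME a. a \<in> cl x) = n \<oplus> x" by auto
 then have "lin_eval \<beta> (comult Q (cl x)) = lin_eval ?\<beta> (\<Delta> (n \<oplus> x))"
  by (simp add: wba_quot_def lin_eval_tensor_map)
 also have "\<dots> = lin_eval ?\<beta> (\<Delta> n) + lin_eval ?\<beta> (\<Delta> x)"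
  using n x N_subset linear_form_add[OF comult_form[OF b]] by auto
 also have "lin_eval ?\<beta> (\<Delta> n) = 0"
  by (rule N_comult[OF b _ n(1)]) (auto simp: cl_N z)
 finally show "lin_eval \<beta> (comult Q (cl x)) = lin_eval \<beta> (tensor_map cl cl (\<Delta> x))"
  by (simp add: lin_eval_tensor_map)
qed

lemma keys_comult_Q:
 assumes x: "x \<in> carrier H"
 shows "keys (comult Q (cl x)) \<subseteq> carrier Q \<times> carrier Q"
proof -
 from some_cl[OF x] obtain n where n: "n \<in> N" "(SOME a. a \<in> cl x) = n \<oplus> x" by auto
 then have "n \<oplus> x \<in> carrier H" using N_subset x by auto
 then have "keys (tensor_map cl cl (\<Delta> (n \<oplus> x))) \<subseteq> carrier Q \<times> carrier Q"
  by (intro keys_tensor_map[OF keys_comult]) (auto simp: carrier_Q)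
 moreover have "comult Q (cl x) = tensor_map cl cl (\<Delta> (n \<oplus> x))" using n by (simp add: wba_quot_def)
 ultimately show ?thesis by simp
qed

lemma surjection: "weak_bialgebra H \<Longrightarrow> wba_surjection H Q cl"
 by (intro wba_surjection.intro)
   (simp_all add: carrier_Q[symmetric] add_Q smult_Q mult_Q zero_Q one_Q keys_comult_Q comult_Q counit_Q)

text \<open>Evaluation at a chosen representative is harmless because \<open>f\<close> vanishes on
  \<open>N\<close>. For the comultiplication, a form on \<open>H'\<close> is pulled back to
  \<open>H\<close> in two ways, directly along \<open>f\<close> and through the quotient, with the
  same result.\<close>

lemma factor:
 assumes hom: "wba_hom H H' f" and ker: "\<And>n. n \<in> N \<Longrightarrow> f n = \<zero>\<^bsub>H'\<^esub>"
 defines "g \<equiv> \<lambda>A. f (SOME a. a \<in> A)"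
 shows "wba_hom Q H' g" and "\<And>x. x \<in> carrier H \<Longrightarrow> g (cl x) = f x"
proof -
 have H: "weak_bialgebra H" and H': "weak_bialgebra H'" and lin: "linear_on H H' f"
  and f: "f \<in> ring_hom H H'"
  and com: "\<And>x. x \<in> carrier H \<Longrightarrow> tensor_eq H' H' (comult H' (f x)) (tensor_map f f (\<Delta> x))"
  and eps: "\<And>x. x \<in> carrier H \<Longrightarrow> counit H' (f x) = \<epsilon> x"
  using hom by (auto simp: wba_hom_def)
 interpret H': weak_bialgebra H' by (rule H')
 interpret cl: wba_surjection H Q cl by (rule surjection[OF H])
 show *: "g (cl x) = f x" if x: "x \<in> carrier H" for x
 proof -
  from some_cl[OF x] obtain n where n: "n \<in> N" "(SOME a. a \<in> cl x) = n \<oplus> x" by auto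
  then show ?thesis unfolding g_def
   using x N_subset linear_on_add[OF lin, of n x] linear_on_closed[OF lin x] by (auto simp: ker)
 qed
 have lin': "linear_on Q H' g"
  using lin by (auto simp: linear_on_def carrier_Q add_Q smult_Q * S.smult_in)
 have "tensor_eq H' H' (comult H' (g (cl x))) (tensor_map g g (comult Q (cl x)))"
  if x: "x \<in> carrier H" for x
  unfolding tensor_eq_iff
 proof (intro allI impI)
  fix \<beta> assume \<beta>: "bilinear_form H' H' \<beta>"
  have "lin_eval \<beta> (comult H' (g (cl x))) = lin_eval (\<lambda>(a, b). \<beta> (f a, f b)) (\<Delta> x)"
   using x tensor_map_bilinear[OF com \<beta>] by (simp add: *)
  also have "\<dots> = lin_eval (\<lambda>(a, b). \<beta> (g (cl a), g (cl b))) (\<Delta> x)"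
   using keys_comult[OF x] by (intro lin_eval_cong) (auto simp: *)
  also have "\<dots> = lin_eval (\<lambda>(a, b). \<beta> (g a, g b)) (comult Q (cl x))"
   using cl.push[OF bilinear_form_comp[OF \<beta> lin' lin'] x] by simp
  finally show "lin_eval \<beta> (comult H' (g (cl x))) = lin_eval \<beta> (tensor_map g g (comult Q (cl x)))"
   by (simp add: lin_eval_tensor_map)
 qed
 moreover have "g \<in> ring_hom Q H'"
  using f lin' by (auto simp: ring_hom_def carrier_Q mult_Q one_Q * mult_closed one_closed
    linear_on_def Pi_iff)
 ultimately show "wba_hom Q H' g"
  unfolding wba_hom_def using cl.weak_bialgebra' H' lin'
  by (auto simp: carrier_Q * counit_Q eps)
qed

end

section \<open>Comodules: pushforward and transport of structure\<close>

lemma right_comodule_module: "right_comodule H N \<Longrightarrow> scalars_module N"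
 by (simp add: right_comodule_def scalars_module_def)

lemma coact_form:
 assumes "right_comodule H N" "bilinear_form N H \<beta>"
 shows "linear_form N (\<lambda>v. lin_eval \<beta> (coact N v))"
 using assms by (auto simp: right_comodule_def linear_form_def tensor_eq_iff lin_eval_add lin_eval_scale)

lemma keys_coact:
 "\<lbrakk>right_comodule H N; v \<in> carrier N; (a, b) \<in> keys (coact N v)\<rbrakk> \<Longrightarrow>
  a \<in> carrier N \<and> b \<in> carrier H"
 unfolding right_comodule_def by blast

text \<open>Forms on the pushforward are pulled back along the identity in the first factor and
  along \<open>f\<close> in the others. Coassociativity then reduces to the compatibility of
  \<open>f\<close> with the comultiplications, the counit axiom to its compatibility with the
  counits.\<close>

lemma right_comodule_pushforward:
 assumes N: "right_comodule H N" and f: "wba_hom H H' f"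
 shows "right_comodule H' (pushforward f N)"
proof -
 let ?N = "pushforward f N"
 have H: "weak_bialgebra H" and H': "weak_bialgebra H'" and lin: "linear_on H H' f"
  and com: "\<And>x. x \<in> carrier H \<Longrightarrow> tensor_eq H' H' (comult H' (f x)) (tensor_map f f (comult H x))"
  and eps: "\<And>x. x \<in> carrier H \<Longrightarrow> counit H' (f x) = counit H x"
  using f by (auto simp: wba_hom_def)
 interpret H: weak_bialgebra H by (rule H)
 interpret H': weak_bialgebra H' by (rule H')
 interpret N: scalars_module N by (rule right_comodule_module[OF N])
 have [simp]: "carrier ?N = carrier N" "add ?N = add N" "smult ?N = smult N" "zero ?N = zero N"
  by (simp_all add: pushforward_def)
 have coact: "coact ?N v = tensor_map (\<lambda>x. x) f (coact N v)" for v
  by (simp add: pushforward_def)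
 have N': "Module.module scalars ?N"
  by (rule scalars_moduleI)
    (auto simp: N.a_ac N.smult_add N.smult_distrib N.smult_mult N.smult_1 N.smult_zero_left N.smult_in)
 interpret N': scalars_module ?N by (rule scalars_module.intro[OF N'])
 have idl: "linear_on N ?N (\<lambda>x. x)" by (simp add: linear_on_def)
 have keys: "keys (coact ?N v) \<subseteq> carrier N \<times> carrier H'" if "v \<in> carrier N" for v
  unfolding coact using keys_coact[OF N that] linear_on_closed[OF lin]
  by (intro keys_tensor_map[of _ "carrier N" "carrier H"]) auto
 have lf: "linear_form N (\<lambda>v. lin_eval \<beta> (coact ?N v))" if "bilinear_form ?N H' \<beta>" for \<beta>
  using coact_form[OF N bilinear_form_comp[OF that idl lin]] by (simp add: coact lin_eval_tensor_map)
 show ?thesis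
  unfolding right_comodule_def
 proof (intro conjI allI ballI N')
  fix v assume "v \<in> carrier ?N"
  then have v: "v \<in> carrier N" by simp
  show "keys (coact ?N v) \<subseteq> carrier ?N \<times> carrier H'" using keys[OF v] by simp
  show "tensor_eq ?N H' (coact ?N (v \<oplus>\<^bsub>?N\<^esub> w)) (coact ?N v + coact ?N w)" if "w \<in> carrier ?N" for w
   using linear_form_add[OF lf v] that by (simp add: tensor_eq_iff lin_eval_add)
  show "tensor_eq ?N H' (coact ?N (c \<odot>\<^bsub>?N\<^esub> v)) (pm_scale c (coact ?N v))" for c
   using linear_form_smult[OF lf v] by (simp add: tensor_eq_iff lin_eval_scale)
  show "tensor3_eq ?N H' H' (split_left (coact ?N) (coact ?N v)) (split_right (comult H') (coact ?N v))"
   unfolding tensor3_eq_iff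
  proof (intro allI impI)
   fix \<gamma> assume \<gamma>: "trilinear_form ?N H' H' \<gamma>"
   let ?\<gamma> = "\<lambda>(a, b, c). \<gamma> (a, f b, f c)"
   have "lin_eval \<gamma> (split_left (coact ?N) (coact ?N v)) = lin_eval ?\<gamma> (split_left (coact N) (coact N v))"
    by (simp add: lin_eval_split_left coact lin_eval_tensor_map case_prod_unfold)
   also have "\<dots> = lin_eval ?\<gamma> (split_right (comult H) (coact N v))"
    using N v trilinear_form_comp[OF \<gamma> idl lin lin] unfolding right_comodule_def
    by (auto intro!: tensor3_eqD)
   also have "\<dots> = lin_eval (\<lambda>(a, b). lin_eval (\<lambda>(c, d). \<gamma> (a, c, d)) (comult H' (f b))) (coact N v)"
    unfolding lin_eval_split_right
    using tensor_map_bilinear[OF com trilinear_form_23[OF \<gamma>]] keys_coact[OF N v]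
    by (intro lin_eval_cong) (auto simp: case_prod_unfold)
   finally show "lin_eval \<gamma> (split_left (coact ?N) (coact ?N v)) =
     lin_eval \<gamma> (split_right (comult H') (coact ?N v))"
    by (simp add: lin_eval_split_right coact lin_eval_tensor_map case_prod_unfold)
  qed
  have kv: "keys (coact N v) \<subseteq> carrier N \<times> carrier H" using keys_coact[OF N v] by auto
  have kv': "keys (coact ?N v) \<subseteq> carrier ?N \<times> carrier H'" using keys[OF v] by simp
  show "contract_right ?N (counit H') (coact ?N v) = v"
   unfolding N'.contract_right_eq_iff[OF kv' \<open>v \<in> carrier ?N\<close>]
  proof (intro allI impI)
   fix g assume g: "linear_form ?N g"
   have "lin_eval (\<lambda>(a, b). counit H' b * g a) (coact ?N v) =
     lin_eval (\<lambda>(a, b). counit H b * g a) (coact N v)"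
    unfolding coact lin_eval_tensor_map using keys_coact[OF N v]
    by (intro lin_eval_cong) (auto simp: eps)
   also have "\<dots> = g v"
    using N v linear_form_comp[OF g idl] unfolding right_comodule_def
    by (auto simp: N.contract_right_eq_iff[OF kv v])
   finally show "lin_eval (\<lambda>(a, b). counit H' b * g a) (coact ?N v) = g v" .
  qed
 qed
qed

text \<open>\<open>N'\<close> is not known to be a comodule beforehand; its axioms are those of
  \<open>N\<close>, transported along the bijection. This serves for \<open>omega_comodule\<close>,
  whose coaction is written in an arbitrary basis.\<close>

lemma comodule_iso_transfer:
 assumes H: "weak_bialgebra H" and N: "right_comodule H N" and N': "Module.module scalars N'"
  and lin: "linear_on N N' \<phi>" and bij: "bij_betw \<phi> (carrier N) (carrier N')"
  and keys': "\<And>v. v \<in> carrier N' \<Longrightarrow> keys (coact N' v) \<subseteq> carrier N' \<times> carrier H"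
  and coact': "\<And>v. v \<in> carrier N \<Longrightarrow>
   tensor_eq N' H (coact N' (\<phi> v)) (tensor_map \<phi> (\<lambda>x. x) (coact N v))"
 shows "comodule_iso H N N' \<phi>"
proof -
 interpret H: weak_bialgebra H by (rule H)
 interpret N: scalars_module N by (rule right_comodule_module[OF N])
 interpret N': scalars_module N' by (rule scalars_module.intro[OF N'])
 have surj: "\<exists>v\<in>carrier N. w = \<phi> v" if "w \<in> carrier N'" for w
  using bij that by (auto simp: bij_betw_def)
 have cl: "\<phi> v \<in> carrier N'" if "v \<in> carrier N" for v using linear_on_closed[OF lin that] .
 have push: "lin_eval \<beta> (coact N' (\<phi> v)) = lin_eval (\<lambda>(a, b). \<beta> (\<phi> a, b)) (coact N v)"
  if "v \<in> carrier N" "bilinear_form N' H \<beta>" for v \<beta>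
  using tensor_map_bilinear[OF coact' that(2)] that(1) by simp
 have lf: "linear_form N' (\<lambda>v. lin_eval \<beta> (coact N' v))" if \<beta>: "bilinear_form N' H \<beta>" for \<beta>
 proof -
  have *: "linear_form N (\<lambda>v. lin_eval \<beta> (coact N' (\<phi> v)))"
   using coact_form[OF N bilinear_form_comp[OF \<beta> lin linear_on_id]]
   by (simp add: linear_form_def push[OF _ \<beta>] N.smult_in)
  show ?thesis unfolding linear_form_def
  proof (intro conjI ballI allI)
   fix x assume "x \<in> carrier N'"
   then obtain v where v: "v \<in> carrier N" "x = \<phi> v" using surj by blast
   show "lin_eval \<beta> (coact N' (c \<odot>\<^bsub>N'\<^esub> x)) = c * lin_eval \<beta> (coact N' x)" for c
    using linear_form_smult[OF * v(1)] linear_on_smult[OF lin v(1)] v(2) by simp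
   fix y assume "y \<in> carrier N'"
   then obtain w where w: "w \<in> carrier N" "y = \<phi> w" using surj by blast
   show "lin_eval \<beta> (coact N' (x \<oplus>\<^bsub>N'\<^esub> y)) = lin_eval \<beta> (coact N' x) + lin_eval \<beta> (coact N' y)"
    using linear_form_add[OF * v(1) w(1)] linear_on_add[OF lin v(1) w(1)] v(2) w(2) by simp
  qed
 qed
 have "right_comodule H N'"
  unfolding right_comodule_def
 proof (intro conjI allI ballI N')
  fix v' assume v': "v' \<in> carrier N'"
  then obtain v where v: "v \<in> carrier N" "v' = \<phi> v" using surj by blast
  show kv': "keys (coact N' v') \<subseteq> carrier N' \<times> carrier H" by (rule keys'[OF v'])
  show "tensor_eq N' H (coact N' (v' \<oplus>\<^bsub>N'\<^esub> w)) (coact N' v' + coact N' w)" if "w \<in> carrier N'" for w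
   using linear_form_add[OF lf v'] that by (simp add: tensor_eq_iff lin_eval_add)
  show "tensor_eq N' H (coact N' (c \<odot>\<^bsub>N'\<^esub> v')) (pm_scale c (coact N' v'))" for c
   using linear_form_smult[OF lf v'] by (simp add: tensor_eq_iff lin_eval_scale)
  show "tensor3_eq N' H H (split_left (coact N') (coact N' v')) (split_right (comult H) (coact N' v'))"
   unfolding tensor3_eq_iff
  proof (intro allI impI)
   fix \<gamma> assume \<gamma>: "trilinear_form N' H H \<gamma>"
   let ?\<gamma> = "\<lambda>(a, b, c). \<gamma> (\<phi> a, b, c)"
   have b1: "bilinear_form N' H (\<lambda>(a, b). lin_eval (\<lambda>(c, d). \<gamma> (c, d, b)) (coact N' a))"
   proof (rule bilinear_formI)
    fix b assume "b \<in> carrier H"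
    then show "linear_form N' (\<lambda>a. case (a, b) of (a, b) \<Rightarrow> lin_eval (\<lambda>(c, d). \<gamma> (c, d, b)) (coact N' a))"
     using lf[OF trilinear_form_12[OF \<gamma>]] by simp
   next
    fix a assume "a \<in> carrier N'"
    from keys'[OF this]
    show "linear_form H (\<lambda>b. case (a, b) of (a, b) \<Rightarrow> lin_eval (\<lambda>(c, d). \<gamma> (c, d, b)) (coact N' a))"
     by (auto intro!: linear_form_lin_eval trilinear_form_3[OF \<gamma>])
   qed
   have b2: "bilinear_form N' H (\<lambda>(a, b). lin_eval (\<lambda>(c, d). \<gamma> (a, c, d)) (comult H b))"
   proof (rule bilinear_formI)
    fix b assume "b \<in> carrier H"
    from H.comult_closed[OF this]
    show "linear_form N' (\<lambda>a. case (a, b) of (a, b) \<Rightarrow> lin_eval (\<lambda>(c, d). \<gamma> (a, c, d)) (comult H b))"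
     by (auto intro!: linear_form_lin_eval trilinear_form_1[OF \<gamma>])
   next
    fix a assume "a \<in> carrier N'"
    then show "linear_form H (\<lambda>b. case (a, b) of (a, b) \<Rightarrow> lin_eval (\<lambda>(c, d). \<gamma> (a, c, d)) (comult H b))"
     using H.linear_form_comult[OF trilinear_form_23[OF \<gamma>]] by simp
   qed
   have "lin_eval \<gamma> (split_left (coact N') (coact N' v')) =
     lin_eval (\<lambda>(a, b). lin_eval (\<lambda>(c, d). \<gamma> (c, d, b)) (coact N' (\<phi> a))) (coact N v)"
    unfolding lin_eval_split_left v(2) using push[OF v(1) b1] by simp
   also have "\<dots> = lin_eval ?\<gamma> (split_left (coact N) (coact N v))"
    unfolding lin_eval_split_left using keys_coact[OF N v(1)]
    by (intro lin_eval_cong) (auto simp: push[OF _ trilinear_form_12[OF \<gamma>]])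
   also have "\<dots> = lin_eval ?\<gamma> (split_right (comult H) (coact N v))"
    using N v trilinear_form_comp[OF \<gamma> lin linear_on_id linear_on_id] unfolding right_comodule_def
    by (auto intro!: tensor3_eqD)
   also have "\<dots> = lin_eval \<gamma> (split_right (comult H) (coact N' v'))"
    unfolding lin_eval_split_right v(2) using push[OF v(1) b2] by simp
   finally show "lin_eval \<gamma> (split_left (coact N') (coact N' v')) =
     lin_eval \<gamma> (split_right (comult H) (coact N' v'))" .
  qed
  have kv: "keys (coact N v) \<subseteq> carrier N \<times> carrier H" using keys_coact[OF N v(1)] by auto
  show "contract_right N' (counit H) (coact N' v') = v'"
   unfolding N'.contract_right_eq_iff[OF kv' v']
  proof (intro allI impI)
   fix g assume g: "linear_form N' g"
   have "bilinear_form N' H (\<lambda>(a, b). counit H b * g a)"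
    by (auto intro!: bilinear_formI linear_form_scale linear_form_scale_right g H.linear_form_counit)
   from push[OF v(1) this]
   have "lin_eval (\<lambda>(a, b). counit H b * g a) (coact N' v') =
     lin_eval (\<lambda>(a, b). counit H b * g (\<phi> a)) (coact N v)" by (simp add: v(2))
   also have "\<dots> = g v'"
    using N v linear_form_comp[OF g lin] unfolding right_comodule_def
    by (auto simp: N.contract_right_eq_iff[OF kv v(1)])
   finally show "lin_eval (\<lambda>(a, b). counit H b * g a) (coact N' v') = g v'" .
  qed
 qed
 then show ?thesis
  unfolding comodule_iso_def using N lin bij coact' by auto
qed

section \<open>The Weak Bialgebra of a finite directed graph\<close>

text \<open>The comodule of paths over the graph Weak Bialgebra itself. The comodule over the
  quotient turns out to be its pushforward along the projection.\<close>

definition graph_comodule ::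
 "('v, 'e) pre_digraph \<Rightarrow> nat \<Rightarrow>
  ('k::field, ('v, 'e) gpath \<Rightarrow>\<^sub>0 'k, ('v, 'e) gpath \<times> ('v, 'e) gpath \<Rightarrow>\<^sub>0 'k) comodule" where
 "graph_comodule G m =
   \<lparr>carrier = {t. keys t \<subseteq> paths G m}, mult = undefined, one = undefined, zero = 0,
   add = (+), smult = pm_scale,
   coact = lin_extend (\<lambda>p. \<Sum>q\<in>paths G m. basis_vec (basis_vec q, basis_vec (q, p)))\<rparr>"

section \<open>Paths and their concatenation\<close>

lemma path_source_Cons [simp]: "path_source G (t, p # ps) = path_source G (tail G p, ps)"
 by (cases ps) (auto simp: path_source_def)

lemma path_source_Nil [simp]: "path_source G (t, []) = t"
 by (simp add: path_source_def)

lemma chain_append: "chain G t (ps @ qs) \<longleftrightarrow> chain G t ps \<and> chain G (path_source G (t, ps)) qs"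
 by (induction ps arbitrary: t) auto

lemma length_path: "p \<in> paths G m \<Longrightarrow> length (snd p) = m" "p \<in> paths G m \<Longrightarrow> path_length p = m"
 by (auto simp: paths_def path_length_def)

lemma path_source_append:
 "path_source G p = path_target q \<Longrightarrow> path_source G (path_append p q) = path_source G q"
 by (cases q) (auto simp: path_append_def path_source_def path_target_def)

lemma path_target_append [simp]: "path_target (path_append p q) = path_target p"
 by (simp add: path_append_def path_target_def)

lemma path_append_assoc: "path_append (path_append p q) r = path_append p (path_append q r)"
 by (simp add: path_append_def)

lemma path_vertex_simps [simp]:
 "path_append p (vertex_path j) = p"
 "path_source G (vertex_path j) = j" "path_target (vertex_path j) = j"
 "vertex_path i = vertex_path j \<longleftrightarrow> i = j"
 by (simp_all add: path_append_def vertex_path_def path_target_def)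

lemma path_append_vertex: "path_target p = j \<Longrightarrow> path_append (vertex_path j) p = p"
 by (auto simp: path_append_def vertex_path_def path_target_def)

lemma path_append_in:
 "\<lbrakk>p \<in> paths G m; q \<in> paths G n; path_source G p = path_target q\<rbrakk> \<Longrightarrow> path_append p q \<in> paths G (m + n)"
 by (auto simp: paths_def path_append_def path_target_def chain_append)

text \<open>The lists of edges split uniquely because \<open>p\<close> and \<open>p'\<close> have
  the same length. The first components of \<open>q\<close> and \<open>q'\<close>, which leave no
  trace in the concatenation, are recovered as the sources of \<open>p\<close> and
  \<open>p'\<close>.\<close>

lemma path_append_cancel:
 assumes "p \<in> paths G m" "p' \<in> paths G m" "path_source G p = path_target q" "path_source G p' = path_target q'"
 shows "path_append p q = path_append p' q' \<longleftrightarrow> p = p' \<and> q = q'"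
proof
 assume "path_append p q = path_append p' q'"
 then have "fst p = fst p'" "snd p @ snd q = snd p' @ snd q'"
  by (simp_all add: path_append_def)
 moreover have "length (snd p) = length (snd p')" using assms(1,2) by (simp add: length_path)
 ultimately have "fst p = fst p'" "snd p = snd p'" "snd q = snd q'" by simp_all
 moreover from this have "p = p'" by (simp add: prod_eq_iff)
 moreover from this have "fst q = fst q'" using assms(3,4) by (simp add: path_target_def)
 ultimately show "p = p' \<and> q = q'" by (simp add: prod_eq_iff)
qed auto

lemma paths_0: "paths G 0 = vertex_path ` verts G"
 by (auto simp: paths_def vertex_path_def)

lemma vertex_path_in: "vertex_path j \<in> paths G 0 \<longleftrightarrow> j \<in> verts G"
 by (auto simp: paths_0)

lemma sum_paths_0: "sum f (paths G 0) = (\<Sum>j\<in>verts G. f (vertex_path j))"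
 unfolding paths_0 by (rule sum.reindex_cong[OF _ refl refl]) (auto simp: inj_on_def)

context fin_digraph
begin

abbreviation "P \<equiv> paths G"

abbreviation "\<sigma> \<equiv> path_source G"

abbreviation "\<tau> \<equiv> path_target"

abbreviation symbols where "symbols \<equiv> (\<Union>m. P m \<times> P m)"

lemma finite_paths [simp]: "finite (P m)"
proof (rule finite_subset)
 show "P m \<subseteq> verts G \<times> {ps. set ps \<subseteq> arcs G \<and> length ps = m}" by (auto simp: paths_def)
 show "finite (verts G \<times> {ps. set ps \<subseteq> arcs G \<and> length ps = m})"
  by (intro finite_cartesian_product finite_lists_length_eq) auto
qed

lemma path_target_in: "p \<in> P m \<Longrightarrow> \<tau> p \<in> verts G"
 by (auto simp: paths_def path_target_def)

lemma path_source_in: "p \<in> P m \<Longrightarrow> \<sigma> p \<in> verts G"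
 by (cases "snd p = []") (auto simp: paths_def path_source_def intro!: tail_in_verts dest!: last_in_set)

lemma edge_path_in: "p \<in> arcs G \<Longrightarrow> edge_path G p \<in> P 1"
 by (auto simp: paths_def edge_path_def)

lemma paths_1: "P 1 = edge_path G ` arcs G"
 by (auto simp: paths_def edge_path_def length_Suc_conv)

lemma inj_edge_path: "inj_on (edge_path G) A"
 by (auto simp: inj_on_def edge_path_def)

lemma edge_path_ends [simp]: "\<sigma> (edge_path G p) = tail G p" "\<tau> (edge_path G p) = head G p"
 by (auto simp: edge_path_def path_source_def path_target_def)

text \<open>The last edge is split off, in accordance with the recursion that defines the vectors
  \<open>path_vec\<close>.\<close>

lemma path_Suc_cases:
 assumes "p \<in> P (Suc m)"
 obtains q e where "q \<in> P m" "e \<in> arcs G" "\<sigma> q = head G e" "p = path_append q (edge_path G e)"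
proof -
 obtain t ps where p: "p = (t, ps)" by force
 with assms have ps: "length ps = Suc m" "set ps \<subseteq> arcs G" "t \<in> verts G" "chain G t ps"
  by (auto simp: paths_def)
 then obtain qs e where qe: "ps = qs @ [e]" by (metis length_Suc_conv_rev)
 show thesis
  by (rule that[of "(t, qs)" e])
    (use ps qe p in \<open>auto simp: paths_def chain_append path_append_def edge_path_def\<close>)
qed

lemma path_split:
 assumes "w \<in> P (m + n)"
 shows "\<exists>u\<in>P m. \<exists>v\<in>P n. \<sigma> u = \<tau> v \<and> w = path_append u v"
proof -
 obtain t ps where w: "w = (t, ps)" by force
 with assms have ps: "length ps = m + n" "set ps \<subseteq> arcs G" "t \<in> verts G" "chain G t ps"
  by (auto simp: paths_def)
 have "chain G t (take m ps @ drop m ps)" using ps by simp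
 then have c: "chain G t (take m ps)" "chain G (\<sigma> (t, take m ps)) (drop m ps)"
  unfolding chain_append by auto
 have "set (take m ps) \<subseteq> arcs G" "set (drop m ps) \<subseteq> arcs G"
  using ps(2) set_take_subset[of m ps] set_drop_subset[of m ps] by auto
 then have "(t, take m ps) \<in> P m" "(\<sigma> (t, take m ps), drop m ps) \<in> P n"
  using ps c path_source_in[of "(t, take m ps)" m] by (auto simp: paths_def)
 then show ?thesis using w
  by (intro bexI[of _ "(t, take m ps)"] bexI[of _ "(\<sigma> (t, take m ps), drop m ps)"])
    (auto simp: path_append_def path_target_def)
qed

text \<open>Every path of length \<open>m + n\<close> splits uniquely after its first
  \<open>m\<close> edges. This is the combinatorial content of the multiplicativity of the
  comultiplication.\<close>

lemma sum_paths_append: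
 "(\<Sum>w\<in>P (m + n). f w) = (\<Sum>u\<in>P m. \<Sum>v\<in>P n. if \<sigma> u = \<tau> v then f (path_append u v) else 0)"
proof -
 let ?A = "{(u, v) \<in> P m \<times> P n. \<sigma> u = \<tau> v}"
 have "bij_betw (\<lambda>(u, v). path_append u v) ?A (P (m + n))"
  unfolding bij_betw_def
 proof
  show "inj_on (\<lambda>(u, v). path_append u v) ?A"
   by (auto simp: inj_on_def path_append_cancel)
  show "(\<lambda>(u, v). path_append u v) ` ?A = P (m + n)"
  proof (intro equalityI subsetI)
   fix w assume "w \<in> P (m + n)"
   then obtain u v where "u \<in> P m" "v \<in> P n" "\<sigma> u = \<tau> v" "w = path_append u v"
    using path_split by blast
   then show "w \<in> (\<lambda>(u, v). path_append u v) ` ?A" by (auto intro!: image_eqI[of _ _ "(u, v)"])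
  qed (auto intro: path_append_in)
 qed
 then have "(\<Sum>w\<in>P (m + n). f w) = (\<Sum>(u, v)\<in>?A. f (path_append u v))"
  by (subst sum.reindex_bij_betw[symmetric]) (auto simp: case_prod_unfold)
 also have "\<dots> = (\<Sum>(u, v)\<in>P m \<times> P n. if \<sigma> u = \<tau> v then f (path_append u v) else 0)"
  by (rule sum.mono_neutral_cong_left) (auto split: if_splits)
 finally show ?thesis by (simp add: sum.cartesian_product)
qed

section \<open>The axioms of the graph Weak Bialgebra, computed on symbols\<close>

abbreviation gmult where
 "gmult \<equiv> \<lambda>(p, q) (r, s).
   if \<sigma> p = \<tau> r \<and> \<sigma> q = \<tau> s then basis_vec (path_append p r, path_append q s) else 0"

abbreviation gcomult where
 "gcomult \<equiv> \<lambda>(p, q). \<Sum>r\<in>P (path_length p). basis_vec (basis_vec (p, r), basis_vec (r, q))"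

abbreviation HG :: "('k::field, ('a, 'b) gpath \<times> ('a, 'b) gpath \<Rightarrow>\<^sub>0 'k) wba" where
 "HG \<equiv> graph_wba G"

lemma HG_simps [simp]:
 "carrier HG = {t. keys t \<subseteq> symbols}"
 "x \<otimes>\<^bsub>HG\<^esub> y = bilin_extend gmult x y" "\<one>\<^bsub>HG\<^esub> = (\<Sum>j\<in>verts G. \<Sum>l\<in>verts G. basis_vec (vertex_path j, vertex_path l))"
 "\<zero>\<^bsub>HG\<^esub> = 0" "x \<oplus>\<^bsub>HG\<^esub> y = x + y" "c \<odot>\<^bsub>HG\<^esub> x = pm_scale c x" "comult HG x = lin_extend gcomult x"
 "counit HG x = lin_eval (\<lambda>(p, q). if p = q then 1 else 0) x"
 by (simp_all add: graph_wba_def)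

lemma gcomult: "p \<in> P m \<Longrightarrow> gcomult (p, q) = (\<Sum>r\<in>P m. basis_vec (basis_vec (p, r), basis_vec (r, q)))"
 by (simp add: length_path)

lemmas lin_simps = bilin_extend_add_left bilin_extend_add_right bilin_extend_scale_left
 bilin_extend_scale_right lin_extend_add lin_extend_scale lin_eval_add lin_eval_scale lin_eval_fun_add
 lin_eval_fun_scale lin_eval_sum bilin_extend_sum_left bilin_extend_sum_right lin_extend_sum
 pm.scale_right_distrib

lemma one_in: "\<one>\<^bsub>HG\<^esub> \<in> carrier (HG :: ('k::field, _) wba)"
proof -
 have "keys (\<one>\<^bsub>HG\<^esub> :: _ \<Rightarrow>\<^sub>0 'k) \<subseteq> P 0 \<times> P 0"
  unfolding HG_simps by (rule order_trans[OF keys_sum_subset], rule UN_least, 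
    rule order_trans[OF keys_sum_subset], rule UN_least) (auto simp: vertex_path_in)
 then show ?thesis by auto
qed

lemma gmult_keys: "x \<in> symbols \<Longrightarrow> y \<in> symbols \<Longrightarrow> keys (gmult x y :: _ \<Rightarrow>\<^sub>0 'k::field) \<subseteq> symbols"
 by (cases x; cases y) (auto intro!: path_append_in)

lemma mult_in:
 fixes x y :: "_ \<Rightarrow>\<^sub>0 'k::field"
 assumes "keys x \<subseteq> symbols" "keys y \<subseteq> symbols"
 shows "keys (bilin_extend gmult x y) \<subseteq> symbols"
 by (rule order_trans[OF keys_bilin_extend]) (intro UN_least gmult_keys subsetD[OF assms(1)] subsetD[OF assms(2)])

lemma gcomult_keys:
 "x \<in> symbols \<Longrightarrow> keys (gcomult x :: _ \<Rightarrow>\<^sub>0 'k::field) \<subseteq> carrier HG \<times> carrier HG"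
proof -
 assume "x \<in> symbols"
 then obtain m p q where x: "x = (p, q)" "p \<in> P m" "q \<in> P m" by auto
 show ?thesis unfolding x(1) gcomult[OF x(2)]
  by (rule order_trans[OF keys_sum_subset]) (use x(2,3) in auto)
qed

lemma graph_module: "Module.module scalars (HG :: ('k::field, _) wba)"
proof (rule scalars_moduleI)
 fix x y :: "('a, 'b) gpath \<times> ('a, 'b) gpath \<Rightarrow>\<^sub>0 'k" and c
 assume x: "x \<in> carrier HG"
 then show "c \<odot>\<^bsub>HG\<^esub> x \<in> carrier HG" using keys_pm_scale[of c x] by auto
 assume "y \<in> carrier HG"
 then show "x \<oplus>\<^bsub>HG\<^esub> y \<in> carrier HG" using x Poly_Mapping.keys_add[of x y] by auto
qed (auto simp: add_ac pm.scale_left_distrib pm.scale_right_distrib)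

lemma mult_assoc_graph:
 fixes x y z :: "_ \<Rightarrow>\<^sub>0 'k::field"
 assumes x: "keys x \<subseteq> symbols" and y: "keys y \<subseteq> symbols"
  and z: "keys z \<subseteq> symbols"
 shows "bilin_extend gmult (bilin_extend gmult x y) z = bilin_extend gmult x (bilin_extend gmult y z)"
 using x
proof (induction x rule: pm_basis_induct)
 case (basis a)
 show ?case using y
 proof (induction y rule: pm_basis_induct)
  case (basis b)
  show ?case using z
  proof (induction z rule: pm_basis_induct)
   case (basis c)
   obtain p q r s t u where *: "a = (p, q)" "b = (r, s)" "c = (t, u)" by (cases a; cases b; cases c) auto
   show ?case unfolding * by (auto simp: path_source_append path_append_assoc)
  qed (simp_all add: lin_simps)
 qed (simp_all add: lin_simps)
qed (simp_all add: lin_simps)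

text \<open>Among the symbols in the unit, only the one formed by the sources of the two paths of a
  given symbol composes with it on the right.\<close>

lemma mult_one_right:
 assumes x: "keys x \<subseteq> symbols"
 shows "bilin_extend gmult x (\<one>\<^bsub>HG\<^esub> :: _ \<Rightarrow>\<^sub>0 'k::field) = x"
 using x
proof (induction x rule: pm_basis_induct)
 case (basis a)
 then obtain m p q where a: "a = (p, q)" "p \<in> P m" "q \<in> P m" by auto
 have "bilin_extend gmult (basis_vec a) (\<one>\<^bsub>HG\<^esub> :: _ \<Rightarrow>\<^sub>0 'k) =
   (\<Sum>j\<in>verts G. \<Sum>l\<in>verts G. if j = \<sigma> p then (if l = \<sigma> q then basis_vec a else 0) else 0)"
  unfolding HG_simps lin_simps by (intro sum.cong refl) (auto simp: a)
 also have "\<dots> = basis_vec a"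
  using a path_source_in by (simp add: sum.If_cases if_distrib[of "\<lambda>f. sum f _"] sum.delta)
 finally show ?case .
qed (simp_all add: lin_simps del: HG_simps)

lemma mult_one_left:
 assumes x: "keys x \<subseteq> symbols"
 shows "bilin_extend gmult (\<one>\<^bsub>HG\<^esub> :: _ \<Rightarrow>\<^sub>0 'k::field) x = x"
 using x
proof (induction x rule: pm_basis_induct)
 case (basis a)
 then obtain m p q where a: "a = (p, q)" "p \<in> P m" "q \<in> P m" by auto
 have "bilin_extend gmult (\<one>\<^bsub>HG\<^esub> :: _ \<Rightarrow>\<^sub>0 'k) (basis_vec a) =
   (\<Sum>j\<in>verts G. \<Sum>l\<in>verts G. if j = \<tau> p then (if l = \<tau> q then basis_vec a else 0) else 0)"
  unfolding HG_simps lin_simps by (intro sum.cong refl) (auto simp: a path_append_vertex)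
 also have "\<dots> = basis_vec a"
  using a path_target_in by (simp add: sum.If_cases if_distrib[of "\<lambda>f. sum f _"] sum.delta)
 finally show ?case .
qed (simp_all add: lin_simps del: HG_simps)

lemma graph_ring: "ring (HG :: ('k::field, _) wba)"
proof (rule ringI)
 show "abelian_group (HG :: ('k, _) wba)" using graph_module by (rule Module.module.axioms(2))
 show "Group.monoid (HG :: ('k, _) wba)"
  using one_in[where 'k='k] mult_one_left[where 'k='k] mult_one_right[where 'k='k]
  by (intro monoidI) (simp_all add: mult_in mult_assoc_graph)
qed (simp_all add: lin_simps)

text \<open>Both iterated coproducts of \<open>[p|q]\<close> are the sum of
  \<open>[p|s] \<otimes> [s|r] \<otimes> [r|q]\<close> over all \<open>s\<close> and
  \<open>r\<close>. The identity therefore holds already between formal combinations.\<close>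

lemma coassoc_graph:
 assumes "keys x \<subseteq> symbols"
 shows "split_left (comult HG) (comult HG x) = split_right (comult HG) (comult HG (x :: _ \<Rightarrow>\<^sub>0 'k::field))"
proof (rule pm_eqI)
 fix \<gamma> :: "_ \<Rightarrow> 'k"
 have "lin_eval \<gamma> (split_left (comult HG) (comult HG x)) =
   lin_eval (\<lambda>z. lin_eval (\<lambda>(a, b). lin_eval (\<lambda>(c, d). \<gamma> (c, d, b)) (lin_extend gcomult a)) (gcomult z)) x"
  by (simp add: lin_eval_split_left lin_eval_extend)
 also have "\<dots> = lin_eval (\<lambda>z. lin_eval (\<lambda>(a, b). lin_eval (\<lambda>(c, d). \<gamma> (a, c, d)) (lin_extend gcomult b)) (gcomult z)) x"
 proof (rule lin_eval_cong)
  fix z assume "z \<in> keys x"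
  then obtain m p q where z: "z = (p, q)" "p \<in> P m" "q \<in> P m" using assms by blast
  have "lin_eval (\<lambda>(a, b). lin_eval (\<lambda>(c, d). \<gamma> (c, d, b)) (lin_extend gcomult a)) (gcomult z) =
    (\<Sum>r\<in>P m. \<Sum>s\<in>P m. \<gamma> (basis_vec (p, s), basis_vec (s, r), basis_vec (r, q)))"
   unfolding z(1) gcomult[OF z(2)] by (simp add: lin_eval_sum length_path[OF z(2)])
  also have "\<dots> = (\<Sum>s\<in>P m. \<Sum>r\<in>P m. \<gamma> (basis_vec (p, s), basis_vec (s, r), basis_vec (r, q)))"
   by (rule sum.swap)
  also have "\<dots> = lin_eval (\<lambda>(a, b). lin_eval (\<lambda>(c, d). \<gamma> (a, c, d)) (lin_extend gcomult b)) (gcomult z)"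
   unfolding z(1) gcomult[OF z(2)] by (auto simp: lin_eval_sum length_path intro!: sum.cong)
  finally show "lin_eval (\<lambda>(a, b). lin_eval (\<lambda>(c, d). \<gamma> (c, d, b)) (lin_extend gcomult a)) (gcomult z) =
    lin_eval (\<lambda>(a, b). lin_eval (\<lambda>(c, d). \<gamma> (a, c, d)) (lin_extend gcomult b)) (gcomult z)" .
 qed
 finally show "lin_eval \<gamma> (split_left (comult HG) (comult HG x)) =
   lin_eval \<gamma> (split_right (comult HG) (comult HG x))"
  by (simp add: lin_eval_split_right lin_eval_extend)
qed

lemma keys_comult_graph:
 assumes "x \<in> carrier (HG :: ('k::field, _) wba)"
 shows "keys (comult HG x) \<subseteq> carrier HG \<times> carrier HG"
proof -
 have "keys (lin_extend gcomult x) \<subseteq> carrier HG \<times> carrier HG"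
 proof (rule order_trans[OF keys_lin_extend], rule UN_least, rule gcomult_keys)
  fix z assume "z \<in> keys x"
  then show "z \<in> symbols" using assms by auto
 qed
 then show ?thesis by simp
qed

sublocale HG: scalars_module "HG :: ('k::field, _) wba"
 by (rule scalars_module.intro[OF graph_module])

lemma counit_graph:
 assumes x: "x \<in> carrier (HG :: ('k::field, _) wba)"
 shows "contract_left HG (counit HG) (comult HG x) = x" "contract_right HG (counit HG) (comult HG x) = x"
proof -
 have x': "keys x \<subseteq> symbols" using x by simp
 have *: "lin_eval (\<lambda>(b, a). counit HG b * g a) (comult HG x) = g x \<and>
   lin_eval (\<lambda>(a, b). counit HG b * g a) (comult HG x) = g x" if g: "linear_form HG g" for g
  using x'
 proof (induction x rule: pm_basis_induct)
  case zero
  then show ?case using HG.linear_form_zero[OF g] by simp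
 next
  case (basis a)
  then obtain m p q where a: "a = (p, q)" "p \<in> P m" "q \<in> P m" by auto
  then show ?case
   by (simp add: lin_eval_sum length_path[OF a(2)] if_distrib[of "\<lambda>x. x * _"] sum.delta cong: if_cong)
 next
  case (add s t)
  then show ?case using linear_form_add[OF g, of s t] by (simp add: lin_simps)
 next
  case (scale c s)
  then show ?case using linear_form_smult[OF g, of s c] by (simp add: lin_simps)
 qed
 show "contract_left HG (counit HG) (comult HG x) = x"
  unfolding HG.contract_left_eq_iff[OF keys_comult_graph[OF x] x] using * by blast
 show "contract_right HG (counit HG) (comult HG x) = x"
  unfolding HG.contract_right_eq_iff[OF keys_comult_graph[OF x] x] using * by blast
qed

text \<open>In a formal combination of pairs, a pair with an entry 0 is a basis vector and not 0;
  only bilinear forms remove it. Such pairs arise because the product of symbols that do not compose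
  is 0.\<close>

lemma bilinear_form_zero:
 "bilinear_form HG HG \<beta> \<Longrightarrow> x \<in> carrier HG \<Longrightarrow> \<beta> (0, x) = (0 :: 'k::field)"
 "bilinear_form HG HG \<beta> \<Longrightarrow> x \<in> carrier HG \<Longrightarrow> \<beta> (x, 0) = (0 :: 'k::field)"
 by (drule (1) bilinear_form_left, drule HG.linear_form_zero, simp)
  (drule (1) bilinear_form_right, drule HG.linear_form_zero, simp)

lemma trilinear_form_zero:
 "\<lbrakk>trilinear_form HG HG HG \<gamma>; x \<in> carrier HG; y \<in> carrier HG\<rbrakk> \<Longrightarrow> \<gamma> (x, 0, y) = (0 :: 'k::field)"
 by (drule (2) trilinear_form_2, drule HG.linear_form_zero, simp)

text \<open>For composable symbols the middle path of the product is split into \<open>u\<close> and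
  \<open>v\<close>, and the pairs \<open>(u, v)\<close> that do not compose contribute nothing.
  Equality holds only up to \<open>tensor_eq\<close>, because these pairs still occur in the formal
  product.\<close>

lemma comult_mult_graph:
 fixes x y :: "_ \<Rightarrow>\<^sub>0 'k::field"
 assumes x: "x \<in> carrier HG" and y: "y \<in> carrier HG"
 shows "tensor_eq HG HG (comult HG (x \<otimes>\<^bsub>HG\<^esub> y)) (tensor_mult HG (comult HG x) (comult HG y))"
 unfolding tensor_eq_iff
proof (intro allI impI)
 fix \<beta> :: "_ \<Rightarrow> 'k" assume \<beta>: "bilinear_form HG HG \<beta>"
 have y': "keys y \<subseteq> symbols" using y by simp
 have x': "keys x \<subseteq> symbols" using x by simp
 from x' show "lin_eval \<beta> (comult HG (x \<otimes>\<^bsub>HG\<^esub> y)) = lin_eval \<beta> (tensor_mult HG (comult HG x) (comult HG y))"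
 proof (induction x rule: pm_basis_induct)
  case (basis a)
  then obtain m p q where a: "a = (p, q)" "p \<in> P m" "q \<in> P m" by auto
  from y' show ?case
  proof (induction y rule: pm_basis_induct)
   case (basis b)
   then obtain n r s where b: "b = (r, s)" "r \<in> P n" "s \<in> P n" by auto
   have "lin_eval \<beta> (tensor_mult HG (comult HG (basis_vec a)) (comult HG (basis_vec b))) =
     (\<Sum>u\<in>P m. \<Sum>v\<in>P n. \<beta> (gmult (p, u) (r, v), gmult (u, q) (v, s)))"
    unfolding lin_eval_tensor_mult a(1) b(1)
    by (simp add: lin_eval_sum length_path[OF a(2)] length_path[OF b(2)])
   also have "\<dots> = lin_eval \<beta> (comult HG (basis_vec a \<otimes>\<^bsub>HG\<^esub> basis_vec b))"
   proof (cases "\<sigma> p = \<tau> r \<and> \<sigma> q = \<tau> s")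
    case True
    have pr: "path_append p r \<in> P (m + n)" using a b True by (auto intro: path_append_in)
    have "(\<Sum>u\<in>P m. \<Sum>v\<in>P n. \<beta> (gmult (p, u) (r, v), gmult (u, q) (v, s))) =
      (\<Sum>u\<in>P m. \<Sum>v\<in>P n. if \<sigma> u = \<tau> v then \<beta> (basis_vec (path_append p r, path_append u v),
       basis_vec (path_append u v, path_append q s)) else 0)"
     using True bilinear_form_zero[OF \<beta>, of 0] by (intro sum.cong refl) auto
    also have "\<dots> = (\<Sum>w\<in>P (m + n). \<beta> (basis_vec (path_append p r, w), basis_vec (w, path_append q s)))"
     by (rule sum_paths_append[symmetric])
    finally show ?thesis using True by (simp add: a(1) b(1) length_path[OF pr] lin_eval_sum)
   next
    case False
    \<comment> \<open>If the symbols do not compose, one of the two entries vanishes for every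
      middle pair: the first if the upper paths do not compose, the second if the lower ones do
      not.\<close>
    have "\<beta> (gmult (p, u) (r, v), gmult (u, q) (v, s)) = 0" if u: "u \<in> P m" and v: "v \<in> P n" for u v
    proof -
     have c: "gmult (p, u) (r, v) \<in> carrier (HG :: ('k, _) wba)" "gmult (u, q) (v, s) \<in> carrier (HG :: ('k, _) wba)"
      using a b u v by (auto intro!: exI[of _ "m + n"] path_append_in)
     from False consider "gmult (p, u) (r, v) = (0 :: _ \<Rightarrow>\<^sub>0 'k)" | "gmult (u, q) (v, s) = (0 :: _ \<Rightarrow>\<^sub>0 'k)"
      by auto
     then show ?thesis
     proof cases
      case 1
      show ?thesis unfolding 1 by (rule bilinear_form_zero(1)[OF \<beta> c(2)])
     next
      case 2
      show ?thesis unfolding 2 by (rule bilinear_form_zero(2)[OF \<beta> c(1)])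
     qed
    qed
    then show ?thesis using False by (auto simp: a(1) b(1) intro!: sum.neutral)
   qed
   finally show ?case by simp
  qed (simp_all add: lin_simps tensor_mult_def)
 qed (simp_all add: lin_simps tensor_mult_def)
qed

lemma counit_gmult:
 assumes "p \<in> P m" "q \<in> P m" "r \<in> P n" "s \<in> P n"
 shows "lin_eval (\<lambda>(p, q). if p = q then 1 else 0) (gmult (p, q) (r, s)) =
  (if p = q \<and> r = s \<and> \<sigma> p = \<tau> r then 1 else (0 :: 'k::field))"
 using assms by (auto simp: path_append_cancel)

definition pm_linear :: "(('c \<Rightarrow>\<^sub>0 'k::field) \<Rightarrow> 'k) \<Rightarrow> bool" where
 "pm_linear F \<longleftrightarrow> (\<forall>s t. F (s + t) = F s + F t) \<and> (\<forall>c s. F (pm_scale c s) = c * F s)"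

lemma pm_linear_ext:
 assumes t: "keys t \<subseteq> A" and F: "pm_linear F" and F': "pm_linear F'"
  and eq: "\<And>x. x \<in> A \<Longrightarrow> F (basis_vec x) = F' (basis_vec x)"
 shows "F t = F' t"
 using t
proof (induction t rule: pm_basis_induct)
 case zero
 have "F (pm_scale 0 0) = 0 * F 0" "F' (pm_scale 0 0) = 0 * F' 0"
  using F F' unfolding pm_linear_def by blast+
 then show ?case by simp
qed (use F F' eq in \<open>auto simp: pm_linear_def\<close>)

text \<open>The three expressions are linear in each argument and may be compared on symbols
  \<open>[p|q]\<close>, \<open>[r|s]\<close>, \<open>[t|u]\<close>. There each is 1 if
  \<open>p = q\<close>, \<open>r = s\<close>, \<open>t = u\<close> and the paths compose, and 0
  otherwise; the sum over the middle paths of the coproduct of \<open>[r|s]\<close> has at most one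
  nonzero term.\<close>

lemma counit_mult_graph:
 fixes x y z :: "_ \<Rightarrow>\<^sub>0 'k::field"
 assumes x: "x \<in> carrier HG" and y: "y \<in> carrier HG" and z: "z \<in> carrier HG"
 shows "counit HG (x \<otimes>\<^bsub>HG\<^esub> y \<otimes>\<^bsub>HG\<^esub> z) =
   lin_eval (\<lambda>(y', y''). counit HG (x \<otimes>\<^bsub>HG\<^esub> y') * counit HG (y'' \<otimes>\<^bsub>HG\<^esub> z)) (comult HG y) \<and>
  counit HG (x \<otimes>\<^bsub>HG\<^esub> y \<otimes>\<^bsub>HG\<^esub> z) =
   lin_eval (\<lambda>(y', y''). counit HG (x \<otimes>\<^bsub>HG\<^esub> y'') * counit HG (y' \<otimes>\<^bsub>HG\<^esub> z)) (comult HG y)"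
proof -
 have x': "keys x \<subseteq> symbols" and y': "keys y \<subseteq> symbols"
  and z': "keys z \<subseteq> symbols" using assms by simp_all
 define F1 F2 F3 where "F1 = (\<lambda>x y z. counit HG (x \<otimes>\<^bsub>HG\<^esub> y \<otimes>\<^bsub>HG\<^esub> z) :: 'k)"
  and "F2 = (\<lambda>x y z. lin_eval (\<lambda>(y', y''). counit HG (x \<otimes>\<^bsub>HG\<^esub> y') * counit HG (y'' \<otimes>\<^bsub>HG\<^esub> z)) (comult HG y) :: 'k)"
  and "F3 = (\<lambda>x y z. lin_eval (\<lambda>(y', y''). counit HG (x \<otimes>\<^bsub>HG\<^esub> y'') * counit HG (y' \<otimes>\<^bsub>HG\<^esub> z)) (comult HG y) :: 'k)"
 note F = F1_def F2_def F3_def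
 note ls = pm_linear_def F lin_simps case_prod_unfold distrib_left distrib_right mult.assoc mult.left_commute
 have lin: "pm_linear (\<lambda>x. F1 x y z)" "pm_linear (\<lambda>y. F1 x y z)" "pm_linear (\<lambda>z. F1 x y z)"
  "pm_linear (\<lambda>x. F2 x y z)" "pm_linear (\<lambda>y. F2 x y z)" "pm_linear (\<lambda>z. F2 x y z)"
  "pm_linear (\<lambda>x. F3 x y z)" "pm_linear (\<lambda>y. F3 x y z)" "pm_linear (\<lambda>z. F3 x y z)" for x y z
  by (simp_all add: ls)
 have basis: "F1 (basis_vec a) (basis_vec b) (basis_vec c) = F2 (basis_vec a) (basis_vec b) (basis_vec c) \<and>
   F1 (basis_vec a) (basis_vec b) (basis_vec c) = F3 (basis_vec a) (basis_vec b) (basis_vec c)"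
  if symb: "a \<in> symbols" "b \<in> symbols" "c \<in> symbols" for a b c
 proof -
  obtain m p q where a: "a = (p, q)" "p \<in> P m" "q \<in> P m" using symb(1) by auto
  obtain n r s where b: "b = (r, s)" "r \<in> P n" "s \<in> P n" using symb(2) by auto
  obtain l t u where c: "c = (t, u)" "t \<in> P l" "u \<in> P l" using symb(3) by auto
  have e1: "counit HG (basis_vec a \<otimes>\<^bsub>HG\<^esub> basis_vec b \<otimes>\<^bsub>HG\<^esub> basis_vec c) =
    (if p = q \<and> r = s \<and> t = u \<and> \<sigma> p = \<tau> r \<and> \<sigma> r = \<tau> t then 1 else (0 :: 'k))"
  proof (cases "\<sigma> p = \<tau> r \<and> \<sigma> q = \<tau> s")
   case True
   have pr: "path_append p r \<in> P (m + n)" "path_append q s \<in> P (m + n)"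
    using a b True by (auto intro: path_append_in)
   show ?thesis using counit_gmult[OF pr c(2,3), where 'k='k] True a b
    by (simp add: a(1) b(1) c(1) path_source_append path_append_cancel[OF a(2,3)] del: bilin_extend_zero)
  qed (auto simp: a(1) b(1))
  have e2: "lin_eval (\<lambda>(y', y''). counit HG (basis_vec a \<otimes>\<^bsub>HG\<^esub> y') * counit HG (y'' \<otimes>\<^bsub>HG\<^esub> basis_vec c)) (comult HG (basis_vec b)) =
   (\<Sum>v\<in>P n. (if p = q \<and> r = v \<and> \<sigma> p = \<tau> r then 1 else 0) * (if v = s \<and> t = u \<and> \<sigma> v = \<tau> t then 1 else (0 :: 'k)))"
   using counit_gmult[OF a(2,3) b(2), where 'k='k] counit_gmult[OF _ b(3) c(2,3), where 'k='k]
   by (simp add: a(1) b(1) c(1) lin_eval_sum length_path[OF b(2)])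
  have e3: "lin_eval (\<lambda>(y', y''). counit HG (basis_vec a \<otimes>\<^bsub>HG\<^esub> y'') * counit HG (y' \<otimes>\<^bsub>HG\<^esub> basis_vec c)) (comult HG (basis_vec b)) =
   (\<Sum>v\<in>P n. (if p = q \<and> v = s \<and> \<sigma> p = \<tau> v then 1 else 0) * (if r = v \<and> t = u \<and> \<sigma> r = \<tau> t then 1 else (0 :: 'k)))"
   using counit_gmult[OF a(2,3) _ b(3), where 'k='k] counit_gmult[OF b(2) _ c(2,3), where 'k='k]
   by (simp add: a(1) b(1) c(1) lin_eval_sum length_path[OF b(2)])
  have d: "(\<Sum>v\<in>P n. (if A \<and> r = v \<and> B then 1 else 0) * (if v = s \<and> C \<and> D v then 1 else (0 :: 'k))) =
    (if A \<and> r = s \<and> B \<and> C \<and> D r then 1 else 0)" for A B C D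
  proof -
   have "(\<Sum>v\<in>P n. (if A \<and> r = v \<and> B then 1 else 0) * (if v = s \<and> C \<and> D v then 1 else (0 :: 'k))) =
     (\<Sum>v\<in>P n. if v = r then (if A \<and> r = s \<and> B \<and> C \<and> D r then 1 else 0) else 0)"
    by (intro sum.cong refl) auto
   then show ?thesis using b(2) by simp
  qed
  have d': "(\<Sum>v\<in>P n. (if A \<and> v = s \<and> B v then 1 else 0) * (if r = v \<and> C \<and> D then 1 else (0 :: 'k))) =
    (if A \<and> r = s \<and> B r \<and> C \<and> D then 1 else 0)" for A B C D
  proof -
   have "(\<Sum>v\<in>P n. (if A \<and> v = s \<and> B v then 1 else 0) * (if r = v \<and> C \<and> D then 1 else (0 :: 'k))) =
     (\<Sum>v\<in>P n. if v = r then (if A \<and> r = s \<and> B r \<and> C \<and> D then 1 else 0) else 0)"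
    by (intro sum.cong refl) auto
   then show ?thesis using b(2) by simp
  qed
  show ?thesis unfolding F e1 e2 e3 d d' by auto
 qed
 have "F1 x y z = F2 x y z"
 proof (rule pm_linear_ext[OF x' lin(1) lin(4)], rule pm_linear_ext[OF y' lin(2) lin(5)],
   rule pm_linear_ext[OF z' lin(3) lin(6)])
 qed (rule conjunct1[OF basis])
 moreover have "F1 x y z = F3 x y z"
 proof (rule pm_linear_ext[OF x' lin(1) lin(7)], rule pm_linear_ext[OF y' lin(2) lin(8)],
   rule pm_linear_ext[OF z' lin(3) lin(9)])
 qed (rule conjunct2[OF basis])
 ultimately show ?thesis unfolding F by (rule conjI)
qed

lemma comult_one_graph:
 "comult HG \<one>\<^bsub>HG\<^esub> = (\<Sum>j\<in>P 0. \<Sum>l\<in>P 0. \<Sum>i\<in>P 0.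
   basis_vec (basis_vec (j, i), basis_vec (i, l)) :: _ \<Rightarrow>\<^sub>0 'k::field)"
 by (simp add: lin_extend_sum sum_paths_0 path_length_def vertex_path_def)

lemma gmult_vertices:
 assumes "i \<in> P 0" "j \<in> P 0" "i' \<in> P 0" "j' \<in> P 0"
 shows "gmult (i, j) (i', j') = (if i = i' \<and> j = j' then basis_vec (i, j) else (0 :: _ \<Rightarrow>\<^sub>0 'k::field))"
 using assms by (auto simp: paths_0)

text \<open>Symbols of pairs of vertices multiply as orthogonal idempotents, so the sixfold sums for
  the two products collapse to fourfold ones. \<open>r1\<close> and \<open>r2\<close> rename and
  reorder the indices to match the iterated coproduct of the unit.\<close>

lemma comult_one_axioms_graph:
 fixes t :: "_ \<Rightarrow>\<^sub>0 'k::field"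
 defines "t \<equiv> comult HG \<one>\<^bsub>HG\<^esub>"
 shows "tensor3_eq HG HG HG (split_left (comult HG) t)
   (tensor3_mult HG (tensor_one_right HG t) (tensor_one_left HG t))"
  and "tensor3_eq HG HG HG (split_left (comult HG) t)
   (tensor3_mult HG (tensor_one_left HG t) (tensor_one_right HG t))"
proof -
 let ?V = "P 0"
 have v: "basis_vec (i, j) \<in> carrier (HG :: ('k, _) wba)" if "i \<in> ?V" "j \<in> ?V" for i j
  using that by auto
 have one: "basis_vec (i, j) \<otimes>\<^bsub>HG\<^esub> \<one>\<^bsub>HG\<^esub> = (basis_vec (i, j) :: _ \<Rightarrow>\<^sub>0 'k)"
  "\<one>\<^bsub>HG\<^esub> \<otimes>\<^bsub>HG\<^esub> basis_vec (i, j) = (basis_vec (i, j) :: _ \<Rightarrow>\<^sub>0 'k)" if "i \<in> ?V" "j \<in> ?V" for i j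
 proof -
  have "keys (basis_vec (i, j) :: _ \<Rightarrow>\<^sub>0 'k) \<subseteq> symbols" using that by auto
  from mult_one_right[OF this] mult_one_left[OF this]
  show "basis_vec (i, j) \<otimes>\<^bsub>HG\<^esub> \<one>\<^bsub>HG\<^esub> = (basis_vec (i, j) :: _ \<Rightarrow>\<^sub>0 'k)"
   "\<one>\<^bsub>HG\<^esub> \<otimes>\<^bsub>HG\<^esub> basis_vec (i, j) = (basis_vec (i, j) :: _ \<Rightarrow>\<^sub>0 'k)"
   unfolding HG_simps(2) by this+
 qed
 have split: "lin_eval \<gamma> (split_left (comult HG) t) =
   (\<Sum>j\<in>?V. \<Sum>l\<in>?V. \<Sum>i\<in>?V. \<Sum>s\<in>?V. \<gamma> (basis_vec (j, s), basis_vec (s, i), basis_vec (i, l)))"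
  for \<gamma> :: "_ \<Rightarrow> 'k"
  unfolding t_def comult_one_graph lin_eval_split_left lin_eval_sum lin_eval_basis_vec prod.case
  by (intro sum.cong refl) (simp add: lin_eval_sum length_path(2)[of _ G 0])
 have prod1: "lin_eval \<gamma> (tensor3_mult HG (tensor_one_right HG t) (tensor_one_left HG t)) =
   (\<Sum>j\<in>?V. \<Sum>l\<in>?V. \<Sum>i\<in>?V. \<Sum>l'\<in>?V. \<gamma> (basis_vec (j, i), basis_vec (i, l), basis_vec (l, l')))"
  if \<gamma>: "trilinear_form HG HG HG \<gamma>" for \<gamma> :: "_ \<Rightarrow> 'k"
 proof -
  have "lin_eval \<gamma> (tensor3_mult HG (tensor_one_right HG t) (tensor_one_left HG t)) =
    (\<Sum>j\<in>?V. \<Sum>l\<in>?V. \<Sum>i\<in>?V. \<Sum>j'\<in>?V. \<Sum>l'\<in>?V. \<Sum>i'\<in>?V.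
     \<gamma> (basis_vec (j, i), gmult (i, l) (j', i'), basis_vec (i', l')))"
   unfolding t_def comult_one_graph lin_eval_tensor3_mult_one lin_eval_sum lin_eval_basis_vec prod.case
   by (intro sum.cong refl) (simp only: one, simp)
  also have "\<dots> = (\<Sum>j\<in>?V. \<Sum>l\<in>?V. \<Sum>i\<in>?V. \<Sum>j'\<in>?V. \<Sum>l'\<in>?V. \<Sum>i'\<in>?V.
     if i' = l then (if j' = i then \<gamma> (basis_vec (j, i), basis_vec (i, l), basis_vec (l, l')) else 0) else 0)"
   by (intro sum.cong refl, subst gmult_vertices)
    (simp_all add: trilinear_form_zero[OF \<gamma> v v] del: HG_simps split: if_split)
  also have "\<dots> = (\<Sum>j\<in>?V. \<Sum>l\<in>?V. \<Sum>i\<in>?V. \<Sum>j'\<in>?V. if j' = i then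
    \<Sum>l'\<in>?V. \<gamma> (basis_vec (j, i), basis_vec (i, l), basis_vec (l, l')) else 0)"
   by (intro sum.cong refl) (simp add: sum.delta)
  finally show ?thesis by (simp add: sum.delta)
 qed
 have prod2: "lin_eval \<gamma> (tensor3_mult HG (tensor_one_left HG t) (tensor_one_right HG t)) =
   (\<Sum>j\<in>?V. \<Sum>l\<in>?V. \<Sum>i\<in>?V. \<Sum>j'\<in>?V. \<gamma> (basis_vec (j', j), basis_vec (j, i), basis_vec (i, l)))"
  if \<gamma>: "trilinear_form HG HG HG \<gamma>" for \<gamma> :: "_ \<Rightarrow> 'k"
 proof -
  have "lin_eval \<gamma> (tensor3_mult HG (tensor_one_left HG t) (tensor_one_right HG t)) =
    (\<Sum>j\<in>?V. \<Sum>l\<in>?V. \<Sum>i\<in>?V. \<Sum>j'\<in>?V. \<Sum>l'\<in>?V. \<Sum>i'\<in>?V.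
     \<gamma> (basis_vec (j', i'), gmult (j, i) (i', l'), basis_vec (i, l)))"
   unfolding t_def comult_one_graph lin_eval_tensor3_mult_one lin_eval_sum lin_eval_basis_vec prod.case
   by (intro sum.cong refl) (simp only: one, simp)
  also have "\<dots> = (\<Sum>j\<in>?V. \<Sum>l\<in>?V. \<Sum>i\<in>?V. \<Sum>j'\<in>?V. \<Sum>l'\<in>?V. \<Sum>i'\<in>?V.
     if i' = j then (if l' = i then \<gamma> (basis_vec (j', j), basis_vec (j, i), basis_vec (i, l)) else 0) else 0)"
   by (intro sum.cong refl, subst gmult_vertices)
    (simp_all add: trilinear_form_zero[OF \<gamma> v v] del: HG_simps split: if_split)
  also have "\<dots> = (\<Sum>j\<in>?V. \<Sum>l\<in>?V. \<Sum>i\<in>?V. \<Sum>j'\<in>?V. \<Sum>l'\<in>?V. if l' = i then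
    \<gamma> (basis_vec (j', j), basis_vec (j, i), basis_vec (i, l)) else 0)"
   by (intro sum.cong refl) (simp add: sum.delta)
  finally show ?thesis by (simp add: sum.delta)
 qed
 have r1: "(\<Sum>j\<in>?V. \<Sum>l\<in>?V. \<Sum>i\<in>?V. \<Sum>s\<in>?V. F j s i l) = (\<Sum>j\<in>?V. \<Sum>l\<in>?V. \<Sum>i\<in>?V. \<Sum>l'\<in>?V. F j i l l')"
  for F :: "_ \<Rightarrow> _ \<Rightarrow> _ \<Rightarrow> _ \<Rightarrow> 'k"
 proof (rule sum.cong[OF refl])
  fix j
  have "(\<Sum>l\<in>?V. \<Sum>i\<in>?V. \<Sum>s\<in>?V. F j s i l) = (\<Sum>i\<in>?V. \<Sum>l\<in>?V. \<Sum>s\<in>?V. F j s i l)" by (rule sum.swap)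
  also have "\<dots> = (\<Sum>i\<in>?V. \<Sum>s\<in>?V. \<Sum>l\<in>?V. F j s i l)" by (intro sum.cong refl sum.swap)
  finally show "(\<Sum>l\<in>?V. \<Sum>i\<in>?V. \<Sum>s\<in>?V. F j s i l) = (\<Sum>l\<in>?V. \<Sum>i\<in>?V. \<Sum>l'\<in>?V. F j i l l')" .
 qed
 have r2: "(\<Sum>j\<in>?V. \<Sum>l\<in>?V. \<Sum>i\<in>?V. \<Sum>s\<in>?V. F j s i l) = (\<Sum>j\<in>?V. \<Sum>l\<in>?V. \<Sum>i\<in>?V. \<Sum>j'\<in>?V. F j' j i l)"
  for F :: "_ \<Rightarrow> _ \<Rightarrow> _ \<Rightarrow> _ \<Rightarrow> 'k"
 proof -
  have "(\<Sum>j\<in>?V. \<Sum>l\<in>?V. \<Sum>i\<in>?V. \<Sum>s\<in>?V. F j s i l) = (\<Sum>j\<in>?V. \<Sum>l\<in>?V. \<Sum>s\<in>?V. \<Sum>i\<in>?V. F j s i l)"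
   by (intro sum.cong refl sum.swap)
  also have "\<dots> = (\<Sum>j\<in>?V. \<Sum>s\<in>?V. \<Sum>l\<in>?V. \<Sum>i\<in>?V. F j s i l)" by (intro sum.cong refl sum.swap)
  also have "\<dots> = (\<Sum>s\<in>?V. \<Sum>j\<in>?V. \<Sum>l\<in>?V. \<Sum>i\<in>?V. F j s i l)" by (rule sum.swap)
  also have "\<dots> = (\<Sum>s\<in>?V. \<Sum>l\<in>?V. \<Sum>j\<in>?V. \<Sum>i\<in>?V. F j s i l)" by (intro sum.cong refl sum.swap)
  also have "\<dots> = (\<Sum>s\<in>?V. \<Sum>l\<in>?V. \<Sum>i\<in>?V. \<Sum>j\<in>?V. F j s i l)" by (intro sum.cong refl sum.swap)
  finally show ?thesis .
 qed
 show "tensor3_eq HG HG HG (split_left (comult HG) t)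
   (tensor3_mult HG (tensor_one_right HG t) (tensor_one_left HG t))"
  unfolding tensor3_eq_iff split by (intro allI impI, rule trans[OF r1 prod1[symmetric]])
 show "tensor3_eq HG HG HG (split_left (comult HG) t)
   (tensor3_mult HG (tensor_one_left HG t) (tensor_one_right HG t))"
  unfolding tensor3_eq_iff split by (intro allI impI, rule trans[OF r2 prod2[symmetric]])
qed

theorem graph_weak_bialgebra: "weak_bialgebra (HG :: ('k::field, _) wba)"
proof (intro weak_bialgebra.intro graph_module graph_ring weak_bialgebra_axioms.intro)
 fix x :: "_ \<Rightarrow>\<^sub>0 'k" assume x: "x \<in> carrier HG"
 show "tensor3_eq HG HG HG (split_left (comult HG) (comult HG x)) (split_right (comult HG) (comult HG x))"
  using coassoc_graph[of x] x unfolding HG_simps(1) tensor3_eq_iff by auto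
next
 fix x y z :: "_ \<Rightarrow>\<^sub>0 'k" assume "x \<in> carrier HG" "y \<in> carrier HG" "z \<in> carrier HG"
 from counit_mult_graph[OF this]
 show "counit HG (x \<otimes>\<^bsub>HG\<^esub> y \<otimes>\<^bsub>HG\<^esub> z) =
   lin_eval (\<lambda>(y', y''). counit HG (x \<otimes>\<^bsub>HG\<^esub> y') * counit HG (y'' \<otimes>\<^bsub>HG\<^esub> z)) (comult HG y)"
  and "counit HG (x \<otimes>\<^bsub>HG\<^esub> y \<otimes>\<^bsub>HG\<^esub> z) =
   lin_eval (\<lambda>(y', y''). counit HG (x \<otimes>\<^bsub>HG\<^esub> y'') * counit HG (y' \<otimes>\<^bsub>HG\<^esub> z)) (comult HG y)"
  by auto
qed (fact keys_comult_graph counit_graph comult_mult_graph comult_one_axioms_graph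
 | simp add: lin_simps tensor_eq_refl)+

section \<open>Paths as comodules over the graph Weak Bialgebra\<close>

lemma graph_comodule_simps [simp]:
 "carrier (graph_comodule G m) = {t. keys t \<subseteq> P m}"
 "x \<oplus>\<^bsub>graph_comodule G m\<^esub> y = x + y" "c \<odot>\<^bsub>graph_comodule G m\<^esub> x = pm_scale c x"
 "\<zero>\<^bsub>graph_comodule G m\<^esub> = 0"
 "coact (graph_comodule G m) =
   lin_extend (\<lambda>p. \<Sum>q\<in>P m. basis_vec (basis_vec q, basis_vec (q, p)))"
 by (simp_all add: graph_comodule_def)

lemma graph_comodule_module: "Module.module scalars (graph_comodule G m :: ('k::field, _, _) comodule)"
proof (rule scalars_moduleI)
 fix x y :: "('a, 'b) gpath \<Rightarrow>\<^sub>0 'k" and c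
 assume x: "x \<in> carrier (graph_comodule G m)"
 then show "c \<odot>\<^bsub>graph_comodule G m\<^esub> x \<in> carrier (graph_comodule G m)" using keys_pm_scale[of c x] by auto
 assume "y \<in> carrier (graph_comodule G m)"
 then show "x \<oplus>\<^bsub>graph_comodule G m\<^esub> y \<in> carrier (graph_comodule G m)"
  using x Poly_Mapping.keys_add[of x y] by auto
qed (auto simp: add_ac pm.scale_left_distrib pm.scale_right_distrib)

theorem graph_comodule:
 "right_comodule HG (graph_comodule G m :: ('k::field, _, _) comodule)"
proof -
 let ?N = "graph_comodule G m :: ('k, _, _) comodule"
 interpret N: scalars_module ?N by (rule scalars_module.intro[OF graph_comodule_module])
 have keys: "keys (coact ?N v) \<subseteq> carrier ?N \<times> carrier HG" if v: "v \<in> carrier ?N" for v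
  unfolding graph_comodule_simps(5)
 proof (rule order_trans[OF keys_lin_extend], rule UN_least, rule order_trans[OF keys_sum_subset], rule UN_least)
  fix p q assume "p \<in> keys v" "q \<in> P m"
  then show "keys (basis_vec (basis_vec q, basis_vec (q, p)) :: _ \<Rightarrow>\<^sub>0 'k) \<subseteq> carrier ?N \<times> carrier HG"
   using v by auto
 qed
 show ?thesis
  unfolding right_comodule_def
 proof (intro conjI allI ballI graph_comodule_module)
  fix v assume v: "v \<in> carrier ?N"
  show "keys (coact ?N v) \<subseteq> carrier ?N \<times> carrier HG" by (rule keys[OF v])
  show "tensor3_eq ?N HG HG (split_left (coact ?N) (coact ?N v)) (split_right (comult HG) (coact ?N v))"
   unfolding tensor3_eq_iff
  proof (intro allI impI)
   fix \<gamma> :: "_ \<Rightarrow> 'k"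
   have "lin_eval \<gamma> (split_left (coact ?N) (coact ?N v)) =
     lin_eval (\<lambda>p. \<Sum>q\<in>P m. \<Sum>r\<in>P m. \<gamma> (basis_vec r, basis_vec (r, q), basis_vec (q, p))) v"
    by (simp add: lin_eval_split_left lin_eval_extend lin_eval_sum)
   also have "\<dots> = lin_eval (\<lambda>p. \<Sum>r\<in>P m. \<Sum>q\<in>P m. \<gamma> (basis_vec r, basis_vec (r, q), basis_vec (q, p))) v"
    by (rule arg_cong[of _ _ "\<lambda>f. lin_eval f v"]) (intro ext sum.swap)
   also have "\<dots> = lin_eval \<gamma> (split_right (comult HG) (coact ?N v))"
    by (auto simp: lin_eval_split_right lin_eval_extend lin_eval_sum length_path(2)
      intro!: lin_eval_cong sum.cong)
   finally show "lin_eval \<gamma> (split_left (coact ?N) (coact ?N v)) =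
     lin_eval \<gamma> (split_right (comult HG) (coact ?N v))" .
  qed
  show "contract_right ?N (counit HG) (coact ?N v) = v"
   unfolding N.contract_right_eq_iff[OF keys[OF v] v]
  proof (intro allI impI)
   fix g assume g: "linear_form ?N g"
   have "keys v \<subseteq> P m" using v by simp
   then show "lin_eval (\<lambda>(a, b). counit HG b * g a) (coact ?N v) = g v"
   proof (induction v rule: pm_basis_induct)
    case zero
    then show ?case using N.linear_form_zero[OF g] by simp
   next
    case (basis p)
    then show ?case
     by (simp add: lin_eval_sum if_distrib[of "\<lambda>x. x * _"] sum.delta cong: if_cong)
   next
    case (add s t)
    then show ?case using linear_form_add[OF g, of s t] by (simp add: lin_simps)
   next
    case (scale c s)
    then show ?case using linear_form_smult[OF g, of s c] by (simp add: lin_simps)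
   qed
  qed
 qed (simp_all add: lin_simps tensor_eq_refl)
qed

end

section \<open>Typed morphisms\<close>

context linear_category
begin

text \<open>Bundles the membership of the objects with that of the morphism, so that sources and
  targets of composites are found by unification.\<close>

definition arr :: "'o \<Rightarrow> 'o \<Rightarrow> 'm \<Rightarrow> bool" where
 "arr X Y f \<longleftrightarrow> X \<in> obj C \<and> Y \<in> obj C \<and> f \<in> Hom C X Y"

lemma arrI: "\<lbrakk>f \<in> Hom C X Y; X \<in> obj C; Y \<in> obj C\<rbrakk> \<Longrightarrow> arr X Y f"
 by (simp add: arr_def)

lemma arr_comp: "arr X Y f \<Longrightarrow> arr Y Z g \<Longrightarrow> arr X Z (g \<cdot> f)"
 unfolding arr_def using comp_in_hom by blast

lemma arr_id: "X \<in> obj C \<Longrightarrow> arr X X (\<I> X)"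
 by (simp add: arr_def id_in_hom)

lemma arr_zero: "X \<in> obj C \<Longrightarrow> Y \<in> obj C \<Longrightarrow> arr X Y 0"
 by (simp add: arr_def hom_subspace subspace_0)

lemma arr_add: "arr X Y f \<Longrightarrow> arr X Y g \<Longrightarrow> arr X Y (f + g)"
 by (simp add: arr_def hom_subspace subspace_add)

lemma arr_scal: "arr X Y f \<Longrightarrow> arr X Y (scal C c f)"
 by (simp add: arr_def hom_subspace subspace_scale)

lemma arr_sum: "\<lbrakk>X \<in> obj C; Y \<in> obj C; (\<And>a. a \<in> A \<Longrightarrow> arr X Y (f a))\<rbrakk> \<Longrightarrow> arr X Y (\<Sum>a\<in>A. f a)"
 by (simp add: arr_def hom_subspace subspace_sum)

lemma cmp_assoc: "\<lbrakk>arr W X f; arr X Y g; arr Y Z h\<rbrakk> \<Longrightarrow> (h \<cdot> g) \<cdot> f = h \<cdot> (g \<cdot> f)"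
 unfolding arr_def using comp_assoc by blast

lemma cmp_id_left: "arr X Y f \<Longrightarrow> \<I> Y \<cdot> f = f"
 unfolding arr_def using id_left by blast

lemma cmp_id_right: "arr X Y f \<Longrightarrow> f \<cdot> \<I> X = f"
 unfolding arr_def using id_right by blast

lemma cmp_add_left: "\<lbrakk>arr X Y f; arr Y Z g; arr Y Z g'\<rbrakk> \<Longrightarrow> (g + g') \<cdot> f = g \<cdot> f + g' \<cdot> f"
 unfolding arr_def using comp_add_left by blast

lemma cmp_add_right: "\<lbrakk>arr X Y f; arr X Y f'; arr Y Z g\<rbrakk> \<Longrightarrow> g \<cdot> (f + f') = g \<cdot> f + g \<cdot> f'"
 unfolding arr_def using comp_add_right by blast

lemma cmp_scal_left: "arr X Y f \<Longrightarrow> arr Y Z g \<Longrightarrow> scal C c g \<cdot> f = scal C c (g \<cdot> f)"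
 unfolding arr_def using comp_scal_left by blast

lemma cmp_scal_right: "arr X Y f \<Longrightarrow> arr Y Z g \<Longrightarrow> g \<cdot> scal C c f = scal C c (g \<cdot> f)"
 unfolding arr_def using comp_scal_right by blast

lemma cmp_zero_left: "arr X Y f \<Longrightarrow> Z \<in> obj C \<Longrightarrow> 0 \<cdot> f = 0"
 using cmp_scal_left[of X Y f Z 0 0] arr_zero[of Y Z] by (auto simp: arr_def)

lemma cmp_zero_right: "arr Y Z g \<Longrightarrow> X \<in> obj C \<Longrightarrow> g \<cdot> 0 = 0"
 using cmp_scal_right[of X Y 0 Z g 0] arr_zero[of X Y] by (auto simp: arr_def)

lemma cmp_sum_left:
 assumes f: "arr X Y f" and Z: "Z \<in> obj C" and g: "\<And>a. a \<in> A \<Longrightarrow> arr Y Z (g a)"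
 shows "(\<Sum>a\<in>A. g a) \<cdot> f = (\<Sum>a\<in>A. g a \<cdot> f)"
 using g
proof (induction A rule: infinite_finite_induct)
 case (insert a A)
 then have "arr Y Z (\<Sum>a\<in>A. g a)" using f Z by (intro arr_sum) (auto simp: arr_def)
 with insert show ?case using cmp_add_left[OF f, of Z "g a" "\<Sum>a\<in>A. g a"] by simp
qed (simp_all add: cmp_zero_left[OF f Z])

lemma cmp_sum_right:
 assumes g: "arr Y Z g" and X: "X \<in> obj C" and f: "\<And>a. a \<in> A \<Longrightarrow> arr X Y (f a)"
 shows "g \<cdot> (\<Sum>a\<in>A. f a) = (\<Sum>a\<in>A. g \<cdot> f a)"
 using f
proof (induction A rule: infinite_finite_induct)
 case (insert a A)
 then have "arr X Y (\<Sum>a\<in>A. f a)" using g X by (intro arr_sum) (auto simp: arr_def)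
 with insert show ?case using cmp_add_right[of X Y "f a" "\<Sum>a\<in>A. f a" Z g] g by simp
qed (simp_all add: cmp_zero_right[OF g X])

text \<open>Composites are kept bracketed to the right. This lemma and \<open>cmp_swap\<close>
  rewrite the two leftmost factors of such a composite, and nearly all diagram chases below consist
  of them.\<close>

lemma cmp_eq: "\<lbrakk>arr W X h; arr X Y f; arr Y Z g; g \<cdot> f = k\<rbrakk> \<Longrightarrow> g \<cdot> (f \<cdot> h) = k \<cdot> h"
 using cmp_assoc by metis

lemma cmp_swap:
 assumes "arr W X h" "arr X Y f" "arr Y Z g" "arr X Y' f'" "arr Y' Z g'" "g \<cdot> f = g' \<cdot> f'"
 shows "g \<cdot> (f \<cdot> h) = g' \<cdot> (f' \<cdot> h)"
 using cmp_eq[OF assms(1-3,6)] cmp_assoc[OF assms(1,4,5)] by (rule trans)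

lemma inv_mor:
 assumes "iso_mor C X Y f" "X \<in> obj C" "Y \<in> obj C"
 shows "arr Y X (inv_mor C X Y f)" "inv_mor C X Y f \<cdot> f = \<I> X" "f \<cdot> inv_mor C X Y f = \<I> Y"
proof -
 from assms obtain g where f: "arr X Y f" and g: "inverse_mor C X Y f g"
  by (auto simp: iso_mor_def arr_def)
 have "h = g" if "inverse_mor C X Y f h" for h
 proof -
  have *: "arr Y X g" "g \<cdot> f = \<I> X" "f \<cdot> g = \<I> Y" "arr Y X h" "h \<cdot> f = \<I> X"
   using g that assms by (auto simp: inverse_mor_def arr_def)
  have "h = h \<cdot> (f \<cdot> g)" using * by (simp add: cmp_id_right)
  also have "\<dots> = (h \<cdot> f) \<cdot> g" using cmp_assoc[OF *(1) f *(4)] by simp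
  finally show ?thesis using * by (simp add: cmp_id_left)
 qed
 with g have "inv_mor C X Y f = g" unfolding inv_mor_def by (intro the_equality)
 with g assms show "arr Y X (inv_mor C X Y f)" "inv_mor C X Y f \<cdot> f = \<I> X" "f \<cdot> inv_mor C X Y f = \<I> Y"
  by (auto simp: inverse_mor_def arr_def)
qed

end

section \<open>Typed tensor products and coherence of the right unit\<close>

context linear_monoidal_category
begin

lemma arr_tmor: "arr X X' f \<Longrightarrow> arr Y Y' g \<Longrightarrow> arr (X \<boxtimes> Y) (X' \<boxtimes> Y') (f \<star> g)"
 unfolding arr_def using tmor_in_hom tobj_closed by blast

lemma arr_assoc: "\<lbrakk>X \<in> obj C; Y \<in> obj C; Z \<in> obj C\<rbrakk> \<Longrightarrow> arr ((X \<boxtimes> Y) \<boxtimes> Z) (X \<boxtimes> (Y \<boxtimes> Z)) (\<alpha>\<^sub>u X Y Z)"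
 using assoc_iso by (auto simp: arr_def iso_mor_def tobj_closed)

lemma assoc_inv:
 assumes "X \<in> obj C" "Y \<in> obj C" "Z \<in> obj C"
 shows "arr (X \<boxtimes> (Y \<boxtimes> Z)) ((X \<boxtimes> Y) \<boxtimes> Z) (assoc_inv C X Y Z)"
  "assoc_inv C X Y Z \<cdot> \<alpha>\<^sub>u X Y Z = \<I> ((X \<boxtimes> Y) \<boxtimes> Z)" "\<alpha>\<^sub>u X Y Z \<cdot> assoc_inv C X Y Z = \<I> (X \<boxtimes> (Y \<boxtimes> Z))"
 using assms inv_mor[OF assoc_iso] by (auto simp: tobj_closed)

lemma arr_lunit: "X \<in> obj C \<Longrightarrow> arr (\<bbbone> \<boxtimes> X) X (\<lambda>\<^sub>u X)"
 using lunit_iso by (auto simp: arr_def iso_mor_def tobj_closed unit_closed)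

lemma lunit_inv:
 assumes "X \<in> obj C"
 shows "arr X (\<bbbone> \<boxtimes> X) (lunit_inv C X)"
  "lunit_inv C X \<cdot> \<lambda>\<^sub>u X = \<I> (\<bbbone> \<boxtimes> X)" "\<lambda>\<^sub>u X \<cdot> lunit_inv C X = \<I> X"
 using assms inv_mor[OF lunit_iso] by (auto simp: tobj_closed unit_closed)

lemma arr_runit: "X \<in> obj C \<Longrightarrow> arr (X \<boxtimes> \<bbbone>) X (\<rho>\<^sub>u X)"
 using runit_iso by (auto simp: arr_def iso_mor_def tobj_closed unit_closed)

lemma runit_inv:
 assumes "X \<in> obj C"
 shows "arr X (X \<boxtimes> \<bbbone>) (runit_inv C X)"
  "runit_inv C X \<cdot> \<rho>\<^sub>u X = \<I> (X \<boxtimes> \<bbbone>)" "\<rho>\<^sub>u X \<cdot> runit_inv C X = \<I> X"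
 using assms inv_mor[OF runit_iso] by (auto simp: tobj_closed unit_closed)

lemmas typing = arr_comp arr_tmor arr_id arr_assoc assoc_inv(1) arr_lunit lunit_inv(1) arr_runit runit_inv(1)
 tobj_closed unit_closed

lemma tmor_cmp:
 "\<lbrakk>arr X X' f; arr X' X'' f'; arr Y Y' g; arr Y' Y'' g'\<rbrakk> \<Longrightarrow>
  (f' \<cdot> f) \<star> (g' \<cdot> g) = (f' \<star> g') \<cdot> (f \<star> g)"
 unfolding arr_def using tmor_comp by blast

lemma tmor_cmp_left:
 "\<lbrakk>arr X X' f; arr X' X'' f'; Y \<in> obj C\<rbrakk> \<Longrightarrow> (f' \<star> \<I> Y) \<cdot> (f \<star> \<I> Y) = (f' \<cdot> f) \<star> \<I> Y"
 using tmor_cmp[of X X' f X'' f' Y Y "\<I> Y" Y "\<I> Y"] by (simp add: arr_id cmp_id_left[OF arr_id])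

lemma tmor_cmp_right:
 "\<lbrakk>arr X X' f; arr X' X'' f'; Y \<in> obj C\<rbrakk> \<Longrightarrow> (\<I> Y \<star> f') \<cdot> (\<I> Y \<star> f) = \<I> Y \<star> (f' \<cdot> f)"
 using tmor_cmp[of Y Y "\<I> Y" Y "\<I> Y" X X' f X'' f'] by (simp add: arr_id cmp_id_left[OF arr_id])

lemma tmor_interchange:
 assumes "arr X X' f" "arr Y Y' g"
 shows "(f \<star> \<I> Y') \<cdot> (\<I> X \<star> g) = (\<I> X' \<star> g) \<cdot> (f \<star> \<I> Y)"
 using tmor_cmp[of X X "\<I> X" X' f Y Y' g Y' "\<I> Y'"] tmor_cmp[of X X' f X' "\<I> X'" Y Y "\<I> Y" Y' g] assms
 by (auto simp: arr_def id_left id_right id_in_hom)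

lemma tmor_plus_left: "\<lbrakk>arr X X' f; arr X X' f'; arr Y Y' g\<rbrakk> \<Longrightarrow> (f + f') \<star> g = f \<star> g + f' \<star> g"
 unfolding arr_def using tmor_add_left by blast

lemma tmor_plus_right: "\<lbrakk>arr X X' f; arr Y Y' g; arr Y Y' g'\<rbrakk> \<Longrightarrow> f \<star> (g + g') = f \<star> g + f \<star> g'"
 unfolding arr_def using tmor_add_right by blast

lemma tmor_scale_left: "arr X X' f \<Longrightarrow> arr Y Y' g \<Longrightarrow> scal C c f \<star> g = scal C c (f \<star> g)"
 unfolding arr_def using tmor_scal_left by blast

lemma tmor_scale_right: "arr X X' f \<Longrightarrow> arr Y Y' g \<Longrightarrow> f \<star> scal C c g = scal C c (f \<star> g)"
 unfolding arr_def using tmor_scal_right by blast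

lemma tmor_zero_left: "\<lbrakk>X \<in> obj C; X' \<in> obj C; arr Y Y' g\<rbrakk> \<Longrightarrow> 0 \<star> g = 0"
 using tmor_scale_left[OF arr_zero[of X X'], of Y Y' g 0] by simp

lemma tmor_sum_left:
 assumes X: "X \<in> obj C" "X' \<in> obj C" and g: "arr Y Y' g" and f: "\<And>a. a \<in> A \<Longrightarrow> arr X X' (f a)"
 shows "(\<Sum>a\<in>A. f a) \<star> g = (\<Sum>a\<in>A. f a \<star> g)"
 using f
proof (induction A rule: infinite_finite_induct)
 case (insert a A)
 then have "arr X X' (\<Sum>a\<in>A. f a)" using X by (intro arr_sum) auto
 with insert show ?case using tmor_plus_left[of X X' "f a" "\<Sum>a\<in>A. f a" Y Y' g] g by simp
qed (simp_all add: tmor_zero_left[OF X g])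

lemma assoc_nat:
 "\<lbrakk>arr X X' f; arr Y Y' g; arr Z Z' h\<rbrakk> \<Longrightarrow>
  \<alpha>\<^sub>u X' Y' Z' \<cdot> ((f \<star> g) \<star> h) = (f \<star> (g \<star> h)) \<cdot> \<alpha>\<^sub>u X Y Z"
 unfolding arr_def using assoc_natural by blast

lemma runit_nat: "arr X Y f \<Longrightarrow> \<rho>\<^sub>u Y \<cdot> (f \<star> \<I> \<bbbone>) = f \<cdot> \<rho>\<^sub>u X"
 unfolding arr_def using runit_natural by blast

text \<open>Kelly's lemma: the functor $-\otimes\mathbf 1$ is faithful, and after applying it the identity
 follows from the pentagon and the triangle.\<close>

lemma runit_tensor:
 assumes X: "X \<in> obj C" and Y: "Y \<in> obj C"
 shows "(\<I> X \<star> \<rho>\<^sub>u Y) \<cdot> \<alpha>\<^sub>u X Y \<bbbone> = \<rho>\<^sub>u (X \<boxtimes> Y)"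
proof -
 note t = typing X Y
 let ?f = "(\<I> X \<star> \<rho>\<^sub>u Y) \<cdot> \<alpha>\<^sub>u X Y \<bbbone>" and ?g = "\<rho>\<^sub>u (X \<boxtimes> Y)"
 have f: "arr ((X \<boxtimes> Y) \<boxtimes> \<bbbone>) (X \<boxtimes> Y) ?f" by (rule t)+
 have g: "arr ((X \<boxtimes> Y) \<boxtimes> \<bbbone>) (X \<boxtimes> Y) ?g" by (rule t)+
 let ?a = "\<alpha>\<^sub>u X Y \<bbbone>" and ?b = "\<alpha>\<^sub>u (X \<boxtimes> Y) \<bbbone> \<bbbone>"
 have nat1: "?a \<cdot> (\<I> (X \<boxtimes> Y) \<star> \<lambda>\<^sub>u \<bbbone>) = (\<I> X \<star> (\<I> Y \<star> \<lambda>\<^sub>u \<bbbone>)) \<cdot> \<alpha>\<^sub>u X Y (\<bbbone> \<boxtimes> \<bbbone>)"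
  using assoc_nat[of X X "\<I> X" Y Y "\<I> Y" "\<bbbone> \<boxtimes> \<bbbone>" \<bbbone> "\<lambda>\<^sub>u \<bbbone>"] X Y
  by (simp add: typing tmor_id)
 have "?a \<cdot> (?g \<star> \<I> \<bbbone>) = ?a \<cdot> ((\<I> (X \<boxtimes> Y) \<star> \<lambda>\<^sub>u \<bbbone>) \<cdot> ?b)"
  using triangle[of "X \<boxtimes> Y" \<bbbone>] X Y by (simp add: typing)
 also have "\<dots> = (\<I> X \<star> (\<I> Y \<star> \<lambda>\<^sub>u \<bbbone>)) \<cdot> (\<alpha>\<^sub>u X Y (\<bbbone> \<boxtimes> \<bbbone>) \<cdot> ?b)"
  by (rule cmp_swap[OF _ _ _ _ _ nat1]) (rule t)+
 also have "\<alpha>\<^sub>u X Y (\<bbbone> \<boxtimes> \<bbbone>) \<cdot> ?b =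
   (\<I> X \<star> \<alpha>\<^sub>u Y \<bbbone> \<bbbone>) \<cdot> \<alpha>\<^sub>u X (Y \<boxtimes> \<bbbone>) \<bbbone> \<cdot> (?a \<star> \<I> \<bbbone>)"
  by (rule pentagon) (rule t)+
 also have "\<dots> = (\<I> X \<star> \<alpha>\<^sub>u Y \<bbbone> \<bbbone>) \<cdot> (\<alpha>\<^sub>u X (Y \<boxtimes> \<bbbone>) \<bbbone> \<cdot> (?a \<star> \<I> \<bbbone>))"
  by (rule cmp_assoc) (rule t)+
 also have "(\<I> X \<star> (\<I> Y \<star> \<lambda>\<^sub>u \<bbbone>)) \<cdot> \<dots> = (\<I> X \<star> (\<rho>\<^sub>u Y \<star> \<I> \<bbbone>)) \<cdot> (\<alpha>\<^sub>u X (Y \<boxtimes> \<bbbone>) \<bbbone> \<cdot> (?a \<star> \<I> \<bbbone>))"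
 proof (rule cmp_eq)
  show "(\<I> X \<star> (\<I> Y \<star> \<lambda>\<^sub>u \<bbbone>)) \<cdot> (\<I> X \<star> \<alpha>\<^sub>u Y \<bbbone> \<bbbone>) = \<I> X \<star> (\<rho>\<^sub>u Y \<star> \<I> \<bbbone>)"
   unfolding triangle[OF Y unit_closed, symmetric] by (rule tmor_cmp_right) (rule t)+
 qed (rule t)+
 also have "\<dots> = ?a \<cdot> (((\<I> X \<star> \<rho>\<^sub>u Y) \<star> \<I> \<bbbone>) \<cdot> (?a \<star> \<I> \<bbbone>))"
  by (rule cmp_swap[OF _ _ _ _ _ assoc_nat[symmetric]]) (rule t)+
 also have "((\<I> X \<star> \<rho>\<^sub>u Y) \<star> \<I> \<bbbone>) \<cdot> (?a \<star> \<I> \<bbbone>) = ?f \<star> \<I> \<bbbone>"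
  by (rule tmor_cmp_left) (rule t)+
 finally have eq: "?a \<cdot> (?g \<star> \<I> \<bbbone>) = ?a \<cdot> (?f \<star> \<I> \<bbbone>)" .
 have cancel: "assoc_inv C X Y \<bbbone> \<cdot> (?a \<cdot> h) = h" if h: "arr Z ((X \<boxtimes> Y) \<boxtimes> \<bbbone>) h" for Z h
 proof -
  have "assoc_inv C X Y \<bbbone> \<cdot> (?a \<cdot> h) = \<I> ((X \<boxtimes> Y) \<boxtimes> \<bbbone>) \<cdot> h"
   by (rule cmp_eq) (rule t h assoc_inv(2))+
  then show ?thesis by (simp add: cmp_id_left[OF h])
 qed
 have fg: "?g \<star> \<I> \<bbbone> = ?f \<star> \<I> \<bbbone>"
  using cancel[OF arr_tmor[OF f arr_id[OF unit_closed]]]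
   cancel[OF arr_tmor[OF g arr_id[OF unit_closed]]] eq by simp
 \<comment> \<open>Naturality of the right unit recovers \<open>h\<close> from its tensor product
   with the identity of the unit object.\<close>
 have "h = (\<rho>\<^sub>u (X \<boxtimes> Y) \<cdot> (h \<star> \<I> \<bbbone>)) \<cdot> runit_inv C ((X \<boxtimes> Y) \<boxtimes> \<bbbone>)"
  if h: "arr ((X \<boxtimes> Y) \<boxtimes> \<bbbone>) (X \<boxtimes> Y) h" for h
 proof -
  have "(\<rho>\<^sub>u (X \<boxtimes> Y) \<cdot> (h \<star> \<I> \<bbbone>)) \<cdot> runit_inv C ((X \<boxtimes> Y) \<boxtimes> \<bbbone>) =
    (h \<cdot> \<rho>\<^sub>u ((X \<boxtimes> Y) \<boxtimes> \<bbbone>)) \<cdot> runit_inv C ((X \<boxtimes> Y) \<boxtimes> \<bbbone>)" by (simp add: runit_nat[OF h])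
  also have "\<dots> = h \<cdot> (\<rho>\<^sub>u ((X \<boxtimes> Y) \<boxtimes> \<bbbone>) \<cdot> runit_inv C ((X \<boxtimes> Y) \<boxtimes> \<bbbone>))"
   by (rule cmp_assoc) (rule t h)+
  finally show ?thesis using X Y by (simp add: runit_inv(3) typing cmp_id_right[OF h])
 qed
 from this[OF f] this[OF g] fg show ?thesis by simp
qed

end

section \<open>The pairing between $\omega X$ and $(\omega X)^*$\<close>

locale semisimple_monoidal = linear_monoidal_category C
 for C :: "('k::field, 'o, 'm::ab_group_add, 'i) fcat" (structure) +
 assumes hom_fin: "hom_finite C"
  and semisimple: "finitely_split_semisimple C"
  and Vhat_sum: "Vhat_direct_sum C"
begin

abbreviation V where "V \<equiv> Vhat C"

abbreviation J where "J \<equiv> idx C"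

lemma finite_J [simp]: "finite J"
 using semisimple by (simp add: finitely_split_semisimple_def)

lemma V_obj: "V \<in> obj C"
 using Vhat_sum by (simp add: Vhat_direct_sum_def direct_sum_def)

lemma smp_obj: "j \<in> J \<Longrightarrow> smp C j \<in> obj C"
 using Vhat_sum by (simp add: Vhat_direct_sum_def direct_sum_def)

lemma arr_vinj: "j \<in> J \<Longrightarrow> arr (smp C j) V (vinj C j)"
 using Vhat_sum V_obj smp_obj by (simp add: Vhat_direct_sum_def direct_sum_def arr_def)

lemma arr_vprj: "j \<in> J \<Longrightarrow> arr V (smp C j) (vprj C j)"
 using Vhat_sum V_obj smp_obj by (simp add: Vhat_direct_sum_def direct_sum_def arr_def)

lemma vprj_vinj: "j \<in> J \<Longrightarrow> l \<in> J \<Longrightarrow> vprj C j \<cdot> vinj C l = (if j = l then \<I> (smp C j) else 0)"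
 using Vhat_sum by (simp add: Vhat_direct_sum_def direct_sum_def)

lemma id_V: "\<I> V = (\<Sum>j\<in>J. lam C j)"
 using Vhat_sum by (simp add: Vhat_direct_sum_def direct_sum_def lam_def)

lemma smp_End:
 assumes j: "j \<in> J" and f: "arr (smp C j) (smp C j) f"
 shows "\<exists>c. f = scal C c (\<I> (smp C j))"
proof -
 let ?S = "smp C j"
 have "simple_obj C ?S" using semisimple j by (simp add: finitely_split_semisimple_def)
 then obtain \<phi> :: "'m \<Rightarrow> 'k" where "bij_betw \<phi> (Hom C ?S ?S) UNIV" and one: "\<phi> (\<I> ?S) = 1"
  and scal: "\<And>c f. f \<in> Hom C ?S ?S \<Longrightarrow> \<phi> (scal C c f) = c * \<phi> f"
  unfolding simple_obj_def by blast
 then have inj: "inj_on \<phi> (Hom C ?S ?S)" by (auto simp: bij_betw_def)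
 have i: "arr ?S ?S (\<I> ?S)" by (rule arr_id[OF smp_obj[OF j]])
 then have "\<phi> f = \<phi> (scal C (\<phi> f) (\<I> ?S))" using scal[of "\<I> ?S" "\<phi> f"] one by (simp add: arr_def)
 then have "f = scal C (\<phi> f) (\<I> ?S)"
  using inj f arr_scal[OF i, of "\<phi> f"] by (auto simp: inj_on_def arr_def)
 then show ?thesis ..
qed

lemma smp_id_nonzero: "j \<in> J \<Longrightarrow> \<I> (smp C j) \<noteq> 0"
proof
 assume j: "j \<in> J" and z: "\<I> (smp C j) = 0"
 let ?S = "smp C j"
 have "simple_obj C ?S" using semisimple j by (simp add: finitely_split_semisimple_def)
 then obtain \<phi> :: "'m \<Rightarrow> 'k" where one: "\<phi> (\<I> ?S) = 1"
  and scal: "\<And>c f. f \<in> Hom C ?S ?S \<Longrightarrow> \<phi> (scal C c f) = c * \<phi> f"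
  unfolding simple_obj_def by blast
 have "\<phi> (scal C 0 (\<I> ?S)) = 0 * \<phi> (\<I> ?S)"
  by (rule scal) (rule id_in_hom[OF smp_obj[OF j]])
 then show False using one z by simp
qed

lemma smp_Hom_zero: "\<lbrakk>j \<in> J; l \<in> J; j \<noteq> l; arr (smp C j) (smp C l) f\<rbrakk> \<Longrightarrow> f = 0"
 using semisimple by (auto simp: finitely_split_semisimple_def arr_def)

text \<open>By Schur's lemma only the component of \<open>g\<close> in the summand of index
  \<open>j\<close> survives, and it is a scalar.\<close>

lemma arr_smp_V:
 assumes j: "j \<in> J" and g: "arr (smp C j) V g"
 shows "\<exists>c. g = scal C c (vinj C j)"
proof -
 have a: "arr (smp C j) (smp C l) (vprj C l \<cdot> g)" if "l \<in> J" for l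
  by (rule arr_comp[OF g arr_vprj[OF that]])
 obtain c where c: "vprj C j \<cdot> g = scal C c (\<I> (smp C j))" using smp_End[OF j a[OF j]] by auto
 have "g = \<I> V \<cdot> g" using g by (simp add: cmp_id_left)
 also have "\<dots> = (\<Sum>l\<in>J. lam C l \<cdot> g)"
  unfolding id_V by (rule cmp_sum_left[OF g V_obj]) (auto simp: lam_def intro: arr_comp arr_vprj arr_vinj)
 also have "\<dots> = (\<Sum>l\<in>J. vinj C l \<cdot> (vprj C l \<cdot> g))"
  by (intro sum.cong refl) (simp add: lam_def cmp_assoc[OF g arr_vprj arr_vinj])
 also have "\<dots> = (\<Sum>l\<in>J. if l = j then vinj C j \<cdot> (vprj C j \<cdot> g) else 0)"
  by (intro sum.cong refl) (use smp_Hom_zero[OF j _ _ a] cmp_zero_right[OF arr_vinj smp_obj[OF j]] in auto)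
 also have "\<dots> = scal C c (vinj C j)"
  using j cmp_scal_right[OF arr_id[OF smp_obj[OF j]] arr_vinj[OF j], of c]
  by (simp add: c cmp_id_right[OF arr_vinj])
 finally show ?thesis by blast
qed

lemma arr_lam: "j \<in> J \<Longrightarrow> arr V V (lam C j)"
 unfolding lam_def by (rule arr_comp[OF arr_vprj arr_vinj])

lemma lam_mult: "j \<in> J \<Longrightarrow> l \<in> J \<Longrightarrow> lam C j \<cdot> lam C l = (if j = l then lam C j else 0)"
proof -
 assume j: "j \<in> J" and l: "l \<in> J"
 have "lam C j \<cdot> lam C l = vinj C j \<cdot> (vprj C j \<cdot> (vinj C l \<cdot> vprj C l))"
  unfolding lam_def by (rule cmp_assoc[OF arr_comp[OF arr_vprj arr_vinj] arr_vprj arr_vinj]) (fact l l j j)+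
 also have "vprj C j \<cdot> (vinj C l \<cdot> vprj C l) = (if j = l then \<I> (smp C j) else 0) \<cdot> vprj C l"
  by (rule cmp_eq[OF arr_vprj arr_vinj arr_vprj vprj_vinj]) (fact l l j j l)+
 finally show ?thesis
  using j l cmp_zero_left[OF arr_vprj smp_obj] cmp_zero_right[OF arr_vinj V_obj]
  by (auto simp: lam_def cmp_id_left[OF arr_vprj])
qed

lemma lam_nonzero: "j \<in> J \<Longrightarrow> lam C j \<noteq> 0"
proof
 assume j: "j \<in> J" and z: "lam C j = 0"
 have "vprj C j \<cdot> (vinj C j \<cdot> vprj C j) = \<I> (smp C j) \<cdot> vprj C j"
  by (rule cmp_eq[OF arr_vprj arr_vinj arr_vprj]) (use j vprj_vinj in auto)
 then have "vprj C j = 0"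
  using z j cmp_zero_right[OF arr_vprj V_obj] by (simp add: lam_def cmp_id_left[OF arr_vprj])
 then show False using vprj_vinj[OF j j] cmp_zero_left[OF arr_vinj[OF j] smp_obj[OF j]] smp_id_nonzero[OF j]
  by simp
qed

lemma inj_lam: "inj_on (lam C) J"
 unfolding inj_on_def using lam_mult lam_nonzero by metis

lemma sum_lam_mult:
 assumes j: "j \<in> J"
 shows "(\<Sum>l\<in>J. scal C (c l) (lam C l)) \<cdot> lam C j = scal C (c j) (lam C j)"
  and "lam C j \<cdot> (\<Sum>l\<in>J. scal C (c l) (lam C l)) = scal C (c j) (lam C j)"
proof -
 have "(\<Sum>l\<in>J. scal C (c l) (lam C l)) \<cdot> lam C j = (\<Sum>l\<in>J. scal C (c l) (lam C l) \<cdot> lam C j)"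
  by (rule cmp_sum_left[OF arr_lam[OF j] V_obj]) (intro arr_scal arr_lam)
 also have "\<dots> = (\<Sum>l\<in>J. if l = j then scal C (c j) (lam C j) else 0)"
  by (intro sum.cong refl) (simp add: cmp_scal_left[OF arr_lam[OF j] arr_lam] lam_mult j)
 finally show "(\<Sum>l\<in>J. scal C (c l) (lam C l)) \<cdot> lam C j = scal C (c j) (lam C j)" using j by simp
 have "lam C j \<cdot> (\<Sum>l\<in>J. scal C (c l) (lam C l)) = (\<Sum>l\<in>J. lam C j \<cdot> scal C (c l) (lam C l))"
  by (rule cmp_sum_right[OF arr_lam[OF j] V_obj]) (intro arr_scal arr_lam)
 also have "\<dots> = (\<Sum>l\<in>J. if l = j then scal C (c j) (lam C j) else 0)"
  by (intro sum.cong refl) (auto simp add: cmp_scal_right[OF arr_lam arr_lam[OF j]] lam_mult j)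
 finally show "lam C j \<cdot> (\<Sum>l\<in>J. scal C (c l) (lam C l)) = scal C (c j) (lam C j)" using j by simp
qed

lemma End_V:
 assumes r: "arr V V r"
 shows "\<exists>c. r = (\<Sum>j\<in>J. scal C (c j) (lam C j))"
proof -
 have "\<forall>j\<in>J. \<exists>c. r \<cdot> vinj C j = scal C c (vinj C j)"
  using arr_smp_V arr_comp[OF arr_vinj r] by blast
 then obtain c where c: "\<And>j. j \<in> J \<Longrightarrow> r \<cdot> vinj C j = scal C (c j) (vinj C j)" by metis
 have "r = r \<cdot> \<I> V" using r by (simp add: cmp_id_right)
 also have "\<dots> = (\<Sum>j\<in>J. r \<cdot> lam C j)"
  unfolding id_V by (rule cmp_sum_right[OF r V_obj arr_lam])
 also have "\<dots> = (\<Sum>j\<in>J. scal C (c j) (lam C j))"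
 proof (intro sum.cong refl)
  fix j assume j: "j \<in> J"
  have "r \<cdot> lam C j = scal C (c j) (vinj C j) \<cdot> vprj C j"
   unfolding lam_def by (rule cmp_eq[OF arr_vprj[OF j] arr_vinj[OF j] r c[OF j]])
  then show "r \<cdot> lam C j = scal C (c j) (lam C j)"
   by (simp add: lam_def cmp_scal_left[OF arr_vprj[OF j] arr_vinj[OF j]])
 qed
 finally show ?thesis by blast
qed

lemma lam_independent: "independent (lam C ` J)"
proof
 assume "dependent (lam C ` J)"
 then obtain u where u: "\<exists>v\<in>lam C ` J. u v \<noteq> 0" "(\<Sum>v\<in>lam C ` J. scal C (u v) v) = 0"
  by (auto simp: dependent_finite)
 then obtain j where j: "j \<in> J" "u (lam C j) \<noteq> 0" by auto
 have "(\<Sum>l\<in>J. scal C (u (lam C l)) (lam C l)) = 0"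
  using u(2) by (simp add: sum.reindex[OF inj_lam])
 with sum_lam_mult(1)[OF j(1), of "\<lambda>l. u (lam C l)"] have "scal C (u (lam C j)) (lam C j) = 0"
  by (simp add: cmp_zero_left[OF arr_lam[OF j(1)] V_obj])
 then show False using j lam_nonzero[OF j(1)] by simp
qed

lemma End_V_span: "arr V V r \<Longrightarrow> r \<in> span (lam C ` J)"
 using End_V[of r] by (auto simp del: image_eqI intro!: span_sum span_scale span_base[OF imageI])

lemma eps_add: "arr V V r \<Longrightarrow> arr V V s \<Longrightarrow> eps_R C (r + s) = eps_R C r + eps_R C s"
 by (simp add: eps_R_def representation_add[OF lam_independent] End_V_span sum.distrib)

lemma eps_scal: "arr V V r \<Longrightarrow> eps_R C (scal C c r) = c * eps_R C r"
 by (simp add: eps_R_def representation_scale[OF lam_independent] End_V_span sum_distrib_left)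

lemma eps_zero: "eps_R C 0 = 0"
 by (simp add: eps_R_def representation_zero)

lemma eps_sum: "(\<And>a. a \<in> A \<Longrightarrow> arr V V (r a)) \<Longrightarrow> eps_R C (\<Sum>a\<in>A. r a) = (\<Sum>a\<in>A. eps_R C (r a))"
 by (induction A rule: infinite_finite_induct) (simp_all add: eps_zero eps_add arr_sum V_obj)

lemma eps_lam: "j \<in> J \<Longrightarrow> eps_R C (lam C j) = 1"
 using inj_lam
 by (simp add: eps_R_def representation_basis[OF lam_independent] inj_on_eq_iff sum.delta cong: if_cong)

text \<open>The \<open>lam C j\<close> are orthogonal idempotents on which \<open>eps_R\<close> is
  1, so the coefficient of an element of R is read off after multiplication by the idempotent. An
  element of R is thus recovered from values of \<open>eps_R\<close>, and the pairing loses nothing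
  although it is scalar-valued.\<close>

lemma End_V_expand:
 assumes r: "arr V V r"
 shows "r = (\<Sum>j\<in>J. scal C (eps_R C (r \<cdot> lam C j)) (lam C j))"
proof -
 obtain c where c: "r = (\<Sum>j\<in>J. scal C (c j) (lam C j))" using End_V[OF r] by auto
 then have "eps_R C (r \<cdot> lam C j) = c j" if "j \<in> J" for j
  using that by (simp add: sum_lam_mult eps_scal arr_lam eps_lam)
 then show ?thesis using c by (metis (mono_tags, lifting) sum.cong)
qed

lemma End_V_lam_commute: "arr V V r \<Longrightarrow> j \<in> J \<Longrightarrow> lam C j \<cdot> r = r \<cdot> lam C j"
 using End_V[of r] by (auto simp: sum_lam_mult)

section \<open>The pairing: bilinearity and perfectness\<close>

lemma pairing_add_left:
 "\<lbrakk>arr Z V \<theta>; arr Z V \<theta>'; arr V Z v\<rbrakk> \<Longrightarrow> pairing C (\<theta> + \<theta>') v = pairing C \<theta> v + pairing C \<theta>' v"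
 by (simp add: pairing_def cmp_add_left eps_add arr_comp)

lemma pairing_add_right:
 "\<lbrakk>arr Z V \<theta>; arr V Z v; arr V Z v'\<rbrakk> \<Longrightarrow> pairing C \<theta> (v + v') = pairing C \<theta> v + pairing C \<theta> v'"
 by (simp add: pairing_def cmp_add_right eps_add arr_comp)

lemma pairing_scal_left: "arr Z V \<theta> \<Longrightarrow> arr V Z v \<Longrightarrow> pairing C (scal C c \<theta>) v = c * pairing C \<theta> v"
 by (simp add: pairing_def cmp_scal_left eps_scal arr_comp)

lemma pairing_scal_right: "arr Z V \<theta> \<Longrightarrow> arr V Z v \<Longrightarrow> pairing C \<theta> (scal C c v) = c * pairing C \<theta> v"
 by (simp add: pairing_def cmp_scal_right eps_scal arr_comp)

lemma pairing_sum_left: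
 assumes "arr V Z v" "\<And>a. a \<in> A \<Longrightarrow> arr Z V (\<theta> a)"
 shows "pairing C (\<Sum>a\<in>A. \<theta> a) v = (\<Sum>a\<in>A. pairing C (\<theta> a) v)"
 using assms by (simp add: pairing_def cmp_sum_left[OF assms(1) V_obj] eps_sum arr_comp)

lemma pairing_sum_right:
 assumes "arr Z V \<theta>" "\<And>a. a \<in> A \<Longrightarrow> arr V Z (v a)"
 shows "pairing C \<theta> (\<Sum>a\<in>A. v a) = (\<Sum>a\<in>A. pairing C \<theta> (v a))"
 using eps_sum[of A "\<lambda>a. \<theta> \<cdot> v a", OF arr_comp[OF assms(2) assms(1)]]
 by (simp add: pairing_def cmp_sum_right[OF assms(1) V_obj assms(2)])

lemma pairing_zero_right: "arr Z V \<theta> \<Longrightarrow> pairing C \<theta> 0 = 0"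
 by (simp add: pairing_def cmp_zero_right[OF _ V_obj] eps_zero)

lemma pairing_zero_left: "arr V Z v \<Longrightarrow> pairing C 0 v = 0"
 by (simp add: pairing_def cmp_zero_left[OF _ V_obj] eps_zero)

lemma pairing_comp: "\<lbrakk>arr V Z v; arr Z Z' f; arr Z' V \<theta>\<rbrakk> \<Longrightarrow> pairing C (\<theta> \<cdot> f) v = pairing C \<theta> (f \<cdot> v)"
 by (simp add: pairing_def cmp_assoc)

text \<open>Each simple summand of \<open>Z\<close> is a retract of \<open>V\<close>, so the
  identity of \<open>Z\<close> factors through finitely many copies of \<open>V\<close>. Such
  factorizations take the place of dimension counts in the proof that the pairing is
  perfect.\<close>

lemma V_factor:
 assumes Z: "Z \<in> obj C"
 shows "\<exists>n v \<theta>. (\<forall>a<n. arr V Z (v a) \<and> arr Z V (\<theta> a)) \<and> \<I> Z = (\<Sum>a<(n::nat). v a \<cdot> \<theta> a)"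
proof -
 obtain js where js: "set js \<subseteq> J" "is_direct_sum C (map (smp C) js) Z"
  using semisimple Z by (auto simp: finitely_split_semisimple_def)
 let ?n = "length js"
 obtain i p where ip: "direct_sum C {..<?n} (\<lambda>a. map (smp C) js ! a) Z i p"
  using js(2) by (auto simp: is_direct_sum_def)
 have jJ: "js ! a \<in> J" if "a < ?n" for a using js(1) that by auto
 have i: "arr (smp C (js ! a)) Z (i a)" and p: "arr Z (smp C (js ! a)) (p a)" if "a < ?n" for a
  using ip that Z smp_obj[OF jJ[OF that]] by (auto simp: direct_sum_def arr_def)
 let ?v = "\<lambda>a. i a \<cdot> vprj C (js ! a)" and ?\<theta> = "\<lambda>a. vinj C (js ! a) \<cdot> p a"
 have "?v a \<cdot> ?\<theta> a = i a \<cdot> p a" if a: "a < ?n" for a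
 proof -
  note t = i[OF a] p[OF a] arr_vinj[OF jJ[OF a]] arr_vprj[OF jJ[OF a]]
  have "?v a \<cdot> ?\<theta> a = i a \<cdot> (vprj C (js ! a) \<cdot> ?\<theta> a)" by (rule cmp_assoc) (rule t arr_comp)+
  also have "vprj C (js ! a) \<cdot> ?\<theta> a = \<I> (smp C (js ! a)) \<cdot> p a"
   by (rule cmp_eq[OF t(2-4)]) (simp add: vprj_vinj jJ a)
  finally show ?thesis by (simp add: cmp_id_left[OF t(2)])
 qed
 then have "\<I> Z = (\<Sum>a<?n. ?v a \<cdot> ?\<theta> a)" using ip by (simp add: direct_sum_def)
 moreover have "\<forall>a<?n. arr V Z (?v a) \<and> arr Z V (?\<theta> a)"
  using i p arr_vinj arr_vprj jJ by (blast intro: arr_comp)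
 ultimately show ?thesis
  by (intro exI[of _ ?n] exI[of _ ?v] exI[of _ ?\<theta>] conjI)
qed

lemma V_factor_left:
 assumes I: "\<I> Z = (\<Sum>a<(n::nat). v a \<cdot> \<theta> a)" and a: "\<And>a. a < n \<Longrightarrow> arr V Z (v a) \<and> arr Z V (\<theta> a)"
  and f: "arr X Z f"
 shows "f = (\<Sum>a<n. v a \<cdot> (\<theta> a \<cdot> f))"
proof -
 have Z: "Z \<in> obj C" using f by (simp add: arr_def)
 have "f = \<I> Z \<cdot> f" using f by (simp add: cmp_id_left)
 also have "\<dots> = (\<Sum>a<n. (v a \<cdot> \<theta> a) \<cdot> f)"
  unfolding I by (rule cmp_sum_left[OF f Z]) (use a arr_comp in blast)
 also have "\<dots> = (\<Sum>a<n. v a \<cdot> (\<theta> a \<cdot> f))"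
  using a by (intro sum.cong refl cmp_assoc[OF f]) auto
 finally show ?thesis .
qed

lemma V_factor_right:
 assumes I: "\<I> Z = (\<Sum>a<(n::nat). v a \<cdot> \<theta> a)" and a: "\<And>a. a < n \<Longrightarrow> arr V Z (v a) \<and> arr Z V (\<theta> a)"
  and f: "arr Z X f"
 shows "f = (\<Sum>a<n. (f \<cdot> v a) \<cdot> \<theta> a)"
proof -
 have Z: "Z \<in> obj C" using f by (simp add: arr_def)
 have "f = f \<cdot> \<I> Z" using f by (simp add: cmp_id_right)
 also have "\<dots> = (\<Sum>a<n. f \<cdot> (v a \<cdot> \<theta> a))"
  unfolding I by (rule cmp_sum_right[OF f Z]) (use a arr_comp in blast)
 also have "\<dots> = (\<Sum>a<n. (f \<cdot> v a) \<cdot> \<theta> a)"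
 proof (intro sum.cong refl)
  fix b assume "b \<in> {..<n}"
  then have "arr V Z (v b)" "arr Z V (\<theta> b)" using a by auto
  then show "f \<cdot> (v b \<cdot> \<theta> b) = (f \<cdot> v b) \<cdot> \<theta> b" using cmp_assoc[OF _ _ f] by simp
 qed
 finally show ?thesis .
qed

text \<open>The elements \<open>\<theta> \<cdot> v a\<close> of R are determined by pairing
  \<open>\<theta>\<close> with the vectors \<open>v a \<cdot> lam C j\<close>, and they determine
  \<open>\<theta>\<close> because the identity of \<open>Z\<close> is the sum of the
  \<open>v a \<cdot> \<eta> a\<close>.\<close>

lemma pairing_nondegenerate:
 assumes \<theta>: "arr Z V \<theta>" and \<theta>': "arr Z V \<theta>'"
  and eq: "\<And>v. arr V Z v \<Longrightarrow> pairing C \<theta> v = pairing C \<theta>' v"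
 shows "\<theta> = \<theta>'"
proof -
 have Z: "Z \<in> obj C" using \<theta> by (simp add: arr_def)
 obtain n v \<eta> where *: "\<And>a. a < n \<Longrightarrow> arr V Z (v a) \<and> arr Z V (\<eta> a)" "\<I> Z = (\<Sum>a<(n::nat). v a \<cdot> \<eta> a)"
  using V_factor[OF Z] by blast
 have "\<theta> \<cdot> v a = \<theta>' \<cdot> v a" if a: "a < n" for a
 proof -
  have v: "arr V Z (v a)" using * a by auto
  have "eps_R C ((\<theta> \<cdot> v a) \<cdot> lam C j) = eps_R C ((\<theta>' \<cdot> v a) \<cdot> lam C j)" if j: "j \<in> J" for j
   using eq[OF arr_comp[OF arr_lam[OF j] v]]
   by (simp add: pairing_def cmp_assoc[OF arr_lam[OF j] v \<theta>] cmp_assoc[OF arr_lam[OF j] v \<theta>'])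
  then show ?thesis
   using End_V_expand[OF arr_comp[OF v \<theta>]] End_V_expand[OF arr_comp[OF v \<theta>']]
   by (metis (mono_tags, lifting) sum.cong)
 qed
 then have "(\<Sum>a<n. (\<theta> \<cdot> v a) \<cdot> \<eta> a) = (\<Sum>a<n. (\<theta>' \<cdot> v a) \<cdot> \<eta> a)" by simp
 from trans[OF V_factor_right[OF *(2,1) \<theta>] trans[OF this V_factor_right[OF *(2,1) \<theta>', symmetric]]]
 show ?thesis .
qed

text \<open>The other half of perfectness, with an explicit representing covector. It is the source
  of all dual bases below.\<close>

lemma pairing_represents:
 assumes Z: "Z \<in> obj C"
  and add: "\<And>v w. arr V Z v \<Longrightarrow> arr V Z w \<Longrightarrow> c (v + w) = c v + c w"
  and scal: "\<And>v a. arr V Z v \<Longrightarrow> c (scal C a v) = a * (c v :: 'k)"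
 shows "\<exists>\<theta>. arr Z V \<theta> \<and> (\<forall>v. arr V Z v \<longrightarrow> pairing C \<theta> v = c v)"
proof -
 obtain n v \<eta> where *: "\<And>a. a < n \<Longrightarrow> arr V Z (v a) \<and> arr Z V (\<eta> a)" "\<I> Z = (\<Sum>a<(n::nat). v a \<cdot> \<eta> a)"
  using V_factor[OF Z] by blast
 have c0: "c 0 = 0" using scal[OF arr_zero[OF V_obj Z], of 0] by simp
 have csum: "c (\<Sum>a\<in>A. f a) = (\<Sum>a\<in>A. c (f a))" if "\<And>a. a \<in> A \<Longrightarrow> arr V Z (f a)" for f and A :: "'b set"
  using that by (induction A rule: infinite_finite_induct) (simp_all add: c0 add arr_sum V_obj Z)
 \<comment> \<open>Forced by the expansion of \<open>w\<close> as the sum of the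
   \<open>v a \<cdot> (\<eta> a \<cdot> w)\<close>: the coefficients of
   \<open>\<eta> a \<cdot> w\<close> in R are values of \<open>eps_R\<close> after multiplication by
   \<open>lam C j\<close>, and since R is commutative this factor may stand on the left, where it
   becomes part of the covector.\<close>
 define \<theta> where "\<theta> = (\<Sum>a<n. \<Sum>j\<in>J. scal C (c (v a \<cdot> lam C j)) (lam C j \<cdot> \<eta> a))"
 have t: "arr Z V (scal C x (lam C j \<cdot> \<eta> a))" if "a < n" "j \<in> J" for a j x
  using *(1)[OF that(1)] arr_lam[OF that(2)] by (blast intro: arr_scal arr_comp)
 have "arr Z V \<theta>" unfolding \<theta>_def by (intro arr_sum Z V_obj t) auto
 moreover have "pairing C \<theta> w = c w" if w: "arr V Z w" for w
 proof -
  have "pairing C \<theta> w = (\<Sum>a<n. \<Sum>j\<in>J. pairing C (scal C (c (v a \<cdot> lam C j)) (lam C j \<cdot> \<eta> a)) w)"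
   unfolding \<theta>_def using w t by (subst pairing_sum_left[OF w]) (auto intro!: arr_sum Z V_obj t sum.cong pairing_sum_left)
  also have "\<dots> = (\<Sum>a<n. c (v a \<cdot> (\<eta> a \<cdot> w)))"
  proof (intro sum.cong refl)
   fix a assume "a \<in> {..<n}"
   then have a: "arr V Z (v a)" "arr Z V (\<eta> a)" using * by auto
   let ?r = "\<eta> a \<cdot> w"
   have r: "arr V V ?r" by (rule arr_comp[OF w a(2)])
   have "pairing C (scal C (c (v a \<cdot> lam C j)) (lam C j \<cdot> \<eta> a)) w = c (scal C (eps_R C (?r \<cdot> lam C j)) (v a \<cdot> lam C j))"
    if j: "j \<in> J" for j
    using End_V_lam_commute[OF r j] arr_comp[OF a(2) arr_lam[OF j]] arr_comp[OF arr_lam[OF j] a(1)] w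
    by (simp add: pairing_scal_left scal) (simp add: pairing_def cmp_assoc[OF w a(2) arr_lam[OF j]])
   then have "(\<Sum>j\<in>J. pairing C (scal C (c (v a \<cdot> lam C j)) (lam C j \<cdot> \<eta> a)) w) =
     (\<Sum>j\<in>J. c (scal C (eps_R C (?r \<cdot> lam C j)) (v a \<cdot> lam C j)))" by simp
   also have "\<dots> = c (\<Sum>j\<in>J. v a \<cdot> scal C (eps_R C (?r \<cdot> lam C j)) (lam C j))"
    using arr_comp[OF arr_lam a(1)] by (subst csum) (auto simp: cmp_scal_right[OF arr_lam a(1)] intro: arr_scal)
   also have "(\<Sum>j\<in>J. v a \<cdot> scal C (eps_R C (?r \<cdot> lam C j)) (lam C j)) = v a \<cdot> ?r"
    by (subst (2) End_V_expand[OF r]) (rule cmp_sum_right[OF a(1) V_obj, symmetric], intro arr_scal arr_lam)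
   finally show "(\<Sum>j\<in>J. pairing C (scal C (c (v a \<cdot> lam C j)) (lam C j \<cdot> \<eta> a)) w) = c (v a \<cdot> ?r)" .
  qed
  also have "\<dots> = c (\<Sum>a<n. v a \<cdot> (\<eta> a \<cdot> w))"
   by (rule csum[symmetric]) (use * w in \<open>blast intro: arr_comp\<close>)
  finally show ?thesis using V_factor_left[OF *(2,1) w] by simp
 qed
 ultimately show ?thesis by blast
qed

subsection \<open>Dual bases\<close>

lemma omega_iff: "X \<in> obj C \<Longrightarrow> v \<in> omega C X \<longleftrightarrow> arr V (V \<boxtimes> X) v"
 by (simp add: omega_def arr_def V_obj tobj_closed)

lemma omega_dual_iff: "X \<in> obj C \<Longrightarrow> \<theta> \<in> omega_dual C X \<longleftrightarrow> arr (V \<boxtimes> X) V \<theta>"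
 by (simp add: omega_dual_def arr_def V_obj tobj_closed)

text \<open>Indexed families are used instead of sets of vectors, since edges and paths serve as
  indices. Only the expansion of vectors is required; that of covectors follows from
  non-degeneracy.\<close>

definition dual_bases :: "'o \<Rightarrow> 'b set \<Rightarrow> ('b \<Rightarrow> 'm) \<Rightarrow> ('b \<Rightarrow> 'm) \<Rightarrow> bool" where
 "dual_bases X K e d \<longleftrightarrow> finite K \<and> X \<in> obj C \<and>
   (\<forall>k\<in>K. arr V (V \<boxtimes> X) (e k) \<and> arr (V \<boxtimes> X) V (d k)) \<and>
   (\<forall>k\<in>K. \<forall>l\<in>K. pairing C (d k) (e l) = (if k = l then 1 else 0)) \<and>
   (\<forall>v. arr V (V \<boxtimes> X) v \<longrightarrow> v = (\<Sum>k\<in>K. scal C (pairing C (d k) v) (e k)))"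

lemma dual_basesD:
 assumes "dual_bases X K e d"
 shows "finite K" "X \<in> obj C" "\<And>k. k \<in> K \<Longrightarrow> arr V (V \<boxtimes> X) (e k)" "\<And>k. k \<in> K \<Longrightarrow> arr (V \<boxtimes> X) V (d k)"
  "\<And>k l. k \<in> K \<Longrightarrow> l \<in> K \<Longrightarrow> pairing C (d k) (e l) = (if k = l then 1 else 0)"
  "\<And>v. arr V (V \<boxtimes> X) v \<Longrightarrow> v = (\<Sum>k\<in>K. scal C (pairing C (d k) v) (e k))"
 using assms unfolding dual_bases_def by blast+

lemma dual_bases_pairing:
 assumes db: "dual_bases X K e d" and \<theta>: "arr (V \<boxtimes> X) V \<theta>" and v: "arr V (V \<boxtimes> X) v"
 shows "pairing C \<theta> v = (\<Sum>k\<in>K. pairing C \<theta> (e k) * pairing C (d k) v)"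
proof -
 note D = dual_basesD[OF db]
 have "pairing C \<theta> v = pairing C \<theta> (\<Sum>k\<in>K. scal C (pairing C (d k) v) (e k))" using D(6)[OF v] by simp
 also have "\<dots> = (\<Sum>k\<in>K. pairing C \<theta> (scal C (pairing C (d k) v) (e k)))"
  by (rule pairing_sum_right[OF \<theta>]) (intro arr_scal D(3))
 finally show ?thesis using D(3) by (simp add: pairing_scal_right[OF \<theta>] mult.commute)
qed

lemma dual_bases_covector:
 assumes db: "dual_bases X K e d" and \<theta>: "arr (V \<boxtimes> X) V \<theta>"
 shows "\<theta> = (\<Sum>k\<in>K. scal C (pairing C \<theta> (e k)) (d k))"
proof -
 note D = dual_basesD[OF db]
 have o: "V \<boxtimes> X \<in> obj C" by (rule tobj_closed[OF V_obj D(2)])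
 show ?thesis
 proof (rule pairing_nondegenerate[OF \<theta>])
  show "arr (V \<boxtimes> X) V (\<Sum>k\<in>K. scal C (pairing C \<theta> (e k)) (d k))"
   by (intro arr_sum o V_obj arr_scal D(4))
  fix v assume v: "arr V (V \<boxtimes> X) v"
  show "pairing C \<theta> v = pairing C (\<Sum>k\<in>K. scal C (pairing C \<theta> (e k)) (d k)) v"
   unfolding dual_bases_pairing[OF db \<theta> v]
   using D(4) by (subst pairing_sum_left[OF v]) (auto intro: arr_scal simp: pairing_scal_left[OF _ v])
 qed
qed

lemma dual_bases_eqI:
 assumes db: "dual_bases X K e d" and \<theta>: "arr (V \<boxtimes> X) V \<theta>" and \<eta>: "arr (V \<boxtimes> X) V \<eta>"
  and eq: "\<And>k. k \<in> K \<Longrightarrow> pairing C \<theta> (e k) = pairing C \<eta> (e k)"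
 shows "\<theta> = \<eta>"
proof -
 have "(\<Sum>k\<in>K. scal C (pairing C \<theta> (e k)) (d k)) = (\<Sum>k\<in>K. scal C (pairing C \<eta> (e k)) (d k))"
  using eq by simp
 from trans[OF dual_bases_covector[OF db \<theta>] trans[OF this dual_bases_covector[OF db \<eta>, symmetric]]]
 show ?thesis .
qed

lemma dual_vec_eq:
 assumes db: "dual_bases X K e d" and k: "k \<in> K"
 shows "dual_vec C X e K k = d k"
 unfolding dual_vec_def omega_dual_iff[OF dual_basesD(2)[OF db]]
proof (rule the_equality)
 show "arr (V \<boxtimes> X) V (d k) \<and> (\<forall>l\<in>K. pairing C (d k) (e l) = (if l = k then 1 else 0))"
  using dual_basesD(4,5)[OF db] k by auto
 fix \<theta> assume "arr (V \<boxtimes> X) V \<theta> \<and> (\<forall>l\<in>K. pairing C \<theta> (e l) = (if l = k then 1 else 0))"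
 then show "\<theta> = d k" using dual_basesD(4,5)[OF db] k by (intro dual_bases_eqI[OF db]) auto
qed

lemma dual_bases_dual_vec:
 assumes db: "dual_bases X K e d"
 shows "dual_bases X K e (dual_vec C X e K)"
 using db unfolding dual_bases_def by (simp add: dual_vec_eq[OF db] cong: sum.cong)

text \<open>It is enough to give linear coordinate functions \<open>c\<close>: the covectors
  representing them exist by \<open>pairing_represents\<close>, and by uniqueness they are the
  values of \<open>dual_vec\<close>.\<close>

lemma dual_basesI:
 assumes K: "finite K" and X: "X \<in> obj C" and e: "\<And>k. k \<in> K \<Longrightarrow> arr V (V \<boxtimes> X) (e k)"
  and add: "\<And>k v w. \<lbrakk>k \<in> K; arr V (V \<boxtimes> X) v; arr V (V \<boxtimes> X) w\<rbrakk> \<Longrightarrow> c k (v + w) = c k v + c k w"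
  and scal: "\<And>k v a. k \<in> K \<Longrightarrow> arr V (V \<boxtimes> X) v \<Longrightarrow> c k (scal C a v) = a * (c k v :: 'k)"
  and c: "\<And>k l. k \<in> K \<Longrightarrow> l \<in> K \<Longrightarrow> c k (e l) = (if k = l then 1 else 0)"
  and span: "\<And>v. arr V (V \<boxtimes> X) v \<Longrightarrow> v = (\<Sum>k\<in>K. scal C (c k v) (e k))"
 shows "dual_bases X K e (dual_vec C X e K)"
proof -
 have o: "V \<boxtimes> X \<in> obj C" by (rule tobj_closed[OF V_obj X])
 have "\<forall>k\<in>K. \<exists>\<theta>. arr (V \<boxtimes> X) V \<theta> \<and> (\<forall>v. arr V (V \<boxtimes> X) v \<longrightarrow> pairing C \<theta> v = c k v)"
  using pairing_represents[OF o] add scal by blast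
 then obtain d where d: "\<And>k. k \<in> K \<Longrightarrow> arr (V \<boxtimes> X) V (d k)"
  "\<And>k v. k \<in> K \<Longrightarrow> arr V (V \<boxtimes> X) v \<Longrightarrow> pairing C (d k) v = c k v" by metis
 have "v = (\<Sum>k\<in>K. scal C (pairing C (d k) v) (e k))" if "arr V (V \<boxtimes> X) v" for v
 proof -
  have "(\<Sum>k\<in>K. scal C (c k v) (e k)) = (\<Sum>k\<in>K. scal C (pairing C (d k) v) (e k))"
   using d(2)[OF _ that] by simp
  with span[OF that] show ?thesis by (rule trans)
 qed
 then have "dual_bases X K e d"
  unfolding dual_bases_def using K X e d c by auto
 then show ?thesis by (rule dual_bases_dual_vec)
qed

lemma dual_bases_inj:
 assumes db: "dual_bases X K e d"
 shows "inj_on e K"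
 using dual_basesD(5)[OF db] by (metis inj_onI zero_neq_one)

text \<open>Connects coefficients with respect to a set of vectors, in terms of which
  \<open>matrix_elem\<close> is defined, with values of the pairing.\<close>

lemma dual_bases_representation:
 assumes db: "dual_bases X K e d" and v: "arr V (V \<boxtimes> X) v" and k: "k \<in> K"
 shows "representation (e ` K) v (e k) = pairing C (d k) v"
proof -
 note D = dual_basesD[OF db]
 note inj = dual_bases_inj[OF db]
 have ind: "independent (e ` K)"
 proof
  assume "dependent (e ` K)"
  then obtain u where u: "\<exists>v\<in>e ` K. u v \<noteq> 0" "(\<Sum>v\<in>e ` K. scal C (u v) v) = 0"
   using D(1) by (auto simp: dependent_finite)
  then obtain k where k: "k \<in> K" "u (e k) \<noteq> 0" by auto
  have "(\<Sum>l\<in>K. scal C (u (e l)) (e l)) = 0" using u(2) by (simp add: sum.reindex[OF inj])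
  then have "0 = pairing C (d k) (\<Sum>l\<in>K. scal C (u (e l)) (e l))"
   using pairing_zero_right[OF D(4)[OF k(1)]] by simp
  also have "\<dots> = (\<Sum>l\<in>K. if k = l then u (e k) else 0)"
   using D(3) by (subst pairing_sum_right[OF D(4)[OF k(1)]])
    (auto intro!: arr_scal sum.cong simp: pairing_scal_right[OF D(4)[OF k(1)]] D(5)[OF k(1)])
  finally show False using k D(1) by simp
 qed
 let ?f = "\<lambda>b. if b \<in> e ` K then pairing C (d (the_inv_into K e b)) v else 0"
 have f: "?f (e l) = pairing C (d l) v" if "l \<in> K" for l
  using that inj by (simp add: the_inv_into_f_f)
 have "representation (e ` K) v = ?f"
 proof (rule representation_eqI[OF ind])
  show "v \<in> span (e ` K)"
   using D(6)[OF v] by (metis (no_types, lifting) imageI span_base span_scale span_sum)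
  show "finite {b. ?f b \<noteq> 0}" by (rule finite_subset[of _ "e ` K"]) (use D(1) in auto)
  have "(\<Sum>b | ?f b \<noteq> 0. scal C (?f b) b) = (\<Sum>b\<in>e ` K. scal C (?f b) b)"
   using D(1) by (intro sum.mono_neutral_left) auto
  also have "\<dots> = (\<Sum>l\<in>K. scal C (pairing C (d l) v) (e l))"
   by (subst sum.reindex[OF inj]) (auto intro!: sum.cong simp: the_inv_into_f_f[OF inj])
  finally show "(\<Sum>b | ?f b \<noteq> 0. scal C (?f b) b) = v" using D(6)[OF v] by simp
 qed (auto split: if_splits)
 then show ?thesis using f[OF k] by simp
qed

lemma basis_finite:
 assumes "X \<in> obj C" "Y \<in> obj C" "is_basis_of C B (Hom C X Y)"
 shows "finite B"
proof -
 obtain S where "finite S" "span S = Hom C X Y" using hom_fin assms(1,2) unfolding hom_finite_def by blast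
 then show ?thesis
  using independent_span_bound[of S B] assms(3) span_superset[of B] by (auto simp: is_basis_of_def)
qed

lemma dual_bases_basis:
 assumes X: "X \<in> obj C" and B: "is_basis_of C B (omega C X)"
 shows "dual_bases X B (\<lambda>x. x) (dual_vec C X (\<lambda>x. x) B)"
proof (rule dual_basesI[where c = "\<lambda>b v. representation B v b"])
 have ind: "independent B" and sp: "span B = omega C X" using B by (auto simp: is_basis_of_def)
 show fin: "finite B" using basis_finite[OF V_obj tobj_closed[OF V_obj X]] B by (simp add: omega_def)
 have v: "v \<in> span B" if "arr V (V \<boxtimes> X) v" for v using that sp omega_iff[OF X] by simp
 show "arr V (V \<boxtimes> X) k" if "k \<in> B" for k using that sp span_base omega_iff[OF X] by blast
 show "representation B (v + w) k = representation B v k + representation B w k"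
  if "arr V (V \<boxtimes> X) v" "arr V (V \<boxtimes> X) w" for k v w
  using representation_add[OF ind v[OF that(2)] v[OF that(1)]] by simp
 show "representation B (scal C a v) k = a * representation B v k" if "arr V (V \<boxtimes> X) v" for k v a
  using representation_scale[OF ind v[OF that]] by simp
 show "representation B l k = (if k = l then 1 else 0)" if "k \<in> B" "l \<in> B" for k l
  using representation_basis[OF ind that(2)] by auto
 show "w = (\<Sum>k\<in>B. scal C (representation B w k) k)" if "arr V (V \<boxtimes> X) w" for w
  using sum_representation_eq[OF ind v[OF that] fin] by simp
qed (fact X)

lemma omega_basis: "X \<in> obj C \<Longrightarrow> dual_bases X (omega_basis C X) (\<lambda>x. x) (dual_vec C X (\<lambda>x. x) (omega_basis C X))"
proof (rule dual_bases_basis)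
 assume X: "X \<in> obj C"
 obtain B where "B \<subseteq> omega C X" "independent B" "omega C X \<subseteq> span B" using maximal_independent_subset by blast
 moreover have "subspace (omega C X)" using hom_subspace V_obj tobj_closed X by (simp add: omega_def)
 ultimately have "is_basis_of C B (omega C X)"
  using span_minimal[of B "omega C X"] unfolding is_basis_of_def by blast
 then show "is_basis_of C (omega_basis C X) (omega C X)"
  unfolding omega_basis_def by (rule someI)
qed

text \<open>Expanding \<open>e k\<close> in the second basis and summing over \<open>k\<close> first
  reassembles the covectors of the second basis. Here \<open>F\<close> stands for a bilinear form,
  tested on the sum of all e_k (x) e^k. This is how the arbitrary \<open>omega_basis\<close> is
  exchanged for the basis of paths.\<close>

lemma canonical_element:
 assumes db: "dual_bases X K e d" and db': "dual_bases X K' e' d'"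
  and add1: "\<And>v w \<theta>. \<lbrakk>arr V (V \<boxtimes> X) v; arr V (V \<boxtimes> X) w; arr (V \<boxtimes> X) V \<theta>\<rbrakk> \<Longrightarrow> F (v + w) \<theta> = F v \<theta> + F w \<theta>"
  and scal1: "\<And>a v \<theta>. arr V (V \<boxtimes> X) v \<Longrightarrow> arr (V \<boxtimes> X) V \<theta> \<Longrightarrow> F (scal C a v) \<theta> = a * F v \<theta>"
  and add2: "\<And>v \<theta> \<eta>. \<lbrakk>arr V (V \<boxtimes> X) v; arr (V \<boxtimes> X) V \<theta>; arr (V \<boxtimes> X) V \<eta>\<rbrakk> \<Longrightarrow> F v (\<theta> + \<eta>) = F v \<theta> + F v \<eta>"
  and scal2: "\<And>a v \<theta>. arr V (V \<boxtimes> X) v \<Longrightarrow> arr (V \<boxtimes> X) V \<theta> \<Longrightarrow> F v (scal C a \<theta>) = a * (F v \<theta> :: 'k)"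
 shows "(\<Sum>k\<in>K. F (e k) (d k)) = (\<Sum>k\<in>K'. F (e' k) (d' k))"
proof -
 note D = dual_basesD[OF db] and D' = dual_basesD[OF db']
 have o: "V \<boxtimes> X \<in> obj C" by (rule tobj_closed[OF V_obj D(2)])
 have sum1: "F (\<Sum>a\<in>A. f a) \<theta> = (\<Sum>a\<in>A. F (f a) \<theta>)" if "\<And>a. a \<in> A \<Longrightarrow> arr V (V \<boxtimes> X) (f a)" "arr (V \<boxtimes> X) V \<theta>"
  for f \<theta> and A :: "'d set"
  using that scal1[OF arr_zero[OF V_obj o] that(2), of 0]
  by (induction A rule: infinite_finite_induct) (simp_all add: add1 arr_sum V_obj o)
 have sum2: "F v (\<Sum>a\<in>A. f a) = (\<Sum>a\<in>A. F v (f a))" if "\<And>a. a \<in> A \<Longrightarrow> arr (V \<boxtimes> X) V (f a)" "arr V (V \<boxtimes> X) v"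
  for f v and A :: "'c set"
  using that scal2[OF that(2) arr_zero[OF o V_obj], of 0]
  by (induction A rule: infinite_finite_induct) (simp_all add: add2 arr_sum V_obj o)
 have "(\<Sum>k\<in>K. F (e k) (d k)) = (\<Sum>k\<in>K. \<Sum>l\<in>K'. pairing C (d' l) (e k) * F (e' l) (d k))"
 proof (intro sum.cong refl)
  fix k assume k: "k \<in> K"
  have "F (e k) (d k) = F (\<Sum>l\<in>K'. scal C (pairing C (d' l) (e k)) (e' l)) (d k)"
   using D'(6)[OF D(3)[OF k]] by simp
  also have "\<dots> = (\<Sum>l\<in>K'. F (scal C (pairing C (d' l) (e k)) (e' l)) (d k))"
   using D'(3) D(4)[OF k] by (intro sum1 arr_scal) auto
  finally show "F (e k) (d k) = (\<Sum>l\<in>K'. pairing C (d' l) (e k) * F (e' l) (d k))"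
   using D'(3) D(4)[OF k] by (simp add: scal1)
 qed
 also have "\<dots> = (\<Sum>l\<in>K'. \<Sum>k\<in>K. pairing C (d' l) (e k) * F (e' l) (d k))" by (rule sum.swap)
 also have "\<dots> = (\<Sum>l\<in>K'. F (e' l) (d' l))"
 proof (intro sum.cong refl)
  fix l assume l: "l \<in> K'"
  have "F (e' l) (d' l) = F (e' l) (\<Sum>k\<in>K. scal C (pairing C (d' l) (e k)) (d k))"
   using dual_bases_covector[OF db D'(4)[OF l]] by simp
  also have "\<dots> = (\<Sum>k\<in>K. F (e' l) (scal C (pairing C (d' l) (e k)) (d k)))"
   using D(4) D'(3)[OF l] by (intro sum2 arr_scal) auto
  finally show "(\<Sum>k\<in>K. pairing C (d' l) (e k) * F (e' l) (d k)) = F (e' l) (d' l)"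
   using D(4) D'(3)[OF l] by (simp add: scal2)
 qed
 finally show ?thesis .
qed

end

section \<open>Products in the long canonical functor\<close>

context semisimple_monoidal
begin

text \<open>The lax monoidal structure of the long canonical functor, from the product of the spaces
  of \<open>X\<close> and \<open>Y\<close> to that of \<open>X \<boxtimes> Y\<close>;
  \<open>codia\<close> is its counterpart for covectors. Together they form the product of symbols
  in the coend.\<close>

definition dia :: "'o \<Rightarrow> 'o \<Rightarrow> 'm \<Rightarrow> 'm \<Rightarrow> 'm" where
 "dia X Y v w = \<alpha>\<^sub>u V X Y \<cdot> (v \<star> \<I> Y) \<cdot> w"

definition codia :: "'o \<Rightarrow> 'o \<Rightarrow> 'm \<Rightarrow> 'm \<Rightarrow> 'm" where
 "codia X Y \<theta> \<zeta> = \<zeta> \<cdot> (\<theta> \<star> \<I> Y) \<cdot> assoc_inv C V X Y"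

abbreviation om :: "'o \<Rightarrow> 'm \<Rightarrow> bool" where "om X \<equiv> arr V (V \<boxtimes> X)"

abbreviation od :: "'o \<Rightarrow> 'm \<Rightarrow> bool" where "od X \<equiv> arr (V \<boxtimes> X) V"

lemmas ty = typing V_obj

lemma om_obj: "om X v \<Longrightarrow> V \<boxtimes> X \<in> obj C"
 by (simp add: arr_def)

lemma dia_alt:
 assumes "X \<in> obj C" "Y \<in> obj C" "om X v" "om Y w"
 shows "dia X Y v w = \<alpha>\<^sub>u V X Y \<cdot> ((v \<star> \<I> Y) \<cdot> w)"
 unfolding dia_def by (rule cmp_assoc) (rule ty assms)+

lemma codia_alt:
 assumes "X \<in> obj C" "Y \<in> obj C" "od X \<theta>" "od Y \<zeta>"
 shows "codia X Y \<theta> \<zeta> = \<zeta> \<cdot> ((\<theta> \<star> \<I> Y) \<cdot> assoc_inv C V X Y)"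
 unfolding codia_def by (rule cmp_assoc) (rule ty assms)+

lemma arr_dia: "\<lbrakk>X \<in> obj C; Y \<in> obj C; om X v; om Y w\<rbrakk> \<Longrightarrow> om (X \<boxtimes> Y) (dia X Y v w)"
 unfolding dia_def by (rule ty | assumption)+

lemma arr_codia: "\<lbrakk>X \<in> obj C; Y \<in> obj C; od X \<theta>; od Y \<zeta>\<rbrakk> \<Longrightarrow> od (X \<boxtimes> Y) (codia X Y \<theta> \<zeta>)"
 unfolding codia_def by (rule ty | assumption)+

lemma dia_linear:
 assumes X: "X \<in> obj C" and Y: "Y \<in> obj C" and v: "om X v" "om X v'" and w: "om Y w" "om Y w'"
 shows "dia X Y (v + v') w = dia X Y v w + dia X Y v' w"
  and "dia X Y v (w + w') = dia X Y v w + dia X Y v w'"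
  and "dia X Y (scal C c v) w = scal C c (dia X Y v w)"
  and "dia X Y v (scal C c w) = scal C c (dia X Y v w)"
proof -
 note i = arr_id[OF Y] and a = arr_assoc[OF V_obj X Y]
 note t = arr_tmor[OF v(1) i] arr_tmor[OF v(2) i]
 note u = arr_comp[OF t(1) a] arr_comp[OF t(2) a]
 show "dia X Y (v + v') w = dia X Y v w + dia X Y v' w"
  unfolding dia_def tmor_plus_left[OF v i] cmp_add_right[OF t a] by (rule cmp_add_left[OF w(1) u])
 show "dia X Y v (w + w') = dia X Y v w + dia X Y v w'"
  unfolding dia_def by (rule cmp_add_right[OF w u(1)])
 show "dia X Y (scal C c v) w = scal C c (dia X Y v w)"
  unfolding dia_def tmor_scale_left[OF v(1) i] cmp_scal_right[OF t(1) a] by (rule cmp_scal_left[OF w(1) u(1)])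
 show "dia X Y v (scal C c w) = scal C c (dia X Y v w)"
  unfolding dia_def by (rule cmp_scal_right[OF w(1) u(1)])
qed

lemma codia_linear:
 assumes X: "X \<in> obj C" and Y: "Y \<in> obj C" and v: "od X v" "od X v'" and w: "od Y w" "od Y w'"
 shows "codia X Y (v + v') w = codia X Y v w + codia X Y v' w"
  and "codia X Y v (w + w') = codia X Y v w + codia X Y v w'"
  and "codia X Y (scal C c v) w = scal C c (codia X Y v w)"
  and "codia X Y v (scal C c w) = scal C c (codia X Y v w)"
proof -
 note i = arr_id[OF Y] and a = assoc_inv(1)[OF V_obj X Y]
 note t = arr_tmor[OF v(1) i] arr_tmor[OF v(2) i]
 note u = arr_comp[OF t(1) w(1)] arr_comp[OF t(2) w(1)] arr_comp[OF t(1) w(2)]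
 show "codia X Y (v + v') w = codia X Y v w + codia X Y v' w"
  unfolding codia_def tmor_plus_left[OF v i] cmp_add_right[OF t w(1)] by (rule cmp_add_left[OF a u(1,2)])
 show "codia X Y v (w + w') = codia X Y v w + codia X Y v w'"
  unfolding codia_def cmp_add_left[OF t(1) w] by (rule cmp_add_left[OF a u(1,3)])
 show "codia X Y (scal C c v) w = scal C c (codia X Y v w)"
  unfolding codia_def tmor_scale_left[OF v(1) i] cmp_scal_right[OF t(1) w(1)] by (rule cmp_scal_left[OF a u(1)])
 show "codia X Y v (scal C c w) = scal C c (codia X Y v w)"
  unfolding codia_def cmp_scal_left[OF t(1) w(1)] by (rule cmp_scal_left[OF a u(1)])
qed

lemma dia_zero:
 assumes "X \<in> obj C" "Y \<in> obj C"
 shows "om X v \<Longrightarrow> dia X Y v 0 = 0" "om Y w \<Longrightarrow> dia X Y 0 w = 0"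
 using dia_linear(4)[OF assms, of v v 0 0 0] dia_linear(3)[OF assms, of 0 0 w w 0] arr_zero[OF V_obj] assms
 by (simp_all add: V_obj tobj_closed)

lemma omega_map_arr: "arr X Y f \<Longrightarrow> om X v \<Longrightarrow> om Y (omega_map C f v)"
 unfolding omega_map_def by (rule arr_comp arr_tmor arr_id V_obj | assumption)+

lemma omega_comap_arr: "arr X Y f \<Longrightarrow> od Y \<zeta> \<Longrightarrow> od X (\<zeta> \<cdot> (\<I> V \<star> f))"
 by (rule arr_comp arr_tmor arr_id V_obj | assumption)+

lemma omega_map_adjoint:
 assumes "om X v" "arr X Y f" "od Y \<zeta>"
 shows "pairing C (\<zeta> \<cdot> (\<I> V \<star> f)) v = pairing C \<zeta> (omega_map C f v)"
 unfolding omega_map_def by (rule pairing_comp) (rule assms arr_tmor arr_id V_obj)+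

text \<open>The associators cancel, and the element \<open>\<theta> \<cdot> v\<close> of R is left
  acting on \<open>w\<close>. The pairing of two products is therefore not the product of the
  pairings; the idempotent in between is what detects whether paths compose.\<close>

lemma codia_cmp_dia:
 assumes X: "X \<in> obj C" and Y: "Y \<in> obj C" and v: "om X v" and w: "om Y w" and \<theta>: "od X \<theta>" and \<zeta>: "od Y \<zeta>"
 shows "codia X Y \<theta> \<zeta> \<cdot> dia X Y v w = \<zeta> \<cdot> (((\<theta> \<cdot> v) \<star> \<I> Y) \<cdot> w)"
proof -
 note t = ty X Y v w \<theta> \<zeta> arr_dia
 let ?k = "(v \<star> \<I> Y) \<cdot> w"
 have k: "arr V ((V \<boxtimes> X) \<boxtimes> Y) ?k" by (rule t)+
 have "codia X Y \<theta> \<zeta> \<cdot> dia X Y v w = \<zeta> \<cdot> (((\<theta> \<star> \<I> Y) \<cdot> assoc_inv C V X Y) \<cdot> dia X Y v w)"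
  unfolding codia_alt[OF X Y \<theta> \<zeta>] by (rule cmp_assoc) (rule t)+
 also have "((\<theta> \<star> \<I> Y) \<cdot> assoc_inv C V X Y) \<cdot> dia X Y v w = (\<theta> \<star> \<I> Y) \<cdot> (assoc_inv C V X Y \<cdot> dia X Y v w)"
  by (rule cmp_assoc) (rule t)+
 also have "assoc_inv C V X Y \<cdot> dia X Y v w = \<I> ((V \<boxtimes> X) \<boxtimes> Y) \<cdot> ?k"
  unfolding dia_alt[OF X Y v w] by (rule cmp_eq[OF k]) (rule t assoc_inv(2))+
 also have "\<dots> = ?k" by (rule cmp_id_left[OF k])
 also have "(\<theta> \<star> \<I> Y) \<cdot> ?k = ((\<theta> \<cdot> v) \<star> \<I> Y) \<cdot> w"
  by (rule cmp_eq[OF w _ _ tmor_cmp_left]) (rule t)+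
 finally show ?thesis .
qed

text \<open>After removing the associator, the identity of \<open>V \<boxtimes> X\<close> is
  inserted in the form of a sum of \<open>v a \<cdot> \<theta> a\<close>; the parts
  \<open>v a\<close> become first factors, and the remainders are the second factors.\<close>

lemma dia_span:
 assumes X: "X \<in> obj C" and Y: "Y \<in> obj C" and u: "om (X \<boxtimes> Y) u"
 shows "\<exists>n v w. (\<forall>a<n. om X (v a) \<and> om Y (w a)) \<and> u = (\<Sum>a<(n::nat). dia X Y (v a) (w a))"
proof -
 obtain n v \<theta> where *: "\<And>a. a < n \<Longrightarrow> om X (v a) \<and> od X (\<theta> a)" "\<I> (V \<boxtimes> X) = (\<Sum>a<(n::nat). v a \<cdot> \<theta> a)"
  using V_factor[OF tobj_closed[OF V_obj X]] by blast
 note t = ty X Y u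
 note o = tobj_closed[OF V_obj X]
 let ?u = "assoc_inv C V X Y \<cdot> u"
 have u': "arr V ((V \<boxtimes> X) \<boxtimes> Y) ?u" by (rule t)+
 have w: "om Y ((\<theta> a \<star> \<I> Y) \<cdot> ?u)" if "a < n" for a
  using *(1)[OF that] by (auto intro!: arr_comp[OF u'] arr_tmor arr_id Y)
 have va: "arr (V \<boxtimes> X) (V \<boxtimes> X) (v a \<cdot> \<theta> a)" if "a < n" for a using *(1)[OF that] by (blast intro: arr_comp)
 have "?u = (\<I> (V \<boxtimes> X) \<star> \<I> Y) \<cdot> ?u"
  using cmp_id_left[OF u'] tmor_id[OF tobj_closed[OF V_obj X] Y] by simp
 also have "\<I> (V \<boxtimes> X) \<star> \<I> Y = (\<Sum>a<n. (v a \<cdot> \<theta> a) \<star> \<I> Y)"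
  unfolding *(2) by (rule tmor_sum_left[OF o o arr_id[OF Y]]) (use va in auto)
 also have "\<dots> \<cdot> ?u = (\<Sum>a<n. ((v a \<cdot> \<theta> a) \<star> \<I> Y) \<cdot> ?u)"
  by (rule cmp_sum_left[OF u' tobj_closed[OF o Y]]) (use va in \<open>auto intro!: arr_tmor arr_id Y\<close>)
 also have "\<dots> = (\<Sum>a<n. (v a \<star> \<I> Y) \<cdot> ((\<theta> a \<star> \<I> Y) \<cdot> ?u))"
 proof (intro sum.cong refl)
  fix a assume "a \<in> {..<n}"
  then have a: "om X (v a)" "od X (\<theta> a)" using * by auto
  show "((v a \<cdot> \<theta> a) \<star> \<I> Y) \<cdot> ?u = (v a \<star> \<I> Y) \<cdot> ((\<theta> a \<star> \<I> Y) \<cdot> ?u)"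
   by (rule cmp_eq[OF u' _ _ tmor_cmp_left, symmetric]) (rule a ty X Y)+
 qed
 finally have e: "?u = (\<Sum>a<n. (v a \<star> \<I> Y) \<cdot> ((\<theta> a \<star> \<I> Y) \<cdot> ?u))" .
 have "u = \<I> (V \<boxtimes> (X \<boxtimes> Y)) \<cdot> u" by (rule cmp_id_left[OF u, symmetric])
 also have "\<dots> = \<alpha>\<^sub>u V X Y \<cdot> ?u"
  by (rule cmp_eq[symmetric]) (rule t assoc_inv(3))+
 also have "\<dots> = \<alpha>\<^sub>u V X Y \<cdot> (\<Sum>a<n. (v a \<star> \<I> Y) \<cdot> ((\<theta> a \<star> \<I> Y) \<cdot> ?u))" using e by (rule arg_cong)
 also have "\<dots> = (\<Sum>a<n. \<alpha>\<^sub>u V X Y \<cdot> ((v a \<star> \<I> Y) \<cdot> ((\<theta> a \<star> \<I> Y) \<cdot> ?u)))"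
  by (rule cmp_sum_right[OF arr_assoc[OF V_obj X Y] V_obj])
   (use * w in \<open>auto intro!: arr_comp[OF w] arr_tmor arr_id Y\<close>)
 also have "\<dots> = (\<Sum>a<n. dia X Y (v a) ((\<theta> a \<star> \<I> Y) \<cdot> ?u))"
  by (intro sum.cong refl dia_alt[OF X Y, symmetric]) (use * w in auto)
 finally have "u = (\<Sum>a<n. dia X Y (v a) ((\<theta> a \<star> \<I> Y) \<cdot> ?u))" .
 moreover have "\<forall>a<n. om X (v a) \<and> om Y ((\<theta> a \<star> \<I> Y) \<cdot> ?u)" using *(1) w by blast
 ultimately show ?thesis
  by (intro exI[of _ n] exI[of _ v] exI[of _ "\<lambda>a. (\<theta> a \<star> \<I> Y) \<cdot> ?u"] conjI)
qed

lemma omega_map_dia_left: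
 assumes Y: "Y \<in> obj C" and f: "arr X X' f" and v: "om X v" and w: "om Y w"
 shows "omega_map C (f \<star> \<I> Y) (dia X Y v w) = dia X' Y (omega_map C f v) w"
proof -
 have X: "X \<in> obj C" "X' \<in> obj C" using f by (auto simp: arr_def)
 note t = ty X Y f v w
 have "omega_map C (f \<star> \<I> Y) (dia X Y v w) = \<alpha>\<^sub>u V X' Y \<cdot> (((\<I> V \<star> f) \<star> \<I> Y) \<cdot> ((v \<star> \<I> Y) \<cdot> w))"
  unfolding omega_map_def dia_alt[OF X(1) Y v w]
  by (rule cmp_swap[OF _ _ _ _ _ assoc_nat[symmetric]]) (rule t)+
 also have "((\<I> V \<star> f) \<star> \<I> Y) \<cdot> ((v \<star> \<I> Y) \<cdot> w) = (omega_map C f v \<star> \<I> Y) \<cdot> w"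
  unfolding omega_map_def by (rule cmp_eq[OF w _ _ tmor_cmp_left]) (rule t)+
 also have "\<alpha>\<^sub>u V X' Y \<cdot> \<dots> = dia X' Y (omega_map C f v) w"
  unfolding omega_map_def by (rule dia_alt[symmetric]) (rule t)+
 finally show ?thesis .
qed

lemma omega_map_dia_right:
 assumes X: "X \<in> obj C" and g: "arr Y Y' g" and v: "om X v" and w: "om Y w"
 shows "omega_map C (\<I> X \<star> g) (dia X Y v w) = dia X Y' v (omega_map C g w)"
proof -
 have Y: "Y \<in> obj C" "Y' \<in> obj C" using g by (auto simp: arr_def)
 note t = ty X Y g v w
 have nat: "\<alpha>\<^sub>u V X Y' \<cdot> (\<I> (V \<boxtimes> X) \<star> g) = (\<I> V \<star> (\<I> X \<star> g)) \<cdot> \<alpha>\<^sub>u V X Y"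
  using assoc_nat[OF arr_id[OF V_obj] arr_id[OF X] g] by (simp add: tmor_id V_obj X)
 have "omega_map C (\<I> X \<star> g) (dia X Y v w) = \<alpha>\<^sub>u V X Y' \<cdot> ((\<I> (V \<boxtimes> X) \<star> g) \<cdot> ((v \<star> \<I> Y) \<cdot> w))"
  unfolding omega_map_def dia_alt[OF X Y(1) v w]
  by (rule cmp_swap[OF _ _ _ _ _ nat[symmetric]]) (rule t)+
 also have "(\<I> (V \<boxtimes> X) \<star> g) \<cdot> ((v \<star> \<I> Y) \<cdot> w) = (v \<star> \<I> Y') \<cdot> omega_map C g w"
  unfolding omega_map_def by (rule cmp_swap[OF _ _ _ _ _ tmor_interchange[symmetric]]) (rule t)+
 also have "\<alpha>\<^sub>u V X Y' \<cdot> \<dots> = dia X Y' v (omega_map C g w)"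
  unfolding omega_map_def by (rule dia_alt[symmetric]) (rule t)+
 finally show ?thesis .
qed

text \<open>This is the pentagon, applied after naturality has moved \<open>v\<close> past the
  associator.\<close>

lemma dia_assoc:
 assumes X: "X \<in> obj C" and Y: "Y \<in> obj C" and Z: "Z \<in> obj C" and v: "om X v" and w: "om Y w" and u: "om Z u"
 shows "omega_map C (\<alpha>\<^sub>u X Y Z) (dia (X \<boxtimes> Y) Z (dia X Y v w) u) = dia X (Y \<boxtimes> Z) v (dia Y Z w u)"
proof -
 note t = ty X Y Z v w u
 have nat: "(v \<star> \<I> (Y \<boxtimes> Z)) \<cdot> \<alpha>\<^sub>u V Y Z = \<alpha>\<^sub>u (V \<boxtimes> X) Y Z \<cdot> ((v \<star> \<I> Y) \<star> \<I> Z)"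
  using assoc_nat[OF v arr_id[OF Y] arr_id[OF Z]] by (simp add: tmor_id Y Z)
 let ?h = "(v \<star> \<I> Y) \<cdot> w" and ?a = "\<alpha>\<^sub>u V X Y"
 let ?k = "(?h \<star> \<I> Z) \<cdot> u"
 have "dia X (Y \<boxtimes> Z) v (dia Y Z w u) =
   \<alpha>\<^sub>u V X (Y \<boxtimes> Z) \<cdot> ((v \<star> \<I> (Y \<boxtimes> Z)) \<cdot> (\<alpha>\<^sub>u V Y Z \<cdot> ((w \<star> \<I> Z) \<cdot> u)))"
  unfolding dia_alt[OF Y Z w u] by (rule dia_alt) (rule t)+
 also have "(v \<star> \<I> (Y \<boxtimes> Z)) \<cdot> (\<alpha>\<^sub>u V Y Z \<cdot> ((w \<star> \<I> Z) \<cdot> u)) =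
   \<alpha>\<^sub>u (V \<boxtimes> X) Y Z \<cdot> (((v \<star> \<I> Y) \<star> \<I> Z) \<cdot> ((w \<star> \<I> Z) \<cdot> u))"
  by (rule cmp_swap[OF _ _ _ _ _ nat]) (rule t)+
 also have "((v \<star> \<I> Y) \<star> \<I> Z) \<cdot> ((w \<star> \<I> Z) \<cdot> u) = ?k"
  by (rule cmp_eq[OF u _ _ tmor_cmp_left]) (rule t)+
 also have "\<alpha>\<^sub>u V X (Y \<boxtimes> Z) \<cdot> (\<alpha>\<^sub>u (V \<boxtimes> X) Y Z \<cdot> ?k) =
   ((\<I> V \<star> \<alpha>\<^sub>u X Y Z) \<cdot> \<alpha>\<^sub>u V (X \<boxtimes> Y) Z \<cdot> (?a \<star> \<I> Z)) \<cdot> ?k"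
  by (rule cmp_eq[OF _ _ _ pentagon]) (rule t)+
 also have "\<dots> = ((\<I> V \<star> \<alpha>\<^sub>u X Y Z) \<cdot> \<alpha>\<^sub>u V (X \<boxtimes> Y) Z) \<cdot> ((?a \<star> \<I> Z) \<cdot> ?k)"
  by (rule cmp_assoc) (rule t)+
 also have "(?a \<star> \<I> Z) \<cdot> ?k = (dia X Y v w \<star> \<I> Z) \<cdot> u"
  unfolding dia_alt[OF X Y v w] by (rule cmp_eq[OF u _ _ tmor_cmp_left]) (rule t)+
 also have "((\<I> V \<star> \<alpha>\<^sub>u X Y Z) \<cdot> \<alpha>\<^sub>u V (X \<boxtimes> Y) Z) \<cdot> \<dots> =
   (\<I> V \<star> \<alpha>\<^sub>u X Y Z) \<cdot> (\<alpha>\<^sub>u V (X \<boxtimes> Y) Z \<cdot> ((dia X Y v w \<star> \<I> Z) \<cdot> u))"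
  by (rule cmp_assoc) (rule t arr_dia)+
 also have "\<alpha>\<^sub>u V (X \<boxtimes> Y) Z \<cdot> ((dia X Y v w \<star> \<I> Z) \<cdot> u) = dia (X \<boxtimes> Y) Z (dia X Y v w) u"
  by (rule dia_alt[symmetric]) (rule t arr_dia)+
 finally show ?thesis by (simp add: omega_map_def)
qed

text \<open>The right unit identifies the space of the unit object with R. By the triangle,
  multiplication by such an element from the left is the left action of R; the companion
  \<open>dia_unit_right\<close> yields precomposition and rests on
  \<open>runit_tensor\<close>.\<close>

lemma dia_unit_left:
 assumes Y: "Y \<in> obj C" and r: "arr V V r" and w: "om Y w"
 shows "omega_map C (\<lambda>\<^sub>u Y) (dia \<bbbone> Y (runit_inv C V \<cdot> r) w) = (r \<star> \<I> Y) \<cdot> w"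
proof -
 note t = ty Y r w
 let ?v = "runit_inv C V \<cdot> r"
 have v: "om \<bbbone> ?v" by (rule t)+
 have "omega_map C (\<lambda>\<^sub>u Y) (dia \<bbbone> Y ?v w) = (\<rho>\<^sub>u V \<star> \<I> Y) \<cdot> ((?v \<star> \<I> Y) \<cdot> w)"
  unfolding omega_map_def dia_alt[OF unit_closed Y v w]
  by (rule cmp_eq[OF _ _ _ triangle]) (rule t)+
 also have "\<dots> = ((\<rho>\<^sub>u V \<cdot> ?v) \<star> \<I> Y) \<cdot> w"
  by (rule cmp_eq[OF w _ _ tmor_cmp_left]) (rule t)+
 also have "\<rho>\<^sub>u V \<cdot> ?v = \<I> V \<cdot> r" by (rule cmp_eq[OF r]) (rule t runit_inv(3))+
 finally show ?thesis by (simp add: cmp_id_left[OF r])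
qed

lemma dia_unit_right:
 assumes X: "X \<in> obj C" and v: "om X v" and r: "arr V V r"
 shows "omega_map C (\<rho>\<^sub>u X) (dia X \<bbbone> v (runit_inv C V \<cdot> r)) = v \<cdot> r"
proof -
 note t = ty X v r
 let ?w = "runit_inv C V \<cdot> r"
 have w: "om \<bbbone> ?w" by (rule t)+
 have "omega_map C (\<rho>\<^sub>u X) (dia X \<bbbone> v ?w) = \<rho>\<^sub>u (V \<boxtimes> X) \<cdot> ((v \<star> \<I> \<bbbone>) \<cdot> ?w)"
  unfolding omega_map_def dia_alt[OF X unit_closed v w]
  by (rule cmp_eq[OF _ _ _ runit_tensor]) (rule t)+
 also have "\<dots> = v \<cdot> (\<rho>\<^sub>u V \<cdot> ?w)"
  by (rule cmp_swap[OF _ _ _ _ _ runit_nat]) (rule t)+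
 also have "\<rho>\<^sub>u V \<cdot> ?w = \<I> V \<cdot> r" by (rule cmp_eq[OF r]) (rule t runit_inv(3))+
 finally show ?thesis by (simp add: cmp_id_left[OF r])
qed

text \<open>The product is defined over R. With \<open>r\<close> an idempotent
  \<open>lam C j\<close> this shows that products of path vectors with different inner vertices
  vanish.\<close>

lemma dia_balanced:
 assumes X: "X \<in> obj C" and Y: "Y \<in> obj C" and v: "om X v" and r: "arr V V r" and w: "om Y w"
 shows "dia X Y (v \<cdot> r) w = dia X Y v ((r \<star> \<I> Y) \<cdot> w)"
proof -
 note t = ty X Y v r w
 have "(v \<star> \<I> Y) \<cdot> ((r \<star> \<I> Y) \<cdot> w) = ((v \<cdot> r) \<star> \<I> Y) \<cdot> w"
  by (rule cmp_eq[OF w _ _ tmor_cmp_left]) (rule t)+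
 moreover have "dia X Y (v \<cdot> r) w = \<alpha>\<^sub>u V X Y \<cdot> (((v \<cdot> r) \<star> \<I> Y) \<cdot> w)"
  by (rule dia_alt) (rule t)+
 moreover have "dia X Y v ((r \<star> \<I> Y) \<cdot> w) = \<alpha>\<^sub>u V X Y \<cdot> ((v \<star> \<I> Y) \<cdot> ((r \<star> \<I> Y) \<cdot> w))"
  by (rule dia_alt) (rule t)+
 ultimately show ?thesis by simp
qed

lemma dia_cmp_right:
 assumes X: "X \<in> obj C" and Y: "Y \<in> obj C" and v: "om X v" and r: "arr V V r" and w: "om Y w"
 shows "dia X Y v w \<cdot> r = dia X Y v (w \<cdot> r)"
 unfolding dia_def by (rule cmp_assoc) (rule ty assms)+

lemma dia_in_span:
 assumes db: "dual_bases X K e d" and db': "dual_bases Y K' e' d'" and u: "om (X \<boxtimes> Y) u"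
 shows "u \<in> span ((\<lambda>(k, l). dia X Y (e k) (e' l)) ` (K \<times> K'))"
proof -
 let ?S = "span ((\<lambda>(k, l). dia X Y (e k) (e' l)) ` (K \<times> K'))"
 note D = dual_basesD[OF db] and D' = dual_basesD[OF db']
 note X = D(2) and Y = D'(2)
 have l: "dia X Y (e k) w \<in> ?S" if k: "k \<in> K" and w: "om Y w" for k w
 proof -
  have "dia X Y (e k) (\<Sum>l\<in>L. scal C (c l) (e' l)) \<in> ?S" if "finite L" "L \<subseteq> K'" for L c
   using that
  proof (induction L)
   case empty
   then show ?case using dia_zero(1)[OF X Y D(3)[OF k]] by (simp add: span_zero)
  next
   case (insert l L)
   then have l: "om Y (e' l)" and s: "om Y (\<Sum>l\<in>L. scal C (c l) (e' l))"
    by (auto intro!: arr_sum arr_scal D'(3) ty Y)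
   have "dia X Y (e k) (e' l) \<in> ?S" using insert k by (auto intro!: span_base)
   then show ?case using insert dia_linear[OF X Y D(3)[OF k] D(3)[OF k] arr_scal[OF l] s]
     dia_linear(4)[OF X Y D(3)[OF k] D(3)[OF k] l l]
    by (auto intro!: span_add span_scale)
  qed
  from this[OF D'(1), of "\<lambda>l. pairing C (d' l) w"] show ?thesis using D'(6)[OF w] by simp
 qed
 have vw: "dia X Y v w \<in> ?S" if v: "om X v" and w: "om Y w" for v w
 proof -
  have "dia X Y (\<Sum>k\<in>L. scal C (c k) (e k)) w \<in> ?S" if "finite L" "L \<subseteq> K" for L c
   using that
  proof (induction L)
   case empty
   then show ?case using dia_zero(2)[OF X Y w] by (simp add: span_zero)
  next
   case (insert k L)
   then have k: "om X (e k)" and s: "om X (\<Sum>l\<in>L. scal C (c l) (e l))"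
    by (auto intro!: arr_sum arr_scal D(3) ty X)
   have "dia X Y (e k) w \<in> ?S" using insert l[OF _ w] by simp
   then show ?case using insert dia_linear[OF X Y arr_scal[OF k] s w w] dia_linear(3)[OF X Y k k w w]
    by (auto intro!: span_add span_scale)
  qed
  from this[OF D(1), of "\<lambda>k. pairing C (d k) v"] show ?thesis using D(6)[OF v] by simp
 qed
 obtain n v w where "\<And>a. a < n \<Longrightarrow> om X (v a) \<and> om Y (w a)" "u = (\<Sum>a<(n::nat). dia X Y (v a) (w a))"
  using dia_span[OF X Y u] by blast
 then show ?thesis using vw by (auto intro!: span_sum)
qed

text \<open>Products of basis vectors span the space of \<open>X \<boxtimes> Y\<close>, so covectors
  may be compared on them. The naturality of \<open>codia\<close> and its values on path covectors
  are derived in this way from the corresponding facts about \<open>dia\<close>.\<close>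

lemma dia_dual_eqI:
 assumes db: "dual_bases X K e d" and db': "dual_bases Y K' e' d'"
  and \<theta>: "od (X \<boxtimes> Y) \<theta>" and \<eta>: "od (X \<boxtimes> Y) \<eta>"
  and eq: "\<And>k l. k \<in> K \<Longrightarrow> l \<in> K' \<Longrightarrow> pairing C \<theta> (dia X Y (e k) (e' l)) = pairing C \<eta> (dia X Y (e k) (e' l))"
 shows "\<theta> = \<eta>"
proof (rule pairing_nondegenerate[OF \<theta> \<eta>])
 note D = dual_basesD[OF db] and D' = dual_basesD[OF db']
 have o: "V \<boxtimes> (X \<boxtimes> Y) \<in> obj C" by (intro ty D D')
 fix u assume "om (X \<boxtimes> Y) u"
 from dia_in_span[OF db db' this]
 have "om (X \<boxtimes> Y) u \<and> pairing C \<theta> u = pairing C \<eta> u"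
 proof (rule span_induct)
  show "subspace {u. om (X \<boxtimes> Y) u \<and> pairing C \<theta> u = pairing C \<eta> u}"
   using pairing_zero_right[OF \<theta>] pairing_zero_right[OF \<eta>]
   by (auto simp: subspace_def arr_zero[OF V_obj o] arr_add arr_scal
     pairing_add_right[OF \<theta>] pairing_add_right[OF \<eta>] pairing_scal_right[OF \<theta>] pairing_scal_right[OF \<eta>])
  fix x assume "x \<in> (\<lambda>(k, l). dia X Y (e k) (e' l)) ` (K \<times> K')"
  then show "om (X \<boxtimes> Y) x \<and> pairing C \<theta> x = pairing C \<eta> x"
   using eq D(2,3) D'(2,3) by (auto intro!: arr_dia)
 qed
 then show "pairing C \<theta> u = pairing C \<eta> u" ..
qed

lemma codia_map_left:
 assumes Y: "Y \<in> obj C" and f: "arr X X' f" and \<theta>: "od X' \<theta>" and \<zeta>: "od Y \<zeta>"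
 shows "codia X Y (\<theta> \<cdot> (\<I> V \<star> f)) \<zeta> = codia X' Y \<theta> \<zeta> \<cdot> (\<I> V \<star> (f \<star> \<I> Y))"
proof -
 have X: "X \<in> obj C" "X' \<in> obj C" using f by (auto simp: arr_def)
 note t = ty X Y f \<theta> \<zeta> arr_codia
 note c = omega_comap_arr[OF f \<theta>]
 have fY: "arr (X \<boxtimes> Y) (X' \<boxtimes> Y) (f \<star> \<I> Y)" by (rule t)+
 show ?thesis
 proof (rule dia_dual_eqI[OF omega_basis[OF X(1)] omega_basis[OF Y]])
  fix v w assume "v \<in> omega_basis C X" "w \<in> omega_basis C Y"
  then have v: "om X v" and w: "om Y w"
   using dual_basesD(3)[OF omega_basis] X Y by blast+
  have fv: "om X' (omega_map C f v)" by (rule omega_map_arr[OF f v])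
  have "pairing C (codia X Y (\<theta> \<cdot> (\<I> V \<star> f)) \<zeta>) (dia X Y v w) =
    eps_R C (\<zeta> \<cdot> (((\<theta> \<cdot> omega_map C f v) \<star> \<I> Y) \<cdot> w))"
   unfolding pairing_def codia_cmp_dia[OF X(1) Y v w c \<zeta>] omega_map_def
   by (subst cmp_assoc) (rule t v refl)+
  also have "\<dots> = pairing C (codia X' Y \<theta> \<zeta> \<cdot> (\<I> V \<star> (f \<star> \<I> Y))) (dia X Y v w)"
   unfolding omega_map_adjoint[OF arr_dia[OF X(1) Y v w] fY arr_codia[OF X(2) Y \<theta> \<zeta>]]
    omega_map_dia_left[OF Y f v w]
   by (simp add: pairing_def codia_cmp_dia[OF X(2) Y fv w \<theta> \<zeta>])
  finally show "pairing C (codia X Y (\<theta> \<cdot> (\<I> V \<star> f)) \<zeta>) (dia X Y v w) =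
    pairing C (codia X' Y \<theta> \<zeta> \<cdot> (\<I> V \<star> (f \<star> \<I> Y))) (dia X Y v w)" .
 qed (rule t c omega_comap_arr[OF fY])+
qed

lemma codia_map_right:
 assumes X: "X \<in> obj C" and g: "arr Y Y' g" and \<theta>: "od X \<theta>" and \<zeta>: "od Y' \<zeta>"
 shows "codia X Y \<theta> (\<zeta> \<cdot> (\<I> V \<star> g)) = codia X Y' \<theta> \<zeta> \<cdot> (\<I> V \<star> (\<I> X \<star> g))"
proof -
 have Y: "Y \<in> obj C" "Y' \<in> obj C" using g by (auto simp: arr_def)
 note t = ty X Y g \<theta> \<zeta> arr_codia
 note c = omega_comap_arr[OF g \<zeta>]
 have Xg: "arr (X \<boxtimes> Y) (X \<boxtimes> Y') (\<I> X \<star> g)" by (rule t)+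
 show ?thesis
 proof (rule dia_dual_eqI[OF omega_basis[OF X] omega_basis[OF Y(1)]])
  fix v w assume "v \<in> omega_basis C X" "w \<in> omega_basis C Y"
  then have v: "om X v" and w: "om Y w"
   using dual_basesD(3)[OF omega_basis] X Y by blast+
  have gw: "om Y' (omega_map C g w)" by (rule omega_map_arr[OF g w])
  let ?r = "(\<theta> \<cdot> v) \<star> \<I> Y"
  have "(\<zeta> \<cdot> (\<I> V \<star> g)) \<cdot> (?r \<cdot> w) = \<zeta> \<cdot> ((\<I> V \<star> g) \<cdot> (?r \<cdot> w))"
   by (rule cmp_assoc) (rule t v w)+
  also have "(\<I> V \<star> g) \<cdot> (?r \<cdot> w) = ((\<theta> \<cdot> v) \<star> \<I> Y') \<cdot> omega_map C g w"
   unfolding omega_map_def by (rule cmp_swap[OF _ _ _ _ _ tmor_interchange[symmetric]]) (rule t v w)+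
  finally have "pairing C (codia X Y \<theta> (\<zeta> \<cdot> (\<I> V \<star> g))) (dia X Y v w) =
    pairing C (codia X Y' \<theta> \<zeta>) (dia X Y' v (omega_map C g w))"
   by (simp add: pairing_def codia_cmp_dia[OF X Y(1) v w \<theta> c] codia_cmp_dia[OF X Y(2) v gw \<theta> \<zeta>])
  then show "pairing C (codia X Y \<theta> (\<zeta> \<cdot> (\<I> V \<star> g))) (dia X Y v w) =
    pairing C (codia X Y' \<theta> \<zeta> \<cdot> (\<I> V \<star> (\<I> X \<star> g))) (dia X Y v w)"
   unfolding omega_map_adjoint[OF arr_dia[OF X Y(1) v w] Xg arr_codia[OF X Y(2) \<theta> \<zeta>]]
    omega_map_dia_right[OF X g v w] .
 qed (rule t c omega_comap_arr[OF Xg])+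
qed

end

section \<open>Bases of $\omega(M^{\otimes n})$ indexed by paths\<close>

locale dimension_bases = semisimple_monoidal C
 for C :: "('k::field, 'o, 'm::ab_group_add, 'i) fcat" (structure) +
 fixes M :: 'o and B :: "'i \<Rightarrow> 'i \<Rightarrow> 'm set"
 assumes M: "M \<in> obj C" and bases: "edge_bases C M B"
begin

abbreviation "\<G> \<equiv> dimension_graph C B"

abbreviation "tp \<equiv> tensor_power C M"

abbreviation "pv \<equiv> path_vec C M"

lemma edge_basis:
 assumes "j \<in> J" "l \<in> J"
 shows "independent (B j l)" "span (B j l) = Hom C (smp C j) (smp C l \<boxtimes> M)" "finite (B j l)"
proof -
 have *: "is_basis_of C (B j l) (Hom C (smp C j) (smp C l \<boxtimes> M))"
  using bases assms by (simp add: edge_bases_def)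
 then show "independent (B j l)" "span (B j l) = Hom C (smp C j) (smp C l \<boxtimes> M)"
  by (simp_all add: is_basis_of_def)
 show "finite (B j l)"
  by (rule basis_finite[OF smp_obj[OF assms(1)] tobj_closed[OF smp_obj[OF assms(2)] M] *])
qed

lemma graph_simps [simp]:
 "verts \<G> = J" "tail \<G> (j, b, l) = j" "head \<G> (j, b, l) = l"
 "(j, b, l) \<in> arcs \<G> \<longleftrightarrow> j \<in> J \<and> l \<in> J \<and> b \<in> B j l"
 by (simp_all add: dimension_graph_def)

lemma arcs_image: "arcs \<G> = (\<lambda>(j, l, b). (j, b, l)) ` (SIGMA j:J. SIGMA l:J. B j l)"
 by (auto simp: dimension_graph_def image_iff)

sublocale G: fin_digraph \<G>
proof
 show "finite (verts \<G>)" by simp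
 show "finite (arcs \<G>)"
  unfolding arcs_image using edge_basis(3) by (intro finite_imageI finite_SigmaI) auto
qed (auto simp: dimension_graph_def)

lemma sum_arcs: "(\<Sum>p\<in>arcs \<G>. f p) = (\<Sum>j\<in>J. \<Sum>l\<in>J. \<Sum>b\<in>B j l. f (j, b, l))"
proof -
 have "inj_on (\<lambda>(j, l, b). (j, b, l)) (SIGMA j:J. SIGMA l:J. B j l)" by (auto simp: inj_on_def)
 then have "(\<Sum>p\<in>arcs \<G>. f p) = (\<Sum>(j, l, b)\<in>(SIGMA j:J. SIGMA l:J. B j l). f (j, b, l))"
  unfolding arcs_image by (simp add: sum.reindex case_prod_unfold)
 also have "\<dots> = (\<Sum>j\<in>J. \<Sum>(l, b)\<in>(SIGMA l:J. B j l). f (j, b, l))"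
  using edge_basis(3) by (subst sum.Sigma) (auto simp: case_prod_unfold)
 also have "\<dots> = (\<Sum>j\<in>J. \<Sum>l\<in>J. \<Sum>b\<in>B j l. f (j, b, l))"
  using edge_basis(3) by (intro sum.cong refl, subst sum.Sigma) (auto simp: case_prod_unfold)
 finally show ?thesis .
qed

lemma arr_edge: "\<lbrakk>j \<in> J; l \<in> J; b \<in> B j l\<rbrakk> \<Longrightarrow> arr (smp C j) (smp C l \<boxtimes> M) b"
 using edge_basis(2)[of j l] span_base[of b "B j l"] by (simp add: arr_def smp_obj tobj_closed M)

lemma edge_om: "p \<in> arcs \<G> \<Longrightarrow> om M (edge_vec C M p)"
proof (cases p)
 case (fields j b l)
 moreover assume "p \<in> arcs \<G>"
 ultimately have *: "j \<in> J" "l \<in> J" "b \<in> B j l" by auto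
 show ?thesis unfolding fields edge_vec_def prod.case
  by (rule arr_comp[OF arr_vprj[OF *(1)] arr_comp[OF arr_edge[OF *] arr_tmor[OF arr_vinj[OF *(2)] arr_id[OF M]]]])
qed

lemma vprj_lam: "j \<in> J \<Longrightarrow> i \<in> J \<Longrightarrow> vprj C j \<cdot> lam C i = (if i = j then vprj C j else 0)"
proof -
 assume j: "j \<in> J" and i: "i \<in> J"
 have "vprj C j \<cdot> lam C i = (if j = i then \<I> (smp C j) else 0) \<cdot> vprj C i"
  unfolding lam_def by (rule cmp_eq[OF arr_vprj arr_vinj arr_vprj vprj_vinj]) (fact i i j j i)+
 then show ?thesis using i j cmp_zero_left[OF arr_vprj smp_obj] by (auto simp: cmp_id_left[OF arr_vprj])
qed

lemma lam_vinj: "l \<in> J \<Longrightarrow> i \<in> J \<Longrightarrow> lam C i \<cdot> vinj C l = (if i = l then vinj C l else 0)"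
proof -
 assume l: "l \<in> J" and i: "i \<in> J"
 have "lam C i \<cdot> vinj C l = vinj C i \<cdot> (vprj C i \<cdot> vinj C l)"
  unfolding lam_def by (rule cmp_assoc[OF arr_vinj arr_vprj arr_vinj]) (fact l i i)+
 then show ?thesis using i l cmp_zero_right[OF arr_vinj smp_obj]
  by (auto simp: vprj_vinj cmp_id_right[OF arr_vinj])
qed

text \<open>The idempotents of R see the source of an edge from the right and, by
  \<open>edge_lam_left\<close>, its target from the left. This is the form in which the graph
  appears inside the category.\<close>

lemma edge_lam_right:
 assumes p: "p \<in> arcs \<G>" and i: "i \<in> J"
 shows "edge_vec C M p \<cdot> lam C i = (if i = tail \<G> p then edge_vec C M p else 0)"
proof -
 obtain j b l where pe: "p = (j, b, l)" by (cases p)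
 with p have *: "j \<in> J" "l \<in> J" "b \<in> B j l" by auto
 let ?g = "(vinj C l \<star> \<I> M) \<cdot> b"
 have g: "arr (smp C j) (V \<boxtimes> M) ?g"
  by (rule arr_comp[OF arr_edge[OF *] arr_tmor[OF arr_vinj[OF *(2)] arr_id[OF M]]])
 have "edge_vec C M p \<cdot> lam C i = ?g \<cdot> (vprj C j \<cdot> lam C i)"
  unfolding pe edge_vec_def prod.case by (rule cmp_assoc[OF arr_lam[OF i] arr_vprj[OF *(1)] g])
 then show ?thesis
  using cmp_zero_right[OF g V_obj] by (simp add: vprj_lam * i pe edge_vec_def)
qed

lemma edge_lam_left:
 assumes p: "p \<in> arcs \<G>" and i: "i \<in> J"
 shows "(lam C i \<star> \<I> M) \<cdot> edge_vec C M p = (if i = head \<G> p then edge_vec C M p else 0)"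
proof -
 obtain j b l where pe: "p = (j, b, l)" by (cases p)
 with p have *: "j \<in> J" "l \<in> J" "b \<in> B j l" by auto
 note t = arr_vinj[OF *(2)] arr_vprj[OF *(1)] arr_edge[OF *] arr_lam[OF i] ty M
 have "(lam C i \<star> \<I> M) \<cdot> edge_vec C M p = ((lam C i \<star> \<I> M) \<cdot> ((vinj C l \<star> \<I> M) \<cdot> b)) \<cdot> vprj C j"
  unfolding pe edge_vec_def prod.case by (rule cmp_assoc[symmetric]) (rule t)+
 also have "(lam C i \<star> \<I> M) \<cdot> ((vinj C l \<star> \<I> M) \<cdot> b) = ((lam C i \<cdot> vinj C l) \<star> \<I> M) \<cdot> b"
  by (rule cmp_eq[OF _ _ _ tmor_cmp_left]) (rule t)+
 finally show ?thesis
  using * i cmp_zero_left[OF arr_edge[OF *] tobj_closed[OF V_obj M]] cmp_zero_left[OF arr_vprj[OF *(1)] tobj_closed[OF V_obj M]]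
   tmor_zero_left[OF smp_obj[OF *(2)] V_obj arr_id[OF M]]
  by (auto simp: lam_vinj pe edge_vec_def)
qed

text \<open>The block of \<open>v\<close> that maps V_j to V_l (x) M.\<close>

definition component :: "'i \<Rightarrow> 'i \<Rightarrow> 'm \<Rightarrow> 'm" where
 "component j l v = ((vprj C l \<star> \<I> M) \<cdot> v) \<cdot> vinj C j"

lemma arr_component: "\<lbrakk>j \<in> J; l \<in> J; om M v\<rbrakk> \<Longrightarrow> arr (smp C j) (smp C l \<boxtimes> M) (component j l v)"
 unfolding component_def by (rule arr_comp arr_vinj arr_tmor arr_vprj arr_id M | assumption)+

lemma component_linear:
 assumes j: "j \<in> J" and l: "l \<in> J" and v: "om M v" and w: "om M w"
 shows "component j l (v + w) = component j l v + component j l w"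
  and "component j l (scal C a v) = scal C a (component j l v)"
proof -
 have t: "arr (V \<boxtimes> M) (smp C l \<boxtimes> M) (vprj C l \<star> \<I> M)" by (rule arr_tmor arr_vprj l arr_id M)+
 show "component j l (v + w) = component j l v + component j l w"
  unfolding component_def cmp_add_right[OF v w t]
  by (rule cmp_add_left[OF arr_vinj[OF j] arr_comp[OF v t] arr_comp[OF w t]])
 show "component j l (scal C a v) = scal C a (component j l v)"
  unfolding component_def cmp_scal_right[OF v t] by (rule cmp_scal_left[OF arr_vinj[OF j] arr_comp[OF v t]])
qed

lemma component_edge:
 assumes j: "j \<in> J" and l: "l \<in> J" and b: "b \<in> B j l" and j': "j' \<in> J" and l': "l' \<in> J"
 shows "component j' l' (edge_vec C M (j, b, l)) = (if j' = j \<and> l' = l then b else 0)"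
proof -
 note bb = arr_edge[OF j l b]
 note t = arr_vinj[OF l] arr_vprj[OF l'] arr_vprj[OF j] arr_vinj[OF j'] bb ty M
 let ?g = "(vinj C l \<star> \<I> M) \<cdot> b"
 have g: "arr (smp C j) (V \<boxtimes> M) ?g" by (rule t)+
 have "component j' l' (edge_vec C M (j, b, l)) = (vprj C l' \<star> \<I> M) \<cdot> ((?g \<cdot> vprj C j) \<cdot> vinj C j')"
  unfolding component_def edge_vec_def prod.case by (rule cmp_assoc) (rule t)+
 also have "(?g \<cdot> vprj C j) \<cdot> vinj C j' = ?g \<cdot> (vprj C j \<cdot> vinj C j')" by (rule cmp_assoc) (rule t)+
 also have "\<dots> = (if j' = j then ?g else 0)"
  using j j' cmp_zero_right[OF g smp_obj] by (auto simp: vprj_vinj cmp_id_right[OF g])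
 also have "(vprj C l' \<star> \<I> M) \<cdot> \<dots> = (if j' = j then (vprj C l' \<star> \<I> M) \<cdot> ?g else 0)"
  using cmp_zero_right[OF arr_tmor[OF arr_vprj[OF l'] arr_id[OF M]] smp_obj[OF j']] by simp
 also have "(vprj C l' \<star> \<I> M) \<cdot> ?g = ((vprj C l' \<cdot> vinj C l) \<star> \<I> M) \<cdot> b"
  by (rule cmp_eq[OF _ _ _ tmor_cmp_left]) (rule t)+
 also have "\<dots> = (if l' = l then b else 0)"
  using l l' tmor_zero_left[OF smp_obj smp_obj arr_id[OF M]] cmp_zero_left[OF bb tobj_closed[OF smp_obj M]]
   cmp_id_left[OF bb] by (auto simp: vprj_vinj tmor_id smp_obj M)
 finally show ?thesis by auto
qed

lemma component_expand:
 assumes v: "om M v"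
 shows "v = (\<Sum>j\<in>J. \<Sum>l\<in>J. ((vinj C l \<star> \<I> M) \<cdot> component j l v) \<cdot> vprj C j)"
proof -
 have o: "V \<boxtimes> M \<in> obj C" by (rule om_obj[OF v])
 have "v = v \<cdot> \<I> V" using v by (simp add: cmp_id_right)
 also have "\<dots> = (\<Sum>j\<in>J. v \<cdot> lam C j)" unfolding id_V by (rule cmp_sum_right[OF v V_obj arr_lam])
 also have "\<dots> = (\<Sum>j\<in>J. \<Sum>l\<in>J. (lam C l \<star> \<I> M) \<cdot> (v \<cdot> lam C j))"
 proof (intro sum.cong refl)
  fix j assume j: "j \<in> J"
  have vj: "om M (v \<cdot> lam C j)" by (rule arr_comp[OF arr_lam[OF j] v])
  have "v \<cdot> lam C j = (\<I> V \<star> \<I> M) \<cdot> (v \<cdot> lam C j)" using cmp_id_left[OF vj] by (simp add: tmor_id V_obj M)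
  also have "\<I> V \<star> \<I> M = (\<Sum>l\<in>J. lam C l \<star> \<I> M)"
   unfolding id_V by (rule tmor_sum_left[OF V_obj V_obj arr_id[OF M] arr_lam])
  also have "\<dots> \<cdot> (v \<cdot> lam C j) = (\<Sum>l\<in>J. (lam C l \<star> \<I> M) \<cdot> (v \<cdot> lam C j))"
   by (rule cmp_sum_left[OF vj o]) (intro arr_tmor arr_lam arr_id M)
  finally show "v \<cdot> lam C j = (\<Sum>l\<in>J. (lam C l \<star> \<I> M) \<cdot> (v \<cdot> lam C j))" .
 qed
 also have "\<dots> = (\<Sum>j\<in>J. \<Sum>l\<in>J. ((vinj C l \<star> \<I> M) \<cdot> component j l v) \<cdot> vprj C j)"
 proof (intro sum.cong refl)
  fix j l assume j: "j \<in> J" and l: "l \<in> J"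
  note t = arr_vinj[OF l] arr_vprj[OF l] arr_vprj[OF j] arr_vinj[OF j] v ty M
  let ?g = "(vprj C l \<star> \<I> M) \<cdot> v"
  have "((vinj C l \<star> \<I> M) \<cdot> component j l v) \<cdot> vprj C j = (vinj C l \<star> \<I> M) \<cdot> ((?g \<cdot> vinj C j) \<cdot> vprj C j)"
   unfolding component_def by (rule cmp_assoc) (rule t)+
  also have "(?g \<cdot> vinj C j) \<cdot> vprj C j = ?g \<cdot> lam C j" unfolding lam_def by (rule cmp_assoc) (rule t)+
  also have "\<dots> = (vprj C l \<star> \<I> M) \<cdot> (v \<cdot> lam C j)" by (rule cmp_assoc) (rule t arr_lam[OF j])+
  also have "(vinj C l \<star> \<I> M) \<cdot> \<dots> = (lam C l \<star> \<I> M) \<cdot> (v \<cdot> lam C j)"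
   unfolding lam_def[of _ l] by (rule cmp_eq[OF _ _ _ tmor_cmp_left]) (rule t arr_lam[OF j])+
  finally show "(lam C l \<star> \<I> M) \<cdot> (v \<cdot> lam C j) = ((vinj C l \<star> \<I> M) \<cdot> component j l v) \<cdot> vprj C j" by simp
 qed
 finally show ?thesis .
qed

text \<open>As coordinate at the edge \<open>(j, b, l)\<close> serves the coefficient of
  \<open>b\<close> in the block of the vector from \<open>j\<close> to \<open>l\<close>. By
  \<open>component_edge\<close> the blocks of an edge vector are the basis vector itself and
  zeros.\<close>

lemma edge_dual_bases: "dual_bases M (arcs \<G>) (edge_vec C M) (edge_covec C M B)"
proof -
 let ?c = "\<lambda>(j, b, l) v. representation (B j l) (component j l v) b"
 have sp: "component j l v \<in> span (B j l)" if "j \<in> J" "l \<in> J" "om M v" for j l v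
  using arr_component[OF that] edge_basis(2)[OF that(1,2)] by (simp add: arr_def)
 have "dual_bases M (arcs \<G>) (edge_vec C M) (dual_vec C M (edge_vec C M) (arcs \<G>))"
 proof (rule dual_basesI[where c = ?c])
  show "finite (arcs \<G>)" by simp
  show "?c k (v + w) = ?c k v + ?c k w" if k: "k \<in> arcs \<G>" and v: "om M v" and w: "om M w" for k v w
  proof (cases k)
   case (fields j b l)
   with k have *: "j \<in> J" "l \<in> J" by auto
   show ?thesis using representation_add[OF edge_basis(1)[OF *] sp[OF * w] sp[OF * v]]
    by (simp add: fields component_linear[OF * v w])
  qed
  show "?c k (scal C a v) = a * ?c k v" if k: "k \<in> arcs \<G>" and v: "om M v" for k v a
  proof (cases k)
   case (fields j b l)
   with k have *: "j \<in> J" "l \<in> J" by auto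
   show ?thesis using representation_scale[OF edge_basis(1)[OF *] sp[OF * v]]
    by (simp add: fields component_linear[OF * v v])
  qed
  show "?c k (edge_vec C M k') = (if k = k' then 1 else 0)" if "k \<in> arcs \<G>" "k' \<in> arcs \<G>" for k k'
  proof -
   obtain j b l j' b' l' where e: "k = (j, b, l)" "k' = (j', b', l')" by (cases k; cases k')
   with that have *: "j \<in> J" "l \<in> J" "b \<in> B j l" "j' \<in> J" "l' \<in> J" "b' \<in> B j' l'" by auto
   then show ?thesis using representation_basis[OF edge_basis(1)[OF *(1,2)], of b']
    by (auto simp: e component_edge representation_zero)
  qed
  show "v = (\<Sum>k\<in>arcs \<G>. scal C (?c k v) (edge_vec C M k))" if v: "om M v" for v
  proof -
   have "(\<Sum>b\<in>B j l. scal C (?c (j, b, l) v) (edge_vec C M (j, b, l))) =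
     ((vinj C l \<star> \<I> M) \<cdot> component j l v) \<cdot> vprj C j" if jl: "j \<in> J" "l \<in> J" for j l
   proof -
    let ?c = "representation (B j l) (component j l v)" and ?i = "vinj C l \<star> \<I> M"
    have i: "arr (smp C l \<boxtimes> M) (V \<boxtimes> M) ?i" by (intro arr_tmor arr_vinj jl arr_id M)
    note p = arr_vprj[OF jl(1)] and b = arr_edge[OF jl]
    have "component j l v = (\<Sum>b\<in>B j l. scal C (?c b) b)"
     by (rule sum_representation_eq[OF edge_basis(1)[OF jl] sp[OF jl v] edge_basis(3)[OF jl] order_refl, symmetric])
    then have "(?i \<cdot> component j l v) \<cdot> vprj C j = (?i \<cdot> (\<Sum>b\<in>B j l. scal C (?c b) b)) \<cdot> vprj C j" by simp
    also have "?i \<cdot> (\<Sum>b\<in>B j l. scal C (?c b) b) = (\<Sum>b\<in>B j l. ?i \<cdot> scal C (?c b) b)"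
     by (rule cmp_sum_right[OF i smp_obj[OF jl(1)]]) (intro arr_scal b)
    also have "\<dots> \<cdot> vprj C j = (\<Sum>b\<in>B j l. (?i \<cdot> scal C (?c b) b) \<cdot> vprj C j)"
     by (rule cmp_sum_left[OF p tobj_closed[OF V_obj M]]) (intro arr_comp[OF _ i] arr_scal b)
    also have "\<dots> = (\<Sum>b\<in>B j l. scal C (?c b) (edge_vec C M (j, b, l)))"
     using b by (intro sum.cong refl)
      (simp add: cmp_scal_right[OF b i] cmp_scal_left[OF p arr_comp[OF b i]] edge_vec_def)
    finally show ?thesis by simp
   qed
   then have "(\<Sum>k\<in>arcs \<G>. scal C (?c k v) (edge_vec C M k)) =
     (\<Sum>j\<in>J. \<Sum>l\<in>J. ((vinj C l \<star> \<I> M) \<cdot> component j l v) \<cdot> vprj C j)"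
    unfolding sum_arcs by (intro sum.cong refl) auto
   with component_expand[OF v] show ?thesis by (rule trans[OF _ sym])
  qed
 qed (fact M edge_om)+
 then show ?thesis unfolding edge_covec_def .
qed

section \<open>Vectors of paths and their dual bases\<close>

lemma tp_obj: "tp n \<in> obj C"
 by (induction n rule: induct_nat_012) (auto simp: unit_closed M tobj_closed)

lemma tp_Suc: "0 < n \<Longrightarrow> tp (Suc n) = tp n \<boxtimes> M"
 by (cases n) auto

lemma fst_vertex_path [simp]: "fst (vertex_path j) = j"
 by (simp add: vertex_path_def)

lemma pv_vertex: "pv (vertex_path j) = runit_inv C V \<cdot> lam C j"
 by (simp add: path_vec_def vertex_path_def vertex_vec_def)

lemma pv_edge: "pv (edge_path \<G> e) = edge_vec C M e"
 by (simp add: path_vec_def edge_path_def)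

text \<open>Length 0 is excluded for \<open>q\<close>: the vector of a single edge lies in the space
  of \<open>M\<close> and is not a product with a vertex vector, which would lie in that of
  \<open>\<bbbone> \<boxtimes> M\<close>.\<close>

lemma pv_step:
 assumes q: "q \<in> G.P n" and n: "0 < n"
 shows "pv (path_append q (edge_path \<G> e)) = dia (tp n) M (pv q) (edge_vec C M e)"
proof -
 have len: "length (snd q) = n" using q by (rule length_path)
 obtain f fs where f: "rev (snd q) = f # fs" using len n by (cases "rev (snd q)") auto
 have "length (f # fs) = n" using len f by (metis length_rev)
 then show ?thesis using f n len
  by (auto simp: path_vec_def path_append_def edge_path_def dia_def)
qed

definition pd :: "nat \<Rightarrow> ('i, 'i \<times> 'm \<times> 'i) gpath \<Rightarrow> 'm" where
 "pd n = dual_vec C (tp n) pv (G.P n)"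

text \<open>The right unit of \<open>V\<close> identifies vectors and covectors of the unit object
  with elements of R; both families then become the idempotents \<open>lam C j\<close>, and the
  pairing becomes \<open>eps_R\<close> of a product.\<close>

lemma vertex_dual_bases: "dual_bases \<bbbone> (G.P 0) pv (\<lambda>p. lam C (fst p) \<cdot> \<rho>\<^sub>u V)"
 unfolding dual_bases_def
proof (intro conjI ballI allI impI)
 note r = runit_inv(1)[OF V_obj] and s = arr_runit[OF V_obj]
 show "om \<bbbone> (pv p)" if "p \<in> G.P 0" for p
  using that by (auto simp: paths_0 pv_vertex intro!: arr_comp[OF arr_lam r])
 show "od \<bbbone> (lam C (fst p) \<cdot> \<rho>\<^sub>u V)" if "p \<in> G.P 0" for p
  using that by (auto simp: paths_0 intro!: arr_comp[OF s arr_lam])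
 have rr: "\<rho>\<^sub>u V \<cdot> (runit_inv C V \<cdot> f) = f" if f: "arr V V f" for f
  using cmp_eq[OF f r s runit_inv(3)[OF V_obj]] by (simp add: cmp_id_left[OF f])
 show "pairing C (lam C (fst p) \<cdot> \<rho>\<^sub>u V) (pv q) = (if p = q then 1 else 0)" if "p \<in> G.P 0" "q \<in> G.P 0" for p q
 proof -
  from that obtain j l where e: "p = vertex_path j" "q = vertex_path l" "j \<in> J" "l \<in> J" by (auto simp: paths_0)
  have "(lam C j \<cdot> \<rho>\<^sub>u V) \<cdot> (runit_inv C V \<cdot> lam C l) = lam C j \<cdot> lam C l"
   using cmp_assoc[OF arr_comp[OF arr_lam[OF e(4)] r] s arr_lam[OF e(3)]] by (simp add: rr arr_lam e)
  then show ?thesis using e by (simp add: pairing_def pv_vertex lam_mult eps_lam eps_zero)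
 qed
 show "v = (\<Sum>k\<in>G.P 0. scal C (pairing C (lam C (fst k) \<cdot> \<rho>\<^sub>u V) v) (pv k))" if v: "om \<bbbone> v" for v
 proof -
  let ?r = "\<rho>\<^sub>u V \<cdot> v"
  have r': "arr V V ?r" by (rule arr_comp[OF v s])
  have c: "pairing C (lam C j \<cdot> \<rho>\<^sub>u V) v = eps_R C (?r \<cdot> lam C j)" if j: "j \<in> J" for j
   using End_V_lam_commute[OF r' j] by (simp add: pairing_def cmp_assoc[OF v s arr_lam[OF j]])
  have "v = runit_inv C V \<cdot> ?r"
   using cmp_eq[OF v s r runit_inv(2)[OF V_obj]] by (simp add: cmp_id_left[OF v])
  also have "\<dots> = runit_inv C V \<cdot> (\<Sum>j\<in>J. scal C (eps_R C (?r \<cdot> lam C j)) (lam C j))"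
   using End_V_expand[OF r'] by simp
  also have "\<dots> = (\<Sum>j\<in>J. runit_inv C V \<cdot> scal C (eps_R C (?r \<cdot> lam C j)) (lam C j))"
   by (rule cmp_sum_right[OF r V_obj]) (intro arr_scal arr_lam)
  also have "\<dots> = (\<Sum>k\<in>G.P 0. scal C (pairing C (lam C (fst k) \<cdot> \<rho>\<^sub>u V) v) (pv k))"
   unfolding sum_paths_0 graph_simps
   by (intro sum.cong refl) (simp add: pv_vertex c cmp_scal_right[OF arr_lam r])
  finally show ?thesis .
 qed
qed (auto simp: unit_closed)

lemma dual_bases_reindex:
 assumes db: "dual_bases X K (\<lambda>k. e (f k)) (\<lambda>k. d (f k))" and bij: "bij_betw f K K'"
 shows "dual_bases X K' e d"
proof -
 note D = dual_basesD[OF db]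
 have K': "K' = f ` K" and inj: "inj_on f K" using bij by (auto simp: bij_betw_def)
 show ?thesis
  unfolding dual_bases_def K'
 proof (intro conjI allI impI ballI)
  show "v = (\<Sum>k\<in>f ` K. scal C (pairing C (d k) v) (e k))" if "om X v" for v
   using D(6)[OF that] by (simp add: sum.reindex[OF inj])
  show "pairing C (d k) (e l) = (if k = l then 1 else 0)" if "k \<in> f ` K" "l \<in> f ` K" for k l
   using that D(5) inj by (auto simp: inj_on_eq_iff)
 qed (use D(1-4) in auto)
qed

lemma edge_path_dual_bases: "dual_bases M (G.P 1) pv (\<lambda>p. edge_covec C M B (hd (snd p)))"
proof -
 have bij: "bij_betw (edge_path \<G>) (arcs \<G>) (G.P 1)"
  unfolding bij_betw_def using G.paths_1 G.inj_edge_path by blast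
 have "dual_bases M (arcs \<G>) (\<lambda>e. pv (edge_path \<G> e)) (\<lambda>e. edge_covec C M B (hd (snd (edge_path \<G> e))))"
  using edge_dual_bases unfolding pv_edge by (simp add: edge_path_def)
 from dual_bases_reindex[OF this bij] show ?thesis .
qed

text \<open>The source of a path has to be carried along in the induction, since it decides which
  products with a further edge survive. Lengths 0 and 1 are both start cases, because neither power
  is written as a tensor product with \<open>M\<close>.\<close>

lemma path_dual_bases_aux:
 "dual_bases (tp n) (G.P n) pv (pd n) \<and>
  (\<forall>p\<in>G.P n. \<forall>i\<in>J. pv p \<cdot> lam C i = (if i = G.\<sigma> p then pv p else 0))"
proof (induction n rule: induct_nat_012)
 case 0
 have "pv p \<cdot> lam C i = (if i = G.\<sigma> p then pv p else 0)" if "p \<in> G.P 0" and i: "i \<in> J" for p i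
 proof -
  from that obtain j where e: "p = vertex_path j" "j \<in> J" by (auto simp: paths_0)
  note r = runit_inv(1)[OF V_obj]
  have "pv p \<cdot> lam C i = runit_inv C V \<cdot> (lam C j \<cdot> lam C i)"
   unfolding e(1) pv_vertex by (rule cmp_assoc[OF arr_lam[OF i] arr_lam[OF e(2)] r])
  then show ?thesis using e i cmp_zero_right[OF r V_obj] by (auto simp: lam_mult pv_vertex)
 qed
 then show ?case using dual_bases_dual_vec[OF vertex_dual_bases] by (simp add: pd_def)
next
 case 1
 have "pv p \<cdot> lam C i = (if i = G.\<sigma> p then pv p else 0)" if "p \<in> G.P 1" and i: "i \<in> J" for p i
  using that edge_lam_right[OF _ i] by (auto simp: G.paths_1 pv_edge simp del: One_nat_def)
 then show ?case using dual_bases_dual_vec[OF edge_path_dual_bases] by (simp add: pd_def)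
next
 case (ge2 n)
 let ?m = "Suc n"
 note IH = conjunct1[OF ge2(2)] and lamr = bspec[OF bspec[OF conjunct2[OF ge2(2)]]]
 note D = dual_basesD[OF IH] and E = dual_basesD[OF edge_dual_bases]
 have X: "tp ?m \<in> obj C" by (rule tp_obj)
 have tps: "tp (Suc ?m) = tp ?m \<boxtimes> M" by simp
 \<comment> \<open>Stronger than biorthogonality: the composite is determined as an element of R,
   not only its value under \<open>eps_R\<close>. The idempotent at the source is needed for the
   next edge.\<close>
 have pdpv: "pd ?m p \<cdot> pv q = (if p = q then lam C (G.\<sigma> p) else 0)" if p: "p \<in> G.P ?m" and q: "q \<in> G.P ?m" for p q
 proof -
  have r: "arr V V (pd ?m p \<cdot> pv q)" by (rule arr_comp[OF D(3)[OF q] D(4)[OF p]])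
  have s: "G.\<sigma> q \<in> J" using G.path_source_in[OF q] by simp
  have "eps_R C ((pd ?m p \<cdot> pv q) \<cdot> lam C i) = (if p = q \<and> i = G.\<sigma> p then 1 else 0)" if i: "i \<in> J" for i
  proof -
   have "(pd ?m p \<cdot> pv q) \<cdot> lam C i = pd ?m p \<cdot> (pv q \<cdot> lam C i)"
    by (rule cmp_assoc[OF arr_lam[OF i] D(3)[OF q] D(4)[OF p]])
   then show ?thesis using D(5)[OF p q] lamr[OF q i] cmp_zero_right[OF D(4)[OF p] V_obj]
    by (auto simp: pairing_def eps_zero)
  qed
  then have "(\<Sum>i\<in>J. scal C (eps_R C ((pd ?m p \<cdot> pv q) \<cdot> lam C i)) (lam C i)) =
    (\<Sum>i\<in>J. if i = G.\<sigma> q then (if p = q then lam C (G.\<sigma> p) else 0) else 0)"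
   by (intro sum.cong refl) auto
  with End_V_expand[OF r] show ?thesis using s by simp
 qed
 \<comment> \<open>Candidate for the dual basis: the product of the covector of the path without its
   last edge and the covector of that edge.\<close>
 define d where "d p = codia (tp ?m) M (pd ?m (fst p, butlast (snd p))) (edge_covec C M B (last (snd p)))" for p
 have d: "d (path_append q (edge_path \<G> e)) = codia (tp ?m) M (pd ?m q) (edge_covec C M B e)" for q e
  by (simp add: d_def path_append_def edge_path_def)
 have biorth: "pairing C (codia (tp ?m) M (pd ?m q) (edge_covec C M B e)) (dia (tp ?m) M (pv q') (edge_vec C M e')) =
   (if q = q' \<and> e = e' \<and> G.\<sigma> q = head \<G> e' then 1 else 0)"
  if q: "q \<in> G.P ?m" and e: "e \<in> arcs \<G>" and q': "q' \<in> G.P ?m" and e': "e' \<in> arcs \<G>" for q e q' e'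
 proof -
  have s: "G.\<sigma> q \<in> J" using G.path_source_in[OF q] by simp
  have "codia (tp ?m) M (pd ?m q) (edge_covec C M B e) \<cdot> dia (tp ?m) M (pv q') (edge_vec C M e') =
    edge_covec C M B e \<cdot> (((pd ?m q \<cdot> pv q') \<star> \<I> M) \<cdot> edge_vec C M e')"
   by (rule codia_cmp_dia[OF X M D(3)[OF q'] E(3)[OF e'] D(4)[OF q] E(4)[OF e]])
  also have "((pd ?m q \<cdot> pv q') \<star> \<I> M) \<cdot> edge_vec C M e' = (if q = q' \<and> G.\<sigma> q = head \<G> e' then edge_vec C M e' else 0)"
   using edge_lam_left[OF e' s] tmor_zero_left[OF V_obj V_obj arr_id[OF M]]
    cmp_zero_left[OF E(3)[OF e'] om_obj[OF E(3)[OF e']]] by (auto simp: pdpv[OF q q'])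
  finally show ?thesis
   using E(5)[OF e e'] cmp_zero_right[OF E(4)[OF e] V_obj] by (auto simp: pairing_def eps_zero)
 qed
 have dec: "\<exists>q e. q \<in> G.P ?m \<and> e \<in> arcs \<G> \<and> G.\<sigma> q = head \<G> e \<and> p = path_append q (edge_path \<G> e) \<and>
   pv p = dia (tp ?m) M (pv q) (edge_vec C M e) \<and> d p = codia (tp ?m) M (pd ?m q) (edge_covec C M B e)"
  if "p \<in> G.P (Suc ?m)" for p
  using that by (rule G.path_Suc_cases) (use pv_step[of _ ?m] d in blast)
 have "dual_bases (tp (Suc ?m)) (G.P (Suc ?m)) pv d"
  unfolding dual_bases_def
 proof (intro conjI ballI allI impI)
  show "om (tp (Suc ?m)) (pv p)" if "p \<in> G.P (Suc ?m)" for p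
   using dec[OF that] arr_dia[OF X M D(3) E(3)] by auto
  show dd: "od (tp (Suc ?m)) (d p)" if "p \<in> G.P (Suc ?m)" for p
   using dec[OF that] arr_codia[OF X M D(4) E(4)] by auto
  show bi: "pairing C (d p) (pv p') = (if p = p' then 1 else 0)" if p: "p \<in> G.P (Suc ?m)" and p': "p' \<in> G.P (Suc ?m)" for p p'
  proof -
   obtain q e q' e' where "q \<in> G.P ?m" "e \<in> arcs \<G>" "G.\<sigma> q = head \<G> e" and pp: "p = path_append q (edge_path \<G> e)"
    and "d p = codia (tp ?m) M (pd ?m q) (edge_covec C M B e)"
    and "q' \<in> G.P ?m" "e' \<in> arcs \<G>" "G.\<sigma> q' = head \<G> e'" and pp': "p' = path_append q' (edge_path \<G> e')"
    and "pv p' = dia (tp ?m) M (pv q') (edge_vec C M e')"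
    using dec[OF p] dec[OF p'] by blast
   moreover from this have "p = p' \<longleftrightarrow> q = q' \<and> edge_path \<G> e = edge_path \<G> e'"
    unfolding pp pp' by (intro path_append_cancel) auto
   moreover have "edge_path \<G> e = edge_path \<G> e' \<longleftrightarrow> e = e'" by (auto simp: edge_path_def)
   ultimately show ?thesis using biorth[of q e q' e'] by simp
  qed
  show "v = (\<Sum>k\<in>G.P (Suc ?m). scal C (pairing C (d k) v) (pv k))" if v: "om (tp (Suc ?m)) v" for v
  proof -
   \<comment> \<open>The expansion to be proved equal to the identity. By linearity it suffices to
     treat products of a path vector and an edge vector, which span.\<close>
   define S where "S u = (\<Sum>k\<in>G.P (Suc ?m). scal C (pairing C (d k) u) (pv k))" for u
   have "v \<in> span ((\<lambda>(k, l). dia (tp ?m) M (pv k) (edge_vec C M l)) ` (G.P ?m \<times> arcs \<G>))"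
    using dia_in_span[OF IH edge_dual_bases] v by simp
   then have "om (tp (Suc ?m)) v \<and> v = S v"
   proof (rule span_induct)
    have o: "V \<boxtimes> tp (Suc ?m) \<in> obj C" by (rule om_obj[OF v])
    have "S (u + w) = S u + S w" "S (scal C c u) = scal C c (S u)"
     if "om (tp (Suc ?m)) u" "om (tp (Suc ?m)) w" for u w c
     unfolding S_def using that
     by (simp_all add: pairing_add_right[OF dd] pairing_scal_right[OF dd] scale_left_distrib sum.distrib scale_sum_right)
    moreover have "S 0 = 0" unfolding S_def by (simp add: pairing_zero_right[OF dd])
    ultimately show "subspace {v. om (tp (Suc ?m)) v \<and> v = S v}"
     unfolding subspace_def using arr_zero[OF V_obj o] by (simp add: arr_add arr_scal del: tensor_power.simps)
    fix u assume "u \<in> (\<lambda>(k, l). dia (tp ?m) M (pv k) (edge_vec C M l)) ` (G.P ?m \<times> arcs \<G>)"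
    then obtain q e where qe: "q \<in> G.P ?m" "e \<in> arcs \<G>" and u: "u = dia (tp ?m) M (pv q) (edge_vec C M e)" by auto
    have uo: "om (tp (Suc ?m)) u" unfolding u tps by (rule arr_dia[OF X M D(3)[OF qe(1)] E(3)[OF qe(2)]])
    show "om (tp (Suc ?m)) u \<and> u = S u"
    proof (cases "G.\<sigma> q = head \<G> e")
     case True
     let ?p = "path_append q (edge_path \<G> e)"
     have p: "?p \<in> G.P (Suc ?m)" using path_append_in[OF qe(1) G.edge_path_in[OF qe(2)]] True by simp
     have up: "u = pv ?p" unfolding u using pv_step[OF qe(1)] by simp
     have "S u = (\<Sum>k\<in>G.P (Suc ?m). if k = ?p then pv ?p else 0)"
      unfolding S_def up by (intro sum.cong refl) (auto simp: bi[OF _ p])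
     then show ?thesis using p uo by (simp add: up del: tensor_power.simps)
    next
     case False
     \<comment> \<open>The idempotent at the source of \<open>q\<close> may be inserted for free;
       moved across the product it kills an edge with a different target.\<close>
     have "u = dia (tp ?m) M (pv q \<cdot> lam C (G.\<sigma> q)) (edge_vec C M e)"
      unfolding u using lamr[OF qe(1), of "G.\<sigma> q"] G.path_source_in[OF qe(1)] by simp
     also have "\<dots> = dia (tp ?m) M (pv q) ((lam C (G.\<sigma> q) \<star> \<I> M) \<cdot> edge_vec C M e)"
      by (rule dia_balanced[OF X M D(3)[OF qe(1)] arr_lam E(3)[OF qe(2)]]) (use G.path_source_in[OF qe(1)] in simp)
     also have "\<dots> = 0"
      using False edge_lam_left[OF qe(2), of "G.\<sigma> q"] G.path_source_in[OF qe(1)] dia_zero(1)[OF X M D(3)[OF qe(1)]] by simp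
     finally have "u = 0" .
     then show ?thesis using uo \<open>S 0 = 0\<close> by simp
    qed
   qed
   then show ?thesis unfolding S_def by blast
  qed
 qed (simp_all add: tp_obj del: tensor_power.simps)
 from dual_bases_dual_vec[OF this] have "dual_bases (tp (Suc ?m)) (G.P (Suc ?m)) pv (pd (Suc ?m))"
  unfolding pd_def .
 moreover have "pv p \<cdot> lam C i = (if i = G.\<sigma> p then pv p else 0)" if p: "p \<in> G.P (Suc ?m)" and i: "i \<in> J" for p i
 proof -
  obtain q e where *: "q \<in> G.P ?m" "e \<in> arcs \<G>" "G.\<sigma> q = head \<G> e" "p = path_append q (edge_path \<G> e)"
   "pv p = dia (tp ?m) M (pv q) (edge_vec C M e)" using dec[OF p] by blast
  have "pv p \<cdot> lam C i = dia (tp ?m) M (pv q) (edge_vec C M e \<cdot> lam C i)"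
   unfolding *(5) by (rule dia_cmp_right[OF X M D(3)[OF *(1)] arr_lam[OF i] E(3)[OF *(2)]])
  moreover have "G.\<sigma> p = tail \<G> e" using *(3,4) by (simp add: path_source_append)
  ultimately show ?thesis
   using edge_lam_right[OF *(2) i] dia_zero(1)[OF X M D(3)[OF *(1)]] *(5) by auto
 qed
 ultimately show ?case by blast
qed

lemma path_dual_bases: "dual_bases (tp n) (G.P n) pv (pd n)"
 using path_dual_bases_aux by blast

lemma pv_lam: "p \<in> G.P n \<Longrightarrow> i \<in> J \<Longrightarrow> pv p \<cdot> lam C i = (if i = G.\<sigma> p then pv p else 0)"
 using path_dual_bases_aux by blast

lemmas pv_om = dual_basesD(3)[OF path_dual_bases]
 and pd_od = dual_basesD(4)[OF path_dual_bases]
 and pd_pv = dual_basesD(5)[OF path_dual_bases]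

lemma pd_cmp_pv:
 assumes p: "p \<in> G.P n" and q: "q \<in> G.P n"
 shows "pd n p \<cdot> pv q = (if p = q then lam C (G.\<sigma> p) else 0)"
proof -
 have r: "arr V V (pd n p \<cdot> pv q)" by (rule arr_comp[OF pv_om[OF q] pd_od[OF p]])
 have s: "G.\<sigma> q \<in> J" using G.path_source_in[OF q] by simp
 have "eps_R C ((pd n p \<cdot> pv q) \<cdot> lam C i) = (if p = q \<and> i = G.\<sigma> p then 1 else 0)" if i: "i \<in> J" for i
 proof -
  have "(pd n p \<cdot> pv q) \<cdot> lam C i = pd n p \<cdot> (pv q \<cdot> lam C i)"
   by (rule cmp_assoc[OF arr_lam[OF i] pv_om[OF q] pd_od[OF p]])
  then show ?thesis using pd_pv[OF p q] pv_lam[OF q i] cmp_zero_right[OF pd_od[OF p] V_obj]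
   by (auto simp: pairing_def eps_zero)
 qed
 then have "(\<Sum>i\<in>J. scal C (eps_R C ((pd n p \<cdot> pv q) \<cdot> lam C i)) (lam C i)) =
   (\<Sum>i\<in>J. if i = G.\<sigma> q then (if p = q then lam C (G.\<sigma> p) else 0) else 0)"
  by (intro sum.cong refl) auto
 with End_V_expand[OF r] show ?thesis using s by simp
qed

lemma dia_edge_zero:
 assumes q: "q \<in> G.P n" and e: "e \<in> arcs \<G>" and ne: "G.\<sigma> q \<noteq> head \<G> e"
 shows "dia (tp n) M (pv q) (edge_vec C M e) = 0"
proof -
 have s: "G.\<sigma> q \<in> J" using G.path_source_in[OF q] by simp
 have "dia (tp n) M (pv q) (edge_vec C M e) = dia (tp n) M (pv q \<cdot> lam C (G.\<sigma> q)) (edge_vec C M e)"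
  using pv_lam[OF q s] by simp
 also have "\<dots> = dia (tp n) M (pv q) ((lam C (G.\<sigma> q) \<star> \<I> M) \<cdot> edge_vec C M e)"
  by (rule dia_balanced[OF tp_obj M pv_om[OF q] arr_lam[OF s] edge_om[OF e]])
 also have "\<dots> = 0"
  using ne edge_lam_left[OF e s] dia_zero(1)[OF tp_obj M pv_om[OF q]] by simp
 finally show ?thesis .
qed

section \<open>Products of path vectors and concatenation\<close>

lemma lam_dia:
 assumes X: "X \<in> obj C" and Y: "Y \<in> obj C" and r: "arr V V r" and v: "om X v" and w: "om Y w"
 shows "(r \<star> \<I> (X \<boxtimes> Y)) \<cdot> dia X Y v w = dia X Y ((r \<star> \<I> X) \<cdot> v) w"
proof -
 note t = ty X Y r v w
 have nat: "(r \<star> \<I> (X \<boxtimes> Y)) \<cdot> \<alpha>\<^sub>u V X Y = \<alpha>\<^sub>u V X Y \<cdot> ((r \<star> \<I> X) \<star> \<I> Y)"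
  using assoc_nat[OF r arr_id[OF X] arr_id[OF Y]] by (simp add: tmor_id X Y)
 have "(r \<star> \<I> (X \<boxtimes> Y)) \<cdot> dia X Y v w = \<alpha>\<^sub>u V X Y \<cdot> (((r \<star> \<I> X) \<star> \<I> Y) \<cdot> ((v \<star> \<I> Y) \<cdot> w))"
  unfolding dia_alt[OF X Y v w] by (rule cmp_swap[OF _ _ _ _ _ nat]) (rule t)+
 also have "((r \<star> \<I> X) \<star> \<I> Y) \<cdot> ((v \<star> \<I> Y) \<cdot> w) = (((r \<star> \<I> X) \<cdot> v) \<star> \<I> Y) \<cdot> w"
  by (rule cmp_eq[OF w _ _ tmor_cmp_left]) (rule t)+
 also have "\<alpha>\<^sub>u V X Y \<cdot> \<dots> = dia X Y ((r \<star> \<I> X) \<cdot> v) w"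
  by (rule dia_alt[symmetric]) (rule t)+
 finally show ?thesis .
qed

text \<open>The left action of R passes to the first factor of a product, so it sees only the
  beginning of a path.\<close>

lemma pv_lam_left:
 "\<forall>p\<in>G.P n. \<forall>i\<in>J. (lam C i \<star> \<I> (tp n)) \<cdot> pv p = (if i = G.\<tau> p then pv p else 0)"
proof (induction n rule: induct_nat_012)
 case 0
 have "(lam C i \<star> \<I> \<bbbone>) \<cdot> pv p = (if i = G.\<tau> p then pv p else 0)" if "p \<in> G.P 0" and i: "i \<in> J" for p i
 proof -
  from that obtain j where e: "p = vertex_path j" "j \<in> J" by (auto simp: paths_0)
  note r = runit_inv(1)[OF V_obj] and s = arr_runit[OF V_obj] and l = arr_lam[OF i] and lj = arr_lam[OF e(2)]
  have li: "arr (V \<boxtimes> \<bbbone>) (V \<boxtimes> \<bbbone>) (lam C i \<star> \<I> \<bbbone>)" by (intro arr_tmor l arr_id unit_closed)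
  have pj: "om \<bbbone> (runit_inv C V \<cdot> lam C j)" by (rule arr_comp[OF lj r])
  have x: "om \<bbbone> ((lam C i \<star> \<I> \<bbbone>) \<cdot> (runit_inv C V \<cdot> lam C j))" by (rule arr_comp[OF pj li])
  have rr: "\<rho>\<^sub>u V \<cdot> (runit_inv C V \<cdot> lam C j) = lam C j"
   using cmp_eq[OF lj r s runit_inv(3)[OF V_obj]] by (simp add: cmp_id_left[OF lj])
  have "(lam C i \<star> \<I> \<bbbone>) \<cdot> (runit_inv C V \<cdot> lam C j) = runit_inv C V \<cdot> (\<rho>\<^sub>u V \<cdot> ((lam C i \<star> \<I> \<bbbone>) \<cdot> (runit_inv C V \<cdot> lam C j)))"
   using cmp_eq[OF x s r runit_inv(2)[OF V_obj]] by (simp add: cmp_id_left[OF x])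
  also have "\<rho>\<^sub>u V \<cdot> ((lam C i \<star> \<I> \<bbbone>) \<cdot> (runit_inv C V \<cdot> lam C j)) = lam C i \<cdot> (\<rho>\<^sub>u V \<cdot> (runit_inv C V \<cdot> lam C j))"
   by (rule cmp_swap[OF pj li s s l runit_nat[OF l]])
  finally show ?thesis
   using i e cmp_zero_right[OF r V_obj] by (auto simp: rr lam_mult pv_vertex)
 qed
 then show ?case by simp
next
 case 1
 show ?case using edge_lam_left by (auto simp: G.paths_1[unfolded One_nat_def] pv_edge)
next
 case (ge2 n)
 have tps: "tp (Suc (Suc n)) = tp (Suc n) \<boxtimes> M" by simp
 show ?case
 proof (intro ballI)
  fix p i assume p: "p \<in> G.P (Suc (Suc n))" and i: "i \<in> J"
  from p obtain q e where q: "q \<in> G.P (Suc n)" and e: "e \<in> arcs \<G>" and pp: "p = path_append q (edge_path \<G> e)"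
   by (rule G.path_Suc_cases)
  have pvp: "pv p = dia (tp (Suc n)) M (pv q) (edge_vec C M e)" unfolding pp by (rule pv_step[OF q]) simp
  have "(lam C i \<star> \<I> (tp (Suc (Suc n)))) \<cdot> pv p = dia (tp (Suc n)) M ((lam C i \<star> \<I> (tp (Suc n))) \<cdot> pv q) (edge_vec C M e)"
   unfolding pvp tps by (rule lam_dia[OF tp_obj M arr_lam[OF i] pv_om[OF q] edge_om[OF e]])
  also have "(lam C i \<star> \<I> (tp (Suc n))) \<cdot> pv q = (if i = G.\<tau> q then pv q else 0)" using ge2(2) q i by blast
  finally show "(lam C i \<star> \<I> (tp (Suc (Suc n)))) \<cdot> pv p = (if i = G.\<tau> p then pv p else 0)"
   using dia_zero(2)[OF tp_obj M edge_om[OF e]] by (auto simp: pp pvp[unfolded pp])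
 qed
qed

text \<open>The isomorphisms $M^{\otimes n}\otimes M^{\otimes m}\to M^{\otimes(n+m)}$ send products of path
 vectors to the vectors of the concatenated paths; only their existence matters.\<close>

lemma tensor_power_iso:
 "\<exists>f. arr (tp n \<boxtimes> tp m) (tp (n + m)) f \<and> (\<forall>p\<in>G.P n. \<forall>r\<in>G.P m.
   omega_map C f (dia (tp n) (tp m) (pv p) (pv r)) =
    (if G.\<sigma> p = G.\<tau> r then pv (path_append p r) else 0))"
proof (induction m rule: induct_nat_012)
 case 0
 have "omega_map C (\<rho>\<^sub>u (tp n)) (dia (tp n) \<bbbone> (pv p) (pv r)) =
   (if G.\<sigma> p = G.\<tau> r then pv (path_append p r) else 0)" if p: "p \<in> G.P n" and r: "r \<in> G.P 0" for p r
 proof -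
  from r obtain j where j: "r = vertex_path j" "j \<in> J" by (auto simp: paths_0)
  show ?thesis unfolding j(1) pv_vertex dia_unit_right[OF tp_obj pv_om[OF p] arr_lam[OF j(2)]]
   using pv_lam[OF p j(2)] by auto
 qed
 then show ?case using arr_runit[OF tp_obj[of n]] by auto
next
 case 1
 show ?case
 proof (cases "n = 0")
  case True
  have "omega_map C (\<lambda>\<^sub>u M) (dia \<bbbone> M (pv p) (pv r)) =
    (if G.\<sigma> p = G.\<tau> r then pv (path_append p r) else 0)" if p: "p \<in> G.P 0" and r: "r \<in> G.P 1" for p r
  proof -
   from p obtain j where j: "p = vertex_path j" "j \<in> J" by (auto simp: paths_0)
   from r obtain e where e: "r = edge_path \<G> e" "e \<in> arcs \<G>" by (auto simp: G.paths_1 simp del: One_nat_def)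
   show ?thesis unfolding j(1) e(1) pv_vertex pv_edge dia_unit_left[OF M arr_lam[OF j(2)] edge_om[OF e(2)]]
    using edge_lam_left[OF e(2) j(2)] by (auto simp: path_append_vertex pv_edge)
  qed
  then show ?thesis using arr_lunit[OF M] True by auto
 next
  case False
  have "omega_map C (\<I> (tp n \<boxtimes> M)) (dia (tp n) M (pv p) (pv r)) =
    (if G.\<sigma> p = G.\<tau> r then pv (path_append p r) else 0)" if p: "p \<in> G.P n" and r: "r \<in> G.P 1" for p r
  proof -
   from r obtain e where e: "r = edge_path \<G> e" "e \<in> arcs \<G>" by (auto simp: G.paths_1 simp del: One_nat_def)
   have o: "om (tp n \<boxtimes> M) (dia (tp n) M (pv p) (pv r))"
    unfolding e(1) pv_edge by (rule arr_dia[OF tp_obj M pv_om[OF p] edge_om[OF e(2)]])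
   have "omega_map C (\<I> (tp n \<boxtimes> M)) (dia (tp n) M (pv p) (pv r)) = dia (tp n) M (pv p) (pv r)"
    unfolding omega_map_def using cmp_id_left[OF o] by (simp add: tmor_id V_obj tobj_closed tp_obj M)
   then show ?thesis
    using pv_step[OF p, of e] False dia_edge_zero[OF p e(2)] by (auto simp: e(1) pv_edge)
  qed
  moreover have "arr (tp n \<boxtimes> M) (tp (Suc n)) (\<I> (tp n \<boxtimes> M))"
   using False by (simp add: tp_Suc arr_id tobj_closed tp_obj M)
  ultimately show ?thesis by auto
 qed
next
 case (ge2 m)
 let ?m = "Suc m"
 obtain f where f: "arr (tp n \<boxtimes> tp ?m) (tp (n + ?m)) f"
  and fe: "\<And>p r. p \<in> G.P n \<Longrightarrow> r \<in> G.P ?m \<Longrightarrow> omega_map C f (dia (tp n) (tp ?m) (pv p) (pv r)) =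
    (if G.\<sigma> p = G.\<tau> r then pv (path_append p r) else 0)" using ge2(2) by blast
 note X = tp_obj[of n] and Y = tp_obj[of ?m]
 let ?a = "assoc_inv C (tp n) (tp ?m) M"
 \<comment> \<open>Powers are bracketed to the left, so the inverse associator separates the last
   factor \<open>M\<close> before the map from the induction hypothesis is applied to the
   rest.\<close>
 let ?f = "(f \<star> \<I> M) \<cdot> ?a"
 have fM: "arr ((tp n \<boxtimes> tp ?m) \<boxtimes> M) (tp (n + ?m) \<boxtimes> M) (f \<star> \<I> M)" by (rule arr_tmor[OF f arr_id[OF M]])
 note a = assoc_inv(1)[OF X Y M]
 have tps: "tp (Suc ?m) = tp ?m \<boxtimes> M" "tp (n + Suc ?m) = tp (n + ?m) \<boxtimes> M" by (simp_all add: tp_Suc)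
 have "arr (tp n \<boxtimes> tp (Suc ?m)) (tp (n + Suc ?m)) ?f" unfolding tps by (rule arr_comp[OF a fM])
 moreover have "omega_map C ?f (dia (tp n) (tp (Suc ?m)) (pv p) (pv r)) =
   (if G.\<sigma> p = G.\<tau> r then pv (path_append p r) else 0)" if p: "p \<in> G.P n" and r: "r \<in> G.P (Suc ?m)" for p r
 proof -
  from r obtain q e where q: "q \<in> G.P ?m" and e: "e \<in> arcs \<G>" and qe: "G.\<sigma> q = head \<G> e" and rr: "r = path_append q (edge_path \<G> e)"
   by (rule G.path_Suc_cases)
  note P = pv_om[OF p] and Q = pv_om[OF q] and E = edge_om[OF e]
  have "pv r = dia (tp ?m) M (pv q) (edge_vec C M e)" unfolding rr by (rule pv_step[OF q]) simp
  let ?u = "dia (tp n \<boxtimes> tp ?m) M (dia (tp n) (tp ?m) (pv p) (pv q)) (edge_vec C M e)"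
  have e1: "dia (tp n) (tp (Suc ?m)) (pv p) (pv r) = omega_map C (\<alpha>\<^sub>u (tp n) (tp ?m) M) ?u"
   unfolding tps \<open>pv r = _\<close> by (rule dia_assoc[OF X Y M P Q E, symmetric])
  have e2: "omega_map C ?f (omega_map C (\<alpha>\<^sub>u (tp n) (tp ?m) M) ?u) = omega_map C (f \<star> \<I> M) ?u"
  proof -
   have u: "om ((tp n \<boxtimes> tp ?m) \<boxtimes> M) ?u" by (rule arr_dia[OF tobj_closed[OF X Y] M arr_dia[OF X Y P Q] E])
   note al = arr_assoc[OF X Y M]
   have "?f \<cdot> \<alpha>\<^sub>u (tp n) (tp ?m) M = (f \<star> \<I> M) \<cdot> (?a \<cdot> \<alpha>\<^sub>u (tp n) (tp ?m) M)"
    by (rule cmp_assoc[OF al a fM])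
   then have fa: "?f \<cdot> \<alpha>\<^sub>u (tp n) (tp ?m) M = f \<star> \<I> M"
    by (simp only: assoc_inv(2)[OF X Y M] cmp_id_right[OF fM])
   have "(\<I> V \<star> ?f) \<cdot> (\<I> V \<star> \<alpha>\<^sub>u (tp n) (tp ?m) M) = \<I> V \<star> (f \<star> \<I> M)"
    using tmor_cmp_right[OF al arr_comp[OF a fM] V_obj] by (simp only: fa)
   from cmp_eq[OF u arr_tmor[OF arr_id[OF V_obj] al] arr_tmor[OF arr_id[OF V_obj] arr_comp[OF a fM]] this]
   show ?thesis by (simp only: omega_map_def)
  qed
  have e3: "omega_map C (f \<star> \<I> M) ?u = dia (tp (n + ?m)) M (omega_map C f (dia (tp n) (tp ?m) (pv p) (pv q))) (edge_vec C M e)"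
   by (rule omega_map_dia_left[OF M f arr_dia[OF X Y P Q] E])
  have e4: "dia (tp (n + ?m)) M (omega_map C f (dia (tp n) (tp ?m) (pv p) (pv q))) (edge_vec C M e) =
    (if G.\<sigma> p = G.\<tau> r then pv (path_append p r) else 0)"
  proof (cases "G.\<sigma> p = G.\<tau> q")
   case True
   have "pv (path_append p r) = dia (tp (n + ?m)) M (pv (path_append p q)) (edge_vec C M e)"
    unfolding rr path_append_assoc[symmetric] by (rule pv_step[OF path_append_in[OF p q True]]) simp
   moreover have "G.\<tau> r = G.\<tau> q" unfolding rr by simp
   ultimately show ?thesis by (simp only: fe[OF p q] True if_True simp_thms)
  next
   case False
   then show ?thesis by (simp add: fe[OF p q] rr dia_zero(2)[OF tp_obj M E])
  qed
  show ?thesis unfolding e1 by (rule trans[OF e2 trans[OF e3 e4]])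
 qed
 ultimately show ?case by blast
qed

text \<open>The counterpart of the equation for \<open>dia\<close>, with the same \<open>f\<close>
  now acting on the covector. In a symbol of the coend, \<open>f\<close> can then be moved to the
  vector, where it produces the concatenated path; this is what multiplicativity of the surjection
  comes down to.\<close>

lemma codia_pd:
 assumes f: "arr (tp n \<boxtimes> tp m) (tp (n + m)) f"
  and fe: "\<And>p r. p \<in> G.P n \<Longrightarrow> r \<in> G.P m \<Longrightarrow> omega_map C f (dia (tp n) (tp m) (pv p) (pv r)) =
    (if G.\<sigma> p = G.\<tau> r then pv (path_append p r) else 0)"
  and p: "p \<in> G.P n" and r: "r \<in> G.P m"
 shows "codia (tp n) (tp m) (pd n p) (pd m r) =
  (if G.\<sigma> p = G.\<tau> r then pd (n + m) (path_append p r) \<cdot> (\<I> V \<star> f) else 0)"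
proof (rule dia_dual_eqI[OF path_dual_bases path_dual_bases])
 note X = tp_obj[of n] and Y = tp_obj[of m]
 have o: "V \<boxtimes> (tp n \<boxtimes> tp m) \<in> obj C" by (intro tobj_closed V_obj X Y)
 have pr: "path_append p r \<in> G.P (n + m)" if "G.\<sigma> p = G.\<tau> r" by (rule path_append_in[OF p r that])
 show "od (tp n \<boxtimes> tp m) (codia (tp n) (tp m) (pd n p) (pd m r))"
  by (rule arr_codia[OF X Y pd_od[OF p] pd_od[OF r]])
 show "od (tp n \<boxtimes> tp m) (if G.\<sigma> p = G.\<tau> r then pd (n + m) (path_append p r) \<cdot> (\<I> V \<star> f) else 0)"
  using omega_comap_arr[OF f pd_od[OF pr]] arr_zero[OF o V_obj] by simp
 fix q s assume q: "q \<in> G.P n" and s: "s \<in> G.P m"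
 note d = arr_dia[OF X Y pv_om[OF q] pv_om[OF s]]
 have J: "G.\<sigma> p \<in> J" using G.path_source_in[OF p] by simp
 have "pairing C (if G.\<sigma> p = G.\<tau> r then pd (n + m) (path_append p r) \<cdot> (\<I> V \<star> f) else 0) (dia (tp n) (tp m) (pv q) (pv s)) =
   (if p = q \<and> r = s \<and> G.\<sigma> p = G.\<tau> r then 1 else 0)"
 proof (cases "G.\<sigma> p = G.\<tau> r")
  case True
  show ?thesis
  proof (cases "G.\<sigma> q = G.\<tau> s")
   case True': True
   have "path_append p r = path_append q s \<longleftrightarrow> p = q \<and> r = s"
    by (rule path_append_cancel[OF p q True True'])
   then show ?thesis
    using True True' pd_pv[OF pr[OF True] path_append_in[OF q s True']]
    by (simp add: omega_map_adjoint[OF d f pd_od[OF pr[OF True]]] fe[OF q s])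
  next
   case False
   then show ?thesis using True pairing_zero_right[OF pd_od[OF pr[OF True]]]
    by (auto simp: omega_map_adjoint[OF d f pd_od[OF pr[OF True]]] fe[OF q s])
  qed
 qed (simp add: pairing_zero_left[OF d])
 moreover have "pairing C (codia (tp n) (tp m) (pd n p) (pd m r)) (dia (tp n) (tp m) (pv q) (pv s)) =
   (if p = q \<and> r = s \<and> G.\<sigma> p = G.\<tau> r then 1 else 0)"
 proof -
  have "codia (tp n) (tp m) (pd n p) (pd m r) \<cdot> dia (tp n) (tp m) (pv q) (pv s) =
    pd m r \<cdot> (((pd n p \<cdot> pv q) \<star> \<I> (tp m)) \<cdot> pv s)"
   by (rule codia_cmp_dia[OF X Y pv_om[OF q] pv_om[OF s] pd_od[OF p] pd_od[OF r]])
  also have "((pd n p \<cdot> pv q) \<star> \<I> (tp m)) \<cdot> pv s = (if p = q \<and> G.\<sigma> p = G.\<tau> s then pv s else 0)"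
   using bspec[OF bspec[OF pv_lam_left s] J] tmor_zero_left[OF V_obj V_obj arr_id[OF Y]]
    cmp_zero_left[OF pv_om[OF s] om_obj[OF pv_om[OF s]]] by (auto simp: pd_cmp_pv[OF p q])
  finally show ?thesis
   using pd_pv[OF r s] cmp_zero_right[OF pd_od[OF r] V_obj] by (auto simp: pairing_def eps_zero)
 qed
 ultimately show "pairing C (codia (tp n) (tp m) (pd n p) (pd m r)) (dia (tp n) (tp m) (pv q) (pv s)) =
   pairing C (if G.\<sigma> p = G.\<tau> r then pd (n + m) (path_append p r) \<cdot> (\<I> V \<star> f) else 0) (dia (tp n) (tp m) (pv q) (pv s))"
  by simp
qed

end

section \<open>The coend as a Weak Bialgebra\<close>

context semisimple_monoidal
begin

abbreviation CF where "CF \<equiv> coend_free C"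

abbreviation symb where "symb \<equiv> coend_symbols C"

abbreviation CR where "CR \<equiv> coend_relations C"

lemma symb_iff: "(X, \<theta>, v) \<in> symb \<longleftrightarrow> X \<in> obj C \<and> od X \<theta> \<and> om X v"
 by (auto simp: coend_symbols_def omega_iff omega_dual_iff)

text \<open>The linear forms on the coend, given by their values on symbols: bilinear in covector
  and vector, and dinatural in the object.\<close>

definition coend_form :: "('o \<times> 'm \<times> 'm \<Rightarrow> 'k) \<Rightarrow> bool" where
 "coend_form \<phi> \<longleftrightarrow>
   (\<forall>X \<theta> \<theta>' v. X \<in> obj C \<and> od X \<theta> \<and> od X \<theta>' \<and> om X v \<longrightarrow> \<phi> (X, \<theta> + \<theta>', v) = \<phi> (X, \<theta>, v) + \<phi> (X, \<theta>', v)) \<and>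
   (\<forall>X \<theta> v v'. X \<in> obj C \<and> od X \<theta> \<and> om X v \<and> om X v' \<longrightarrow> \<phi> (X, \<theta>, v + v') = \<phi> (X, \<theta>, v) + \<phi> (X, \<theta>, v')) \<and>
   (\<forall>X c \<theta> v. X \<in> obj C \<and> od X \<theta> \<and> om X v \<longrightarrow> \<phi> (X, scal C c \<theta>, v) = c * \<phi> (X, \<theta>, v)) \<and>
   (\<forall>X c \<theta> v. X \<in> obj C \<and> od X \<theta> \<and> om X v \<longrightarrow> \<phi> (X, \<theta>, scal C c v) = c * \<phi> (X, \<theta>, v)) \<and>
   (\<forall>X Y f \<zeta> v. arr X Y f \<and> od Y \<zeta> \<and> om X v \<longrightarrow> \<phi> (Y, \<zeta>, omega_map C f v) = \<phi> (X, \<zeta> \<cdot> (\<I> V \<star> f), v))"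

lemma coend_formI:
 assumes "\<And>X \<theta> \<theta>' v. \<lbrakk>X \<in> obj C; od X \<theta>; od X \<theta>'; om X v\<rbrakk> \<Longrightarrow> \<phi> (X, \<theta> + \<theta>', v) = \<phi> (X, \<theta>, v) + \<phi> (X, \<theta>', v)"
  and "\<And>X \<theta> v v'. \<lbrakk>X \<in> obj C; od X \<theta>; om X v; om X v'\<rbrakk> \<Longrightarrow> \<phi> (X, \<theta>, v + v') = \<phi> (X, \<theta>, v) + \<phi> (X, \<theta>, v')"
  and "\<And>X c \<theta> v. \<lbrakk>X \<in> obj C; od X \<theta>; om X v\<rbrakk> \<Longrightarrow> \<phi> (X, scal C c \<theta>, v) = c * \<phi> (X, \<theta>, v)"
  and "\<And>X c \<theta> v. \<lbrakk>X \<in> obj C; od X \<theta>; om X v\<rbrakk> \<Longrightarrow> \<phi> (X, \<theta>, scal C c v) = c * \<phi> (X, \<theta>, v)"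
  and "\<And>X Y f \<zeta> v. \<lbrakk>arr X Y f; od Y \<zeta>; om X v\<rbrakk> \<Longrightarrow> \<phi> (Y, \<zeta>, omega_map C f v) = \<phi> (X, \<zeta> \<cdot> (\<I> V \<star> f), v)"
 shows "coend_form \<phi>"
 unfolding coend_form_def using assms by auto

lemma coend_formD:
 assumes "coend_form \<phi>"
 shows "\<And>X \<theta> \<theta>' v. \<lbrakk>X \<in> obj C; od X \<theta>; od X \<theta>'; om X v\<rbrakk> \<Longrightarrow> \<phi> (X, \<theta> + \<theta>', v) = \<phi> (X, \<theta>, v) + \<phi> (X, \<theta>', v)"
  and "\<And>X \<theta> v v'. \<lbrakk>X \<in> obj C; od X \<theta>; om X v; om X v'\<rbrakk> \<Longrightarrow> \<phi> (X, \<theta>, v + v') = \<phi> (X, \<theta>, v) + \<phi> (X, \<theta>, v')"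
  and "\<And>X c \<theta> v. \<lbrakk>X \<in> obj C; od X \<theta>; om X v\<rbrakk> \<Longrightarrow> \<phi> (X, scal C c \<theta>, v) = c * \<phi> (X, \<theta>, v)"
  and "\<And>X c \<theta> v. \<lbrakk>X \<in> obj C; od X \<theta>; om X v\<rbrakk> \<Longrightarrow> \<phi> (X, \<theta>, scal C c v) = c * \<phi> (X, \<theta>, v)"
  and "\<And>X Y f \<zeta> v. \<lbrakk>arr X Y f; od Y \<zeta>; om X v\<rbrakk> \<Longrightarrow> \<phi> (Y, \<zeta>, omega_map C f v) = \<phi> (X, \<zeta> \<cdot> (\<I> V \<star> f), v)"
 using assms unfolding coend_form_def by simp_all

lemma coend_form_sums:
 assumes \<phi>: "coend_form \<phi>" and X: "X \<in> obj C"
 shows "od X \<theta> \<Longrightarrow> (\<And>a. a \<in> A \<Longrightarrow> om X (v a)) \<Longrightarrow> \<phi> (X, \<theta>, \<Sum>a\<in>A. v a) = (\<Sum>a\<in>A. \<phi> (X, \<theta>, v a))"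
  and "om X w \<Longrightarrow> (\<And>b. b \<in> A' \<Longrightarrow> od X (\<eta> b)) \<Longrightarrow> \<phi> (X, \<Sum>b\<in>A'. \<eta> b, w) = (\<Sum>b\<in>A'. \<phi> (X, \<eta> b, w))"
proof -
 note D = coend_formD[OF \<phi>]
 have o: "V \<boxtimes> X \<in> obj C" by (rule tobj_closed[OF V_obj X])
 show "\<phi> (X, \<theta>, \<Sum>a\<in>A. v a) = (\<Sum>a\<in>A. \<phi> (X, \<theta>, v a))" if t: "od X \<theta>" and v: "\<And>a. a \<in> A \<Longrightarrow> om X (v a)"
  using v D(4)[OF X t arr_zero[OF V_obj o], of 0]
  by (induction A rule: infinite_finite_induct) (simp_all add: D(2)[OF X t] arr_sum V_obj o)
 show "\<phi> (X, \<Sum>b\<in>A'. \<eta> b, w) = (\<Sum>b\<in>A'. \<phi> (X, \<eta> b, w))" if w: "om X w" and v: "\<And>b. b \<in> A' \<Longrightarrow> od X (\<eta> b)"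
  using v D(3)[OF X arr_zero[OF o V_obj] w, of 0]
  by (induction A' rule: infinite_finite_induct) (simp_all add: D(1)[OF X _ _ w] arr_sum V_obj o)
qed

text \<open>Coend forms are the annihilator of the generating set \<open>S\<close>, and the
  relations are the span of \<open>S\<close>; by the criterion for spans each determines the
  other.\<close>

lemma coend_form_iff: "coend_form \<phi> \<longleftrightarrow> (\<forall>r\<in>CR. lin_eval \<phi> r = 0)"
 and coend_relations_iff: "t \<in> CR \<longleftrightarrow> (\<forall>\<phi>. coend_form \<phi> \<longrightarrow> lin_eval \<phi> t = 0)"
proof -
 define S :: "('o \<times> 'm \<times> 'm \<Rightarrow>\<^sub>0 'k) set" where "S =
   {basis_vec (X, \<theta> + \<theta>', v) - basis_vec (X, \<theta>, v) - basis_vec (X, \<theta>', v) | X \<theta> \<theta>' v.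
    X \<in> obj C \<and> \<theta> \<in> omega_dual C X \<and> \<theta>' \<in> omega_dual C X \<and> v \<in> omega C X} \<union>
   {basis_vec (X, \<theta>, v + v') - basis_vec (X, \<theta>, v) - basis_vec (X, \<theta>, v') | X \<theta> v v'.
    X \<in> obj C \<and> \<theta> \<in> omega_dual C X \<and> v \<in> omega C X \<and> v' \<in> omega C X} \<union>
   {basis_vec (X, scal C c \<theta>, v) - pm_scale c (basis_vec (X, \<theta>, v)) | X c \<theta> v.
    X \<in> obj C \<and> \<theta> \<in> omega_dual C X \<and> v \<in> omega C X} \<union>
   {basis_vec (X, \<theta>, scal C c v) - pm_scale c (basis_vec (X, \<theta>, v)) | X c \<theta> v.
    X \<in> obj C \<and> \<theta> \<in> omega_dual C X \<and> v \<in> omega C X} \<union>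
   {basis_vec (Y, \<zeta>, omega_map C f v) - basis_vec (X, \<zeta> \<cdot> (\<I> V \<star> f), v) | X Y f \<zeta> v.
    X \<in> obj C \<and> Y \<in> obj C \<and> f \<in> Hom C X Y \<and> \<zeta> \<in> omega_dual C Y \<and> v \<in> omega C X}"
 have rel: "CR = pm.span S" by (simp only: coend_relations_def S_def)
 have m: "od X \<theta> \<longleftrightarrow> \<theta> \<in> omega_dual C X" "om X v \<longleftrightarrow> v \<in> omega C X" if "X \<in> obj C" for X \<theta> v
  using that by (auto simp: omega_iff omega_dual_iff)
 have S1: "basis_vec (X, \<theta> + \<theta>', v) - basis_vec (X, \<theta>, v) - basis_vec (X, \<theta>', v) \<in> S"
  if "X \<in> obj C" "\<theta> \<in> omega_dual C X" "\<theta>' \<in> omega_dual C X" "v \<in> omega C X" for X \<theta> \<theta>' v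
  unfolding S_def by (rule UnI1, rule UnI1, rule UnI1, rule UnI1, rule CollectI, intro exI conjI, rule refl) (fact that)+
 have S2: "basis_vec (X, \<theta>, v + v') - basis_vec (X, \<theta>, v) - basis_vec (X, \<theta>, v') \<in> S"
  if "X \<in> obj C" "\<theta> \<in> omega_dual C X" "v \<in> omega C X" "v' \<in> omega C X" for X \<theta> v v'
  unfolding S_def by (rule UnI1, rule UnI1, rule UnI1, rule UnI2, rule CollectI, intro exI conjI, rule refl) (fact that)+
 have S3: "basis_vec (X, scal C c \<theta>, v) - pm_scale c (basis_vec (X, \<theta>, v)) \<in> S"
  if "X \<in> obj C" "\<theta> \<in> omega_dual C X" "v \<in> omega C X" for X c \<theta> v
  unfolding S_def by (rule UnI1, rule UnI1, rule UnI2, rule CollectI, intro exI conjI, rule refl) (fact that)+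
 have S4: "basis_vec (X, \<theta>, scal C c v) - pm_scale c (basis_vec (X, \<theta>, v)) \<in> S"
  if "X \<in> obj C" "\<theta> \<in> omega_dual C X" "v \<in> omega C X" for X c \<theta> v
  unfolding S_def by (rule UnI1, rule UnI2, rule CollectI, intro exI conjI, rule refl) (fact that)+
 have S5: "basis_vec (Y, \<zeta>, omega_map C f v) - basis_vec (X, \<zeta> \<cdot> (\<I> V \<star> f), v) \<in> S"
  if "X \<in> obj C" "Y \<in> obj C" "f \<in> Hom C X Y" "\<zeta> \<in> omega_dual C Y" "v \<in> omega C X" for X Y f \<zeta> v
  unfolding S_def by (rule UnI2, rule CollectI, intro exI conjI, rule refl) (fact that)+
 have c1: "(\<forall>s\<in>S. lin_eval \<phi> s = 0) \<Longrightarrow> coend_form \<phi>" for \<phi>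
 proof -
  assume s: "\<forall>s\<in>S. lin_eval \<phi> s = 0"
  have z: "lin_eval \<phi> (x - y - z) = 0 \<Longrightarrow> lin_eval \<phi> x = lin_eval \<phi> y + lin_eval \<phi> z"
   "lin_eval \<phi> (x - pm_scale c y) = 0 \<Longrightarrow> lin_eval \<phi> x = c * lin_eval \<phi> y"
   "lin_eval \<phi> (x - y) = 0 \<Longrightarrow> lin_eval \<phi> x = lin_eval \<phi> y" for x y z c
   by (simp_all add: lin_eval_diff lin_eval_add lin_eval_scale diff_eq_eq)
  show "coend_form \<phi>"
  proof (rule coend_formI)
   fix X \<theta> \<theta>' v assume *: "X \<in> obj C" "od X \<theta>" "od X \<theta>'" "om X v"
   have "lin_eval \<phi> (basis_vec (X, \<theta> + \<theta>', v) - basis_vec (X, \<theta>, v) - basis_vec (X, \<theta>', v)) = 0"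
    by (rule bspec[OF s S1]) (use * in \<open>simp_all add: m\<close>)
   from z(1)[OF this] show "\<phi> (X, \<theta> + \<theta>', v) = \<phi> (X, \<theta>, v) + \<phi> (X, \<theta>', v)" by simp
  next
   fix X \<theta> v v' assume *: "X \<in> obj C" "od X \<theta>" "om X v" "om X v'"
   have "lin_eval \<phi> (basis_vec (X, \<theta>, v + v') - basis_vec (X, \<theta>, v) - basis_vec (X, \<theta>, v')) = 0"
    by (rule bspec[OF s S2]) (use * in \<open>simp_all add: m\<close>)
   from z(1)[OF this] show "\<phi> (X, \<theta>, v + v') = \<phi> (X, \<theta>, v) + \<phi> (X, \<theta>, v')" by simp
  next
   fix X c \<theta> v assume *: "X \<in> obj C" "od X \<theta>" "om X v"
   have "lin_eval \<phi> (basis_vec (X, scal C c \<theta>, v) - pm_scale c (basis_vec (X, \<theta>, v))) = 0"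
    by (rule bspec[OF s S3]) (use * in \<open>simp_all add: m\<close>)
   from z(2)[OF this] show "\<phi> (X, scal C c \<theta>, v) = c * \<phi> (X, \<theta>, v)" by simp
   have "lin_eval \<phi> (basis_vec (X, \<theta>, scal C c v) - pm_scale c (basis_vec (X, \<theta>, v))) = 0"
    by (rule bspec[OF s S4]) (use * in \<open>simp_all add: m\<close>)
   from z(2)[OF this] show "\<phi> (X, \<theta>, scal C c v) = c * \<phi> (X, \<theta>, v)" by simp
  next
   fix X Y f \<zeta> v assume *: "arr X Y f" "od Y \<zeta>" "om X v"
   then have *: "X \<in> obj C" "Y \<in> obj C" "f \<in> Hom C X Y" "od Y \<zeta>" "om X v" by (auto simp: arr_def)
   have "lin_eval \<phi> (basis_vec (Y, \<zeta>, omega_map C f v) - basis_vec (X, \<zeta> \<cdot> (\<I> V \<star> f), v)) = 0"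
    by (rule bspec[OF s S5]) (use * in \<open>simp_all add: m\<close>)
   from z(3)[OF this] show "\<phi> (Y, \<zeta>, omega_map C f v) = \<phi> (X, \<zeta> \<cdot> (\<I> V \<star> f), v)" by simp
  qed
 qed
 have c2: "coend_form \<phi> \<Longrightarrow> s \<in> S \<Longrightarrow> lin_eval \<phi> s = 0" for \<phi> s
 proof -
  assume \<phi>: "coend_form \<phi>" and s: "s \<in> S"
  note D = coend_formD[OF \<phi>]
  show "lin_eval \<phi> s = 0"
   using s unfolding S_def
   by (elim UnE CollectE exE conjE)
    (simp_all add: lin_eval_diff lin_eval_scale D(1-4) m[symmetric] D(5)[OF arrI])
 qed
 have i: "coend_form \<phi> \<longleftrightarrow> (\<forall>s\<in>S. lin_eval \<phi> s = 0)" for \<phi> using c1 c2 by blast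
 show t: "t \<in> CR \<longleftrightarrow> (\<forall>\<phi>. coend_form \<phi> \<longrightarrow> lin_eval \<phi> t = 0)" for t
  unfolding rel in_pm_span_iff i ..
 show "coend_form \<phi> \<longleftrightarrow> (\<forall>r\<in>CR. lin_eval \<phi> r = 0)"
  using t c1 pm.span_base[of _ S] unfolding rel by blast
qed

section \<open>The operations on symbols and their descent to the coend\<close>

lemma CF_simps [simp]:
 "carrier CF = {t. keys t \<subseteq> symb}" "\<zero>\<^bsub>CF\<^esub> = 0" "x \<oplus>\<^bsub>CF\<^esub> y = x + y" "c \<odot>\<^bsub>CF\<^esub> x = pm_scale c x"
 by (simp_all add: coend_free_def)

lemma mult_CF: "x \<otimes>\<^bsub>CF\<^esub> y =
  bilin_extend (\<lambda>(X, \<theta>, v) (Y, \<zeta>, w). basis_vec (X \<boxtimes> Y, codia X Y \<theta> \<zeta>, dia X Y v w)) x y"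
 by (simp add: coend_free_def codia_def dia_def)

lemma one_CF: "\<one>\<^bsub>CF\<^esub> = basis_vec (\<bbbone>, \<rho>\<^sub>u V, runit_inv C V)"
 by (simp add: coend_free_def)

abbreviation ob where "ob \<equiv> omega_basis C"

abbreviation obd where "obd X \<equiv> dual_vec C X (\<lambda>x. x) (ob X)"

lemma comult_CF: "comult CF x = lin_extend (\<lambda>(X, \<theta>, v). \<Sum>b\<in>ob X.
  basis_vec (basis_vec (X, \<theta>, b), basis_vec (X, obd X b, v))) x"
 by (simp add: coend_free_def)

lemma counit_CF: "counit CF x = lin_eval (\<lambda>(X, \<theta>, v). pairing C \<theta> v) x"
 by (simp add: coend_free_def pairing_def)

lemma CF_module: "Module.module scalars CF"
proof (rule scalars_moduleI)
 fix x y :: "'o \<times> 'm \<times> 'm \<Rightarrow>\<^sub>0 'k" and c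
 assume x: "x \<in> carrier CF"
 then show "c \<odot>\<^bsub>CF\<^esub> x \<in> carrier CF" using keys_pm_scale[of c x] by auto
 assume "y \<in> carrier CF"
 then show "x \<oplus>\<^bsub>CF\<^esub> y \<in> carrier CF" using x Poly_Mapping.keys_add[of x y] by auto
qed (auto simp: add_ac pm.scale_left_distrib pm.scale_right_distrib)

lemma symb_mult: "(X, \<theta>, v) \<in> symb \<Longrightarrow> (Y, \<zeta>, w) \<in> symb \<Longrightarrow> (X \<boxtimes> Y, codia X Y \<theta> \<zeta>, dia X Y v w) \<in> symb"
 by (simp add: symb_iff tobj_closed arr_dia arr_codia)

text \<open>Coend forms are constrained only on \<open>symb\<close>, so the indicator function of a
  triple outside \<open>symb\<close> is one. It vanishes on every relation, which means that the
  triple does not occur in it.\<close>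

lemma CR_subset: "CR \<subseteq> carrier CF"
proof
 fix t assume t: "t \<in> CR"
 have "x \<in> symb" if x: "x \<in> keys t" for x
 proof (rule ccontr)
  assume n: "x \<notin> symb"
  let ?\<phi> = "\<lambda>y. if y = x then 1 else (0 :: 'k)"
  have z: "?\<phi> y = 0" if "y \<in> symb" for y using n that by auto
  have o: "V \<boxtimes> X \<in> obj C" if "X \<in> obj C" for X by (rule tobj_closed[OF V_obj that])
  have "coend_form ?\<phi>"
  proof (rule coend_formI)
   fix X Y f \<zeta> v assume *: "arr X Y f" "od Y \<zeta>" "om X v"
   then have "(Y, \<zeta>, omega_map C f v) \<in> symb" "(X, \<zeta> \<cdot> (\<I> V \<star> f), v) \<in> symb"
    by (auto simp: symb_iff omega_map_arr omega_comap_arr) (auto simp: arr_def)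
   then show "?\<phi> (Y, \<zeta>, omega_map C f v) = ?\<phi> (X, \<zeta> \<cdot> (\<I> V \<star> f), v)" using z by metis
  qed (simp_all add: z symb_iff arr_add arr_scal)
  then have "lin_eval ?\<phi> t = 0" using t coend_relations_iff by blast
  moreover have "lin_eval ?\<phi> t = lookup t x"
   using x by (simp add: lin_eval_def if_distrib[of "(*) _"] sum.delta cong: if_cong)
  ultimately show False using x by (simp add: in_keys_iff)
 qed
 then show "t \<in> carrier CF" by auto
qed

text \<open>Multiplication by a fixed symbol is dinatural in the other factor because
  \<open>dia\<close> and \<open>codia\<close> are natural. With the version for the other side, the
  coend relations form a two-sided ideal.\<close>

lemma coend_form_mult_right:
 assumes \<phi>: "coend_form \<phi>" and s: "(Y, \<zeta>, w) \<in> symb"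
 shows "coend_form (\<lambda>(X, \<theta>, v). \<phi> (X \<boxtimes> Y, codia X Y \<theta> \<zeta>, dia X Y v w))"
proof -
 have Y: "Y \<in> obj C" and z: "od Y \<zeta>" and w: "om Y w" using s by (auto simp: symb_iff)
 note D = coend_formD[OF \<phi>]
 show ?thesis
 proof (rule coend_formI; unfold prod.case)
  fix X \<theta> \<theta>' v v' c assume X: "X \<in> obj C" and t: "od X \<theta>" and v: "om X v"
  note XY = tobj_closed[OF X Y]
  note c = arr_codia[OF X Y t z] and d = arr_dia[OF X Y v w]
  show "od X \<theta>' \<Longrightarrow> \<phi> (X \<boxtimes> Y, codia X Y (\<theta> + \<theta>') \<zeta>, dia X Y v w) =
    \<phi> (X \<boxtimes> Y, codia X Y \<theta> \<zeta>, dia X Y v w) + \<phi> (X \<boxtimes> Y, codia X Y \<theta>' \<zeta>, dia X Y v w)"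
   using D(1)[OF XY c arr_codia[OF X Y _ z] d] codia_linear(1)[OF X Y t _ z z] by simp
  show "om X v' \<Longrightarrow> \<phi> (X \<boxtimes> Y, codia X Y \<theta> \<zeta>, dia X Y (v + v') w) =
    \<phi> (X \<boxtimes> Y, codia X Y \<theta> \<zeta>, dia X Y v w) + \<phi> (X \<boxtimes> Y, codia X Y \<theta> \<zeta>, dia X Y v' w)"
   using D(2)[OF XY c d arr_dia[OF X Y _ w]] dia_linear(1)[OF X Y v _ w w] by simp
  show "\<phi> (X \<boxtimes> Y, codia X Y (scal C c \<theta>) \<zeta>, dia X Y v w) = c * \<phi> (X \<boxtimes> Y, codia X Y \<theta> \<zeta>, dia X Y v w)"
   using D(3)[OF XY c d] codia_linear(3)[OF X Y t t z z] by simp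
  show "\<phi> (X \<boxtimes> Y, codia X Y \<theta> \<zeta>, dia X Y (scal C c v) w) = c * \<phi> (X \<boxtimes> Y, codia X Y \<theta> \<zeta>, dia X Y v w)"
   using D(4)[OF XY c d] dia_linear(3)[OF X Y v v w w] by simp
 next
  fix X X' f \<theta> v assume f: "arr X X' f" and t: "od X' \<theta>" and v: "om X v"
  then have X: "X \<in> obj C" "X' \<in> obj C" by (auto simp: arr_def)
  show "\<phi> (X' \<boxtimes> Y, codia X' Y \<theta> \<zeta>, dia X' Y (omega_map C f v) w) =
    \<phi> (X \<boxtimes> Y, codia X Y (\<theta> \<cdot> (\<I> V \<star> f)) \<zeta>, dia X Y v w)"
   using D(5)[OF arr_tmor[OF f arr_id[OF Y]] arr_codia[OF X(2) Y t z] arr_dia[OF X(1) Y v w]]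
   by (simp only: omega_map_dia_left[OF Y f v w] codia_map_left[OF Y f t z])
 qed
qed

lemma coend_form_mult_left:
 assumes \<phi>: "coend_form \<phi>" and s: "(Y, \<zeta>, w) \<in> symb"
 shows "coend_form (\<lambda>(X, \<theta>, v). \<phi> (Y \<boxtimes> X, codia Y X \<zeta> \<theta>, dia Y X w v))"
proof -
 have Y: "Y \<in> obj C" and z: "od Y \<zeta>" and w: "om Y w" using s by (auto simp: symb_iff)
 note D = coend_formD[OF \<phi>]
 show ?thesis
 proof (rule coend_formI; unfold prod.case)
  fix X \<theta> \<theta>' v v' c assume X: "X \<in> obj C" and t: "od X \<theta>" and v: "om X v"
  note XY = tobj_closed[OF Y X]
  note c = arr_codia[OF Y X z t] and d = arr_dia[OF Y X w v]
  show "od X \<theta>' \<Longrightarrow> \<phi> (Y \<boxtimes> X, codia Y X \<zeta> (\<theta> + \<theta>'), dia Y X w v) =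
    \<phi> (Y \<boxtimes> X, codia Y X \<zeta> \<theta>, dia Y X w v) + \<phi> (Y \<boxtimes> X, codia Y X \<zeta> \<theta>', dia Y X w v)"
   using D(1)[OF XY c arr_codia[OF Y X z] d] codia_linear(2)[OF Y X z z t] by simp
  show "om X v' \<Longrightarrow> \<phi> (Y \<boxtimes> X, codia Y X \<zeta> \<theta>, dia Y X w (v + v')) =
    \<phi> (Y \<boxtimes> X, codia Y X \<zeta> \<theta>, dia Y X w v) + \<phi> (Y \<boxtimes> X, codia Y X \<zeta> \<theta>, dia Y X w v')"
   using D(2)[OF XY c d arr_dia[OF Y X w]] dia_linear(2)[OF Y X w w v] by simp
  show "\<phi> (Y \<boxtimes> X, codia Y X \<zeta> (scal C c \<theta>), dia Y X w v) = c * \<phi> (Y \<boxtimes> X, codia Y X \<zeta> \<theta>, dia Y X w v)"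
   using D(3)[OF XY c d] codia_linear(4)[OF Y X z z t t] by simp
  show "\<phi> (Y \<boxtimes> X, codia Y X \<zeta> \<theta>, dia Y X w (scal C c v)) = c * \<phi> (Y \<boxtimes> X, codia Y X \<zeta> \<theta>, dia Y X w v)"
   using D(4)[OF XY c d] dia_linear(4)[OF Y X w w v v] by simp
 next
  fix X X' f \<theta> v assume f: "arr X X' f" and t: "od X' \<theta>" and v: "om X v"
  then have X: "X \<in> obj C" "X' \<in> obj C" by (auto simp: arr_def)
  show "\<phi> (Y \<boxtimes> X', codia Y X' \<zeta> \<theta>, dia Y X' w (omega_map C f v)) =
    \<phi> (Y \<boxtimes> X, codia Y X \<zeta> (\<theta> \<cdot> (\<I> V \<star> f)), dia Y X w v)"
   using D(5)[OF arr_tmor[OF arr_id[OF Y] f] arr_codia[OF Y X(2) z t] arr_dia[OF Y X(1) w v]]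
   by (simp only: omega_map_dia_right[OF Y f w v] codia_map_right[OF Y f z t])
 qed
qed

text \<open>A form in two coend variables, contracted with the canonical element of
 $\omega X\otimes(\omega X)^*$, is again dinatural: this is what makes the comultiplication well-defined.\<close>

lemma coend_form_comult:
 assumes l: "\<And>s. s \<in> symb \<Longrightarrow> coend_form (\<lambda>r. F r s)" and r: "\<And>s. s \<in> symb \<Longrightarrow> coend_form (F s)"
 shows "coend_form (\<lambda>(X, \<theta>, v). \<Sum>b\<in>ob X. F (X, \<theta>, b) (X, obd X b, v))"
proof -
 have ob: "om X b" and obd: "od X (obd X b)" if "X \<in> obj C" "b \<in> ob X" for X b
  using dual_basesD(3,4)[OF omega_basis[OF that(1)] that(2)] by auto
 show ?thesis
 proof (rule coend_formI; unfold prod.case)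
  fix X \<theta> \<theta>' v v' c assume X: "X \<in> obj C" and t: "od X \<theta>" and v: "om X v"
  have s1: "(X, \<theta>, b) \<in> symb" and s2: "(X, obd X b, v) \<in> symb" if "b \<in> ob X" for b
   using ob[OF X that] obd[OF X that] X t v by (auto simp: symb_iff)
  show "od X \<theta>' \<Longrightarrow> (\<Sum>b\<in>ob X. F (X, \<theta> + \<theta>', b) (X, obd X b, v)) =
    (\<Sum>b\<in>ob X. F (X, \<theta>, b) (X, obd X b, v)) + (\<Sum>b\<in>ob X. F (X, \<theta>', b) (X, obd X b, v))"
   unfolding sum.distrib[symmetric] by (intro sum.cong refl coend_formD(1)[OF l[OF s2]] X t ob)
  show "om X v' \<Longrightarrow> (\<Sum>b\<in>ob X. F (X, \<theta>, b) (X, obd X b, v + v')) =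
    (\<Sum>b\<in>ob X. F (X, \<theta>, b) (X, obd X b, v)) + (\<Sum>b\<in>ob X. F (X, \<theta>, b) (X, obd X b, v'))"
   unfolding sum.distrib[symmetric] by (intro sum.cong refl coend_formD(2)[OF r[OF s1]] X v obd)
  show "(\<Sum>b\<in>ob X. F (X, scal C c \<theta>, b) (X, obd X b, v)) = c * (\<Sum>b\<in>ob X. F (X, \<theta>, b) (X, obd X b, v))"
   unfolding sum_distrib_left by (intro sum.cong refl coend_formD(3)[OF l[OF s2]] X t ob)
  show "(\<Sum>b\<in>ob X. F (X, \<theta>, b) (X, obd X b, scal C c v)) = c * (\<Sum>b\<in>ob X. F (X, \<theta>, b) (X, obd X b, v))"
   unfolding sum_distrib_left by (intro sum.cong refl coend_formD(4)[OF r[OF s1]] X v obd)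
 next
  fix X Y f \<zeta> v assume f: "arr X Y f" and z: "od Y \<zeta>" and v: "om X v"
  then have X: "X \<in> obj C" and Y: "Y \<in> obj C" by (auto simp: arr_def)
  note BX = omega_basis[OF X] and BY = omega_basis[OF Y]
  \<comment> \<open>The matrix of \<open>omega_map C f\<close> in the two chosen bases. Both sides
    become the double sum with these coefficients, once by expanding covectors and once by expanding
    vectors.\<close>
  let ?p = "\<lambda>b c. pairing C (obd Y b) (omega_map C f c)"
  have "(\<Sum>b\<in>ob Y. F (Y, \<zeta>, b) (Y, obd Y b, omega_map C f v)) =
    (\<Sum>b\<in>ob Y. \<Sum>c\<in>ob X. ?p b c * F (Y, \<zeta>, b) (X, obd X c, v))"
  proof (intro sum.cong refl)
   fix b assume b: "b \<in> ob Y"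
   note zb = ob[OF Y b] and db = obd[OF Y b]
   have s: "(Y, \<zeta>, b) \<in> symb" using Y z zb by (simp add: symb_iff)
   note D = coend_formD[OF r[OF s]]
   have "F (Y, \<zeta>, b) (Y, obd Y b, omega_map C f v) = F (Y, \<zeta>, b) (X, obd Y b \<cdot> (\<I> V \<star> f), v)"
    by (rule D(5)[OF f db v])
   also have "obd Y b \<cdot> (\<I> V \<star> f) = (\<Sum>c\<in>ob X. scal C (?p b c) (obd X c))"
    using dual_bases_covector[OF BX omega_comap_arr[OF f db]]
    by (simp add: omega_map_adjoint[OF ob[OF X] f db] cong: sum.cong)
   also have "F (Y, \<zeta>, b) (X, \<dots>, v) = (\<Sum>c\<in>ob X. F (Y, \<zeta>, b) (X, scal C (?p b c) (obd X c), v))"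
    by (rule coend_form_sums(2)[OF r[OF s] X v]) (intro arr_scal obd X)
   also have "\<dots> = (\<Sum>c\<in>ob X. ?p b c * F (Y, \<zeta>, b) (X, obd X c, v))"
    by (intro sum.cong refl D(3)[OF X obd[OF X] v])
   finally show "F (Y, \<zeta>, b) (Y, obd Y b, omega_map C f v) = (\<Sum>c\<in>ob X. ?p b c * F (Y, \<zeta>, b) (X, obd X c, v))" .
  qed
  also have "\<dots> = (\<Sum>c\<in>ob X. \<Sum>b\<in>ob Y. ?p b c * F (Y, \<zeta>, b) (X, obd X c, v))" by (rule sum.swap)
  also have "\<dots> = (\<Sum>c\<in>ob X. F (X, \<zeta> \<cdot> (\<I> V \<star> f), c) (X, obd X c, v))"
  proof (intro sum.cong refl)
   fix c assume c: "c \<in> ob X"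
   note zc = ob[OF X c] and dc = obd[OF X c]
   have s: "(X, obd X c, v) \<in> symb" using X v dc by (simp add: symb_iff)
   note D = coend_formD[OF l[OF s]]
   have "F (X, \<zeta> \<cdot> (\<I> V \<star> f), c) (X, obd X c, v) = F (Y, \<zeta>, omega_map C f c) (X, obd X c, v)"
    by (rule D(5)[OF f z zc, symmetric])
   also have "omega_map C f c = (\<Sum>b\<in>ob Y. scal C (?p b c) b)"
    by (rule dual_basesD(6)[OF BY omega_map_arr[OF f zc]])
   also have "F (Y, \<zeta>, \<dots>) (X, obd X c, v) = (\<Sum>b\<in>ob Y. F (Y, \<zeta>, scal C (?p b c) b) (X, obd X c, v))"
    by (rule coend_form_sums(1)[OF l[OF s] Y z]) (intro arr_scal ob Y)
   also have "\<dots> = (\<Sum>b\<in>ob Y. ?p b c * F (Y, \<zeta>, b) (X, obd X c, v))"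
    by (intro sum.cong refl D(4)[OF Y z ob[OF Y]])
   finally show "(\<Sum>b\<in>ob Y. ?p b c * F (Y, \<zeta>, b) (X, obd X c, v)) = F (X, \<zeta> \<cdot> (\<I> V \<star> f), c) (X, obd X c, v)"
    by simp
  qed
  finally show "(\<Sum>b\<in>ob Y. F (Y, \<zeta>, b) (Y, obd Y b, omega_map C f v)) =
    (\<Sum>c\<in>ob X. F (X, \<zeta> \<cdot> (\<I> V \<star> f), c) (X, obd X c, v))" .
 qed
qed

lemma coend_form_linear:
 assumes g: "linear_form CF g" and z: "\<And>n. n \<in> CR \<Longrightarrow> g n = 0"
 shows "coend_form (\<lambda>s. g (basis_vec s))"
 unfolding coend_form_iff
proof
 fix r assume r: "r \<in> CR"
 from linear_form_free[OF CF_simps(1,3,4) g subsetD[OF CR_subset r]] z[OF r]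
 show "lin_eval (\<lambda>s. g (basis_vec s)) r = 0" by (rule trans[OF sym])
qed

lemma coend_form_pairing: "coend_form (\<lambda>(X, \<theta>, v). pairing C \<theta> v)"
 by (rule coend_formI) (simp_all add: pairing_add_left pairing_add_right pairing_scal_left pairing_scal_right
   omega_map_adjoint)

text \<open>Establishes only that the operations are well defined on classes. The axioms of a Weak
  Bialgebra for the coend come later, from the surjection of the graph Weak Bialgebra onto
  it.\<close>

sublocale coend: wba_quotient CF CR
proof (rule wba_quotient.intro)
 show "\<zero>\<^bsub>CF\<^esub> \<in> CR" by (simp add: coend_relations_def pm.span_zero)
 fix x y :: "'o \<times> 'm \<times> 'm \<Rightarrow>\<^sub>0 'k" and c
 show "x \<in> CR \<Longrightarrow> y \<in> CR \<Longrightarrow> x \<oplus>\<^bsub>CF\<^esub> y \<in> CR" by (simp add: coend_relations_def pm.span_add)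
 show "x \<in> CR \<Longrightarrow> c \<odot>\<^bsub>CF\<^esub> x \<in> CR" by (simp add: coend_relations_def pm.span_scale)
next
 fix x y :: "'o \<times> 'm \<times> 'm \<Rightarrow>\<^sub>0 'k"
 assume x: "x \<in> carrier CF" and y: "y \<in> carrier CF"
 show "x \<otimes>\<^bsub>CF\<^esub> y \<in> carrier CF"
  unfolding mult_CF CF_simps mem_Collect_eq
 proof (rule order_trans[OF keys_bilin_extend], intro UN_least)
  fix a b assume "a \<in> keys x" "b \<in> keys y"
  then have ab: "a \<in> symb" "b \<in> symb" using x y by auto
  obtain X \<theta> v Y \<zeta> w where "a = (X, \<theta>, v)" "b = (Y, \<zeta>, w)" by (cases a; cases b)
  with ab show "keys ((\<lambda>(X, \<theta>, v) (Y, \<zeta>, w). basis_vec (X \<boxtimes> Y, codia X Y \<theta> \<zeta>, dia X Y v w)) a b :: _ \<Rightarrow>\<^sub>0 'k) \<subseteq> symb"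
   by (simp add: symb_mult)
 qed
next
 show "\<one>\<^bsub>CF\<^esub> \<in> carrier CF"
  by (simp add: one_CF symb_iff unit_closed runit_inv(1)[OF V_obj] arr_runit[OF V_obj])
next
 fix x n :: "'o \<times> 'm \<times> 'm \<Rightarrow>\<^sub>0 'k"
 assume x: "x \<in> carrier CF" and n: "n \<in> CR"
 have z: "lin_eval \<phi> n = 0" if "coend_form \<phi>" for \<phi> using n that coend_relations_iff by blast
 show "x \<otimes>\<^bsub>CF\<^esub> n \<in> CR"
  unfolding mult_CF coend_relations_iff
 proof (intro allI impI)
  fix \<phi> assume \<phi>: "coend_form \<phi>"
  let ?m = "\<lambda>(X, \<theta>, v) (Y, \<zeta>, w). basis_vec (X \<boxtimes> Y, codia X Y \<theta> \<zeta>, dia X Y v w) :: _ \<Rightarrow>\<^sub>0 'k"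
  have "lin_eval \<phi> (bilin_extend ?m x n) = lin_eval (\<lambda>a. lin_eval (\<lambda>b. lin_eval \<phi> (?m a b)) n) x"
   by (rule lin_eval_bilin_extend)
  also have "\<dots> = lin_eval (\<lambda>a. 0) x"
  proof (rule lin_eval_cong)
   fix a assume "a \<in> keys x"
   then have a: "a \<in> symb" using x by auto
   obtain X \<theta> v where e: "a = (X, \<theta>, v)" by (cases a)
   show "lin_eval (\<lambda>b. lin_eval \<phi> (?m a b)) n = 0"
    using z[OF coend_form_mult_left[OF \<phi> a[unfolded e]]] by (simp add: e case_prod_unfold)
  qed
  finally show "lin_eval \<phi> (bilin_extend ?m x n) = 0" by simp
 qed
 show "n \<otimes>\<^bsub>CF\<^esub> x \<in> CR"
  unfolding mult_CF coend_relations_iff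
 proof (intro allI impI)
  fix \<phi> assume \<phi>: "coend_form \<phi>"
  let ?m = "\<lambda>(X, \<theta>, v) (Y, \<zeta>, w). basis_vec (X \<boxtimes> Y, codia X Y \<theta> \<zeta>, dia X Y v w) :: _ \<Rightarrow>\<^sub>0 'k"
  have "lin_eval \<phi> (bilin_extend ?m n x) = lin_eval (\<lambda>b. lin_eval (\<lambda>a. lin_eval \<phi> (?m a b)) n) x"
   unfolding lin_eval_bilin_extend by (rule lin_eval_swap)
  also have "\<dots> = lin_eval (\<lambda>a. 0) x"
  proof (rule lin_eval_cong)
   fix a assume "a \<in> keys x"
   then have a: "a \<in> symb" using x by auto
   obtain X \<theta> v where e: "a = (X, \<theta>, v)" by (cases a)
   show "lin_eval (\<lambda>b. lin_eval \<phi> (?m b a)) n = 0"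
    using z[OF coend_form_mult_right[OF \<phi> a[unfolded e]]] by (simp add: e case_prod_unfold)
  qed
  finally show "lin_eval \<phi> (bilin_extend ?m n x) = 0" by simp
 qed
next
 fix x assume x: "x \<in> carrier CF"
 show "keys (comult CF x) \<subseteq> carrier CF \<times> carrier CF"
  unfolding comult_CF
 proof (rule order_trans[OF keys_lin_extend], intro UN_least)
  fix a assume "a \<in> keys x"
  then have a: "a \<in> symb" using x by auto
  obtain X \<theta> v where e: "a = (X, \<theta>, v)" by (cases a)
  then have *: "X \<in> obj C" "od X \<theta>" "om X v" using a by (auto simp: symb_iff)
  show "keys ((case a of (X, \<theta>, v) \<Rightarrow>
    \<Sum>b\<in>ob X. basis_vec (basis_vec (X, \<theta>, b), basis_vec (X, obd X b, v))) :: _ \<Rightarrow>\<^sub>0 'k)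
    \<subseteq> carrier CF \<times> carrier CF"
   unfolding e prod.case
   by (rule order_trans[OF keys_sum_subset])
    (use * dual_basesD(3,4)[OF omega_basis[OF *(1)]] in \<open>auto simp: symb_iff\<close>)
 qed
next
 fix \<beta> n assume b: "bilinear_form CF CF \<beta>" and n: "n \<in> CR"
  and z: "\<And>m x. m \<in> CR \<Longrightarrow> x \<in> carrier CF \<Longrightarrow> \<beta> (m, x) = 0 \<and> \<beta> (x, m) = 0"
 have bv: "basis_vec s \<in> carrier CF" if "s \<in> symb" for s using that by simp
 have "coend_form (\<lambda>r. \<beta> (basis_vec r, basis_vec s))" "coend_form (\<lambda>r. \<beta> (basis_vec s, basis_vec r))"
  if "s \<in> symb" for s
  using coend_form_linear[OF bilinear_form_left[OF b bv[OF that]]]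
   coend_form_linear[OF bilinear_form_right[OF b bv[OF that]]] z[OF _ bv[OF that]] by auto
 from coend_form_comult[of "\<lambda>r s. \<beta> (basis_vec r, basis_vec s)", OF this]
 have "lin_eval (\<lambda>(X, \<theta>, v). \<Sum>b\<in>ob X. \<beta> (basis_vec (X, \<theta>, b), basis_vec (X, obd X b, v))) n = 0"
  using n unfolding coend_form_iff by blast
 then show "lin_eval \<beta> (comult CF n) = 0"
  by (simp add: comult_CF lin_eval_extend lin_eval_sum case_prod_unfold)
next
 fix n assume "n \<in> CR"
 then show "counit CF n = 0"
  using coend_form_pairing unfolding coend_form_iff counit_CF by blast
qed (simp_all add: CF_module CR_subset mult_CF bilin_extend_add_left bilin_extend_add_right linear_form_def
  comult_CF lin_extend_add lin_extend_scale lin_eval_add lin_eval_scale counit_CF del: CF_simps(1))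

lemma coend_eq: "coend C = coend.Q"
 by (simp add: coend_def)

lemma coend_elem_eq: "coend_elem C X \<theta> v = coend.cl (basis_vec (X, \<theta>, v))"
 by (simp add: coend_elem_def)

text \<open>The working criterion for equality in the coend: a class is known as soon as the values
  of all coend forms on it are known.\<close>

lemma cl_eqI:
 assumes "s \<in> carrier CF" "t \<in> carrier CF" "\<And>\<phi>. coend_form \<phi> \<Longrightarrow> lin_eval \<phi> s = lin_eval \<phi> t"
 shows "coend.cl s = coend.cl t"
proof -
 have "s - t \<in> CR" using assms(3) by (simp add: coend_relations_iff lin_eval_diff)
 moreover have "s \<ominus>\<^bsub>CF\<^esub> t = s - t"
 proof -
  have m: "- t \<in> carrier CF" using assms(2) by (auto simp: in_keys_iff)
  have "\<ominus>\<^bsub>CF\<^esub> t = - t" by (rule coend.S.minus_equality) (use m assms(2) in auto)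
  then show ?thesis by (simp add: a_minus_def)
 qed
 ultimately show ?thesis using coend.cl_eq_iff[OF assms(1,2)] by simp
qed

end

section \<open>The surjection onto the coend\<close>

context linear_category
begin

lemma direct_sumD:
 assumes "direct_sum C K W X i p"
 shows "finite K" "X \<in> obj C" "\<And>a. a \<in> K \<Longrightarrow> arr (W a) X (i a)" "\<And>a. a \<in> K \<Longrightarrow> arr X (W a) (p a)"
  "\<And>a b. a \<in> K \<Longrightarrow> b \<in> K \<Longrightarrow> p a \<cdot> i b = (if a = b then \<I> (W a) else 0)" "\<I> X = (\<Sum>a\<in>K. i a \<cdot> p a)"
 using assms unfolding direct_sum_def arr_def by auto

text \<open>Iterates binary sums. The index set is an arbitrary finite set, so that one element can
  be removed from it in the construction of a complement.\<close>

lemma finite_direct_sum: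
 assumes add: "additive_category C" and K: "finite K" and W: "\<And>a. a \<in> K \<Longrightarrow> W a \<in> obj C"
 shows "\<exists>Z i p. direct_sum C K W Z i p"
 using K W
proof (induction K)
 case empty
 obtain Z where "zero_obj C Z" using add by (auto simp: additive_category_def)
 then obtain i p where z: "direct_sum C {..<0} (\<lambda>n. ([] :: 'o list) ! n) Z i p"
  by (auto simp: zero_obj_def is_direct_sum_def)
 have "direct_sum C {} W Z (\<lambda>_. 0) (\<lambda>_. 0)" using direct_sumD(2,6)[OF z] by (simp add: direct_sum_def)
 then show ?case by blast
next
 case (insert k K)
 then obtain Z i p where Z: "direct_sum C K W Z i p" by auto
 note D = direct_sumD[OF Z]
 obtain Z' where "is_direct_sum C [W k, Z] Z'"
  using add D(2) insert.prems[of k] unfolding additive_category_def by blast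
 then obtain i' p' where Z': "direct_sum C {..<2} (\<lambda>n. [W k, Z] ! n) Z' i' p'"
  by (auto simp: is_direct_sum_def numeral_2_eq_2)
 note D' = direct_sumD[OF Z']
 obtain i0 p0 i1 p1 where ar: "arr (W k) Z' i0" "arr Z' (W k) p0" "arr Z Z' i1" "arr Z' Z p1"
  and eq: "p0 \<cdot> i0 = \<I> (W k)" "p1 \<cdot> i1 = \<I> Z" "p0 \<cdot> i1 = 0" "p1 \<cdot> i0 = 0"
  and sum: "\<I> Z' = i0 \<cdot> p0 + i1 \<cdot> p1"
 proof (rule that[of "i' 0" "p' 0" "i' 1" "p' 1"])
 qed (use D'(3,4)[of 0] D'(3,4)[of 1] D'(5)[of 0 0] D'(5)[of 1 1] D'(5)[of 0 1] D'(5)[of 1 0] D'(6)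
   in \<open>auto simp: numeral_2_eq_2\<close>)
 let ?i = "\<lambda>a. if a = k then i0 else i1 \<cdot> i a" and ?p = "\<lambda>a. if a = k then p0 else p a \<cdot> p1"
 have Wk: "W k \<in> obj C" and Wo: "\<And>a. a \<in> K \<Longrightarrow> W a \<in> obj C" using insert.prems by auto
 have ia: "arr (W a) Z' (i1 \<cdot> i a)" and pa: "arr Z' (W a) (p a \<cdot> p1)" if "a \<in> K" for a
  using arr_comp[OF D(3)[OF that] ar(3)] arr_comp[OF ar(4) D(4)[OF that]] by auto
 have "direct_sum C (insert k K) W Z' ?i ?p"
  unfolding direct_sum_def
 proof (intro conjI ballI)
  show "\<I> Z' = (\<Sum>a\<in>insert k K. ?i a \<cdot> ?p a)"
  proof -
   have "i1 \<cdot> p1 = i1 \<cdot> (\<I> Z \<cdot> p1)" by (simp add: cmp_id_left[OF ar(4)])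
   also have "\<I> Z \<cdot> p1 = (\<Sum>a\<in>K. (i a \<cdot> p a) \<cdot> p1)"
    unfolding D(6) by (rule cmp_sum_left[OF ar(4) D(2)]) (rule arr_comp[OF D(4) D(3)])
   also have "i1 \<cdot> \<dots> = (\<Sum>a\<in>K. i1 \<cdot> ((i a \<cdot> p a) \<cdot> p1))"
    by (rule cmp_sum_right[OF ar(3) _ arr_comp[OF ar(4) arr_comp[OF D(4) D(3)]]])
     (use direct_sumD(2)[OF Z'] in auto)
   also have "\<dots> = (\<Sum>a\<in>K. (i1 \<cdot> i a) \<cdot> (p a \<cdot> p1))"
    using cmp_assoc[OF ar(4) D(4) D(3)] cmp_assoc[OF pa D(3) ar(3)] by (intro sum.cong refl) simp
   finally have "\<I> Z' = i0 \<cdot> p0 + (\<Sum>a\<in>K. (i1 \<cdot> i a) \<cdot> (p a \<cdot> p1))" using sum by simp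
   moreover have "(\<Sum>a\<in>K. ?i a \<cdot> ?p a) = (\<Sum>a\<in>K. (i1 \<cdot> i a) \<cdot> (p a \<cdot> p1))"
    using insert.hyps by (intro sum.cong refl) auto
   ultimately show ?thesis using insert.hyps by simp
  qed
  fix a b assume a: "a \<in> insert k K" and b: "b \<in> insert k K"
  have 1: "(p a \<cdot> p1) \<cdot> (i1 \<cdot> i b) = p a \<cdot> i b" if "a \<in> K" "b \<in> K"
  proof -
   have "(p a \<cdot> p1) \<cdot> (i1 \<cdot> i b) = p a \<cdot> (p1 \<cdot> (i1 \<cdot> i b))"
    by (rule cmp_assoc[OF ia[OF that(2)] ar(4) D(4)[OF that(1)]])
   also have "p1 \<cdot> (i1 \<cdot> i b) = \<I> Z \<cdot> i b" by (rule cmp_eq[OF D(3)[OF that(2)] ar(3,4) eq(2)])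
   finally show ?thesis by (simp add: cmp_id_left[OF D(3)[OF that(2)]])
  qed
  have 2: "p0 \<cdot> (i1 \<cdot> i b) = 0" if "b \<in> K"
   using cmp_eq[OF D(3)[OF that] ar(3) ar(2) eq(3)] cmp_zero_left[OF D(3)[OF that] Wk] by simp
  have 3: "(p a \<cdot> p1) \<cdot> i0 = 0" if "a \<in> K"
   using cmp_assoc[OF ar(1) ar(4) D(4)[OF that]] cmp_zero_right[OF D(4)[OF that] Wk] eq(4) by simp
  show "?p a \<cdot> ?i b = (if a = b then \<I> (W a) else 0)"
   using a b 1 2 3 eq(1) D(5) insert.hyps by auto
 qed (use insert.hyps ar ia pa Wk Wo in \<open>auto simp: arr_def\<close>)
 then show ?case by blast
qed

text \<open>A direct summand in the sense of \<open>direct_summand\<close> comes with a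
  complementary object. Here it is a sum \<open>Z\<close> of all the other summands;
  \<open>I1\<close> and \<open>P1\<close> identify it with the complement of \<open>W k\<close>
  inside \<open>X\<close>.\<close>

lemma direct_summandI:
 assumes add: "additive_category C" and X: "direct_sum C K W X i p" and k: "k \<in> K"
 shows "direct_summand C (W k) X"
proof -
 note D = direct_sumD[OF X]
 have Wo: "W a \<in> obj C" if "a \<in> K" for a using X that by (simp add: direct_sum_def)
 let ?K = "K - {k}"
 obtain Z i' p' where Z: "direct_sum C ?K W Z i' p'"
  using finite_direct_sum[OF add, of ?K W] D(1) Wo by auto
 note D' = direct_sumD[OF Z]
 have mem: "a \<in> K" if "a \<in> ?K" for a using that by simp
 define I1 where "I1 = (\<Sum>a\<in>?K. i a \<cdot> p' a)"
 define P1 where "P1 = (\<Sum>a\<in>?K. i' a \<cdot> p a)"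
 have a1: "arr Z X (i a \<cdot> p' a)" and a2: "arr X Z (i' a \<cdot> p a)" if "a \<in> ?K" for a
  using arr_comp[OF D'(4)[OF that] D(3)[OF mem[OF that]]] arr_comp[OF D(4)[OF mem[OF that]] D'(3)[OF that]] by auto
 have I1: "arr Z X I1" and P1: "arr X Z P1" unfolding I1_def P1_def by (intro arr_sum D(2) D'(2) a1 a2; assumption)+
 have pI: "p a \<cdot> I1 = (if a = k then 0 else p' a)" if a: "a \<in> K" for a
 proof -
  have "p a \<cdot> I1 = (\<Sum>b\<in>?K. p a \<cdot> (i b \<cdot> p' b))" unfolding I1_def by (rule cmp_sum_right[OF D(4)[OF a] D'(2) a1])
  also have "\<dots> = (\<Sum>b\<in>?K. if b = a then p' a else 0)"
  proof (intro sum.cong refl)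
   fix b assume b: "b \<in> ?K"
   have "p a \<cdot> (i b \<cdot> p' b) = (if a = b then \<I> (W a) else 0) \<cdot> p' b"
    by (rule cmp_eq[OF D'(4)[OF b] D(3)[OF mem[OF b]] D(4)[OF a] D(5)[OF a mem[OF b]]])
   then show "p a \<cdot> (i b \<cdot> p' b) = (if b = a then p' a else 0)"
    using cmp_id_left[OF D'(4)[OF b]] cmp_zero_left[OF D'(4)[OF b] Wo[OF a]] by auto
  qed
  finally show ?thesis using a D(1) by simp
 qed
 have Pi: "P1 \<cdot> i k = 0"
 proof -
  have "P1 \<cdot> i k = (\<Sum>b\<in>?K. (i' b \<cdot> p b) \<cdot> i k)" unfolding P1_def by (rule cmp_sum_left[OF D(3)[OF k] D'(2) a2])
  also have "\<dots> = (\<Sum>b\<in>?K. 0)"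
  proof (intro sum.cong refl)
   fix b assume b: "b \<in> ?K"
   show "(i' b \<cdot> p b) \<cdot> i k = 0"
    using cmp_assoc[OF D(3)[OF k] D(4)[OF mem[OF b]] D'(3)[OF b]] D(5)[OF mem[OF b] k] b
     cmp_zero_right[OF D'(3)[OF b] Wo[OF k]] by auto
  qed
  finally show ?thesis by simp
 qed
 have PI: "P1 \<cdot> I1 = \<I> Z"
 proof -
  have "P1 \<cdot> I1 = (\<Sum>b\<in>?K. (i' b \<cdot> p b) \<cdot> I1)" unfolding P1_def by (rule cmp_sum_left[OF I1 D'(2) a2])
  also have "\<dots> = (\<Sum>b\<in>?K. i' b \<cdot> p' b)"
  proof (intro sum.cong refl)
   fix b assume b: "b \<in> ?K"
   then show "(i' b \<cdot> p b) \<cdot> I1 = i' b \<cdot> p' b"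
    using cmp_assoc[OF I1 D(4)[OF mem[OF b]] D'(3)[OF b]] pI[OF mem[OF b]] by simp
  qed
  finally show ?thesis using D'(6) by simp
 qed
 have IP: "I1 \<cdot> P1 = (\<Sum>a\<in>?K. i a \<cdot> p a)"
 proof -
  have "I1 \<cdot> P1 = (\<Sum>b\<in>?K. (i b \<cdot> p' b) \<cdot> P1)" unfolding I1_def by (rule cmp_sum_left[OF P1 D(2) a1])
  also have "\<dots> = (\<Sum>b\<in>?K. i b \<cdot> p b)"
  proof (intro sum.cong refl)
   fix b assume b: "b \<in> ?K"
   have "p' b \<cdot> P1 = (\<Sum>c\<in>?K. p' b \<cdot> (i' c \<cdot> p c))" unfolding P1_def by (rule cmp_sum_right[OF D'(4)[OF b] D(2) a2])
   also have "\<dots> = (\<Sum>c\<in>?K. if c = b then p b else 0)"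
   proof (intro sum.cong refl)
    fix c assume c: "c \<in> ?K"
    have "p' b \<cdot> (i' c \<cdot> p c) = (if b = c then \<I> (W b) else 0) \<cdot> p c"
     by (rule cmp_eq[OF D(4)[OF mem[OF c]] D'(3)[OF c] D'(4)[OF b] D'(5)[OF b c]])
    then show "p' b \<cdot> (i' c \<cdot> p c) = (if c = b then p b else 0)"
     using cmp_id_left[OF D(4)[OF mem[OF c]]] cmp_zero_left[OF D(4)[OF mem[OF c]] Wo[OF mem[OF b]]] by auto
   qed
   also have "\<dots> = p b" using b D(1) by simp
   finally show "(i b \<cdot> p' b) \<cdot> P1 = i b \<cdot> p b"
    using cmp_assoc[OF P1 D'(4)[OF b] D(3)[OF mem[OF b]]] by simp
  qed
  finally show ?thesis .
 qed
 have "\<I> X = i k \<cdot> p k + I1 \<cdot> P1" unfolding IP D(6) using D(1) k by (rule sum.remove)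
 then have "direct_sum C {..<2} (\<lambda>n. [W k, Z] ! n) X (\<lambda>n. [i k, I1] ! n) (\<lambda>n. [p k, P1] ! n)"
  unfolding direct_sum_def numeral_2_eq_2
  using D(2) D'(2) Wo[OF k] D(3,4)[OF k] I1 P1 pI[OF k] Pi PI D(5)[OF k k]
  by (auto simp: arr_def less_Suc_eq)
 then have "is_direct_sum C [W k, Z] X" by (auto simp: is_direct_sum_def numeral_2_eq_2)
 then show ?thesis using D'(2) by (auto simp: direct_summand_def)
qed

end

context semisimple_monoidal
begin

lemma tmor_sum_right:
 assumes Y: "Y \<in> obj C" "Y' \<in> obj C" and f: "\<And>a. a \<in> A \<Longrightarrow> arr Y Y' (f a)" and g: "arr X X' g"
 shows "g \<star> (\<Sum>a\<in>A. f a) = (\<Sum>a\<in>A. g \<star> f a)"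
 using f
proof (induction A rule: infinite_finite_induct)
 case (insert a A)
 then have "arr Y Y' (\<Sum>a\<in>A. f a)" using Y by (intro arr_sum) auto
 with insert show ?case using tmor_plus_right[OF g, of Y Y' "f a" "\<Sum>a\<in>A. f a"] by simp
qed (use tmor_scale_right[OF g arr_zero[OF Y], of 0] in simp_all)

lemma omega_map_cmp:
 assumes f: "arr X Y f" and g: "arr Y Z g" and v: "om X v"
 shows "omega_map C (g \<cdot> f) v = omega_map C g (omega_map C f v)"
 unfolding omega_map_def
 by (rule cmp_eq[OF v arr_tmor[OF arr_id[OF V_obj] f] arr_tmor[OF arr_id[OF V_obj] g] tmor_cmp_right[OF f g V_obj], symmetric])

lemma omega_map_id: "X \<in> obj C \<Longrightarrow> om X v \<Longrightarrow> omega_map C (\<I> X) v = v"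
 using cmp_id_left[of V "V \<boxtimes> X" v] by (simp add: omega_map_def tmor_id V_obj)

lemma omega_map_sum:
 assumes f: "\<And>a. a \<in> A \<Longrightarrow> arr X Y (f a)" and v: "om X v" and X: "X \<in> obj C" and Y: "Y \<in> obj C"
 shows "omega_map C (\<Sum>a\<in>A. f a) v = (\<Sum>a\<in>A. omega_map C (f a) v)"
proof -
 have "\<I> V \<star> (\<Sum>a\<in>A. f a) = (\<Sum>a\<in>A. \<I> V \<star> f a)"
  by (rule tmor_sum_right[OF X Y _ arr_id[OF V_obj]]) (rule f)
 then show ?thesis
  unfolding omega_map_def
  by (simp only:) (rule cmp_sum_left[OF v tobj_closed[OF V_obj Y]], intro arr_tmor arr_id V_obj f)
qed

end

section \<open>Retracts of tensor powers and the map back from the coend\<close>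

locale fusion_generator = dimension_bases C M B
 for C :: "('k::field, 'o, 'm::ab_group_add, 'i) fcat" (structure) and M :: 'o and B :: "'i \<Rightarrow> 'i \<Rightarrow> 'm set" +
 assumes additive: "additive_category C" and generates: "generates_as_fusion_category C M"
begin

definition retract :: "'i \<Rightarrow> nat \<Rightarrow> bool" where
 "retract j n \<longleftrightarrow> (\<exists>u w. arr (smp C j) (tp n) u \<and> arr (tp n) (smp C j) w \<and> w \<cdot> u = \<I> (smp C j))"

lemma retract_exists:
 assumes j: "j \<in> J"
 shows "\<exists>n. retract j n"
proof -
 obtain n where "direct_summand C (smp C j) (tp n)" using generates j by (auto simp: generates_as_fusion_category_def)
 then obtain Z i p where "direct_sum C {..<length [smp C j, Z]} (\<lambda>n. [smp C j, Z] ! n) (tp n) i p"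
  by (auto simp: direct_summand_def is_direct_sum_def)
 from direct_sumD(3,4)[OF this, of 0] direct_sumD(5)[OF this, of 0 0]
 have "retract j n" unfolding retract_def by auto
 then show ?thesis ..
qed

text \<open>A simple retract of a tensor power must occur in the decomposition of that power, as all
  components of the embedding would vanish by Schur's lemma otherwise; it is then a direct summand.
  A retract of both the unit object and \<open>M\<close> would be a nonzero common summand.\<close>

lemma retract_disjoint:
 assumes j: "j \<in> J"
 shows "\<not> (retract j 0 \<and> retract j 1)"
proof
 assume r: "retract j 0 \<and> retract j 1"
 have ds: "direct_summand C (smp C j) (tp n)" if "retract j n" for n
 proof -
  from that obtain u w where uw: "arr (smp C j) (tp n) u" "arr (tp n) (smp C j) w" "w \<cdot> u = \<I> (smp C j)"
   by (auto simp: retract_def)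
  obtain js i p where js: "set js \<subseteq> J" and ds: "direct_sum C {..<length (map (smp C) js)} (\<lambda>a. map (smp C) js ! a) (tp n) i p"
   using semisimple tp_obj[of n] by (auto simp: finitely_split_semisimple_def is_direct_sum_def)
  note D = direct_sumD[OF ds]
  note ia = D(3) and pa = D(4)
  have "\<exists>a<length js. js ! a = j"
  proof (rule ccontr)
   assume no: "\<not> ?thesis"
   have "u = \<I> (tp n) \<cdot> u" by (simp add: cmp_id_left[OF uw(1)])
   also have "\<dots> = (\<Sum>a<length (map (smp C) js). (i a \<cdot> p a) \<cdot> u)"
    unfolding D(6) by (rule cmp_sum_left[OF uw(1) tp_obj]) (rule arr_comp[OF pa ia])
   also have "\<dots> = (\<Sum>a<length (map (smp C) js). 0)"
   proof (intro sum.cong refl)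
    fix a assume a: "a \<in> {..<length (map (smp C) js)}"
    then have jja: "js ! a \<in> J" "js ! a \<noteq> j" using js no by auto
    have "arr (smp C j) (smp C (js ! a)) (p a \<cdot> u)" using arr_comp[OF uw(1) pa[OF a]] a by simp
    then have "p a \<cdot> u = 0" using smp_Hom_zero[OF j jja(1)] jja(2) by blast
    then show "(i a \<cdot> p a) \<cdot> u = 0"
     using cmp_assoc[OF uw(1) pa[OF a] ia[OF a]] cmp_zero_right[OF ia[OF a] smp_obj[OF j]] by simp
   qed
   finally have "u = 0" by simp
   then show False using uw(3) smp_id_nonzero[OF j] cmp_zero_right[OF uw(2) smp_obj[OF j]] by simp
  qed
  then obtain a where "a < length js" "js ! a = j" by blast
  then show ?thesis using direct_summandI[OF additive ds, of a] by simp
 qed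
 have "\<not> zero_obj C (smp C j)"
 proof
  assume "zero_obj C (smp C j)"
  then obtain i p where "direct_sum C {..<length ([] :: 'o list)} (\<lambda>n. [] ! n) (smp C j) i p"
   by (auto simp: zero_obj_def is_direct_sum_def)
  from direct_sumD(6)[OF this] show False using smp_id_nonzero[OF j] by simp
 qed
 then show False
  using generates ds[of 0] ds[of 1] r smp_obj[OF j] unfolding generates_as_fusion_category_def by auto
qed

text \<open>The degree depends on the index \<open>j\<close> alone and not on the object in which
  V_j occurs. This is what later makes the map back from the coend dinatural.\<close>

definition ret_deg :: "'i \<Rightarrow> nat" where
 "ret_deg j = (if retract j 0 then 0 else if retract j 1 then 1 else SOME n. retract j n)"

definition ret_in :: "'i \<Rightarrow> 'm" where
 "ret_in j = (SOME u. \<exists>w. arr (smp C j) (tp (ret_deg j)) u \<and> arr (tp (ret_deg j)) (smp C j) w \<and> w \<cdot> u = \<I> (smp C j))"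

definition ret_out :: "'i \<Rightarrow> 'm" where
 "ret_out j = (SOME w. arr (smp C j) (tp (ret_deg j)) (ret_in j) \<and> arr (tp (ret_deg j)) (smp C j) w \<and> w \<cdot> ret_in j = \<I> (smp C j))"

lemma ret_deg_low: "\<lbrakk>j \<in> J; n \<le> 1; retract j n\<rbrakk> \<Longrightarrow> ret_deg j = n"
 using retract_disjoint[of j] by (auto simp: ret_deg_def le_Suc_eq)

lemma ret:
 assumes j: "j \<in> J"
 shows "arr (smp C j) (tp (ret_deg j)) (ret_in j)" "arr (tp (ret_deg j)) (smp C j) (ret_out j)"
  "ret_out j \<cdot> ret_in j = \<I> (smp C j)"
proof -
 have "retract j (ret_deg j)"
  using someI_ex[OF retract_exists[OF j]] by (auto simp: ret_deg_def)
 then have "\<exists>w. arr (smp C j) (tp (ret_deg j)) (ret_in j) \<and> arr (tp (ret_deg j)) (smp C j) w \<and> w \<cdot> ret_in j = \<I> (smp C j)"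
  unfolding retract_def ret_in_def by (rule someI_ex)
 from someI_ex[OF this]
 show "arr (smp C j) (tp (ret_deg j)) (ret_in j)" "arr (tp (ret_deg j)) (smp C j) (ret_out j)"
  "ret_out j \<cdot> ret_in j = \<I> (smp C j)"
  unfolding ret_out_def[symmetric] by auto
qed

definition decomp :: "'o \<Rightarrow> 'i list \<times> (nat \<Rightarrow> 'm) \<times> (nat \<Rightarrow> 'm)" where
 "decomp X = (SOME (js, i, p). set js \<subseteq> J \<and> direct_sum C {..<length js} (\<lambda>a. smp C (js ! a)) X i p)"

definition "dlen X = length (fst (decomp X))"
definition "dix X a = fst (decomp X) ! a"
definition "din X = fst (snd (decomp X))"
definition "dout X = snd (snd (decomp X))"

lemma decomp:
 assumes X: "X \<in> obj C"
 shows "\<And>a. a < dlen X \<Longrightarrow> dix X a \<in> J" "direct_sum C {..<dlen X} (\<lambda>a. smp C (dix X a)) X (din X) (dout X)"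
proof -
 obtain js i p where js: "set js \<subseteq> J" and ds: "direct_sum C {..<length (map (smp C) js)} (\<lambda>a. map (smp C) js ! a) X i p"
  using semisimple X by (auto simp: finitely_split_semisimple_def is_direct_sum_def)
 from ds have "direct_sum C {..<length js} (\<lambda>a. smp C (js ! a)) X i p" unfolding direct_sum_def by simp
 then have "case (js, i, p) of (js, i, p) \<Rightarrow> set js \<subseteq> J \<and> direct_sum C {..<length js} (\<lambda>a. smp C (js ! a)) X i p"
  using js by simp
 from someI[of "\<lambda>(js, i, p). set js \<subseteq> J \<and> direct_sum C {..<length js} (\<lambda>a. smp C (js ! a)) X i p", OF this]
 have *: "set (fst (decomp X)) \<subseteq> J \<and> direct_sum C {..<dlen X} (\<lambda>a. smp C (dix X a)) X (din X) (dout X)"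
  unfolding decomp_def[symmetric] dlen_def dix_def din_def dout_def by (simp add: case_prod_unfold)
 then show "direct_sum C {..<dlen X} (\<lambda>a. smp C (dix X a)) X (din X) (dout X)" by blast
 show "dix X a \<in> J" if "a < dlen X" for a using * that by (auto simp: dix_def dlen_def)
qed

text \<open>Every object factors through tensor powers of $M$: $\mathrm{id}_X=\sum_a G_aF_a$.\<close>

definition "facF X a = ret_in (dix X a) \<cdot> dout X a"
definition "facG X a = din X a \<cdot> ret_out (dix X a)"
abbreviation "fdeg X a \<equiv> ret_deg (dix X a)"

lemma fac:
 assumes X: "X \<in> obj C"
 shows "\<And>a. a < dlen X \<Longrightarrow> arr X (tp (fdeg X a)) (facF X a)" "\<And>a. a < dlen X \<Longrightarrow> arr (tp (fdeg X a)) X (facG X a)"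
  "\<I> X = (\<Sum>a<dlen X. facG X a \<cdot> facF X a)"
proof -
 note D = direct_sumD[OF decomp(2)[OF X]] and jJ = decomp(1)[OF X]
 show F: "arr X (tp (fdeg X a)) (facF X a)" and G: "arr (tp (fdeg X a)) X (facG X a)" if a: "a < dlen X" for a
  using arr_comp[OF D(4) ret(1)[OF jJ]] arr_comp[OF ret(2)[OF jJ] D(3)] a by (auto simp: facF_def facG_def)
 have "facG X a \<cdot> facF X a = din X a \<cdot> dout X a" if a: "a < dlen X" for a
 proof -
  note r = ret[OF jJ[OF a]]
  have i: "arr (smp C (dix X a)) X (din X a)" and p: "arr X (smp C (dix X a)) (dout X a)" using D(3,4) a by auto
  have "facG X a \<cdot> facF X a = din X a \<cdot> (ret_out (dix X a) \<cdot> facF X a)"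
   unfolding facG_def by (rule cmp_assoc[OF F[OF a] r(2) i])
  also have "ret_out (dix X a) \<cdot> facF X a = \<I> (smp C (dix X a)) \<cdot> dout X a"
   unfolding facF_def by (rule cmp_eq[OF p r])
  finally show ?thesis by (simp add: cmp_id_left[OF p])
 qed
 then show "\<I> X = (\<Sum>a<dlen X. facG X a \<cdot> facF X a)" using D(6) by simp
qed

text \<open>The element $\theta\otimes v$ of $(\omega M^{\otimes n})^*\otimes\omega M^{\otimes n}$, expanded in the
 path bases.\<close>

definition path_tensor where
 "path_tensor n \<theta> v = (\<Sum>p\<in>G.P n. \<Sum>q\<in>G.P n. pm_scale (pairing C \<theta> (pv p) * pairing C (pd n q) v) (basis_vec (p, q)))"

lemma lin_eval_path_tensor:
 "lin_eval g (path_tensor n \<theta> v) = (\<Sum>p\<in>G.P n. \<Sum>q\<in>G.P n. pairing C \<theta> (pv p) * pairing C (pd n q) v * g (p, q))"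
 by (simp add: path_tensor_def lin_eval_sum lin_eval_scale)

lemma path_tensor_keys: "keys (path_tensor n \<theta> v) \<subseteq> G.P n \<times> G.P n"
 unfolding path_tensor_def
 by (rule order_trans[OF keys_sum_subset], rule UN_least, rule order_trans[OF keys_sum_subset], rule UN_least,
   rule order_trans[OF keys_pm_scale]) simp

lemma path_tensor_form:
 fixes g :: "_ \<Rightarrow> 'k" and n
 defines "h \<equiv> \<lambda>\<theta> v. lin_eval g (path_tensor n \<theta> v)"
 shows "\<And>\<theta> \<theta>' v. od (tp n) \<theta> \<Longrightarrow> od (tp n) \<theta>' \<Longrightarrow> h (\<theta> + \<theta>') v = h \<theta> v + h \<theta>' v"
  "\<And>\<theta> v v'. om (tp n) v \<Longrightarrow> om (tp n) v' \<Longrightarrow> h \<theta> (v + v') = h \<theta> v + h \<theta> v'"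
  "\<And>c \<theta> v. od (tp n) \<theta> \<Longrightarrow> h (scal C c \<theta>) v = c * h \<theta> v"
  "\<And>c \<theta> v. om (tp n) v \<Longrightarrow> h \<theta> (scal C c v) = c * h \<theta> v"
 unfolding h_def lin_eval_path_tensor
 by (simp_all add: pairing_add_left[OF _ _ pv_om] pairing_add_right[OF pd_od] pairing_scal_left[OF _ pv_om]
   pairing_scal_right[OF pd_od] distrib_left distrib_right sum.distrib sum_distrib_left ac_simps)

text \<open>The map from \<open>[p|q]\<close> to \<open>[e^p|e_q]\<close> on the level of formal
  combinations, before classes are taken.\<close>

definition lift :: "(('i, 'i \<times> 'm \<times> 'i) gpath \<times> ('i, 'i \<times> 'm \<times> 'i) gpath \<Rightarrow>\<^sub>0 'k) \<Rightarrow> ('o \<times> 'm \<times> 'm \<Rightarrow>\<^sub>0 'k)" where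
 "lift = lin_extend (\<lambda>(p, q). basis_vec (tp (path_length p), pd (path_length p) p, pv q))"

lemma lift_basis: "p \<in> G.P n \<Longrightarrow> lift (basis_vec (p, q)) = basis_vec (tp n, pd n p, pv q)"
 by (simp add: lift_def length_path)

lemma symb_path: "p \<in> G.P n \<Longrightarrow> q \<in> G.P n \<Longrightarrow> (tp n, pd n p, pv q) \<in> symb"
 by (simp add: symb_iff tp_obj pv_om pd_od)

lemma lift_in: "x \<in> carrier G.HG \<Longrightarrow> lift x \<in> carrier CF"
 unfolding lift_def CF_simps mem_Collect_eq
proof (rule order_trans[OF keys_lin_extend], rule UN_least)
 fix z assume "x \<in> carrier G.HG" "z \<in> keys x"
 then obtain n p q where z: "z = (p, q)" "p \<in> G.P n" "q \<in> G.P n" by auto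
 show "keys ((case z of (p, q) \<Rightarrow> basis_vec (tp (path_length p), pd (path_length p) p, pv q)) :: _ \<Rightarrow>\<^sub>0 'k) \<subseteq> symb"
  using symb_path[OF z(2,3)] by (simp add: z(1) length_path(2)[OF z(2)])
qed

text \<open>Expanding covector and vector in the path bases and recombining them under a bilinear
  form changes nothing, so \<open>lift\<close> undoes \<open>path_tensor\<close> modulo the coend
  relations.\<close>

lemma lift_path_tensor:
 assumes \<phi>: "coend_form \<phi>" and t: "od (tp n) \<theta>" and v: "om (tp n) v"
 shows "lin_eval \<phi> (lift (path_tensor n \<theta> v)) = \<phi> (tp n, \<theta>, v)"
proof -
 note X = tp_obj[of n] and D = coend_formD[OF \<phi>]
 have "lin_eval \<phi> (lift (path_tensor n \<theta> v)) =
   (\<Sum>p\<in>G.P n. \<Sum>q\<in>G.P n. pairing C \<theta> (pv p) * (pairing C (pd n q) v * \<phi> (tp n, pd n p, pv q)))"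
  unfolding lift_def lin_eval_extend lin_eval_path_tensor
  by (intro sum.cong refl) (simp add: length_path(2)[of _ \<G> n] mult.assoc)
 also have "\<dots> = (\<Sum>p\<in>G.P n. pairing C \<theta> (pv p) * \<phi> (tp n, pd n p, v))"
 proof (intro sum.cong refl)
  fix p assume p: "p \<in> G.P n"
  have "\<phi> (tp n, pd n p, \<Sum>q\<in>G.P n. scal C (pairing C (pd n q) v) (pv q)) =
    (\<Sum>q\<in>G.P n. \<phi> (tp n, pd n p, scal C (pairing C (pd n q) v) (pv q)))"
   by (rule coend_form_sums(1)[OF \<phi> X pd_od[OF p]]) (intro arr_scal pv_om)
  also have "\<dots> = (\<Sum>q\<in>G.P n. pairing C (pd n q) v * \<phi> (tp n, pd n p, pv q))"
   by (intro sum.cong refl D(4)[OF X pd_od[OF p] pv_om])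
  finally show "(\<Sum>q\<in>G.P n. pairing C \<theta> (pv p) * (pairing C (pd n q) v * \<phi> (tp n, pd n p, pv q))) =
    pairing C \<theta> (pv p) * \<phi> (tp n, pd n p, v)"
   using dual_basesD(6)[OF path_dual_bases v] by (simp add: sum_distrib_left)
 qed
 also have "\<dots> = (\<Sum>p\<in>G.P n. \<phi> (tp n, scal C (pairing C \<theta> (pv p)) (pd n p), v))"
  by (intro sum.cong refl D(3)[OF X pd_od v, symmetric])
 also have "\<dots> = \<phi> (tp n, \<Sum>p\<in>G.P n. scal C (pairing C \<theta> (pv p)) (pd n p), v)"
  by (rule coend_form_sums(2)[OF \<phi> X v, symmetric]) (intro arr_scal pd_od)
 finally show ?thesis using dual_bases_covector[OF path_dual_bases t] by simp
qed

text \<open>The vector is pushed forward along \<open>facF X a\<close> and the covector pulled back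
  along \<open>facG X a\<close>, so that both live on a tensor power of \<open>M\<close>.\<close>

definition sect where
 "sect = lin_extend (\<lambda>(X, \<theta>, v). \<Sum>a<dlen X.
   path_tensor (fdeg X a) (\<theta> \<cdot> (\<I> V \<star> facG X a)) (omega_map C (facF X a) v))"

lemma sect_in: "sect t \<in> carrier G.HG"
proof -
 have "keys (sect t) \<subseteq> G.symbols"
  unfolding sect_def
 proof (rule order_trans[OF keys_lin_extend], rule UN_least)
  fix z assume "z \<in> keys t"
  obtain X \<theta> v where z: "z = (X, \<theta>, v)" by (cases z)
  show "keys ((case z of (X, \<theta>, v) \<Rightarrow> \<Sum>a<dlen X.
    path_tensor (fdeg X a) (\<theta> \<cdot> (\<I> V \<star> facG X a)) (omega_map C (facF X a) v))) \<subseteq> G.symbols"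
   unfolding z prod.case
   by (rule order_trans[OF keys_sum_subset], rule UN_least, rule order_trans[OF path_tensor_keys]) auto
 qed
 then show ?thesis by simp
qed

text \<open>Dinaturality moves \<open>facG X a\<close> from the covector to the vector, where the
  sum of the composites with \<open>facF X a\<close> is the identity of \<open>X\<close>. Thus
  \<open>sect\<close> provides preimages under the surjection.\<close>

lemma lift_sect:
 assumes \<phi>: "coend_form \<phi>" and t: "t \<in> carrier CF"
 shows "lin_eval \<phi> (lift (sect t)) = lin_eval \<phi> t"
proof -
 have "lin_eval \<phi> (lift (sect t)) = lin_eval (\<lambda>z. lin_eval \<phi> (lift (sect (basis_vec z)))) t"
  unfolding lift_def sect_def by (simp add: lin_eval_extend)
 also have "\<dots> = lin_eval \<phi> t"
 proof (rule lin_eval_cong)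
  fix z assume "z \<in> keys t"
  then have "z \<in> symb" using t by auto
  then obtain X \<theta> v where z: "z = (X, \<theta>, v)" and X: "X \<in> obj C" and th: "od X \<theta>" and v: "om X v"
   by (cases z) (auto simp: symb_iff)
  note F = fac[OF X]
  have GF: "arr X X (facG X a \<cdot> facF X a)" if "a < dlen X" for a using arr_comp[OF F(1,2)] that by auto
  have "lin_eval \<phi> (lift (sect (basis_vec z))) = (\<Sum>a<dlen X. \<phi> (tp (fdeg X a), \<theta> \<cdot> (\<I> V \<star> facG X a), omega_map C (facF X a) v))"
   unfolding z sect_def lin_extend_basis_vec prod.case
   by (subst lift_def, subst lin_extend_sum, fold lift_def, unfold lin_eval_sum, intro sum.cong refl lift_path_tensor[OF \<phi>])
    (use omega_comap_arr[OF F(2) th] omega_map_arr[OF F(1) v] in auto)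
  also have "\<dots> = (\<Sum>a<dlen X. \<phi> (X, \<theta>, omega_map C (facG X a \<cdot> facF X a) v))"
  proof (intro sum.cong refl)
   fix a assume "a \<in> {..<dlen X}"
   then have f: "arr X (tp (fdeg X a)) (facF X a)" and g: "arr (tp (fdeg X a)) X (facG X a)" using F by auto
   show "\<phi> (tp (fdeg X a), \<theta> \<cdot> (\<I> V \<star> facG X a), omega_map C (facF X a) v) = \<phi> (X, \<theta>, omega_map C (facG X a \<cdot> facF X a) v)"
    using coend_formD(5)[OF \<phi> g th omega_map_arr[OF f v]] by (simp add: omega_map_cmp[OF f g v])
  qed
  also have "\<dots> = \<phi> (X, \<theta>, \<Sum>a<dlen X. omega_map C (facG X a \<cdot> facF X a) v)"
   by (rule coend_form_sums(1)[OF \<phi> X th, symmetric]) (use omega_map_arr[OF GF v] in auto)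
  also have "(\<Sum>a<dlen X. omega_map C (facG X a \<cdot> facF X a) v) = omega_map C (\<I> X) v"
   unfolding F(3) by (rule omega_map_sum[symmetric]) (use GF v X in auto)
  also have "omega_map C (\<I> X) v = v" by (rule omega_map_id[OF X v])
  finally show "lin_eval \<phi> (lift (sect (basis_vec z))) = \<phi> z" by (simp add: z)
 qed
 finally show ?thesis .
qed

end

context scalars_module
begin

lemma a_inv_smult: "x \<in> carrier V \<Longrightarrow> \<ominus> x = (- 1) \<odot> x"
 using smult_add[of x "- 1" 1] by (intro minus_equality) (auto simp: smult_1 smult_zero_left smult_in)

end

context semisimple_monoidal
begin

text \<open>Allows a bilinear form on the coend to be treated as a coend form in one variable at a
  time, the other variable being a fixed class.\<close>

lemma coend_form_quot:
 assumes g: "linear_form (coend C) g"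
 shows "coend_form (\<lambda>s. g (coend.cl (basis_vec s)))"
proof (rule coend_form_linear)
 have l: "linear_on CF (coend C) coend.cl" using coend.linear_cl by (simp add: coend_eq)
 show "linear_form CF (\<lambda>s. g (coend.cl s))" by (rule linear_form_comp[OF g l])
 fix n assume n: "n \<in> CR"
 then have nc: "n \<in> carrier CF" using CR_subset by auto
 have "coend.cl n = coend.cl (pm_scale 0 n)"
  using coend.cl_N[OF n] coend.cl_N[OF coend.N_smult[OF n, of 0]] by simp
 then have "g (coend.cl n) = g (coend.cl (0 \<odot>\<^bsub>CF\<^esub> n))" by simp
 also have "\<dots> = 0 * g (coend.cl n)"
  unfolding linear_on_smult[OF l nc] by (rule linear_form_smult[OF g linear_on_closed[OF l nc]])
 finally show "g (coend.cl n) = 0" by simp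
qed

end

section \<open>The homomorphism from the graph Weak Bialgebra onto the coend\<close>

context fusion_generator
begin

abbreviation Hg :: "('k, ('i, 'i \<times> 'm \<times> 'i) gpath \<times> ('i, 'i \<times> 'm \<times> 'i) gpath \<Rightarrow>\<^sub>0 'k) wba" where
 "Hg \<equiv> graph_wba \<G>"

text \<open>An explicit version of \<open>canonical_pi\<close>, which is introduced by a definite
  description. The two agree on the carrier, as shown once uniqueness is available.\<close>

definition graph_pi where "graph_pi x = coend.cl (lift x)"

lemma lift_linear:
 "lift (x + y) = lift x + lift y" "lift (pm_scale c x) = pm_scale c (lift x)" "lift 0 = 0"
 by (simp_all add: lift_def lin_extend_add lin_extend_scale)

text \<open>The two sides carry symbols at different objects, \<open>tp (n + m)\<close> and
  \<open>tp n \<boxtimes> tp m\<close>. A comparison map \<open>f\<close> between these, pulled out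
  of the covector and applied to the vector by dinaturality, turns one symbol into the
  other.\<close>

lemma lift_mult:
 assumes x: "x \<in> carrier Hg" and y: "y \<in> carrier Hg"
 shows "coend.cl (lift (x \<otimes>\<^bsub>Hg\<^esub> y)) = coend.cl (lift x \<otimes>\<^bsub>CF\<^esub> lift y)"
proof (rule cl_eqI)
 have "x \<otimes>\<^bsub>Hg\<^esub> y \<in> carrier Hg" using G.mult_in[of x y] x y by simp
 then show "lift (x \<otimes>\<^bsub>Hg\<^esub> y) \<in> carrier CF" by (rule lift_in)
 show "lift x \<otimes>\<^bsub>CF\<^esub> lift y \<in> carrier CF" by (rule coend.mult_closed[OF lift_in[OF x] lift_in[OF y]])
 fix \<phi> assume \<phi>: "coend_form \<phi>"
 note D = coend_formD[OF \<phi>]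
 let ?m = "\<lambda>(X, \<theta>, v) (Y, \<zeta>, w). basis_vec (X \<boxtimes> Y, codia X Y \<theta> \<zeta>, dia X Y v w) :: _ \<Rightarrow>\<^sub>0 'k"
 let ?L = "\<lambda>(p, q). (tp (path_length p), pd (path_length p) p, pv q)"
 have "lin_eval \<phi> (lift (x \<otimes>\<^bsub>Hg\<^esub> y)) = lin_eval (\<lambda>a. lin_eval (\<lambda>b. lin_eval \<phi> (lift (G.gmult a b))) y) x"
  by (simp add: lift_def lin_eval_extend lin_eval_bilin_extend)
 also have "\<dots> = lin_eval (\<lambda>a. lin_eval (\<lambda>b. lin_eval \<phi> (?m (?L a) (?L b))) y) x"
 proof (intro lin_eval_cong)
  fix a b assume ab: "a \<in> keys x" "b \<in> keys y"
  obtain n p q where a: "a = (p, q)" "p \<in> G.P n" "q \<in> G.P n" using x ab(1) by auto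
  obtain m r s where b: "b = (r, s)" "r \<in> G.P m" "s \<in> G.P m" using y ab(2) by auto
  obtain f where f: "arr (tp n \<boxtimes> tp m) (tp (n + m)) f"
   and fe: "\<And>p r. p \<in> G.P n \<Longrightarrow> r \<in> G.P m \<Longrightarrow> omega_map C f (dia (tp n) (tp m) (pv p) (pv r)) =
     (if G.\<sigma> p = G.\<tau> r then pv (path_append p r) else 0)" using tensor_power_iso[of n m] by blast
  note X = tp_obj[of n] and Y = tp_obj[of m]
  note XY = tobj_closed[OF X Y]
  note dd = arr_dia[OF X Y pv_om[OF a(3)] pv_om[OF b(3)]]
  have "\<phi> (tp n \<boxtimes> tp m, codia (tp n) (tp m) (pd n p) (pd m r), dia (tp n) (tp m) (pv q) (pv s)) =
    lin_eval \<phi> (lift (G.gmult (p, q) (r, s)))"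
  proof (cases "G.\<sigma> p = G.\<tau> r")
   case True
   have pr: "path_append p r \<in> G.P (n + m)" by (rule path_append_in[OF a(2) b(2) True])
   note pdo = pd_od[OF pr]
   have "\<phi> (tp n \<boxtimes> tp m, codia (tp n) (tp m) (pd n p) (pd m r), dia (tp n) (tp m) (pv q) (pv s)) =
     \<phi> (tp (n + m), pd (n + m) (path_append p r), omega_map C f (dia (tp n) (tp m) (pv q) (pv s)))"
    using codia_pd[OF f fe a(2) b(2)] True D(5)[OF f pdo dd] by simp
   \<comment> \<open>Includes the case that the second paths \<open>q\<close> and \<open>s\<close>
     do not compose: the vector in the symbol is then 0, and a coend form vanishes there.\<close>
   also have "\<dots> = lin_eval \<phi> (lift (G.gmult (p, q) (r, s)))"
    using D(4)[OF tp_obj pdo arr_zero[OF V_obj tobj_closed[OF V_obj tp_obj]], of 0]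
    by (simp add: fe[OF a(3) b(3)] True lift_basis[OF pr] lift_linear)
   finally show ?thesis .
  next
   case False
   then show ?thesis
    using codia_pd[OF f fe a(2) b(2)] D(3)[OF XY arr_zero[OF tobj_closed[OF V_obj XY] V_obj] dd, of 0]
    by (simp add: lift_linear)
  qed
  then show "lin_eval \<phi> (lift (G.gmult a b)) = lin_eval \<phi> (?m (?L a) (?L b))"
   by (simp add: a(1) b(1) length_path(2)[OF a(2)] length_path(2)[OF b(2)])
 qed
 also have "\<dots> = lin_eval \<phi> (lift x \<otimes>\<^bsub>CF\<^esub> lift y)"
  by (simp add: mult_CF lin_eval_bilin_extend lift_def lin_eval_extend case_prod_unfold)
 finally show "lin_eval \<phi> (lift (x \<otimes>\<^bsub>Hg\<^esub> y)) = lin_eval \<phi> (lift x \<otimes>\<^bsub>CF\<^esub> lift y)" .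
qed

lemma pd_vertex: "j \<in> J \<Longrightarrow> pd 0 (vertex_path j) = vertex_covec C j"
 using dual_vec_eq[OF vertex_dual_bases, of "vertex_path j"]
 by (simp add: pd_def vertex_covec_def vertex_path_in)

lemma pd_edge: "e \<in> arcs \<G> \<Longrightarrow> pd 1 (edge_path \<G> e) = edge_covec C M B e"
 using dual_vec_eq[OF edge_path_dual_bases G.edge_path_in, of e] by (simp add: pd_def edge_path_def)

lemma graph_pi_vertex:
 "j \<in> J \<Longrightarrow> l \<in> J \<Longrightarrow> graph_pi (basis_vec (vertex_path j, vertex_path l)) = coend_elem C \<bbbone> (vertex_covec C j) (vertex_vec C l)"
 using lift_basis[of "vertex_path j" 0 "vertex_path l"]
 by (simp add: graph_pi_def coend_elem_eq vertex_path_in pd_vertex pv_vertex vertex_vec_def)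

lemma graph_pi_edge:
 "p \<in> arcs \<G> \<Longrightarrow> graph_pi (basis_vec (edge_path \<G> p, edge_path \<G> q)) = coend_elem C M (edge_covec C M B p) (edge_vec C M q)"
 using lift_basis[OF G.edge_path_in, of p "edge_path \<G> q"] pd_edge[of p]
 by (simp add: graph_pi_def coend_elem_eq pv_edge)

text \<open>The idempotents \<open>lam C j\<close> sum to the identity of \<open>V\<close>, so the
  vertex covectors sum to the right unit and the vertex vectors to its inverse.\<close>

lemma lift_one: "coend.cl (lift \<one>\<^bsub>Hg\<^esub>) = \<one>\<^bsub>coend C\<^esub>"
 unfolding coend_eq coend.one_Q
proof (rule cl_eqI)
 show "lift \<one>\<^bsub>Hg\<^esub> \<in> carrier CF" by (rule lift_in[OF G.one_in])
 show "\<one>\<^bsub>CF\<^esub> \<in> carrier CF" by (rule coend.one_closed)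
 fix \<phi> assume \<phi>: "coend_form \<phi>"
 note r = runit_inv(1)[OF V_obj] and s = arr_runit[OF V_obj]
 have c: "od \<bbbone> (lam C j \<cdot> \<rho>\<^sub>u V)" and v: "om \<bbbone> (runit_inv C V \<cdot> lam C j)" if "j \<in> J" for j
  using arr_comp[OF s arr_lam[OF that]] arr_comp[OF arr_lam[OF that] r] by simp_all
 have "lin_eval \<phi> (lift \<one>\<^bsub>Hg\<^esub>) = (\<Sum>j\<in>J. \<Sum>l\<in>J. \<phi> (\<bbbone>, lam C j \<cdot> \<rho>\<^sub>u V, runit_inv C V \<cdot> lam C l))"
  using pd_vertex by (simp add: lift_def lin_extend_sum lin_eval_sum length_path(2)[of _ \<G> 0] vertex_path_in pv_vertex vertex_covec_def)
 also have "\<dots> = (\<Sum>j\<in>J. \<phi> (\<bbbone>, lam C j \<cdot> \<rho>\<^sub>u V, \<Sum>l\<in>J. runit_inv C V \<cdot> lam C l))"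
  by (intro sum.cong refl coend_form_sums(1)[OF \<phi> unit_closed, symmetric] c v)
 also have "\<dots> = \<phi> (\<bbbone>, \<Sum>j\<in>J. lam C j \<cdot> \<rho>\<^sub>u V, \<Sum>l\<in>J. runit_inv C V \<cdot> lam C l)"
  using arr_sum[OF V_obj tobj_closed[OF V_obj unit_closed] v, of J]
  by (intro coend_form_sums(2)[OF \<phi> unit_closed, symmetric] c) auto
 also have "(\<Sum>j\<in>J. lam C j \<cdot> \<rho>\<^sub>u V) = \<rho>\<^sub>u V"
  using cmp_sum_left[OF s V_obj arr_lam, of J] cmp_id_left[OF s] by (simp add: id_V)
 also have "(\<Sum>l\<in>J. runit_inv C V \<cdot> lam C l) = runit_inv C V"
  using cmp_sum_right[OF r V_obj arr_lam, of J] cmp_id_right[OF r] by (simp add: id_V)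
 finally show "lin_eval \<phi> (lift \<one>\<^bsub>Hg\<^esub>) = lin_eval \<phi> \<one>\<^bsub>CF\<^esub>" by (simp add: one_CF)
qed

text \<open>The comultiplication of the coend uses an arbitrary basis, that of the graph uses paths.
  For a bilinear form on the coend, \<open>canonical_element\<close> exchanges the one for the
  other.\<close>

lemma lift_comult:
 assumes x: "x \<in> carrier Hg"
 shows "tensor_eq (coend C) (coend C) (comult (coend C) (graph_pi x)) (tensor_map graph_pi graph_pi (comult Hg x))"
 unfolding tensor_eq_iff
proof (intro allI impI)
 fix \<beta> assume \<beta>: "bilinear_form (coend C) (coend C) \<beta>"
 let ?c = "\<lambda>s. coend.cl (basis_vec s)"
 have c: "?c s \<in> carrier (coend C)" if "s \<in> symb" for s using that by (simp add: coend_eq coend.carrier_Q)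
 have "lin_eval \<beta> (comult (coend C) (graph_pi x)) = lin_eval (\<lambda>(a, b). \<beta> (coend.cl a, coend.cl b)) (comult CF (lift x))"
  unfolding graph_pi_def coend_eq
  by (rule tensor_map_bilinear[OF coend.comult_Q[OF lift_in[OF x]]]) (use \<beta> in \<open>simp add: coend_eq\<close>)
 also have "\<dots> = lin_eval (\<lambda>(p, q). \<Sum>b\<in>ob (tp (path_length p)). \<beta> (?c (tp (path_length p), pd (path_length p) p, b),
   ?c (tp (path_length p), obd (tp (path_length p)) b, pv q))) x"
  by (simp add: comult_CF lift_def lin_eval_extend lin_eval_sum case_prod_unfold)
 also have "\<dots> = lin_eval (\<lambda>(p, q). \<Sum>r\<in>G.P (path_length p). \<beta> (graph_pi (basis_vec (p, r)), graph_pi (basis_vec (r, q)))) x"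
 proof (rule lin_eval_cong)
  fix a assume "a \<in> keys x"
  then obtain n p q where a: "a = (p, q)" "p \<in> G.P n" "q \<in> G.P n" using x by auto
  note X = tp_obj[of n] and p = pd_od[OF a(2)] and q = pv_om[OF a(3)]
  have s1: "(tp n, pd n p, v) \<in> symb" if "om (tp n) v" for v using that X p by (simp add: symb_iff)
  have s2: "(tp n, \<theta>, pv q) \<in> symb" if "od (tp n) \<theta>" for \<theta> using that X q by (simp add: symb_iff)
  note L = coend_formD[OF coend_form_quot[OF bilinear_form_left[OF \<beta> c[OF s2]]]]
   and R = coend_formD[OF coend_form_quot[OF bilinear_form_right[OF \<beta> c[OF s1]]]]
  have "(\<Sum>b\<in>ob (tp n). \<beta> (?c (tp n, pd n p, b), ?c (tp n, obd (tp n) b, pv q))) =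
    (\<Sum>r\<in>G.P n. \<beta> (?c (tp n, pd n p, pv r), ?c (tp n, pd n r, pv q)))"
   by (rule canonical_element[OF omega_basis[OF X] path_dual_bases])
    (simp_all add: L(2)[OF _ X p] L(4)[OF _ X p] R(1)[OF _ X _ _ q] R(3)[OF _ X _ q])
  then show "(case a of (p, q) \<Rightarrow> \<Sum>b\<in>ob (tp (path_length p)). \<beta> (?c (tp (path_length p), pd (path_length p) p, b),
    ?c (tp (path_length p), obd (tp (path_length p)) b, pv q))) =
   (case a of (p, q) \<Rightarrow> \<Sum>r\<in>G.P (path_length p). \<beta> (graph_pi (basis_vec (p, r)), graph_pi (basis_vec (r, q))))"
   by (simp add: a(1) length_path(2)[OF a(2)] graph_pi_def lift_basis[OF a(2)] lift_basis cong: sum.cong)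
 qed
 also have "\<dots> = lin_eval \<beta> (tensor_map graph_pi graph_pi (comult Hg x))"
  by (simp add: lin_eval_tensor_map lin_eval_extend lin_eval_sum case_prod_unfold)
 finally show "lin_eval \<beta> (comult (coend C) (graph_pi x)) = lin_eval \<beta> (tensor_map graph_pi graph_pi (comult Hg x))" .
qed

lemma lift_counit: "x \<in> carrier Hg \<Longrightarrow> counit CF (lift x) = counit Hg x"
proof -
 assume x: "x \<in> carrier Hg"
 have "counit CF (lift x) = lin_eval (\<lambda>(p, q). pairing C (pd (path_length p) p) (pv q)) x"
  by (simp add: counit_CF lift_def lin_eval_extend case_prod_unfold)
 also have "\<dots> = counit Hg x"
  unfolding G.HG_simps
 proof (rule lin_eval_cong)
  fix a assume "a \<in> keys x"
  then obtain n p q where a: "a = (p, q)" "p \<in> G.P n" "q \<in> G.P n" using x by auto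
  show "(case a of (p, q) \<Rightarrow> pairing C (pd (path_length p) p) (pv q)) = (case a of (p, q) \<Rightarrow> if p = q then 1 else 0)"
   by (simp add: a(1) length_path(2)[OF a(2)] pd_pv[OF a(2,3)])
 qed
 finally show ?thesis .
qed

lemma graph_pi_carrier: "graph_pi ` carrier Hg = carrier (coend C)"
proof (intro equalityI subsetI)
 fix y assume "y \<in> carrier (coend C)"
 then obtain t where t: "t \<in> carrier CF" "y = coend.cl t" by (auto simp: coend_eq coend.carrier_Q simp del: CF_simps(1))
 have "y = graph_pi (sect t)"
  unfolding t(2) graph_pi_def by (rule cl_eqI[OF t(1) lift_in[OF sect_in]]) (simp add: lift_sect t(1) del: CF_simps(1))
 then show "y \<in> graph_pi ` carrier Hg" using sect_in by blast
next
 fix y assume "y \<in> graph_pi ` carrier Hg"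
 then obtain x where "x \<in> carrier Hg" "y = coend.cl (lift x)" by (auto simp: graph_pi_def simp del: G.HG_simps(1))
 then show "y \<in> carrier (coend C)" unfolding coend_eq coend.carrier_Q using lift_in by blast
qed

text \<open>Here the axioms reach the coend: that it is a Weak Bialgebra is the conclusion
  \<open>pi.weak_bialgebra'\<close>.\<close>

sublocale pi: wba_surjection Hg "coend C" graph_pi
proof (rule wba_surjection.intro)
 fix x y c assume x: "x \<in> carrier Hg" and y: "y \<in> carrier Hg"
 note lx = lift_in[OF x] and ly = lift_in[OF y]
 show "graph_pi (x \<oplus>\<^bsub>Hg\<^esub> y) = graph_pi x \<oplus>\<^bsub>coend C\<^esub> graph_pi y"
  unfolding graph_pi_def coend_eq coend.add_Q[OF lx ly] by (simp add: lift_linear)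
 show "graph_pi (x \<otimes>\<^bsub>Hg\<^esub> y) = graph_pi x \<otimes>\<^bsub>coend C\<^esub> graph_pi y"
  using lift_mult[OF x y] coend.mult_Q[OF lx ly] by (simp only: graph_pi_def coend_eq)
next
 fix x c assume x: "x \<in> carrier Hg"
 note lx = lift_in[OF x]
 show "graph_pi (c \<odot>\<^bsub>Hg\<^esub> x) = c \<odot>\<^bsub>coend C\<^esub> graph_pi x"
  unfolding graph_pi_def coend_eq coend.smult_Q[OF lx] by (simp add: lift_linear)
 show "keys (comult (coend C) (graph_pi x)) \<subseteq> carrier (coend C) \<times> carrier (coend C)"
  unfolding graph_pi_def coend_eq by (rule coend.keys_comult_Q[OF lx])
 show "tensor_eq (coend C) (coend C) (comult (coend C) (graph_pi x)) (tensor_map graph_pi graph_pi (comult Hg x))"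
  by (rule lift_comult[OF x])
 show "counit (coend C) (graph_pi x) = counit Hg x"
  unfolding graph_pi_def coend_eq coend.counit_Q[OF lx] by (rule lift_counit[OF x])
next
 show "graph_pi \<zero>\<^bsub>Hg\<^esub> = \<zero>\<^bsub>coend C\<^esub>" by (simp add: graph_pi_def coend_eq coend.zero_Q lift_linear)
 show "graph_pi \<one>\<^bsub>Hg\<^esub> = \<one>\<^bsub>coend C\<^esub>" unfolding graph_pi_def by (rule lift_one)
qed (fact G.graph_weak_bialgebra graph_pi_carrier)+

text \<open>A symbol of positive degree is the product of a symbol of lower degree and one of degree
  1, by splitting off the last edges of both paths. A multiplicative map is thus determined in
  degrees 0 and 1.\<close>

lemma hom_unique:
 assumes f: "wba_hom Hg (coend C) f"
  and v: "\<And>j l. j \<in> J \<Longrightarrow> l \<in> J \<Longrightarrow> f (basis_vec (vertex_path j, vertex_path l)) =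
   coend_elem C \<bbbone> (vertex_covec C j) (vertex_vec C l)"
  and e: "\<And>p q. p \<in> arcs \<G> \<Longrightarrow> q \<in> arcs \<G> \<Longrightarrow> f (basis_vec (edge_path \<G> p, edge_path \<G> q)) =
   coend_elem C M (edge_covec C M B p) (edge_vec C M q)"
  and x: "x \<in> carrier Hg"
 shows "f x = graph_pi x"
proof -
 have lin: "linear_on Hg (coend C) f" and rh: "f \<in> ring_hom Hg (coend C)" using f by (auto simp: wba_hom_def)
 have bas: "\<forall>p\<in>G.P n. \<forall>q\<in>G.P n. f (basis_vec (p, q)) = graph_pi (basis_vec (p, q))" for n
 proof (induction n)
  case 0
  then show ?case by (auto simp: paths_0 v graph_pi_vertex)
 next
  case (Suc n)
  show ?case
  proof (intro ballI)
   fix p q assume p: "p \<in> G.P (Suc n)" and q: "q \<in> G.P (Suc n)"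
   obtain p' d where p': "p' \<in> G.P n" "d \<in> arcs \<G>" "G.\<sigma> p' = head \<G> d" "p = path_append p' (edge_path \<G> d)"
    using p by (rule G.path_Suc_cases)
   obtain q' e' where q': "q' \<in> G.P n" "e' \<in> arcs \<G>" "G.\<sigma> q' = head \<G> e'" "q = path_append q' (edge_path \<G> e')"
    using q by (rule G.path_Suc_cases)
   have b1: "basis_vec (p', q') \<in> carrier Hg" and b2: "basis_vec (edge_path \<G> d, edge_path \<G> e') \<in> carrier Hg"
    using p'(1,2) q'(1,2) G.edge_path_in[of d] G.edge_path_in[of e'] by auto
   have pq: "basis_vec (p, q) = basis_vec (p', q') \<otimes>\<^bsub>Hg\<^esub> basis_vec (edge_path \<G> d, edge_path \<G> e')"
    using p'(3) q'(3) by (simp add: p'(4) q'(4))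
   show "f (basis_vec (p, q)) = graph_pi (basis_vec (p, q))"
    unfolding pq pi.hom_mult[OF b1 b2] ring_hom_mult[OF rh b1 b2]
    using Suc p'(1,2) q'(1,2) e graph_pi_edge by simp
  qed
 qed
 have "keys x \<subseteq> G.symbols" using x by simp
 then show ?thesis
 proof (induction x rule: pm_basis_induct)
  case zero
  have z: "(0 :: _ \<Rightarrow>\<^sub>0 'k) \<in> carrier Hg" by simp
  interpret Q: scalars_module "coend C" by (rule scalars_module.intro[OF pi.module'])
  show ?case
   using linear_on_smult[OF lin z, of 0] linear_on_smult[OF pi.linear z, of 0]
    Q.smult_zero_left[OF linear_on_closed[OF lin z]] Q.smult_zero_left[OF linear_on_closed[OF pi.linear z]] by simp
 next
  case (basis a)
  then show ?case using bas by auto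
 next
  case (add s t)
  then show ?case using linear_on_add[OF lin, of s t] linear_on_add[OF pi.linear, of s t] by simp
 next
  case (scale c s)
  then show ?case using linear_on_smult[OF lin, of s c] linear_on_smult[OF pi.linear, of s c] by simp
 qed
qed

text \<open>Needed to pass from \<open>graph_pi\<close> to its restriction to the carrier, as the
  description of \<open>canonical_pi\<close> demands an extensional function.\<close>

lemma wba_hom_cong:
 assumes "wba_hom H H' f" "\<And>x. x \<in> carrier H \<Longrightarrow> f x = g x"
 shows "wba_hom H H' g"
proof -
 interpret H: weak_bialgebra H using assms(1) by (simp add: wba_hom_def)
 have "tensor_eq H' H' (comult H' (g x)) (tensor_map g g (comult H x))" if x: "x \<in> carrier H" for x
 proof -
  have "tensor_map f f (comult H x) = tensor_map g g (comult H x)"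
   unfolding tensor_map_def using H.keys_comult[OF x] assms(2) by (intro lin_extend_cong) auto
  then show ?thesis using assms x by (auto simp: wba_hom_def)
 qed
 moreover have "linear_on H H' g" "g \<in> ring_hom H H'"
  using assms by (auto simp: wba_hom_def linear_on_def ring_hom_def Pi_iff H.S.smult_in)
 ultimately show ?thesis using assms by (auto simp: wba_hom_def)
qed

lemma canonical_pi_eq: "x \<in> carrier Hg \<Longrightarrow> canonical_pi C M B x = graph_pi x"
proof -
 assume x: "x \<in> carrier Hg"
 let ?r = "restrict graph_pi (carrier Hg)"
 have vc: "basis_vec (vertex_path j, vertex_path l) \<in> carrier Hg" if "j \<in> J" "l \<in> J" for j l
  using that by (auto intro!: exI[of _ 0] simp: vertex_path_in)
 have ec: "basis_vec (edge_path \<G> p, edge_path \<G> q) \<in> carrier Hg" if "p \<in> arcs \<G>" "q \<in> arcs \<G>" for p q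
  by simp (rule exI[of _ 1], use that G.edge_path_in in simp)
 have "canonical_pi C M B = ?r"
  unfolding canonical_pi_def
 proof (rule the_equality, intro conjI ballI)
  show "wba_hom Hg (coend C) ?r" by (rule wba_hom_cong[OF pi.hom]) simp
  show "?r (basis_vec (vertex_path j, vertex_path l)) = coend_elem C \<bbbone> (vertex_covec C j) (vertex_vec C l)"
   if "j \<in> J" "l \<in> J" for j l
   unfolding restrict_apply'[OF vc[OF that]] by (rule graph_pi_vertex[OF that])
  show "?r (basis_vec (edge_path \<G> p, edge_path \<G> q)) = coend_elem C M (edge_covec C M B p) (edge_vec C M q)"
   if "p \<in> arcs \<G>" "q \<in> arcs \<G>" for p q
   unfolding restrict_apply'[OF ec[OF that]] by (rule graph_pi_edge[OF that(1)])
 next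
  fix f assume f: "f \<in> extensional (carrier Hg) \<and> wba_hom Hg (coend C) f \<and>
   (\<forall>j\<in>J. \<forall>l\<in>J. f (basis_vec (vertex_path j, vertex_path l)) = coend_elem C \<bbbone> (vertex_covec C j) (vertex_vec C l)) \<and>
   (\<forall>p\<in>arcs \<G>. \<forall>q\<in>arcs \<G>. f (basis_vec (edge_path \<G> p, edge_path \<G> q)) = coend_elem C M (edge_covec C M B p) (edge_vec C M q))"
  show "f = ?r"
  proof (rule extensionalityI[of _ "carrier Hg"])
   fix x assume "x \<in> carrier Hg"
   then show "f x = ?r x" using hom_unique[of f x] f by (simp del: G.HG_simps(1))
  qed (use f in auto)
 qed simp
 then show ?thesis using x by (simp del: G.HG_simps(1))
qed

end

section \<open>The ideal of an endomorphism system\<close>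

context weak_bialgebra
begin

lemma genideal_subset:
 assumes J: "J \<subseteq> carrier H" "\<zero> \<in> J" "\<And>x y. x \<in> J \<Longrightarrow> y \<in> J \<Longrightarrow> x \<oplus> y \<in> J" "\<And>c x. x \<in> J \<Longrightarrow> c \<odot> x \<in> J"
  and l: "\<And>a x. a \<in> J \<Longrightarrow> x \<in> carrier H \<Longrightarrow> x \<otimes> a \<in> J" and r: "\<And>a x. a \<in> J \<Longrightarrow> x \<in> carrier H \<Longrightarrow> a \<otimes> x \<in> J"
  and S: "S \<subseteq> J"
 shows "genideal H S \<subseteq> J"
proof (rule A.genideal_minimal[OF idealI S])
 show "ring H" by (rule A.ring_axioms)
 show "subgroup J (add_monoid H)"
 proof (rule subgroup.intro)
  fix x assume x: "x \<in> J"
  then have "\<ominus> x \<in> J" using J(4)[OF x, of "- 1"] J(1) by (auto simp: S.a_inv_smult)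
  then show "inv\<^bsub>add_monoid H\<^esub> x \<in> J" by (simp add: a_inv_def)
 qed (use J in simp_all)
qed (fact l r)+

lemma linear_on_mult:
 assumes "x \<in> carrier H"
 shows "linear_on H H (\<lambda>y. x \<otimes> y)" "linear_on H H (\<lambda>y. y \<otimes> x)"
 using assms by (auto simp: linear_on_def A.r_distr A.l_distr smult_mult_left smult_mult_right)

lemma bilinear_mult_left:
 "\<lbrakk>bilinear_form H H \<beta>; a \<in> carrier H; b \<in> carrier H\<rbrakk> \<Longrightarrow> bilinear_form H H (\<lambda>(c, d). \<beta> (a \<otimes> c, b \<otimes> d))"
 by (rule bilinear_form_comp) (rule linear_on_mult; assumption | assumption)+

lemma bilinear_mult_right:
 "\<lbrakk>bilinear_form H H \<beta>; a \<in> carrier H; b \<in> carrier H\<rbrakk> \<Longrightarrow> bilinear_form H H (\<lambda>(c, d). \<beta> (c \<otimes> a, d \<otimes> b))"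
 by (rule bilinear_form_comp) (rule linear_on_mult; assumption | assumption)+

text \<open>The coideal property has to be checked on generators only. The set \<open>J\<close> of
  elements whose coproduct is killed by all admissible forms is an ideal, because the
  comultiplication is multiplicative and an admissible form stays admissible when its two arguments
  are multiplied by fixed elements.\<close>

lemma genideal_comult:
 assumes I: "I = genideal H S" "ideal I H" "S \<subseteq> carrier H"
  and S: "\<And>\<beta> s. \<lbrakk>bilinear_form H H \<beta>; (\<And>m x. m \<in> I \<Longrightarrow> x \<in> carrier H \<Longrightarrow> \<beta> (m, x) = 0 \<and> \<beta> (x, m) = 0);
   s \<in> S\<rbrakk> \<Longrightarrow> lin_eval \<beta> (\<Delta> s) = 0"
  and \<beta>: "bilinear_form H H \<beta>" and \<beta>I: "\<And>m x. m \<in> I \<Longrightarrow> x \<in> carrier H \<Longrightarrow> \<beta> (m, x) = 0 \<and> \<beta> (x, m) = 0"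
  and n: "n \<in> I"
 shows "lin_eval \<beta> (\<Delta> n) = 0"
proof -
 define P where "P \<gamma> \<longleftrightarrow> bilinear_form H H \<gamma> \<and> (\<forall>m\<in>I. \<forall>x\<in>carrier H. \<gamma> (m, x) = 0 \<and> \<gamma> (x, m) = 0)" for \<gamma> :: "'a \<times> 'a \<Rightarrow> 'k"
 define J where "J = {x \<in> carrier H. \<forall>\<gamma>. P \<gamma> \<longrightarrow> lin_eval \<gamma> (\<Delta> x) = 0}"
 have Pl: "P (\<lambda>(c, d). \<gamma> (a \<otimes> c, b \<otimes> d))" and Pr: "P (\<lambda>(c, d). \<gamma> (c \<otimes> a, d \<otimes> b))"
  if "P \<gamma>" "a \<in> carrier H" "b \<in> carrier H" for \<gamma> a b
  using that bilinear_mult_left[of \<gamma> a b] bilinear_mult_right[of \<gamma> a b]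
   ideal.I_l_closed[OF I(2)] ideal.I_r_closed[OF I(2)]
  by (auto simp: P_def)
 have lf: "linear_form H (\<lambda>x. lin_eval \<gamma> (\<Delta> x))" if "P \<gamma>" for \<gamma> using that linear_form_comult by (simp add: P_def)
 have "genideal H S \<subseteq> J"
 proof (rule genideal_subset)
  show "J \<subseteq> carrier H" by (auto simp: J_def)
  show "\<zero> \<in> J" using S.linear_form_zero[OF lf] by (simp add: J_def)
  show "x \<oplus> y \<in> J" if "x \<in> J" "y \<in> J" for x y
   using that linear_form_add[OF lf] by (simp add: J_def)
  show "c \<odot> x \<in> J" if "x \<in> J" for c x
   using that linear_form_smult[OF lf] by (simp add: J_def S.smult_in)
  fix a x assume a: "a \<in> J" and x: "x \<in> carrier H"
  then have ac: "a \<in> carrier H" by (simp add: J_def)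
  have "lin_eval \<gamma> (\<Delta> (x \<otimes> a)) = 0" if \<gamma>: "P \<gamma>" for \<gamma>
  proof -
   have "lin_eval \<gamma> (\<Delta> (x \<otimes> a)) = lin_eval (\<lambda>z. lin_eval (\<lambda>(c, d). \<gamma> (fst z \<otimes> c, snd z \<otimes> d)) (\<Delta> a)) (\<Delta> x)"
    using tensor_eqD[OF comult_mult[OF x ac]] \<gamma> by (simp add: P_def lin_eval_tensor_mult case_prod_unfold)
   also have "\<dots> = lin_eval (\<lambda>z. 0) (\<Delta> x)"
   proof (rule lin_eval_cong)
    fix z assume "z \<in> keys (\<Delta> x)"
    then have "fst z \<in> carrier H" "snd z \<in> carrier H" using comult_closed[OF x] by auto
    from Pl[OF \<gamma> this] show "lin_eval (\<lambda>(c, d). \<gamma> (fst z \<otimes> c, snd z \<otimes> d)) (\<Delta> a) = 0" using a by (simp add: J_def)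
   qed
   finally show ?thesis by simp
  qed
  then show "x \<otimes> a \<in> J" using x ac by (simp add: J_def)
  have "lin_eval \<gamma> (\<Delta> (a \<otimes> x)) = 0" if \<gamma>: "P \<gamma>" for \<gamma>
  proof -
   have "lin_eval \<gamma> (\<Delta> (a \<otimes> x)) = lin_eval (\<lambda>z. lin_eval (\<lambda>w. \<gamma> (fst z \<otimes> fst w, snd z \<otimes> snd w)) (\<Delta> x)) (\<Delta> a)"
    using tensor_eqD[OF comult_mult[OF ac x]] \<gamma> by (simp add: P_def lin_eval_tensor_mult case_prod_unfold)
   also have "\<dots> = lin_eval (\<lambda>w. lin_eval (\<lambda>z. \<gamma> (fst z \<otimes> fst w, snd z \<otimes> snd w)) (\<Delta> a)) (\<Delta> x)"
    by (rule lin_eval_swap)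
   also have "\<dots> = lin_eval (\<lambda>z. 0) (\<Delta> x)"
   proof (rule lin_eval_cong)
    fix z assume "z \<in> keys (\<Delta> x)"
    then have "fst z \<in> carrier H" "snd z \<in> carrier H" using comult_closed[OF x] by auto
    from Pr[OF \<gamma> this] show "lin_eval (\<lambda>w. \<gamma> (fst w \<otimes> fst z, snd w \<otimes> snd z)) (\<Delta> a) = 0"
     using a by (simp add: J_def case_prod_unfold)
   qed
   finally show ?thesis by simp
  qed
  then show "a \<otimes> x \<in> J" using x ac by (simp add: J_def)
 next
  show "S \<subseteq> J"
  proof
   fix s assume s: "s \<in> S"
   then have "lin_eval \<gamma> (\<Delta> s) = 0" if "P \<gamma>" for \<gamma> using S[of \<gamma> s] that by (simp add: P_def)
   then show "s \<in> J" using s I(3) by (auto simp: J_def)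
  qed
 qed
 then show ?thesis using n \<beta> \<beta>I I(1) by (auto simp: J_def P_def)
qed

end

context dimension_bases
begin

text \<open>The matrix elements $f_{r;p}$, written by means of the pairing.\<close>

definition mx where
 "mx n h r q = pairing C (pd n r) (omega_map C h (pv q))"

lemma matrix_elem_eq:
 assumes "arr (tp n) (tp n) h" "r \<in> G.P n" "q \<in> G.P n"
 shows "matrix_elem C M B n h r q = mx n h r q"
 unfolding matrix_elem_def mx_def
 by (rule dual_bases_representation[OF path_dual_bases omega_map_arr[OF assms(1) pv_om[OF assms(3)]] assms(2)])

end

context fusion_generator
begin

lemma path_tensor_left:
 assumes r: "r \<in> G.P n"
 shows "path_tensor n (pd n r) v = (\<Sum>p\<in>G.P n. pm_scale (pairing C (pd n p) v) (basis_vec (r, p)))"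
proof (rule pm_eqI)
 fix g :: "_ \<Rightarrow> 'k"
 have "(\<Sum>p\<in>G.P n. \<Sum>q\<in>G.P n. pairing C (pd n r) (pv p) * pairing C (pd n q) v * g (p, q)) =
   (\<Sum>p\<in>G.P n. if p = r then \<Sum>q\<in>G.P n. pairing C (pd n q) v * g (r, q) else 0)"
  using r by (intro sum.cong refl) (auto simp: pd_pv)
 then show "lin_eval g (path_tensor n (pd n r) v) =
   lin_eval g (\<Sum>p\<in>G.P n. pm_scale (pairing C (pd n p) v) (basis_vec (r, p)))"
  using r by (simp add: lin_eval_path_tensor lin_eval_sum lin_eval_scale)
qed

lemma path_tensor_right:
 assumes q: "q \<in> G.P n"
 shows "path_tensor n \<theta> (pv q) = (\<Sum>p\<in>G.P n. pm_scale (pairing C \<theta> (pv p)) (basis_vec (p, q)))"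
proof (rule pm_eqI)
 fix g :: "_ \<Rightarrow> 'k"
 have "(\<Sum>p\<in>G.P n. \<Sum>s\<in>G.P n. pairing C \<theta> (pv p) * pairing C (pd n s) (pv q) * g (p, s)) =
   (\<Sum>p\<in>G.P n. \<Sum>s\<in>G.P n. if s = q then pairing C \<theta> (pv p) * g (p, q) else 0)"
  using q by (intro sum.cong refl) (auto simp: pd_pv)
 then show "lin_eval g (path_tensor n \<theta> (pv q)) =
   lin_eval g (\<Sum>p\<in>G.P n. pm_scale (pairing C \<theta> (pv p)) (basis_vec (p, q)))"
  using q by (simp add: lin_eval_path_tensor lin_eval_sum lin_eval_scale)
qed

text \<open>The shape of a generator of the ideal, for an arbitrary \<open>h\<close> and not only
  for the members of the endomorphism system.\<close>

definition rel where
 "rel n h r q = (\<Sum>p\<in>G.P n. pm_scale (mx n h p q) (basis_vec (r, p))) -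
   (\<Sum>p\<in>G.P n. pm_scale (mx n h r p) (basis_vec (p, q)))"

text \<open>Read without bases, the relation says that \<open>h\<close> may be moved from the
  covector to the vector. In this form it is visibly an instance of the dinaturality of the
  coend.\<close>

lemma rel_path_tensor:
 assumes h: "arr (tp n) (tp n) h" and r: "r \<in> G.P n" and q: "q \<in> G.P n"
 shows "rel n h r q = path_tensor n (pd n r) (omega_map C h (pv q)) - path_tensor n (pd n r \<cdot> (\<I> V \<star> h)) (pv q)"
 unfolding rel_def mx_def path_tensor_left[OF r] path_tensor_right[OF q]
 by (simp add: omega_map_adjoint[OF pv_om h pd_od[OF r]])

lemma lin_eval_rel: "lin_eval g (rel n h r q) = (\<Sum>p\<in>G.P n. mx n h p q * g (r, p)) - (\<Sum>p\<in>G.P n. mx n h r p * g (p, q))"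
 by (simp add: rel_def lin_eval_diff lin_eval_sum lin_eval_scale)

lemma rel_in: "r \<in> G.P n \<Longrightarrow> q \<in> G.P n \<Longrightarrow> rel n h r q \<in> carrier Hg"
proof -
 assume rq: "r \<in> G.P n" "q \<in> G.P n"
 have "keys (rel n h r q) \<subseteq> G.symbols"
  unfolding rel_def
  by (rule order_trans[OF keys_diff_subset], rule Un_least; rule order_trans[OF keys_sum_subset], rule UN_least,
    rule order_trans[OF keys_pm_scale]) (use rq in auto)
 then show ?thesis by simp
qed

lemma graph_pi_rel:
 assumes h: "arr (tp n) (tp n) h" and r: "r \<in> G.P n" and q: "q \<in> G.P n"
 shows "graph_pi (rel n h r q) = \<zero>\<^bsub>coend C\<^esub>"
proof -
 note l = lift_path_tensor[OF _ pd_od[OF r] omega_map_arr[OF h pv_om[OF q]]]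
  and l' = lift_path_tensor[OF _ omega_comap_arr[OF h pd_od[OF r]] pv_om[OF q]]
 have "coend.cl (lift (rel n h r q)) = coend.cl 0"
 proof (rule cl_eqI[OF lift_in[OF rel_in[OF r q]]])
  fix \<phi> assume \<phi>: "coend_form \<phi>"
  have d: "lift (s - t) = lift s - lift t" for s t by (simp add: lift_def lin_extend_diff)
  show "lin_eval \<phi> (lift (rel n h r q)) = lin_eval \<phi> 0"
   using l[OF \<phi>] l'[OF \<phi>] coend_formD(5)[OF \<phi> h pd_od[OF r] pv_om[OF q]]
   by (simp add: rel_path_tensor[OF h r q] d lin_eval_diff)
 qed simp
 then show ?thesis by (simp add: graph_pi_def coend_eq coend.zero_Q)
qed

end

locale endo_system = fusion_generator C M B
 for C :: "('k::field, 'o, 'm::ab_group_add, 'i) fcat" (structure) and M :: 'o and B :: "'i \<Rightarrow> 'i \<Rightarrow> 'm set" +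
 fixes E :: "nat \<Rightarrow> 'm set"
 assumes endo: "endomorphism_system C M E"
begin

abbreviation I where "I \<equiv> endo_ideal C M B E"

lemma E_arr: "f \<in> E n \<Longrightarrow> arr (tp n) (tp n) f"
 using endo tp_obj[of n] by (auto simp: endomorphism_system_def arr_def)

lemma endo_relations_eq: "endo_relations C M B E = {rel n f r q | n f r q. f \<in> E n \<and> r \<in> G.P n \<and> q \<in> G.P n}"
proof -
 have e: "(\<Sum>p\<in>G.P n. pm_scale (matrix_elem C M B n f p q) (basis_vec (r, p))) -
   (\<Sum>p\<in>G.P n. pm_scale (matrix_elem C M B n f r p) (basis_vec (p, q))) = rel n f r q"
  if "f \<in> E n" "r \<in> G.P n" "q \<in> G.P n" for n f r q
  using matrix_elem_eq[OF E_arr[OF that(1)]] that(2,3) by (simp add: rel_def)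
 then show ?thesis unfolding endo_relations_def by (intro Collect_cong ex_cong1 iffI) (elim conjE, simp only: e simp_thms)+
qed

lemma endo_relations_in: "endo_relations C M B E \<subseteq> carrier Hg"
 unfolding endo_relations_eq using rel_in by blast

lemma ideal: "ideal I Hg"
 unfolding endo_ideal_def by (rule pi.H.A.genideal_ideal[OF endo_relations_in])

lemma I_carrier: "n \<in> I \<Longrightarrow> n \<in> carrier Hg"
 using additive_subgroup.a_subset[OF ideal.axioms(1)[OF ideal]] by blast

lemma rel_in_I: "\<lbrakk>f \<in> E n; r \<in> G.P n; q \<in> G.P n\<rbrakk> \<Longrightarrow> rel n f r q \<in> I"
 unfolding endo_ideal_def
 by (rule subsetD[OF pi.H.A.genideal_self[OF endo_relations_in]]) (unfold endo_relations_eq, blast)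

lemma graph_pi_I: "n \<in> I \<Longrightarrow> graph_pi n = \<zero>\<^bsub>coend C\<^esub>"
proof -
 assume n: "n \<in> I"
 interpret K: weak_bialgebra "coend C" by (rule pi.weak_bialgebra')
 let ?J = "{x \<in> carrier Hg. graph_pi x = \<zero>\<^bsub>coend C\<^esub>}"
 have "I \<subseteq> ?J"
  unfolding endo_ideal_def
 proof (rule pi.H.genideal_subset)
  show "endo_relations C M B E \<subseteq> ?J"
   using graph_pi_rel[OF E_arr] rel_in by (auto simp: endo_relations_eq simp del: G.HG_simps)
  show "c \<odot>\<^bsub>Hg\<^esub> x \<in> ?J" if "x \<in> ?J" for c x
   using that pi.hom_smult[of x c] G.HG.smult_in[of x c] by (simp del: G.HG_simps)
 qed (auto simp: pi.hom_add pi.hom_mult pi.hom_zero pi.closed simp del: G.HG_simps)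
 then show ?thesis using n by blast
qed

text \<open>The two parts of the coproduct of a relation are linked by a middle term, the sum of all
  \<open>?c s p\<close> times \<open>[r|s] \<otimes> [p|q]\<close>. The first part becomes this term
  by relations in the second factor (\<open>1\<close>), and it becomes the second part by relations
  in the first factor (\<open>2\<close>).\<close>

lemma I_comult:
 assumes \<beta>: "bilinear_form Hg Hg \<beta>" and I: "\<And>m x. m \<in> I \<Longrightarrow> x \<in> carrier Hg \<Longrightarrow> \<beta> (m, x) = 0 \<and> \<beta> (x, m) = 0"
  and n: "n \<in> I"
 shows "lin_eval \<beta> (comult Hg n) = 0"
proof (rule pi.H.genideal_comult[OF endo_ideal_def ideal endo_relations_in _ \<beta> I n])
 fix \<beta> s assume \<beta>: "bilinear_form Hg Hg \<beta>"
  and I: "\<And>m x. m \<in> I \<Longrightarrow> x \<in> carrier Hg \<Longrightarrow> \<beta> (m, x) = 0 \<and> \<beta> (x, m) = 0"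
  and "s \<in> endo_relations C M B E"
 then obtain n f r q where f: "f \<in> E n" and r: "r \<in> G.P n" and q: "q \<in> G.P n" and s: "s = rel n f r q"
  by (auto simp: endo_relations_eq)
 let ?c = "mx n f" and ?b = "\<lambda>p q. basis_vec (p, q) :: _ \<Rightarrow>\<^sub>0 'k"
 have b: "?b p q \<in> carrier Hg" if "p \<in> G.P n" "q \<in> G.P n" for p q using that by auto
 note free = linear_form_free[OF G.HG_simps(1,5,6)]
 have 1: "(\<Sum>p\<in>G.P n. ?c p q * \<beta> (?b r s, ?b s p)) = (\<Sum>p\<in>G.P n. ?c s p * \<beta> (?b r s, ?b p q))" if "s \<in> G.P n" for s
  using free[OF bilinear_form_right[OF \<beta> b[OF r that]] rel_in[OF that q, of f]] I[OF rel_in_I[OF f that q] b[OF r that]]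
  by (simp add: lin_eval_rel)
 have 2: "(\<Sum>p\<in>G.P n. ?c p s * \<beta> (?b r p, ?b s q)) = (\<Sum>p\<in>G.P n. ?c r p * \<beta> (?b p s, ?b s q))" if "s \<in> G.P n" for s
  using free[OF bilinear_form_left[OF \<beta> b[OF that q]] rel_in[OF r that, of f]] I[OF rel_in_I[OF f r that] b[OF that q]]
  by (simp add: lin_eval_rel)
 have D: "lin_eval \<beta> (G.gcomult (p, q)) = (\<Sum>s\<in>G.P n. \<beta> (?b p s, ?b s q))" if "p \<in> G.P n" for p q
  by (simp add: lin_eval_sum length_path(2)[OF that])
 have "lin_eval \<beta> (comult Hg s) = lin_eval (\<lambda>z. lin_eval \<beta> (G.gcomult z)) s" by (simp add: lin_eval_extend)
 also have "\<dots> = (\<Sum>p\<in>G.P n. ?c p q * (\<Sum>s\<in>G.P n. \<beta> (?b r s, ?b s p))) - (\<Sum>p\<in>G.P n. ?c r p * (\<Sum>s\<in>G.P n. \<beta> (?b p s, ?b s q)))"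
  unfolding s lin_eval_rel by (simp only: D r cong: sum.cong)
 also have "(\<Sum>p\<in>G.P n. ?c p q * (\<Sum>s\<in>G.P n. \<beta> (?b r s, ?b s p))) = (\<Sum>s\<in>G.P n. \<Sum>p\<in>G.P n. ?c p q * \<beta> (?b r s, ?b s p))"
  unfolding sum_distrib_left by (rule sum.swap)
 also have "\<dots> = (\<Sum>s\<in>G.P n. \<Sum>p\<in>G.P n. ?c s p * \<beta> (?b r s, ?b p q))" by (intro sum.cong refl 1)
 also have "\<dots> = (\<Sum>s\<in>G.P n. \<Sum>p\<in>G.P n. ?c p s * \<beta> (?b r p, ?b s q))" by (rule sum.swap)
 also have "\<dots> = (\<Sum>s\<in>G.P n. \<Sum>p\<in>G.P n. ?c r p * \<beta> (?b p s, ?b s q))" by (intro sum.cong refl 2)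
 also have "\<dots> = (\<Sum>p\<in>G.P n. ?c r p * (\<Sum>s\<in>G.P n. \<beta> (?b p s, ?b s q)))" unfolding sum_distrib_left by (rule sum.swap)
 finally show "lin_eval \<beta> (comult Hg s) = 0" by simp
qed

sublocale endo: wba_quotient Hg I
proof (rule wba_quotient.intro)
 interpret K: weak_bialgebra "coend C" by (rule pi.weak_bialgebra')
 show "Module.module scalars Hg" by (rule G.graph_module)
 show "I \<subseteq> carrier Hg" using I_carrier by blast
 show "\<zero>\<^bsub>Hg\<^esub> \<in> I" by (rule additive_subgroup.zero_closed[OF ideal.axioms(1)[OF ideal]])
 show "x \<oplus>\<^bsub>Hg\<^esub> y \<in> I" if "x \<in> I" "y \<in> I" for x y
  by (rule additive_subgroup.a_closed[OF ideal.axioms(1)[OF ideal] that])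
 \<comment> \<open>The ideal is one of rings; closure under scalars comes from multiplying by a
   scalar multiple of the unit.\<close>
 show "c \<odot>\<^bsub>Hg\<^esub> x \<in> I" if x: "x \<in> I" for c x
 proof -
  note xc = I_carrier[OF x]
  have "c \<odot>\<^bsub>Hg\<^esub> x = (c \<odot>\<^bsub>Hg\<^esub> \<one>\<^bsub>Hg\<^esub>) \<otimes>\<^bsub>Hg\<^esub> x"
   using pi.H.smult_mult_left[OF pi.H.A.one_closed xc, of c] pi.H.A.l_one[OF xc] by (simp only:)
  then show ?thesis
   using ideal.I_l_closed[OF ideal x G.HG.smult_in[OF pi.H.A.one_closed, of c]] by (simp only:)
 qed
 show "x \<otimes>\<^bsub>Hg\<^esub> n \<in> I" "n \<otimes>\<^bsub>Hg\<^esub> x \<in> I" if "x \<in> carrier Hg" "n \<in> I" for x n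
  using that by (rule ideal.I_l_closed[OF ideal, rotated], rule ideal.I_r_closed[OF ideal, rotated])
 \<comment> \<open>The counit factors through the surjection onto the coend, which kills the
   ideal.\<close>
 show "counit Hg n = 0" if n: "n \<in> I" for n
  using pi.hom_counit[OF I_carrier[OF n]] graph_pi_I[OF n] K.S.linear_form_zero[OF K.linear_form_counit] by simp
 show "lin_eval \<beta> (comult Hg n) = 0" if "bilinear_form Hg Hg \<beta>"
  "\<And>m x. m \<in> I \<Longrightarrow> x \<in> carrier Hg \<Longrightarrow> \<beta> (m, x) = 0 \<and> \<beta> (x, m) = 0" "n \<in> I" for \<beta> n
  by (rule I_comult[OF that])
qed (fact pi.H.A.m_closed pi.H.A.one_closed pi.H.A.l_distr pi.H.A.r_distr pi.H.comult_closed
 pi.H.linear_form_comult pi.H.linear_form_counit)+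

lemma graph_endo_wba_eq: "graph_endo_wba C M B E = endo.Q"
 by (simp add: graph_endo_wba_def)

lemma endo_proj_eq: "endo_proj C M B E = endo.cl"
 by (rule ext) (simp add: endo_proj_def)

sublocale proj: wba_surjection Hg endo.Q endo.cl
 by (rule endo.surjection[OF pi.wba])

definition pibar where "pibar A = graph_pi (SOME a. a \<in> A)"

lemma pibar: "wba_hom endo.Q (coend C) pibar" "x \<in> carrier Hg \<Longrightarrow> pibar (endo.cl x) = graph_pi x"
 unfolding pibar_def by (rule endo.factor[OF pi.hom graph_pi_I]; assumption)+

lemma pibar_surj: "pibar ` carrier endo.Q = carrier (coend C)"
 unfolding endo.carrier_Q image_image graph_pi_carrier[symmetric] by (intro image_cong refl pibar(2))

section \<open>The comodules of paths\<close>

lemma path_comodule_eq: "path_comodule C M B E m = pushforward endo.cl (graph_comodule \<G> m)"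
 by (simp add: path_comodule_def pushforward_def graph_comodule_def endo_proj_eq tensor_map_def
   lin_extend_lin_extend lin_extend_sum)

lemma right_comodule_path: "right_comodule endo.Q (path_comodule C M B E m)"
 unfolding path_comodule_eq by (rule right_comodule_pushforward[OF G.graph_comodule proj.hom])

lemma path_ident_eq:
 assumes t: "keys t \<subseteq> G.P m"
 shows "path_ident C M t = (\<Sum>p\<in>G.P m. scal C (lookup t p) (pv p))"
 unfolding path_ident_def
 by (rule sum.mono_neutral_left) (use t dual_basesD(1)[OF path_dual_bases, of m] in \<open>auto simp: in_keys_iff\<close>)

lemma path_ident_om: "keys t \<subseteq> G.P m \<Longrightarrow> om (tp m) (path_ident C M t)"
 unfolding path_ident_eq by (intro arr_sum V_obj tobj_closed tp_obj arr_scal pv_om)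

lemma omega_comodule_simps [simp]:
 "X \<in> obj C \<Longrightarrow> carrier (omega_comodule C X) = {v. om X v}" "x \<oplus>\<^bsub>omega_comodule C X\<^esub> y = x + y"
 "\<zero>\<^bsub>omega_comodule C X\<^esub> = 0" "c \<odot>\<^bsub>omega_comodule C X\<^esub> x = scal C c x"
 "coact (omega_comodule C X) v = (\<Sum>b\<in>ob X. basis_vec (b, coend_elem C X (obd X b) v))"
 by (auto simp: omega_comodule_def omega_iff)

lemma omega_comodule_module: "X \<in> obj C \<Longrightarrow> Module.module scalars (omega_comodule C X)"
 by (rule scalars_moduleI)
  (auto simp: arr_zero arr_add arr_scal tobj_closed V_obj scale_left_distrib scale_right_distrib ac_simps)

text \<open>After \<open>canonical_element\<close> has replaced the arbitrary basis in the coaction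
  by path vectors, both coactions send the path \<open>q\<close> to the sum of e_p (x)
  \<open>[e^p|e_q]\<close>. The comodule axioms of \<open>omega_comodule\<close> are obtained along
  the way from those of the paths.\<close>

theorem path_comodule_iso:
 "comodule_iso (coend C) (pushforward pibar (path_comodule C M B E m)) (omega_comodule C (tp m)) (path_ident C M)"
proof -
 let ?N = "pushforward pibar (path_comodule C M B E m)" and ?W = "omega_comodule C (tp m)"
 note X = tp_obj[of m]
 have N: "carrier ?N = {t. keys t \<subseteq> G.P m}" "\<And>x y. x \<oplus>\<^bsub>?N\<^esub> y = x + y" "\<And>c x. c \<odot>\<^bsub>?N\<^esub> x = pm_scale c x"
  by (simp_all add: pushforward_def path_comodule_def)
 have look: "pairing C (pd m q) (path_ident C M t) = lookup t q"
  if t: "keys t \<subseteq> G.P m" and q: "q \<in> G.P m" for t q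
 proof -
  have "pairing C (pd m q) (path_ident C M t) = (\<Sum>p\<in>G.P m. lookup t p * (if q = p then 1 else 0))"
   unfolding path_ident_eq[OF t] using pairing_sum_right[OF pd_od[OF q] arr_scal[OF pv_om], of "G.P m"]
   by (simp add: pairing_scal_right[OF pd_od[OF q] pv_om] pd_pv[OF q] cong: sum.cong)
  then show ?thesis using q dual_basesD(1)[OF path_dual_bases, of m] by (simp add: if_distrib cong: if_cong)
 qed
 show ?thesis
 proof (rule comodule_iso_transfer)
  show "weak_bialgebra (coend C)" by (rule pi.weak_bialgebra')
  show "right_comodule (coend C) ?N" by (rule right_comodule_pushforward[OF right_comodule_path pibar(1)])
  show "Module.module scalars ?W" by (rule omega_comodule_module[OF X])
  show "linear_on ?N ?W (path_ident C M)"
   unfolding linear_on_def N omega_comodule_simps(1)[OF X] omega_comodule_simps(2-4)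
  proof (intro conjI funcsetI ballI allI; unfold mem_Collect_eq)
   fix s t :: "_ \<Rightarrow>\<^sub>0 'k" and c assume s: "keys s \<subseteq> G.P m"
   show "om (tp m) (path_ident C M s)" by (rule path_ident_om[OF s])
   have "keys (pm_scale c s) \<subseteq> G.P m" using keys_pm_scale[of c s] s by blast
   then show "path_ident C M (pm_scale c s) = scal C c (path_ident C M s)"
    by (simp add: path_ident_eq path_ident_eq[OF s] scale_sum_right)
   assume t: "keys t \<subseteq> G.P m"
   have "keys (s + t) \<subseteq> G.P m" using Poly_Mapping.keys_add[of s t] s t by blast
   then show "path_ident C M (s + t) = path_ident C M s + path_ident C M t"
    by (simp add: path_ident_eq path_ident_eq[OF s] path_ident_eq[OF t] lookup_add scale_left_distrib sum.distrib)
  qed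
  show "bij_betw (path_ident C M) (carrier ?N) (carrier ?W)"
   unfolding bij_betw_def
  proof (intro conjI inj_onI equalityI subsetI)
   fix s t assume st: "s \<in> carrier ?N" "t \<in> carrier ?N" and eq: "path_ident C M s = path_ident C M t"
   show "s = t"
   proof (rule poly_mapping_eqI)
    fix p
    show "lookup s p = lookup t p"
    proof (cases "p \<in> G.P m")
     case True
     then show ?thesis using look[of s p] look[of t p] st eq by (simp add: N)
    next
     case False
     then have "p \<notin> keys s" "p \<notin> keys t" using st by (auto simp: N)
     then show ?thesis by (simp add: in_keys_iff)
    qed
   qed
  next
   fix v assume "v \<in> path_ident C M ` carrier ?N"
   then show "v \<in> carrier ?W" using path_ident_om X by (auto simp: N)
  next
   fix v assume "v \<in> carrier ?W"
   then have v: "om (tp m) v" using X by simp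
   let ?t = "\<Sum>p\<in>G.P m. pm_scale (pairing C (pd m p) v) (basis_vec p)"
   have t: "keys ?t \<subseteq> G.P m"
    by (rule order_trans[OF keys_sum_subset], rule UN_least, rule order_trans[OF keys_pm_scale]) simp
   have "lookup ?t q = pairing C (pd m q) v" if "q \<in> G.P m" for q
    using that dual_basesD(1)[OF path_dual_bases, of m]
    by (simp add: lookup_sum lookup_basis_vec if_distrib cong: if_cong)
   then have "path_ident C M ?t = v"
    using path_ident_eq[OF t] dual_basesD(6)[OF path_dual_bases v] by (simp cong: sum.cong)
   then show "v \<in> path_ident C M ` carrier ?N" using t N(1) by (metis (no_types, lifting) imageI mem_Collect_eq)
  qed
  show "keys (coact ?W v) \<subseteq> carrier ?W \<times> carrier (coend C)" if "v \<in> carrier ?W" for v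
  proof -
   note D = dual_basesD(3,4)[OF omega_basis[OF X]]
   have v: "om (tp m) v" using that X by simp
   have "coend_elem C (tp m) (obd (tp m) b) v \<in> carrier (coend C)" if b: "b \<in> ob (tp m)" for b
    unfolding coend_elem_eq coend_eq coend.carrier_Q
    by (rule imageI) (use X v D(2)[OF b] in \<open>simp add: symb_iff\<close>)
   then show ?thesis
    unfolding omega_comodule_simps(5)
    by (intro order_trans[OF keys_sum_subset] UN_least) (use X D(1) in auto)
  qed
  fix t assume "t \<in> carrier ?N"
  then have t: "keys t \<subseteq> G.P m" by (simp add: N)
  show "tensor_eq ?W (coend C) (coact ?W (path_ident C M t)) (tensor_map (path_ident C M) (\<lambda>x. x) (coact ?N t))"
   unfolding tensor_eq_iff
  proof (intro allI impI)
   fix \<beta> assume \<beta>: "bilinear_form ?W (coend C) \<beta>"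
   let ?c = "\<lambda>s. coend.cl (basis_vec s)"
   have c: "?c s \<in> carrier (coend C)" if "s \<in> symb" for s using that by (simp add: coend_eq coend.carrier_Q)
   note v = path_ident_om[OF t]
   have W: "w \<in> carrier ?W" if "om (tp m) w" for w using that X by simp
   note R = coend_form_quot[OF bilinear_form_right[OF \<beta> W]]
   have s: "(tp m, \<theta>, path_ident C M t) \<in> symb" if "od (tp m) \<theta>" for \<theta> using that X v by (simp add: symb_iff)
   have L: "\<beta> (w + w', ?c (tp m, \<theta>, path_ident C M t)) = \<beta> (w, ?c (tp m, \<theta>, path_ident C M t)) + \<beta> (w', ?c (tp m, \<theta>, path_ident C M t))"
    "\<beta> (scal C a w, ?c (tp m, \<theta>, path_ident C M t)) = a * \<beta> (w, ?c (tp m, \<theta>, path_ident C M t))"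
    if "om (tp m) w" "om (tp m) w'" "od (tp m) \<theta>" for w w' \<theta> a
    using linear_form_add[OF bilinear_form_left[OF \<beta> c[OF s[OF that(3)]]] W[OF that(1)] W[OF that(2)]]
     linear_form_smult[OF bilinear_form_left[OF \<beta> c[OF s[OF that(3)]]] W[OF that(1)], of a] by simp_all
   note R' = coend_formD[OF R]
   have "lin_eval \<beta> (coact ?W (path_ident C M t)) = (\<Sum>b\<in>ob (tp m). \<beta> (b, ?c (tp m, obd (tp m) b, path_ident C M t)))"
    by (simp add: lin_eval_sum coend_elem_eq)
   also have "\<dots> = (\<Sum>p\<in>G.P m. \<beta> (pv p, ?c (tp m, pd m p, path_ident C M t)))"
    by (rule canonical_element[OF omega_basis[OF X] path_dual_bases])
     (simp_all add: L(1) L(2)[OF _ arr_zero[OF V_obj tobj_closed[OF V_obj X]]] R'(1)[OF _ X _ _ v] R'(3)[OF _ X _ v])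
   also have "\<dots> = (\<Sum>p\<in>G.P m. \<Sum>q\<in>G.P m. lookup t q * \<beta> (pv p, ?c (tp m, pd m p, pv q)))"
   proof (intro sum.cong refl)
    fix p assume p: "p \<in> G.P m"
    note Rp = R[OF pv_om[OF p]]
    have "\<beta> (pv p, ?c (tp m, pd m p, path_ident C M t)) =
      (\<Sum>q\<in>G.P m. \<beta> (pv p, ?c (tp m, pd m p, scal C (lookup t q) (pv q))))"
     unfolding path_ident_eq[OF t] by (rule coend_form_sums(1)[OF Rp X pd_od[OF p]]) (intro arr_scal pv_om)
    also have "\<dots> = (\<Sum>q\<in>G.P m. lookup t q * \<beta> (pv p, ?c (tp m, pd m p, pv q)))"
     by (intro sum.cong refl coend_formD(4)[OF Rp X pd_od[OF p] pv_om])
    finally show "\<beta> (pv p, ?c (tp m, pd m p, path_ident C M t)) =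
      (\<Sum>q\<in>G.P m. lookup t q * \<beta> (pv p, ?c (tp m, pd m p, pv q)))" .
   qed
   also have "\<dots> = (\<Sum>q\<in>G.P m. lookup t q * (\<Sum>p\<in>G.P m. \<beta> (pv p, ?c (tp m, pd m p, pv q))))"
    unfolding sum_distrib_left by (rule sum.swap)
   also have "\<dots> = (\<Sum>q\<in>G.P m. lookup t q *
     (\<Sum>p\<in>G.P m. \<beta> (path_ident C M (basis_vec p), pibar (endo.cl (basis_vec (p, q))))))"
   proof -
    have "path_ident C M (basis_vec p) = pv p" for p by (simp add: path_ident_def lookup_basis_vec)
    moreover have "pibar (endo.cl (basis_vec (p, q))) = ?c (tp m, pd m p, pv q)" if "p \<in> G.P m" "q \<in> G.P m" for p q
    proof -
     have "basis_vec (p, q) \<in> carrier Hg" using that by auto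
     from pibar(2)[OF this] show ?thesis by (simp only: graph_pi_def lift_basis[OF that(1)])
    qed
    ultimately show ?thesis by (simp cong: sum.cong)
   qed
   also have "\<dots> = lin_eval (\<lambda>q. \<Sum>p\<in>G.P m. \<beta> (path_ident C M (basis_vec p), pibar (endo.cl (basis_vec (p, q))))) t"
    by (rule lin_eval_superset[OF dual_basesD(1)[OF path_dual_bases] t, symmetric])
   also have "\<dots> = lin_eval \<beta> (tensor_map (path_ident C M) (\<lambda>x. x) (coact ?N t))"
    by (simp add: lin_eval_tensor_map pushforward_def path_comodule_def endo_proj_eq lin_eval_extend lin_eval_sum case_prod_unfold)
   finally show "lin_eval \<beta> (coact ?W (path_ident C M t)) = lin_eval \<beta> (tensor_map (path_ident C M) (\<lambda>x. x) (coact ?N t))" .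
  qed
 qed
qed

end

section \<open>Injectivity in degrees zero and one\<close>

context semisimple_monoidal
begin

lemma omega_map_linear:
 assumes f: "arr X Y f" and v: "om X v"
 shows "arr X Y f' \<Longrightarrow> omega_map C (f + f') v = omega_map C f v + omega_map C f' v"
  and "omega_map C (scal C c f) v = scal C c (omega_map C f v)"
  and "omega_map C 0 v = 0"
  and "om X w \<Longrightarrow> omega_map C f (v + w) = omega_map C f v + omega_map C f w"
  and "omega_map C f (scal C c v) = scal C c (omega_map C f v)"
proof -
 note i = arr_id[OF V_obj] and t = arr_tmor[OF arr_id[OF V_obj]]
 show "omega_map C (f + f') v = omega_map C f v + omega_map C f' v" if f': "arr X Y f'"
  unfolding omega_map_def tmor_plus_right[OF i f f'] by (rule cmp_add_left[OF v t[OF f] t[OF f']])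
 show s: "omega_map C (scal C c f) v = scal C c (omega_map C f v)" for c
  unfolding omega_map_def tmor_scale_right[OF i f] by (rule cmp_scal_left[OF v t[OF f]])
 show "omega_map C 0 v = 0" using s[of 0] by simp
 show "omega_map C f (v + w) = omega_map C f v + omega_map C f w" if "om X w"
  unfolding omega_map_def by (rule cmp_add_right[OF v that t[OF f]])
 show "omega_map C f (scal C c v) = scal C c (omega_map C f v)"
  unfolding omega_map_def by (rule cmp_scal_right[OF v t[OF f]])
qed

lemma omega_map_cmp_right:
 assumes f: "arr X Y f" and v: "om X v" and r: "arr V V r"
 shows "omega_map C f (v \<cdot> r) = omega_map C f v \<cdot> r"
 unfolding omega_map_def by (rule cmp_assoc[OF r v arr_tmor[OF arr_id[OF V_obj] f], symmetric])

end

context dimension_bases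
begin

lemma mx_linear:
 assumes f: "arr (tp n) (tp n) f" and r: "r \<in> G.P n" and q: "q \<in> G.P n"
 shows "arr (tp n) (tp n) f' \<Longrightarrow> mx n (f + f') r q = mx n f r q + mx n f' r q"
  and "mx n (scal C c f) r q = c * mx n f r q"
  and "mx n 0 r q = 0"
  and "arr (tp n) (tp n) f' \<Longrightarrow> mx n (f \<cdot> f') r q = (\<Sum>p\<in>G.P n. mx n f r p * mx n f' p q)"
proof -
 note v = pv_om[OF q] and t = pd_od[OF r]
 note L = omega_map_linear[OF f v] and a = omega_map_arr[OF _ v]
 show "mx n (f + f') r q = mx n f r q + mx n f' r q" if f': "arr (tp n) (tp n) f'"
  unfolding mx_def L(1)[OF f'] by (rule pairing_add_right[OF t a[OF f] a[OF f']])
 show "mx n (scal C c f) r q = c * mx n f r q"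
  unfolding mx_def L(2) by (rule pairing_scal_right[OF t a[OF f]])
 show "mx n 0 r q = 0" unfolding mx_def L(3) by (rule pairing_zero_right[OF t])
 show "mx n (f \<cdot> f') r q = (\<Sum>p\<in>G.P n. mx n f r p * mx n f' p q)" if f': "arr (tp n) (tp n) f'"
 proof -
  have "mx n (f \<cdot> f') r q = pairing C (pd n r \<cdot> (\<I> V \<star> f)) (omega_map C f' (pv q))"
   unfolding mx_def omega_map_cmp[OF f' f v] by (rule omega_map_adjoint[OF a[OF f'] f t, symmetric])
  also have "\<dots> = (\<Sum>p\<in>G.P n. pairing C (pd n r \<cdot> (\<I> V \<star> f)) (pv p) * mx n f' p q)"
   unfolding mx_def by (rule dual_bases_pairing[OF path_dual_bases omega_comap_arr[OF f t] a[OF f']])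
  finally show ?thesis by (simp add: mx_def omega_map_adjoint[OF pv_om f t] cong: sum.cong)
 qed
qed

lemma mx_id: "r \<in> G.P n \<Longrightarrow> q \<in> G.P n \<Longrightarrow> mx n (\<I> (tp n)) r q = (if r = q then 1 else 0)"
 by (simp add: mx_def omega_map_id[OF tp_obj pv_om] pd_pv)

text \<open>An endomorphism of the unit object acts diagonally, since $\omega\mathbf 1\cong R$.\<close>

lemma unit_diagonal:
 assumes f: "arr \<bbbone> \<bbbone> f" and j: "j \<in> J"
 shows "\<exists>d. omega_map C f (pv (vertex_path j)) = scal C d (pv (vertex_path j))"
proof -
 let ?v = "pv (vertex_path j)"
 note r = runit_inv(1)[OF V_obj] and s = arr_runit[OF V_obj]
 have v: "om \<bbbone> ?v" unfolding pv_vertex by (rule arr_comp[OF arr_lam[OF j] r])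
 define x where "x = omega_map C f ?v"
 have x: "om \<bbbone> x" unfolding x_def by (rule omega_map_arr[OF f v])
 have "?v \<cdot> lam C j = ?v"
  unfolding pv_vertex using cmp_assoc[OF arr_lam[OF j] arr_lam[OF j] r] lam_mult[OF j j] by simp
 then have xl: "x \<cdot> lam C j = x" unfolding x_def using omega_map_cmp_right[OF f v arr_lam[OF j]] by simp
 define R where "R = \<rho>\<^sub>u V \<cdot> x"
 have R: "arr V V R" unfolding R_def by (rule arr_comp[OF x s])
 have Rl: "R \<cdot> lam C j = R" unfolding R_def using cmp_assoc[OF arr_lam[OF j] x s] xl by simp
 obtain c where c: "R = (\<Sum>i\<in>J. scal C (c i) (lam C i))" using End_V[OF R] by blast
 have Rc: "R = scal C (c j) (lam C j)" using sum_lam_mult(1)[OF j, of c] Rl c by simp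
 have "x = runit_inv C V \<cdot> R"
  unfolding R_def using cmp_eq[OF x s r runit_inv(2)[OF V_obj]] cmp_id_left[OF x] by simp
 then have "x = scal C (c j) ?v" unfolding Rc pv_vertex using cmp_scal_right[OF arr_lam[OF j] r] by simp
 then show ?thesis by (auto simp: x_def)
qed

text \<open>Under the left unit, an edge vector is its own product with the vertex vector at its
  target. The endomorphism acts on the vertex factor alone, hence by its eigenvalue at the target of
  the edge.\<close>

lemma tensor_M_edge:
 assumes f: "arr \<bbbone> \<bbbone> f" and e: "e \<in> arcs \<G>"
  and d: "omega_map C f (pv (vertex_path (head \<G> e))) = scal C d (pv (vertex_path (head \<G> e)))"
 shows "omega_map C (tensor_M C M 0 f) (edge_vec C M e) = scal C d (edge_vec C M e)"
proof -
 let ?w = "edge_vec C M e" and ?v = "pv (vertex_path (head \<G> e))"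
 have j: "head \<G> e \<in> J" using G.head_in_verts[OF e] by simp
 note w = edge_om[OF e] and l = arr_lunit[OF M] and l' = lunit_inv(1)[OF M]
 note fI = arr_tmor[OF f arr_id[OF M]]
 have v: "om \<bbbone> ?v" unfolding pv_vertex by (rule arr_comp[OF arr_lam[OF j] runit_inv(1)[OF V_obj]])
 note vw = arr_dia[OF unit_closed M v w]
 have 1: "omega_map C (\<lambda>\<^sub>u M) (dia \<bbbone> M ?v ?w) = ?w"
  unfolding pv_vertex using dia_unit_left[OF M arr_lam[OF j] w] edge_lam_left[OF e j] by simp
 have "omega_map C (lunit_inv C M) ?w = omega_map C (lunit_inv C M \<cdot> \<lambda>\<^sub>u M) (dia \<bbbone> M ?v ?w)"
  unfolding omega_map_cmp[OF l l' vw] 1 by (rule refl)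
 then have 2: "omega_map C (lunit_inv C M) ?w = dia \<bbbone> M ?v ?w"
  unfolding lunit_inv(2)[OF M] by (simp add: omega_map_id vw tobj_closed unit_closed M)
 have "omega_map C (tensor_M C M 0 f) ?w = omega_map C (\<lambda>\<^sub>u M) (omega_map C (f \<star> \<I> M) (omega_map C (lunit_inv C M) ?w))"
  using omega_map_cmp[OF l' arr_comp[OF fI l] w] omega_map_cmp[OF fI l omega_map_arr[OF l' w]]
  by (simp add: tensor_M_def)
 also have "omega_map C (f \<star> \<I> M) (omega_map C (lunit_inv C M) ?w) = scal C d (dia \<bbbone> M ?v ?w)"
  unfolding 2 omega_map_dia_left[OF M f v w] d by (rule dia_linear(3)[OF unit_closed M v v w w])
 also have "omega_map C (\<lambda>\<^sub>u M) \<dots> = scal C d ?w"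
  unfolding omega_map_linear(5)[OF l vw] 1 by (rule refl)
 finally show ?thesis .
qed

end

section \<open>Dinaturality of the map back from the coend\<close>

context fusion_generator
begin

text \<open>A morphism $f\colon X\to Y$ acts by the same scalars $p_bfi_a$ on both sides of the decompositions.\<close>

lemma decomp_matrix:
 assumes f: "arr X Y f"
 shows "\<exists>c. (\<forall>b<dlen Y. facF Y b \<cdot> f = (\<Sum>a<dlen X. if dix X a = dix Y b then scal C (c b a) (facF X a) else 0)) \<and>
  (\<forall>a<dlen X. f \<cdot> facG X a = (\<Sum>b<dlen Y. if dix X a = dix Y b then scal C (c b a) (facG Y b) else 0))"
proof -
 have X: "X \<in> obj C" and Y: "Y \<in> obj C" using f by (auto simp: arr_def)
 note DX = direct_sumD[OF decomp(2)[OF X]] and JX = decomp(1)[OF X] and rX = ret[OF decomp(1)[OF X]]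
 note DY = direct_sumD[OF decomp(2)[OF Y]] and JY = decomp(1)[OF Y] and rY = ret[OF decomp(1)[OF Y]]
 let ?m = "\<lambda>b a. (dout Y b \<cdot> f) \<cdot> din X a"
 have iX: "arr (smp C (dix X a)) X (din X a)" and pX: "arr X (smp C (dix X a)) (dout X a)" if "a < dlen X" for a
  using DX(3,4)[of a] that by auto
 have iY: "arr (smp C (dix Y b)) Y (din Y b)" and pY: "arr Y (smp C (dix Y b)) (dout Y b)" if "b < dlen Y" for b
  using DY(3,4)[of b] that by auto
 have m: "arr (smp C (dix X a)) (smp C (dix Y b)) (?m b a)" if "a < dlen X" "b < dlen Y" for a b
  by (rule arr_comp[OF iX[OF that(1)] arr_comp[OF f pY[OF that(2)]]])
 have ex: "\<exists>c. ?m b a = (if dix X a = dix Y b then scal C c (\<I> (smp C (dix X a))) else 0)"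
  if ab: "a < dlen X" "b < dlen Y" for a b
 proof (cases "dix X a = dix Y b")
  case True
  then show ?thesis using smp_End[OF JX[OF ab(1)], of "?m b a"] m[OF ab] by simp
 next
  case False
  then show ?thesis using smp_Hom_zero[OF JX[OF ab(1)] JY[OF ab(2)] False m[OF ab]] by simp
 qed
 define c where "c b a = (SOME c. ?m b a = (if dix X a = dix Y b then scal C c (\<I> (smp C (dix X a))) else 0))" for a b
 have c: "?m b a = (if dix X a = dix Y b then scal C (c b a) (\<I> (smp C (dix X a))) else 0)"
  if "a < dlen X" "b < dlen Y" for a b
  unfolding c_def by (rule someI_ex[OF ex[OF that]])
 let ?F = "\<lambda>a b. if dix X a = dix Y b then scal C (c b a) (facF X a) else 0" and ?G = "\<lambda>a b. if dix X a = dix Y b then scal C (c b a) (facG Y b) else 0"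
 show ?thesis
 proof (intro exI[of _ c] conjI allI impI)
  fix b assume b: "b < dlen Y"
  note u = rY(1)[OF b]
  have h: "arr X (tp (fdeg Y b)) (facF Y b \<cdot> f)" by (rule arr_comp[OF f fac(1)[OF Y b]])
  have "facF Y b \<cdot> f = (facF Y b \<cdot> f) \<cdot> \<I> X" by (simp add: cmp_id_right[OF h])
  also have "\<dots> = (\<Sum>a<dlen X. (facF Y b \<cdot> f) \<cdot> (din X a \<cdot> dout X a))"
   unfolding DX(6) by (rule cmp_sum_right[OF h X]) (use arr_comp[OF pX iX] in auto)
  also have "\<dots> = (\<Sum>a<dlen X. ?F a b)"
  proof (intro sum.cong refl)
   fix a assume "a \<in> {..<dlen X}"
   then have a: "a < dlen X" by simp
   note i = iX[OF a] and p = pX[OF a] and q = pY[OF b]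
   have "(facF Y b \<cdot> f) \<cdot> (din X a \<cdot> dout X a) = (ret_in (dix Y b) \<cdot> (dout Y b \<cdot> f)) \<cdot> (din X a \<cdot> dout X a)"
    by (simp add: facF_def cmp_assoc[OF f q u])
   also have "\<dots> = ret_in (dix Y b) \<cdot> ((dout Y b \<cdot> f) \<cdot> (din X a \<cdot> dout X a))"
    by (rule cmp_assoc[OF arr_comp[OF p i] arr_comp[OF f q] u])
   also have "(dout Y b \<cdot> f) \<cdot> (din X a \<cdot> dout X a) = ?m b a \<cdot> dout X a"
    by (rule cmp_assoc[OF p i arr_comp[OF f q], symmetric])
   also have "\<dots> = (if dix X a = dix Y b then scal C (c b a) (dout X a) else 0)"
    unfolding c[OF a b] using cmp_scal_left[OF p arr_id[OF smp_obj[OF JX[OF a]]]] cmp_id_left[OF p]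
     cmp_zero_left[OF p smp_obj[OF JY[OF b]]] by (cases "dix X a = dix Y b") simp_all
   also have "ret_in (dix Y b) \<cdot> \<dots> = ?F a b"
    using cmp_scal_right[OF p rX(1)[OF a]] cmp_zero_right[OF u X] by (cases "dix X a = dix Y b") (simp_all add: facF_def)
   finally show "(facF Y b \<cdot> f) \<cdot> (din X a \<cdot> dout X a) = ?F a b" .
  qed
  finally show "facF Y b \<cdot> f = (\<Sum>a<dlen X. ?F a b)" .
 next
  fix a assume a: "a < dlen X"
  note w = rX(2)[OF a] and i = iX[OF a]
  have h: "arr (tp (fdeg X a)) Y (f \<cdot> facG X a)" by (rule arr_comp[OF fac(2)[OF X a] f])
  have "f \<cdot> facG X a = \<I> Y \<cdot> (f \<cdot> facG X a)" by (simp add: cmp_id_left[OF h])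
  also have "\<dots> = (\<Sum>b<dlen Y. (din Y b \<cdot> dout Y b) \<cdot> (f \<cdot> facG X a))"
   unfolding DY(6) by (rule cmp_sum_left[OF h Y]) (use arr_comp[OF pY iY] in auto)
  also have "\<dots> = (\<Sum>b<dlen Y. ?G a b)"
  proof (intro sum.cong refl)
   fix b assume "b \<in> {..<dlen Y}"
   then have b: "b < dlen Y" by simp
   note q = pY[OF b] and k = iY[OF b]
   have "(din Y b \<cdot> dout Y b) \<cdot> (f \<cdot> facG X a) = din Y b \<cdot> (dout Y b \<cdot> (f \<cdot> facG X a))"
    by (rule cmp_assoc[OF h q k])
   also have "dout Y b \<cdot> (f \<cdot> facG X a) = (dout Y b \<cdot> f) \<cdot> (din X a \<cdot> ret_out (dix X a))"
    unfolding facG_def by (rule cmp_assoc[OF arr_comp[OF w i] f q, symmetric])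
   also have "\<dots> = ?m b a \<cdot> ret_out (dix X a)" by (rule cmp_assoc[OF w i arr_comp[OF f q], symmetric])
   also have "\<dots> = (if dix X a = dix Y b then scal C (c b a) (ret_out (dix X a)) else 0)"
    unfolding c[OF a b] using cmp_scal_left[OF w arr_id[OF smp_obj[OF JX[OF a]]]] cmp_id_left[OF w]
     cmp_zero_left[OF w smp_obj[OF JY[OF b]]] by (cases "dix X a = dix Y b") simp_all
   also have "din Y b \<cdot> \<dots> = ?G a b"
    using cmp_scal_right[OF rY(2)[OF b] k] cmp_zero_right[OF k tp_obj] by (cases "dix X a = dix Y b") (simp_all add: facG_def)
   finally show "(din Y b \<cdot> dout Y b) \<cdot> (f \<cdot> facG X a) = ?G a b" .
  qed
  finally show "f \<cdot> facG X a = (\<Sum>b<dlen Y. ?G a b)" .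
 qed
qed

lemma sect_basis_vec: "lin_eval g (sect (basis_vec (X, \<theta>, v))) =
  (\<Sum>a<dlen X. lin_eval g (path_tensor (fdeg X a) (\<theta> \<cdot> (\<I> V \<star> facG X a)) (omega_map C (facF X a) v)))"
 by (simp add: sect_def lin_eval_sum)

lemma path_tensor_sum:
 shows "(\<And>a. a \<in> A \<Longrightarrow> om (tp n) (v a)) \<Longrightarrow>
   lin_eval g (path_tensor n \<theta> (\<Sum>a\<in>A. v a)) = (\<Sum>a\<in>A. lin_eval g (path_tensor n \<theta> (v a)))"
  and "(\<And>b. b \<in> A' \<Longrightarrow> od (tp n) (\<eta> b)) \<Longrightarrow>
   lin_eval g (path_tensor n (\<Sum>b\<in>A'. \<eta> b) w) = (\<Sum>b\<in>A'. lin_eval g (path_tensor n (\<eta> b) w))"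
proof -
 note X = tobj_closed[OF V_obj tp_obj]
 show "(\<And>a. a \<in> A \<Longrightarrow> om (tp n) (v a)) \<Longrightarrow>
   lin_eval g (path_tensor n \<theta> (\<Sum>a\<in>A. v a)) = (\<Sum>a\<in>A. lin_eval g (path_tensor n \<theta> (v a)))"
 proof (induction A rule: infinite_finite_induct)
  case (insert a A)
  then have "om (tp n) (\<Sum>a\<in>A. v a)" by (intro arr_sum V_obj X) auto
  with insert show ?case using path_tensor_form(2)[OF insert.prems[of a]] by simp
 qed (simp_all add: lin_eval_path_tensor pairing_zero_right[OF pd_od] cong: sum.cong)
 show "(\<And>b. b \<in> A' \<Longrightarrow> od (tp n) (\<eta> b)) \<Longrightarrow>
   lin_eval g (path_tensor n (\<Sum>b\<in>A'. \<eta> b) w) = (\<Sum>b\<in>A'. lin_eval g (path_tensor n (\<eta> b) w))"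
 proof (induction A' rule: infinite_finite_induct)
  case (insert a A)
  then have "od (tp n) (\<Sum>a\<in>A. \<eta> a)" by (intro arr_sum V_obj X) auto
  with insert show ?case using path_tensor_form(1)[OF insert.prems[of a]] by simp
 qed (simp_all add: lin_eval_path_tensor pairing_zero_left[OF pv_om] cong: sum.cong)
qed

text \<open>Holds for every function \<open>g\<close>, without regard to the ideal. A morphism
  connects only summands of the same index, and these factor through the same power by the same
  retraction; since it acts by the same scalars on the maps \<open>facF\<close> and
  \<open>facG\<close>, moving it from one side of a symbol to the other has no effect.\<close>

lemma coend_form_sect: "coend_form (\<lambda>s. lin_eval g (sect (basis_vec s)))"
proof (rule coend_formI)
 note PT = path_tensor_form[where g = g]
 fix X \<theta> \<theta>' v v' c assume X: "X \<in> obj C" and t: "od X \<theta>" and v: "om X v"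
 have F: "arr X (tp (fdeg X a)) (facF X a)" and G: "arr (tp (fdeg X a)) X (facG X a)" if "a \<in> {..<dlen X}" for a
  using fac(1,2)[OF X] that by auto
 note V' = omega_map_arr[OF F] and T = omega_comap_arr[OF G] and tG = arr_tmor[OF arr_id[OF V_obj] G]
 show "od X \<theta>' \<Longrightarrow> lin_eval g (sect (basis_vec (X, \<theta> + \<theta>', v))) =
   lin_eval g (sect (basis_vec (X, \<theta>, v))) + lin_eval g (sect (basis_vec (X, \<theta>', v)))"
  unfolding sect_basis_vec sum.distrib[symmetric]
  by (intro sum.cong refl) (simp only: cmp_add_left[OF tG t] PT(1)[OF T[OF _ t] T])
 show "om X v' \<Longrightarrow> lin_eval g (sect (basis_vec (X, \<theta>, v + v'))) =
   lin_eval g (sect (basis_vec (X, \<theta>, v))) + lin_eval g (sect (basis_vec (X, \<theta>, v')))"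
  unfolding sect_basis_vec sum.distrib[symmetric]
  by (intro sum.cong refl) (simp only: omega_map_linear(4)[OF F v] PT(2)[OF V'[OF _ v] V'])
 show "lin_eval g (sect (basis_vec (X, scal C c \<theta>, v))) = c * lin_eval g (sect (basis_vec (X, \<theta>, v)))"
  unfolding sect_basis_vec sum_distrib_left
  by (intro sum.cong refl) (simp only: cmp_scal_left[OF tG t] PT(3)[OF T[OF _ t]])
 show "lin_eval g (sect (basis_vec (X, \<theta>, scal C c v))) = c * lin_eval g (sect (basis_vec (X, \<theta>, v)))"
  unfolding sect_basis_vec sum_distrib_left
  by (intro sum.cong refl) (simp only: omega_map_linear(5)[OF F v] PT(4)[OF V'[OF _ v]])
next
 note PT = path_tensor_form[where g = g]
 fix X Y f \<zeta> v assume f: "arr X Y f" and z: "od Y \<zeta>" and v: "om X v"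
 have X: "X \<in> obj C" and Y: "Y \<in> obj C" using f by (auto simp: arr_def)
 note FX = fac(1)[OF X] and GX = fac(2)[OF X] and FY = fac(1)[OF Y] and GY = fac(2)[OF Y]
 note i = arr_id[OF V_obj] and VY = tobj_closed[OF V_obj Y]
 obtain c where
  "\<forall>b<dlen Y. facF Y b \<cdot> f = (\<Sum>a<dlen X. if dix X a = dix Y b then scal C (c b a) (facF X a) else 0)"
  "\<forall>a<dlen X. f \<cdot> facG X a = (\<Sum>b<dlen Y. if dix X a = dix Y b then scal C (c b a) (facG Y b) else 0)"
  using decomp_matrix[OF f] by blast
 note cF = this(1)[rule_format] and cG = this(2)[rule_format]
 let ?F = "\<lambda>a b. if dix X a = dix Y b then scal C (c b a) (facF X a) else 0"
 let ?G = "\<lambda>a b. if dix X a = dix Y b then scal C (c b a) (facG Y b) else 0"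
 \<comment> \<open>The contribution of the summand \<open>a\<close> of \<open>X\<close> and the
   summand \<open>b\<close> of \<open>Y\<close>, to which both sides are reduced. It vanishes unless
   the two summands have the same index.\<close>
 let ?t = "\<lambda>a b. lin_eval g (path_tensor (fdeg Y b) (\<zeta> \<cdot> (\<I> V \<star> facG Y b)) (omega_map C (?F a b) v))"
 have aF: "arr X (tp (fdeg Y b)) (?F a b)" if "a \<in> {..<dlen X}" for a b
  using arr_scal[OF FX[of a]] that arr_zero[OF X tp_obj] by auto
 have aG: "arr (tp (fdeg X a)) Y (?G a b)" if "b \<in> {..<dlen Y}" for a b
  using arr_scal[OF GY[of b]] that arr_zero[OF tp_obj Y] by auto
 have L: "lin_eval g (path_tensor (fdeg Y b) (\<zeta> \<cdot> (\<I> V \<star> facG Y b)) (omega_map C (facF Y b) (omega_map C f v))) = (\<Sum>a<dlen X. ?t a b)"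
  if b: "b < dlen Y" for b
 proof -
  have "omega_map C (\<Sum>a<dlen X. ?F a b) v = (\<Sum>a<dlen X. omega_map C (?F a b) v)"
   by (rule omega_map_sum[OF _ v X tp_obj]) (rule aF)
  then show ?thesis
   unfolding omega_map_cmp[OF f FY[OF b] v, symmetric] cF[OF b]
   by (simp only:) (rule path_tensor_sum(1), rule omega_map_arr[OF aF v])
 qed
 have R: "lin_eval g (path_tensor (fdeg X a) ((\<zeta> \<cdot> (\<I> V \<star> f)) \<cdot> (\<I> V \<star> facG X a)) (omega_map C (facF X a) v)) = (\<Sum>b<dlen Y. ?t a b)"
  if a: "a < dlen X" for a
 proof -
  have "(\<zeta> \<cdot> (\<I> V \<star> f)) \<cdot> (\<I> V \<star> facG X a) = \<zeta> \<cdot> (\<I> V \<star> (\<Sum>b<dlen Y. ?G a b))"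
   unfolding cmp_assoc[OF arr_tmor[OF i GX[OF a]] arr_tmor[OF i f] z] tmor_cmp_right[OF GX[OF a] f V_obj] cG[OF a] by (rule refl)
  also have "\<I> V \<star> (\<Sum>b<dlen Y. ?G a b) = (\<Sum>b<dlen Y. \<I> V \<star> ?G a b)" 
   by (rule tmor_sum_right[OF tp_obj Y _ i]) (rule aG)
  also have "\<zeta> \<cdot> \<dots> = (\<Sum>b<dlen Y. \<zeta> \<cdot> (\<I> V \<star> ?G a b))"
   by (rule cmp_sum_right[OF z tobj_closed[OF V_obj tp_obj]]) (rule arr_tmor[OF i aG])
  finally have e: "(\<zeta> \<cdot> (\<I> V \<star> f)) \<cdot> (\<I> V \<star> facG X a) = (\<Sum>b<dlen Y. \<zeta> \<cdot> (\<I> V \<star> ?G a b))" .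
  have "lin_eval g (path_tensor (fdeg X a) (\<zeta> \<cdot> (\<I> V \<star> ?G a b)) (omega_map C (facF X a) v)) = ?t a b" if b: "b \<in> {..<dlen Y}" for b
  proof (cases "dix X a = dix Y b")
   case True
   have G: "arr (tp (fdeg X a)) Y (facG Y b)" using GY[of b] b True by simp
   have "\<zeta> \<cdot> (\<I> V \<star> ?G a b) = scal C (c b a) (\<zeta> \<cdot> (\<I> V \<star> facG Y b))"
    using True tmor_scale_right[OF i G] cmp_scal_right[OF arr_tmor[OF i G] z] by simp
   then show ?thesis
    using PT(3)[OF omega_comap_arr[OF G z]] PT(4)[OF omega_map_arr[OF FX[OF a] v]] omega_map_linear(2)[OF FX[OF a] v] True
    by simp
  next
   case False
   have "\<I> V \<star> 0 = 0" using tmor_sum_right[OF tp_obj[of "fdeg X a"] Y _ i, of "{}"] by simp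
   then show ?thesis
    using False omega_map_linear(3)[OF f v] cmp_zero_right[OF z tobj_closed[OF V_obj tp_obj]]
     path_tensor_sum(1)[of "{}"] path_tensor_sum(2)[of "{}"] by simp
  qed
  then show ?thesis
   unfolding e by (subst path_tensor_sum(2)) (rule omega_comap_arr[OF aG z], assumption, intro sum.cong refl)
 qed
 have "lin_eval g (sect (basis_vec (Y, \<zeta>, omega_map C f v))) = (\<Sum>b<dlen Y. \<Sum>a<dlen X. ?t a b)"
  unfolding sect_basis_vec by (intro sum.cong refl L) simp
 also have "\<dots> = (\<Sum>a<dlen X. \<Sum>b<dlen Y. ?t a b)" by (rule sum.swap)
 also have "\<dots> = lin_eval g (sect (basis_vec (X, \<zeta> \<cdot> (\<I> V \<star> f), v)))"
  unfolding sect_basis_vec by (intro sum.cong refl R[symmetric]) simp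
 finally show "lin_eval g (sect (basis_vec (Y, \<zeta>, omega_map C f v))) =
   lin_eval g (sect (basis_vec (X, \<zeta> \<cdot> (\<I> V \<star> f), v)))" .
qed

text \<open>Condition (iii) of a generator enters here: in degrees $n\le1$ the chosen embeddings into tensor
 powers do not change the degree.\<close>

lemma fdeg_low: "n \<le> 1 \<Longrightarrow> a < dlen (tp n) \<Longrightarrow> fdeg (tp n) a = n"
proof (rule ret_deg_low)
 assume a: "a < dlen (tp n)"
 show "dix (tp n) a \<in> J" by (rule decomp(1)[OF tp_obj a])
 note D = direct_sumD[OF decomp(2)[OF tp_obj, of n]]
 show "retract (dix (tp n) a) n" unfolding retract_def using D(3)[of a] D(4)[of a] D(5)[of a a] a by auto
qed

end

section \<open>The relations of all endomorphisms in degrees zero and one\<close>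

context endo_system
begin

text \<open>States that \<open>g\<close> vanishes on all \<open>rel n h r q\<close>. Read as a
  matrix indexed by paths of length \<open>n\<close>, \<open>g\<close> then commutes with the matrix
  of \<open>h\<close>.\<close>

definition commutes where
 "commutes g n h \<longleftrightarrow> (\<forall>r\<in>G.P n. \<forall>q\<in>G.P n.
   (\<Sum>p\<in>G.P n. mx n h p q * g (r, p)) = (\<Sum>p\<in>G.P n. mx n h r p * g (p, q)))"

text \<open>The matrices commuting with a given one form an algebra, and composition of
  endomorphisms is multiplication of their matrices. The inclusion in the endomorphisms guarantees
  that the latter applies to all generated elements.\<close>

lemma commutes_algebra:
 assumes S: "generated_algebra C S \<subseteq> Hom C (tp n) (tp n)" and c: "\<And>h. h \<in> S \<Longrightarrow> commutes g n h"
  and h: "h \<in> generated_algebra C S"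
 shows "commutes g n h"
proof -
 have ar: "arr (tp n) (tp n) h" if "h \<in> generated_algebra C S" for h using S that tp_obj by (auto simp: arr_def)
 show ?thesis
  using h
 proof induction
  case 1
  show ?case using mx_linear(3)[OF arr_zero[OF tp_obj tp_obj]] by (simp add: commutes_def)
 next
  case (2 f)
  then show ?case by (rule c)
 next
  case (3 f f')
  then show ?case using mx_linear(1)[OF ar[OF 3(1)] _ _ ar[OF 3(2)]]
   by (simp add: commutes_def distrib_right sum.distrib cong: sum.cong)
 next
  case (4 f c)
  then show ?case using mx_linear(2)[OF ar[OF 4(1)]]
   by (simp add: commutes_def mult.assoc flip: sum_distrib_left cong: sum.cong)
 next
  case (5 f f')
  show ?case
   unfolding commutes_def
  proof (intro ballI)
   fix r q assume r: "r \<in> G.P n" and q: "q \<in> G.P n"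
   note mm = mx_linear(4)[OF ar[OF 5(1)] _ _ ar[OF 5(2)]]
   have "(\<Sum>p\<in>G.P n. mx n (f \<cdot> f') p q * g (r, p)) = (\<Sum>p\<in>G.P n. \<Sum>s\<in>G.P n. mx n f p s * g (r, p) * mx n f' s q)"
    by (intro sum.cong refl) (simp only: mm q sum_distrib_right, intro sum.cong refl, simp add: ac_simps)
   also have "\<dots> = (\<Sum>s\<in>G.P n. \<Sum>p\<in>G.P n. mx n f p s * g (r, p) * mx n f' s q)" by (rule sum.swap)
   also have "\<dots> = (\<Sum>s\<in>G.P n. \<Sum>p\<in>G.P n. mx n f r p * g (p, s) * mx n f' s q)"
    unfolding sum_distrib_right[symmetric] using 5(3) r by (intro sum.cong refl) (simp add: commutes_def)
   also have "\<dots> = (\<Sum>p\<in>G.P n. \<Sum>s\<in>G.P n. mx n f r p * (mx n f' s q * g (p, s)))"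
    by (subst sum.swap) (simp add: ac_simps)
   also have "\<dots> = (\<Sum>p\<in>G.P n. \<Sum>s\<in>G.P n. mx n f r p * (mx n f' p s * g (s, q)))"
    unfolding sum_distrib_left[symmetric] using 5(4) q by (intro sum.cong refl) (simp add: commutes_def)
   also have "\<dots> = (\<Sum>s\<in>G.P n. mx n (f \<cdot> f') r s * g (s, q))"
    by (subst sum.swap, intro sum.cong refl) (simp add: mm r sum_distrib_right mult.assoc)
   finally show "(\<Sum>p\<in>G.P n. mx n (f \<cdot> f') p q * g (r, p)) = (\<Sum>p\<in>G.P n. mx n (f \<cdot> f') r p * g (p, q))" .
  qed
 qed
qed

lemma commutes_id: "commutes g n (\<I> (tp n))"
 using dual_basesD(1)[OF path_dual_bases, of n]
 by (simp add: commutes_def mx_id if_distrib[of "\<lambda>x. x * _"] cong: sum.cong if_cong)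

lemma commutes_E:
 assumes g: "\<And>t. t \<in> I \<Longrightarrow> lin_eval g t = 0" and h: "h \<in> E n"
 shows "commutes g n h"
 unfolding commutes_def
proof (intro ballI)
 fix r q assume "r \<in> G.P n" "q \<in> G.P n"
 from g[OF rel_in_I[OF h this]]
 show "(\<Sum>p\<in>G.P n. mx n h p q * g (r, p)) = (\<Sum>p\<in>G.P n. mx n h r p * g (p, q))" by (simp add: lin_eval_rel)
qed

text \<open>The relation is derived from degree zero. As \<open>f\<close> is diagonal with entries
  \<open>d j\<close>, the generator at the targets of \<open>r\<close> and \<open>q\<close> is
  \<open>d (G.\<tau> q) - d (G.\<tau> r)\<close> times a symbol of two vertices. Its product with
  \<open>[r|q]\<close> is the same multiple of \<open>[r|q]\<close>, hence lies in the ideal, and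
  this is the relation needed because \<open>f\<close> acts on edges through their targets.\<close>

lemma commutes_tensor_M:
 assumes g: "\<And>t. t \<in> I \<Longrightarrow> lin_eval g t = 0" and f: "f \<in> E 0"
 shows "commutes g 1 (tensor_M C M 0 f)"
proof -
 have fa: "arr \<bbbone> \<bbbone> f" using E_arr[OF f] by simp
 obtain d where d: "\<And>j. j \<in> J \<Longrightarrow> omega_map C f (pv (vertex_path j)) = scal C (d j) (pv (vertex_path j))"
  using unit_diagonal[OF fa] by metis
 have vp: "vertex_path j \<in> G.P 0" if "j \<in> J" for j using that by (simp add: vertex_path_in)
 have mx0: "mx 0 f (vertex_path i) (vertex_path j) = (if i = j then d j else 0)" if "i \<in> J" "j \<in> J" for i j
  unfolding mx_def d[OF that(2)]
  using pairing_scal_right[OF pd_od[OF vp[OF that(1)]] pv_om[OF vp[OF that(2)]], of "d j"]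
   pd_pv[OF vp[OF that(1)] vp[OF that(2)]]
  by (auto simp: vertex_path_def)
 have mx1: "mx 1 (tensor_M C M 0 f) r q = (if r = q then d (G.\<tau> q) else 0)" if r: "r \<in> G.P 1" and q: "q \<in> G.P 1" for r q
 proof -
  obtain e where e: "e \<in> arcs \<G>" "q = edge_path \<G> e" using q unfolding G.paths_1 by blast
  have "omega_map C (tensor_M C M 0 f) (pv q) = scal C (d (G.\<tau> q)) (pv q)"
   using tensor_M_edge[OF fa e(1) d] G.head_in_verts[OF e(1)] by (simp add: e(2) pv_edge)
  then show ?thesis
   using pairing_scal_right[OF pd_od[OF r] pv_om[OF q]] pd_pv[OF r q] by (simp add: mx_def)
 qed
 have key: "d (G.\<tau> q) * g (r, q) = d (G.\<tau> r) * g (r, q)" if r: "r \<in> G.P 1" and q: "q \<in> G.P 1" for r q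
 proof -
  have tr: "G.\<tau> r \<in> J" and tq: "G.\<tau> q \<in> J" using G.path_target_in[OF r] G.path_target_in[OF q] by auto
  let ?r = "vertex_path (G.\<tau> r) :: ('i, 'i \<times> 'm \<times> 'i) gpath" and ?q = "vertex_path (G.\<tau> q) :: ('i, 'i \<times> 'm \<times> 'i) gpath"
  have b: "basis_vec (r, q) \<in> carrier Hg" using r q by auto
  have gm: "G.gmult (?r, p) (r, q) = (if p = ?q then basis_vec (r, q) else 0)"
   "G.gmult (p, ?q) (r, q) = (if p = ?r then basis_vec (r, q) else 0)" if "p \<in> G.P 0" for p
   using that by (auto simp: paths_0 vertex_path_def path_append_def path_target_def path_source_def)
  have fin: "finite (G.P 0)" using dual_basesD(1)[OF path_dual_bases, of 0] .
  have rel0: "rel 0 f ?r ?q \<in> I" by (rule rel_in_I[OF f vp[OF tr] vp[OF tq]])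
  have "rel 0 f ?r ?q \<otimes>\<^bsub>Hg\<^esub> basis_vec (r, q) =
    bilin_extend G.gmult (rel 0 f ?r ?q) (basis_vec (r, q))" by simp
  then have "lin_eval g (rel 0 f ?r ?q \<otimes>\<^bsub>Hg\<^esub> basis_vec (r, q)) = lin_eval (\<lambda>a. lin_eval g (G.gmult a (r, q))) (rel 0 f ?r ?q)"
   by (simp only: lin_eval_bilin_extend lin_eval_basis_vec)
  also have "\<dots> = (\<Sum>p\<in>G.P 0. if p = ?q then mx 0 f p ?q * g (r, q) else 0) - (\<Sum>p\<in>G.P 0. if p = ?r then mx 0 f ?r p * g (r, q) else 0)"
   unfolding lin_eval_rel by (intro arg_cong2[of _ _ _ _ "(-)"] sum.cong refl) (simp_all only: gm, simp_all)
  also have "\<dots> = d (G.\<tau> q) * g (r, q) - d (G.\<tau> r) * g (r, q)"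
   using vp[OF tr] vp[OF tq] by (simp add: fin mx0 tr tq)
  finally show ?thesis using g[OF ideal.I_r_closed[OF ideal rel0 b]] by simp
 qed
 show ?thesis
  unfolding commutes_def
 proof (intro ballI)
  fix r q assume r: "r \<in> G.P 1" and q: "q \<in> G.P 1"
  have fin: "finite (G.P 1)" using dual_basesD(1)[OF path_dual_bases, of 1] .
  have "(\<Sum>p\<in>G.P 1. mx 1 (tensor_M C M 0 f) p q * g (r, p)) = (\<Sum>p\<in>G.P 1. if p = q then d (G.\<tau> q) * g (r, q) else 0)"
   by (intro sum.cong refl) (simp only: mx1 q, simp)
  moreover have "(\<Sum>p\<in>G.P 1. mx 1 (tensor_M C M 0 f) r p * g (p, q)) = (\<Sum>p\<in>G.P 1. if p = r then d (G.\<tau> r) * g (r, q) else 0)"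
   by (intro sum.cong refl) (simp only: mx1 r, simp)
  ultimately show "(\<Sum>p\<in>G.P 1. mx 1 (tensor_M C M 0 f) p q * g (r, p)) = (\<Sum>p\<in>G.P 1. mx 1 (tensor_M C M 0 f) r p * g (p, q))"
   using key[OF r q] r q fin by simp
 qed
qed

text \<open>The definition of an endomorphism system describes the endomorphisms of the unit object
  and of \<open>M\<close> by generators, for each of which the relations have been obtained; the
  rest follows by \<open>commutes_algebra\<close>.\<close>

lemma commutes_low:
 assumes g: "\<And>t. t \<in> I \<Longrightarrow> lin_eval g t = 0" and n: "n \<le> 1" and h: "arr (tp n) (tp n) h"
 shows "commutes g n h"
proof -
 have e0: "Hom C (tp 0) (tp 0) = generated_algebra C (E 0 \<union> {\<I> (tp 0)})"
  and e1: "Hom C (tp 1) (tp 1) = generated_algebra C ({tensor_M C M 0 f | f. f \<in> E 0} \<union> E 1 \<union> {\<I> (tp 1)})"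
  using endo unfolding endomorphism_system_def One_nat_def by (simp, blast)
 consider "n = 0" | "n = 1" using n by linarith
 then show ?thesis
 proof cases
  case 1
  show ?thesis
   unfolding 1
  proof (rule commutes_algebra[OF equalityD2[OF e0]])
   show "h \<in> generated_algebra C (E 0 \<union> {\<I> (tp 0)})" using h e0 by (simp add: 1 arr_def)
   show "commutes g 0 h" if "h \<in> E 0 \<union> {\<I> (tp 0)}" for h
    using that commutes_E[OF g, where n = 0] commutes_id[of g 0] by blast
  qed
 next
  case 2
  show ?thesis
   unfolding 2
  proof (rule commutes_algebra[OF equalityD2[OF e1]])
   show "h \<in> generated_algebra C ({tensor_M C M 0 f | f. f \<in> E 0} \<union> E 1 \<union> {\<I> (tp 1)})" using h e1 by (simp add: 2 arr_def)
   show "commutes g 1 h" if "h \<in> {tensor_M C M 0 f | f. f \<in> E 0} \<union> E 1 \<union> {\<I> (tp 1)}" for h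
    using that commutes_E[OF g, where n = 1] commutes_id[of g 1] commutes_tensor_M[OF g] by blast
  qed
 qed
qed

text \<open>Extends the relation, known for path vectors, to an arbitrary vector \<open>v\<close> by
  expanding it in path vectors; the endomorphism may be moved from the covector to the vector under
  \<open>g\<close>.\<close>

lemma commutes_path_tensor:
 assumes c: "commutes g n h" and h: "arr (tp n) (tp n) h" and r: "r \<in> G.P n" and v: "om (tp n) v"
 shows "lin_eval g (path_tensor n (pd n r \<cdot> (\<I> V \<star> h)) v) = lin_eval g (path_tensor n (pd n r) (omega_map C h v))"
proof -
 have "lin_eval g (path_tensor n (pd n r \<cdot> (\<I> V \<star> h)) v) =
   (\<Sum>p\<in>G.P n. \<Sum>q\<in>G.P n. pairing C (pd n q) v * (mx n h r p * g (p, q)))"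
  unfolding lin_eval_path_tensor by (intro sum.cong refl) (simp add: mx_def omega_map_adjoint[OF pv_om h pd_od[OF r]])
 also have "\<dots> = (\<Sum>q\<in>G.P n. pairing C (pd n q) v * (\<Sum>p\<in>G.P n. mx n h r p * g (p, q)))"
  unfolding sum_distrib_left by (rule sum.swap)
 also have "\<dots> = (\<Sum>q\<in>G.P n. pairing C (pd n q) v * (\<Sum>p\<in>G.P n. mx n h p q * g (r, p)))"
  using c r by (intro sum.cong refl) (simp add: commutes_def)
 also have "\<dots> = (\<Sum>p\<in>G.P n. \<Sum>q\<in>G.P n. pairing C (pd n q) v * (mx n h p q * g (r, p)))"
  unfolding sum_distrib_left by (rule sum.swap)
 also have "\<dots> = (\<Sum>p\<in>G.P n. pairing C (pd n p) (omega_map C h v) * g (r, p))"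
 proof (intro sum.cong refl)
  fix p assume p: "p \<in> G.P n"
  have "pairing C (pd n p) (omega_map C h v) = pairing C (pd n p \<cdot> (\<I> V \<star> h)) v"
   by (rule omega_map_adjoint[OF v h pd_od[OF p], symmetric])
  also have "\<dots> = (\<Sum>q\<in>G.P n. pairing C (pd n p \<cdot> (\<I> V \<star> h)) (pv q) * pairing C (pd n q) v)"
   by (rule dual_bases_pairing[OF path_dual_bases omega_comap_arr[OF h pd_od[OF p]] v])
  finally show "(\<Sum>q\<in>G.P n. pairing C (pd n q) v * (mx n h p q * g (r, p))) = pairing C (pd n p) (omega_map C h v) * g (r, p)"
   by (simp add: mx_def omega_map_adjoint[OF pv_om h pd_od[OF p]] sum_distrib_right mult.assoc mult.left_commute cong: sum.cong)
 qed
 also have "\<dots> = lin_eval g (path_tensor n (pd n r) (omega_map C h v))"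
  unfolding path_tensor_left[OF r] by (simp add: lin_eval_sum lin_eval_scale)
 finally show ?thesis .
qed

text \<open>For \<open>n \<le> 1\<close> all the maps \<open>facF\<close> and \<open>facG\<close> of
  the power are endomorphisms of it, because the degree is preserved. Under a form vanishing on the
  ideal, \<open>facG\<close> can be moved to the vector, and the composites sum to the
  identity.\<close>

lemma sect_lift:
 assumes g: "\<And>t. t \<in> I \<Longrightarrow> lin_eval g t = 0" and n: "n \<le> 1" and p: "p \<in> G.P n" and q: "q \<in> G.P n"
 shows "lin_eval g (sect (basis_vec (tp n, pd n p, pv q))) = g (p, q)"
proof -
 note X = tp_obj[of n]
 have F: "arr (tp n) (tp n) (facF (tp n) a)" and G: "arr (tp n) (tp n) (facG (tp n) a)" if "a \<in> {..<dlen (tp n)}" for a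
  using fac(1,2)[OF X] fdeg_low[OF n] that by auto
 note v = pv_om[OF q]
 have "lin_eval g (sect (basis_vec (tp n, pd n p, pv q))) =
   (\<Sum>a<dlen (tp n). lin_eval g (path_tensor n (pd n p) (omega_map C (facG (tp n) a \<cdot> facF (tp n) a) (pv q))))"
  unfolding sect_basis_vec
 proof (intro sum.cong refl)
  fix a assume a: "a \<in> {..<dlen (tp n)}"
  then have d: "fdeg (tp n) a = n" using fdeg_low[OF n] by simp
  show "lin_eval g (path_tensor (fdeg (tp n) a) (pd n p \<cdot> (\<I> V \<star> facG (tp n) a)) (omega_map C (facF (tp n) a) (pv q))) =
    lin_eval g (path_tensor n (pd n p) (omega_map C (facG (tp n) a \<cdot> facF (tp n) a) (pv q)))"
   unfolding d omega_map_cmp[OF F[OF a] G[OF a] v]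
   by (rule commutes_path_tensor[OF commutes_low[OF g n G[OF a]] G[OF a] p omega_map_arr[OF F[OF a] v]])
 qed
 also have "\<dots> = (\<Sum>a<dlen (tp n). \<Sum>s\<in>G.P n. pairing C (pd n s) (omega_map C (facG (tp n) a \<cdot> facF (tp n) a) (pv q)) * g (p, s))"
  unfolding path_tensor_left[OF p] by (simp add: lin_eval_sum lin_eval_scale)
 also have "\<dots> = (\<Sum>s\<in>G.P n. (\<Sum>a<dlen (tp n). pairing C (pd n s) (omega_map C (facG (tp n) a \<cdot> facF (tp n) a) (pv q))) * g (p, s))"
  unfolding sum_distrib_right by (rule sum.swap)
 also have "\<dots> = (\<Sum>s\<in>G.P n. if s = q then g (p, s) else 0)"
 proof (intro sum.cong refl)
  fix s assume s: "s \<in> G.P n"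
  note GF = arr_comp[OF F G]
  have "(\<Sum>a<dlen (tp n). pairing C (pd n s) (omega_map C (facG (tp n) a \<cdot> facF (tp n) a) (pv q))) =
    pairing C (pd n s) (\<Sum>a<dlen (tp n). omega_map C (facG (tp n) a \<cdot> facF (tp n) a) (pv q))"
   by (rule pairing_sum_right[OF pd_od[OF s] omega_map_arr[OF GF v], symmetric])
  also have "(\<Sum>a<dlen (tp n). omega_map C (facG (tp n) a \<cdot> facF (tp n) a) (pv q)) = omega_map C (\<I> (tp n)) (pv q)"
   unfolding fac(3)[OF X] by (rule omega_map_sum[OF GF v X X, symmetric])
  finally show "(\<Sum>a<dlen (tp n). pairing C (pd n s) (omega_map C (facG (tp n) a \<cdot> facF (tp n) a) (pv q))) * g (p, s) =
    (if s = q then g (p, s) else 0)"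
   by (simp add: omega_map_id[OF X v] pd_pv[OF s q])
 qed
 finally show ?thesis using q dual_basesD(1)[OF path_dual_bases, of n] by simp
qed

lemma I_iff: "t \<in> I \<longleftrightarrow> (\<forall>g. (\<forall>s\<in>I. lin_eval g s = 0) \<longrightarrow> lin_eval g t = 0)"
proof -
 have "pm.subspace I"
  using endo.N_zero endo.N_add endo.N_smult unfolding pm.subspace_def G.HG_simps by blast
 then have "pm.span I = I" by (rule pm.span_eq_iff[THEN iffD2])
 from in_pm_span_iff[of t I] show ?thesis unfolding \<open>pm.span I = I\<close> .
qed

text \<open>For a form \<open>g\<close> vanishing on the ideal, \<open>g\<close> composed with
  \<open>sect\<close> is a coend form, so it kills \<open>lift z\<close>; in degrees 0 and 1 its
  value there is that of \<open>g\<close> on \<open>z\<close>.\<close>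

lemma graph_pi_low_injective:
 assumes z: "keys z \<subseteq> G.P 0 \<times> G.P 0 \<union> G.P 1 \<times> G.P 1" and "lift z \<in> CR"
 shows "z \<in> I"
 unfolding I_iff
proof (intro allI impI)
 fix g assume g: "\<forall>s\<in>I. lin_eval g s = 0"
 then have g': "\<And>t. t \<in> I \<Longrightarrow> lin_eval g t = 0" by blast
 have "lin_eval g z = lin_eval (\<lambda>(p, q). lin_eval g (sect (basis_vec (tp (path_length p), pd (path_length p) p, pv q)))) z"
 proof (rule lin_eval_cong)
  fix a assume "a \<in> keys z"
  then obtain n p q where a: "a = (p, q)" "n \<le> 1" "p \<in> G.P n" "q \<in> G.P n" using z by fastforce
  show "g a = (case a of (p, q) \<Rightarrow> lin_eval g (sect (basis_vec (tp (path_length p), pd (path_length p) p, pv q))))"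
   using sect_lift[OF g' a(2-4)] by (simp add: a(1) length_path(2)[OF a(3)])
 qed
 also have "\<dots> = lin_eval (\<lambda>s. lin_eval g (sect (basis_vec s))) (lift z)"
  by (simp add: lift_def lin_eval_extend case_prod_unfold)
 also have "\<dots> = 0" using coend_form_sect[of g] assms(2) unfolding coend_form_iff by blast
 finally show "lin_eval g z = 0" .
qed

text \<open>Elements of the sum of the two components have representatives supported in degrees 0
  and 1, and so do differences of these; hence the kernel statement for representatives
  suffices.\<close>

theorem pibar_injective:
 "inj_on pibar (graph_endo_component C M B E 0 <+>\<^bsub>endo.Q\<^esub> graph_endo_component C M B E 1)"
proof (rule inj_onI)
 let ?P = "G.P 0 \<times> G.P 0 \<union> G.P 1 \<times> G.P 1"
 have rep: "\<exists>z. keys z \<subseteq> ?P \<and> z \<in> carrier Hg \<and> x = endo.cl z"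
  if "x \<in> graph_endo_component C M B E 0 <+>\<^bsub>endo.Q\<^esub> graph_endo_component C M B E 1" for x
 proof -
  from that obtain s t where st: "keys s \<subseteq> G.P 0 \<times> G.P 0" "keys t \<subseteq> G.P 1 \<times> G.P 1"
   "x = endo.cl s \<oplus>\<^bsub>endo.Q\<^esub> endo.cl t"
   unfolding set_add_def' graph_endo_component_def endo_proj_eq by blast
  then have c: "s \<in> carrier Hg" "t \<in> carrier Hg" by auto
  have "x = endo.cl (s + t)" using endo.add_Q[OF c] st(3) by simp
  moreover have k: "keys (s + t) \<subseteq> ?P" using Poly_Mapping.keys_add[of s t] st(1,2) by blast
  moreover have "s + t \<in> carrier Hg" using k by auto
  ultimately show ?thesis by blast
 qed
 fix x y assume x: "x \<in> graph_endo_component C M B E 0 <+>\<^bsub>endo.Q\<^esub> graph_endo_component C M B E 1"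
  and y: "y \<in> graph_endo_component C M B E 0 <+>\<^bsub>endo.Q\<^esub> graph_endo_component C M B E 1" and eq: "pibar x = pibar y"
 obtain z where z: "keys z \<subseteq> ?P" "z \<in> carrier Hg" "x = endo.cl z" using rep[OF x] by blast
 obtain w where w: "keys w \<subseteq> ?P" "w \<in> carrier Hg" "y = endo.cl w" using rep[OF y] by blast
 have "coend.cl (lift z) = coend.cl (lift w)" using eq pibar(2)[OF z(2)] pibar(2)[OF w(2)] by (simp add: z(3) w(3) graph_pi_def)
 then have "lift z \<ominus>\<^bsub>CF\<^esub> lift w \<in> CR" using coend.cl_eq_iff[OF lift_in[OF z(2)] lift_in[OF w(2)]] by simp
 moreover have "lift z \<ominus>\<^bsub>CF\<^esub> lift w = lift (z - w)"
  using coend.S.a_inv_smult[OF lift_in[OF w(2)]] pm.scale_minus_left[of 1 "lift w"]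
  by (simp add: a_minus_def lift_def lin_extend_diff)
 ultimately have "z - w \<in> I"
  using graph_pi_low_injective[of "z - w"] keys_diff_subset[of z w] z(1) w(1) by (auto dest: subset_trans)
 moreover have "z \<ominus>\<^bsub>Hg\<^esub> w = z - w"
  using G.HG.a_inv_smult[OF w(2)] pm.scale_minus_left[of 1 w] by (simp add: a_minus_def)
 ultimately show "x = y" using endo.cl_eq_iff[OF z(2) w(2)] z(3) w(3) by simp
qed

end

theorem proposition4p7:
  fixes C :: "('k::field, 'o, 'm::ab_group_add, 'i) fcat"
    and M :: 'o
    and B :: "'i \<Rightarrow> 'i \<Rightarrow> 'm set"
    and E :: "nat \<Rightarrow> 'm set"
  assumes "linear_monoidal_category C"
    and "additive_category C"
    and "hom_finite C"
    and "left_autonomous C"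
    and "finitely_split_semisimple C"
    and "Vhat_direct_sum C"
    and "generates_as_fusion_category C M"
    and "edge_bases C M B"
    and "endomorphism_system C M E"
  shows "\<exists>\<pi>bar.
    wba_hom (graph_endo_wba C M B E) (coend C) \<pi>bar \<and>
    (\<forall>x\<in>carrier (graph_wba (dimension_graph C B)).
       \<pi>bar (endo_proj C M B E x) = canonical_pi C M B x) \<and>
    \<pi>bar ` carrier (graph_endo_wba C M B E) = carrier (coend C) \<and>
    (\<forall>j\<in>verts (dimension_graph C B). \<forall>l\<in>verts (dimension_graph C B).
       \<pi>bar (endo_proj C M B E (basis_vec (vertex_path j, vertex_path l))) =
       coend_elem C (unit_obj C) (vertex_covec C j) (vertex_vec C l)) \<and>
    (\<forall>p\<in>arcs (dimension_graph C B). \<forall>q\<in>arcs (dimension_graph C B).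
       \<pi>bar (endo_proj C M B E (basis_vec
         (edge_path (dimension_graph C B) p, edge_path (dimension_graph C B) q))) =
       coend_elem C M (edge_covec C M B p) (edge_vec C M q)) \<and>
    pushes_forward (graph_endo_wba C M B E) (coend C) \<pi>bar
      (path_ident C M) (path_comodule C M B E 1) (omega_comodule C M) \<and>
    pushes_forward (graph_endo_wba C M B E) (coend C) \<pi>bar
      (path_ident C M) (path_comodule C M B E 0) (omega_comodule C (unit_obj C)) \<and>
    inj_on \<pi>bar
      (graph_endo_component C M B E 0 <+>\<^bsub>graph_endo_wba C M B E\<^esub> graph_endo_component C M B E 1)"
proof -
 interpret linear_monoidal_category C by (rule assms(1))
 interpret endo_system C M B E
  by unfold_locales (use assms in \<open>auto simp: generates_as_fusion_category_def\<close>)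
 have v: "basis_vec (vertex_path j, vertex_path l) \<in> carrier Hg" if "j \<in> verts \<G>" "l \<in> verts \<G>" for j l
  by simp (rule exI[of _ 0], use that in \<open>simp add: vertex_path_in\<close>)
 have e: "basis_vec (edge_path \<G> p, edge_path \<G> q) \<in> carrier Hg" if "p \<in> arcs \<G>" "q \<in> arcs \<G>" for p q
  by simp (rule exI[of _ 1], use that G.edge_path_in in simp)
 \<comment> \<open>Proved for every power. For \<open>m = 0\<close> and \<open>m = 1\<close> the
   power is by definition the unit object and \<open>M\<close> itself, which gives the two comodule
   statements.\<close>
 have comod: "pushes_forward endo.Q (coend C) pibar (path_ident C M) (path_comodule C M B E m) (omega_comodule C (tp m))" for m
  unfolding pushes_forward_def using right_comodule_path path_comodule_iso by blast
 show ?thesis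
  unfolding graph_endo_wba_eq
 proof (intro exI[of _ pibar] conjI ballI)
  show "wba_hom endo.Q (coend C) pibar" by (rule pibar(1))
  show "pibar (endo_proj C M B E x) = canonical_pi C M B x" if "x \<in> carrier Hg" for x
   using pibar(2)[OF that] canonical_pi_eq[OF that] by (simp only: endo_proj_eq)
  show "pibar ` carrier endo.Q = carrier (coend C)" by (rule pibar_surj)
  show "pibar (endo_proj C M B E (basis_vec (vertex_path j, vertex_path l))) =
    coend_elem C (unit_obj C) (vertex_covec C j) (vertex_vec C l)" if "j \<in> verts \<G>" "l \<in> verts \<G>" for j l
   using pibar(2)[OF v[OF that]] graph_pi_vertex[of j l] that by (simp add: endo_proj_eq)
  show "pibar (endo_proj C M B E (basis_vec (edge_path \<G> p, edge_path \<G> q))) =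
    coend_elem C M (edge_covec C M B p) (edge_vec C M q)" if "p \<in> arcs \<G>" "q \<in> arcs \<G>" for p q
   using pibar(2)[OF e[OF that]] graph_pi_edge[OF that(1)] by (simp only: endo_proj_eq)
  show "pushes_forward endo.Q (coend C) pibar (path_ident C M) (path_comodule C M B E 1) (omega_comodule C M)"
   using comod[of 1] by simp
  show "pushes_forward endo.Q (coend C) pibar (path_ident C M) (path_comodule C M B E 0) (omega_comodule C (unit_obj C))"
   using comod[of 0] by simp
  show "inj_on pibar (graph_endo_component C M B E 0 <+>\<^bsub>endo.Q\<^esub> graph_endo_component C M B E 1)"
   by (rule pibar_injective)
 qed
qed

end
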